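(* Let $\mathcal{N}_{A\to B_1\cdots B_K}$ be a quantum broadcast channel with $K$ receivers and let $\mathscr{A}\subseteq2^{[K]}$ be an access structure. For $T\in\mathscr{A}$ let $\mathcal{N}^{(T)}_{A\to B_T}=\mathrm{Tr}_{B_{T^c}}\circ\mathcal{N}_{A\to B_1\cdots B_K}$. Define $$I_c(\mathscr{A})=\max_{|\phi\rangle_{A'A}}\ \min_{T\in\mathscr{A}}\ I(A'\rangle B_T)_{\sigma^{(T)}},\qquad \sigma^{(T)}_{A'B_T}=(\mathrm{id}_{A'}\otimes\mathcal{N}^{(T)}_{A\to B_T})(|\phi\rangle\langle\phi|_{A'A}),$$ and let $I_c(\mathscr{A}^{\otimes n})$ be the same quantity with each $\mathcal{N}^{(T)}$ replaced by $(\mathcal{N}^{(T)})^{\otimes n}$ (inputs $|\phi\rangle_{A'A^n}$, outputs $B_T^n$). Then the quantum secret sharing capacity satisfies $$C_{\mathrm{QSS}}(\mathscr{A})\ \ge\ I_c(\mathscr{A}),$$ and furthermore $$C_{\mathrm{QSS}}(\mathscr{A})=\lim_{n\to\infty}\frac1n\, I_c(\mathscr{A}^{\otimes n}).$$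
   Context: All Hilbert spaces are finite-dimensional, $\mathcal{L}(\mathcal{H})$ denotes the linear operators on $\mathcal{H}$, "channel" means completely positive trace-preserving map, logarithms are base 2, and fidelity is $F(\rho,\sigma)=\|\sqrt{\rho}\sqrt{\sigma}\|_1^2$. $[K]=\{1,\dots,K\}$, $T^c=[K]\setminus T$, $B_T=(B_k)_{k\in T}$. The coherent information of a bipartite state is $I(A\rangle B)_\rho=H(B)_\rho-H(AB)_\rho$ with $H$ the von Neumann entropy. The maximum is over pure states $|\phi\rangle_{A'A}$ with $A'$ a reference system of the same dimension as the channel input. Access structure: an adversary structure is a family $\mathscr{Z}\subseteq 2^{[K]}$ that is downward-closed ($Z\in\mathscr{Z}$, $Z'\subseteq Z$ imply $Z'\in\mathscr{Z}$) and self-dual ($Z\in\mathscr{Z}\iff Z^c\notin\mathscr{Z}$ for every $Z\subseteq[K]$). The corresponding access structure is $\mathscr{A}=2^{[K]}\setminus\mathscr{Z}$; its members are the qualified sets. Broadcast channel: a channel $\mathcal{N}_{A\to B_1\cdots B_K}:\mathcal{L}(\mathcal{H}_A)\to\mathcal{L}(\mathcal{H}_{B_1}\otimes\cdots\otimes\mathcal{H}_{B_K})$, used $n$ times as $\mathcal{N}^{\otimes n}$; participant $k$ receives $B_k^n$, and $B_T^n=(B_k^n)_{k\in T}$. QSS code: a $(2^{nR},n)$ QSS code consists of a secret space $\mathcal{H}_S$ of dimension $2^{nR}$ (when this is not a positive integer, read $\max\{1,\lfloor 2^{nR}\rfloor\}$), an encoding channel $\mathcal{F}_{S\to A^n}:\mathcal{L}(\mathcal{H}_S)\to\mathcal{L}(\mathcal{H}_A^{\otimes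 n})$, and decoding channels $\mathcal{D}^{(T)}_{B_T^n\to\widehat S}:\mathcal{L}(\mathcal{H}_{B_T}^{\otimes n})\to\mathcal{L}(\mathcal{H}_S)$ for each $T\in\mathscr{A}$. For a unit vector $|\phi\rangle_{S'S}\in\mathcal{H}_{S'}\otimes\mathcal{H}_S$ ($\mathcal{H}_{S'}\cong\mathcal{H}_S$ a reference), let $$\rho^{(T)}_{S'\widehat S B_{T^c}^n}=\big(\mathrm{id}_{S'}\otimes\mathcal{D}^{(T)}_{B_T^n\to\widehat S}\otimes\mathrm{id}_{B_{T^c}^n}\big)\big(\mathrm{id}_{S'}\otimes\mathcal{N}^{\otimes n}\circ\mathcal{F}\big)(|\phi\rangle\langle\phi|_{S'S}),$$ and let $\rho^{(T)}_{S'\widehat S}$ be its reduced state on $S'\widehat S$. QSS capacity: $R\ge0$ is an achievable QSS rate for $\mathscr{A}$ if for every $\varepsilon,\delta>0$ and every sufficiently large $n$ (depending on $\varepsilon,\delta,R$) there is a $(2^{n(R-\delta)},n)$ QSS code with $F(|\phi\rangle\langle\phi|_{S'S},\rho^{(T)}_{S'\widehat S})\ge1-\varepsilon$ for all $T\in\mathscr{A}$ and all unit vectors $|\phi\rangle_{S'S}$. $C_{\mathrm{QSS}}(\mathscr{A})$ is the supremum of achievable QSS rates. *)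

theory Defs
  imports "HOL-Analysis.Analysis"
begin

text \<open>
  A finite-dimensional Hilbert space is given by a finite set \<open>I\<close> labelling an orthonormal basis,
  that is, it is the space of functions \<open>I \<rightarrow> \<complex>\<close>.  Vectors and operators are total functions that
  vanish off \<open>I\<close>.  The space labelled by \<open>I \<times> J\<close> is the tensor product of those labelled by \<open>I\<close>
  and \<open>J\<close>, and the space labelled by \<open>PiE T I\<close> is the tensor product of the spaces labelled
  by \<open>I k\<close>, \<open>k \<in> T\<close>.  Label sets rather than types are used because the dimensions depend on the
  number of channel uses and on the set of participants.
\<close>

type_synonym 'i ket = "'i \<Rightarrow> complex"
type_synonym 'i oper = "'i \<Rightarrow> 'i \<Rightarrow> complex"
type_synonym ('i, 'j) superop = "'i oper \<Rightarrow> 'j oper"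

definition opers :: "'i set \<Rightarrow> 'i oper set" where
  "opers I = {X. \<forall>i j. i \<notin> I \<or> j \<notin> I \<longrightarrow> X i j = 0}"

definition unit_kets :: "'i set \<Rightarrow> 'i ket set" where
  "unit_kets I = {\<phi>. (\<forall>i. i \<notin> I \<longrightarrow> \<phi> i = 0) \<and> (\<Sum>i\<in>I. (cmod (\<phi> i))\<^sup>2) = 1}"

definition ketbra :: "'i ket \<Rightarrow> 'i oper" where
  "ketbra \<phi> = (\<lambda>i j. \<phi> i * cnj (\<phi> j))"

definition op_diag :: "'i set \<Rightarrow> ('i \<Rightarrow> real) \<Rightarrow> 'i oper" where
  "op_diag I d = (\<lambda>i j. if i \<in> I \<and> i = j then complex_of_real (d i) else 0)"

definition op_one :: "'i set \<Rightarrow> 'i oper" where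
  "op_one I = op_diag I (\<lambda>_. 1)"

definition op_mult :: "'i set \<Rightarrow> 'i oper \<Rightarrow> 'i oper \<Rightarrow> 'i oper" where
  "op_mult I X Y = (\<lambda>i j. \<Sum>k\<in>I. X i k * Y k j)"

definition op_adjoint :: "'i oper \<Rightarrow> 'i oper" where
  "op_adjoint X = (\<lambda>i j. cnj (X j i))"

definition op_trace :: "'i set \<Rightarrow> 'i oper \<Rightarrow> complex" where
  "op_trace I X = (\<Sum>i\<in>I. X i i)"

definition op_psd :: "'i set \<Rightarrow> 'i oper \<Rightarrow> bool" where
  "op_psd I X \<longleftrightarrow> X \<in> opers I \<and>
     (\<forall>v. (\<Sum>i\<in>I. \<Sum>j\<in>I. cnj (v i) * X i j * v j) \<in> \<real>\<^sub>\<ge>\<^sub>0)"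

definition op_unitary :: "'i set \<Rightarrow> 'i oper \<Rightarrow> bool" where
  "op_unitary I U \<longleftrightarrow> U \<in> opers I \<and>
     op_mult I (op_adjoint U) U = op_one I \<and> op_mult I U (op_adjoint U) = op_one I"

text \<open>
  Functional calculus for a self-adjoint operator: \<open>f(A) = U diag(f \<circ> d) U\<^sup>\<dagger>\<close> for any unitary
  diagonalisation \<open>A = U diag(d) U\<^sup>\<dagger>\<close>; the result does not depend on the diagonalisation.
\<close>

definition op_fun :: "(real \<Rightarrow> real) \<Rightarrow> 'i set \<Rightarrow> 'i oper \<Rightarrow> 'i oper" where
  "op_fun f I A = (SOME B. \<exists>U d. op_unitary I U \<and>
     A = op_mult I (op_mult I U (op_diag I d)) (op_adjoint U) \<and>
     B = op_mult I (op_mult I U (op_diag I (\<lambda>i. f (d i)))) (op_adjoint U))"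

definition op_sqrt :: "'i set \<Rightarrow> 'i oper \<Rightarrow> 'i oper" where
  "op_sqrt I A = op_fun sqrt I A"

definition trace_norm :: "'i set \<Rightarrow> 'i oper \<Rightarrow> real" where
  "trace_norm I X = Re (op_trace I (op_sqrt I (op_mult I (op_adjoint X) X)))"

definition fidelity :: "'i set \<Rightarrow> 'i oper \<Rightarrow> 'i oper \<Rightarrow> real" where
  "fidelity I \<rho> \<sigma> = (trace_norm I (op_mult I (op_sqrt I \<rho>) (op_sqrt I \<sigma>)))\<^sup>2"

text \<open>
  \<open>H(\<rho>) = - Tr (\<rho> log \<rho>)\<close>.  The value of \<open>log 2\<close> at \<open>0\<close> is irrelevant, because it is only taken on
  the kernel of \<open>\<rho>\<close>.
\<close>

definition vn_entropy :: "'i set \<Rightarrow> 'i oper \<Rightarrow> real" where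
  "vn_entropy I \<rho> = - Re (op_trace I (op_mult I \<rho> (op_fun (log 2) I \<rho>)))"

definition ptrace_fst :: "'i set \<Rightarrow> ('i \<times> 'j, 'j) superop" where
  "ptrace_fst I X = (\<lambda>j j'. \<Sum>i\<in>I. X (i, j) (i, j'))"

definition ptrace_snd :: "'j set \<Rightarrow> ('i \<times> 'j, 'i) superop" where
  "ptrace_snd J X = (\<lambda>i i'. \<Sum>j\<in>J. X (i, j) (i', j))"

definition coherent_info :: "'i set \<Rightarrow> 'j set \<Rightarrow> ('i \<times> 'j) oper \<Rightarrow> real" where
  "coherent_info I J \<rho> = vn_entropy J (ptrace_fst I \<rho>) - vn_entropy (I \<times> J) \<rho>"

definition mat_unit :: "'i \<Rightarrow> 'i \<Rightarrow> 'i oper" where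
  "mat_unit i i' = (\<lambda>a b. if a = i \<and> b = i' then 1 else 0)"

text \<open>
  Tensor products of linear maps: the operator argument is expanded in the matrix units of the
  input spaces, labelled \<open>I\<close> and \<open>J\<close>, respectively \<open>I\<close> in each of the \<open>n\<close> factors.
\<close>

definition so_tensor ::
  "'i set \<Rightarrow> 'j set \<Rightarrow> ('i, 'k) superop \<Rightarrow> ('j, 'l) superop \<Rightarrow> ('i \<times> 'j, 'k \<times> 'l) superop" where
  "so_tensor I J \<Phi> \<Psi> X = (\<lambda>(k, l) (k', l'). \<Sum>i\<in>I. \<Sum>i'\<in>I. \<Sum>j\<in>J. \<Sum>j'\<in>J.
     X (i, j) (i', j') * \<Phi> (mat_unit i i') k k' * \<Psi> (mat_unit j j') l l')"

definition sys_power :: "nat \<Rightarrow> 'i set \<Rightarrow> (nat \<Rightarrow> 'i) set" where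
  "sys_power n I = PiE {..<n} (\<lambda>_. I)"

definition so_power ::
  "nat \<Rightarrow> 'i set \<Rightarrow> 'j set \<Rightarrow> ('i, 'j) superop \<Rightarrow> (nat \<Rightarrow> 'i, nat \<Rightarrow> 'j) superop" where
  "so_power n I J \<Phi> X = (\<lambda>y y'. if y \<in> sys_power n J \<and> y' \<in> sys_power n J
     then \<Sum>x\<in>sys_power n I. \<Sum>x'\<in>sys_power n I.
       X x x' * (\<Prod>t<n. \<Phi> (mat_unit (x t) (x' t)) (y t) (y' t))
     else 0)"

definition channel :: "'i set \<Rightarrow> 'j set \<Rightarrow> ('i, 'j) superop \<Rightarrow> bool" where
  "channel I J \<Phi> \<longleftrightarrow>
     (\<forall>X\<in>opers I. \<Phi> X \<in> opers J) \<and>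
     (\<forall>X\<in>opers I. \<forall>Y\<in>opers I. \<Phi> (\<lambda>i i'. X i i' + Y i i') = (\<lambda>j j'. \<Phi> X j j' + \<Phi> Y j j')) \<and>
     (\<forall>c. \<forall>X\<in>opers I. \<Phi> (\<lambda>i i'. c * X i i') = (\<lambda>j j'. c * \<Phi> X j j')) \<and>
     (\<forall>r::nat. \<forall>X. op_psd ({..<r} \<times> I) X \<longrightarrow>
        op_psd ({..<r} \<times> J) (so_tensor {..<r} I id \<Phi> X)) \<and>
     (\<forall>X\<in>opers I. op_trace J (\<Phi> X) = op_trace I X)"

text \<open>
  \<open>relabel I f\<close> is conjugation by the unitary that identifies the basis label \<open>i \<in> I\<close> with \<open>f i\<close>;
  it is used only with \<open>f\<close> injective on \<open>I\<close>.
\<close>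

definition relabel :: "'i set \<Rightarrow> ('i \<Rightarrow> 'j) \<Rightarrow> ('j, 'i) superop" where
  "relabel I f X = (\<lambda>i i'. if i \<in> I \<and> i' \<in> I then X (f i) (f i') else 0)"

definition adversary_structure :: "nat \<Rightarrow> nat set set \<Rightarrow> bool" where
  "adversary_structure K \<Z> \<longleftrightarrow> \<Z> \<subseteq> Pow {1..K} \<and>
     (\<forall>Z Z'. Z \<in> \<Z> \<and> Z' \<subseteq> Z \<longrightarrow> Z' \<in> \<Z>) \<and>
     (\<forall>Z. Z \<subseteq> {1..K} \<longrightarrow> (Z \<in> \<Z> \<longleftrightarrow> {1..K} - Z \<notin> \<Z>))"

definition access_structure :: "nat \<Rightarrow> nat set set \<Rightarrow> bool" where
  "access_structure K \<A> \<longleftrightarrow> (\<exists>\<Z>. adversary_structure K \<Z> \<and> \<A> = Pow {1..K} - \<Z>)"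

text \<open>The system \<open>B\<^sub>T\<close>, where \<open>B\<^sub>k\<close> has dimension \<open>dB k\<close>.\<close>

definition sys_B :: "(nat \<Rightarrow> nat) \<Rightarrow> nat set \<Rightarrow> (nat \<Rightarrow> nat) set" where
  "sys_B dB T = PiE T (\<lambda>k. {..<dB k})"

definition marginal_channel ::
  "nat \<Rightarrow> (nat \<Rightarrow> nat) \<Rightarrow> ('a, nat \<Rightarrow> nat) superop \<Rightarrow> nat set \<Rightarrow> ('a, nat \<Rightarrow> nat) superop" where
  "marginal_channel K dB N T X = ptrace_snd (sys_B dB ({1..K} - T))
     (relabel (sys_B dB T \<times> sys_B dB ({1..K} - T)) (merge T ({1..K} - T)) (N X))"

text \<open>
  For a family of channels \<open>M T\<close>, \<open>T \<in> \<A>\<close>, from a system \<open>A\<close> to systems \<open>J T\<close>: the maximum over pure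
  states on \<open>A'A\<close> of the least coherent information.  The reference \<open>A'\<close> has the same labels as \<open>A\<close>.
\<close>

definition coherent_info_max ::
  "nat set set \<Rightarrow> 'a set \<Rightarrow> (nat set \<Rightarrow> 'b set) \<Rightarrow> (nat set \<Rightarrow> ('a, 'b) superop) \<Rightarrow> real" where
  "coherent_info_max \<A> A J M = (GREATEST c. \<exists>\<phi>\<in>unit_kets (A \<times> A).
     c = Min ((\<lambda>T. coherent_info A (J T) (so_tensor A A id (M T) (ketbra \<phi>))) ` \<A>))"

definition Ic :: "nat \<Rightarrow> nat \<Rightarrow> (nat \<Rightarrow> nat) \<Rightarrow> (nat, nat \<Rightarrow> nat) superop \<Rightarrow> nat set set \<Rightarrow> real" where
  "Ic K dA dB N \<A> =
     coherent_info_max \<A> {..<dA} (sys_B dB) (marginal_channel K dB N)"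

definition Ic_power ::
  "nat \<Rightarrow> nat \<Rightarrow> (nat \<Rightarrow> nat) \<Rightarrow> (nat, nat \<Rightarrow> nat) superop \<Rightarrow> nat set set \<Rightarrow> nat \<Rightarrow> real" where
  "Ic_power K dA dB N \<A> n =
     coherent_info_max \<A> (sys_power n {..<dA}) (\<lambda>T. sys_power n (sys_B dB T))
       (\<lambda>T. so_power n {..<dA} (sys_B dB T) (marginal_channel K dB N T))"

definition secret_dim :: "nat \<Rightarrow> real \<Rightarrow> nat" where
  "secret_dim n R = nat (max 1 \<lfloor>2 powr (real n * R)\<rfloor>)"

definition qss_code ::
  "nat \<Rightarrow> (nat \<Rightarrow> nat) \<Rightarrow> nat set set \<Rightarrow> nat \<Rightarrow> nat \<Rightarrow> (nat, nat \<Rightarrow> nat) superop \<Rightarrow>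
   (nat set \<Rightarrow> (nat \<Rightarrow> nat \<Rightarrow> nat, nat) superop) \<Rightarrow> bool" where
  "qss_code dA dB \<A> m n F D \<longleftrightarrow>
     channel {..<m} (sys_power n {..<dA}) F \<and>
     (\<forall>T\<in>\<A>. channel (sys_power n (sys_B dB T)) {..<m} (D T))"

text \<open>
  The state on \<open>S'\<close>, the decoded system, and \<open>n\<close> copies of \<open>B\<^bsub>T\<^sup>c\<^esub>\<close>, grouped as
  \<open>(S' \<times> S) \<times> B\<^bsub>T\<^sup>c\<^esub>\<^sup>n\<close>, for a secret space of dimension \<open>m\<close>.  Before decoding, the channel output
  is regrouped from \<open>S' \<times> B\<^sup>n\<close> to \<open>(S' \<times> B\<^sub>T\<^sup>n) \<times> B\<^bsub>T\<^sup>c\<^esub>\<^sup>n\<close>.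
\<close>

definition decoded_state ::
  "nat \<Rightarrow> nat \<Rightarrow> (nat \<Rightarrow> nat) \<Rightarrow> (nat, nat \<Rightarrow> nat) superop \<Rightarrow> nat \<Rightarrow> nat \<Rightarrow>
   (nat, nat \<Rightarrow> nat) superop \<Rightarrow> (nat set \<Rightarrow> (nat \<Rightarrow> nat \<Rightarrow> nat, nat) superop) \<Rightarrow> nat set \<Rightarrow>
   (nat \<times> nat) ket \<Rightarrow> ((nat \<times> nat) \<times> (nat \<Rightarrow> nat \<Rightarrow> nat)) oper" where
  "decoded_state K dA dB N m n F D T \<phi> =
     (let S = {..<m};
          T' = {1..K} - T;
          BT = sys_power n (sys_B dB T);
          BT' = sys_power n (sys_B dB T');
          out = so_tensor S S id (so_power n {..<dA} (sys_B dB {1..K}) N \<circ> F) (ketbra \<phi>);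
          regrouped = relabel ((S \<times> BT) \<times> BT')
            (\<lambda>((s, x), y). (s, \<lambda>t\<in>{..<n}. merge T T' (x t, y t))) out
      in so_tensor (S \<times> BT) BT' (so_tensor S BT id (D T)) id regrouped)"

definition reduced_decoded_state ::
  "nat \<Rightarrow> nat \<Rightarrow> (nat \<Rightarrow> nat) \<Rightarrow> (nat, nat \<Rightarrow> nat) superop \<Rightarrow> nat \<Rightarrow> nat \<Rightarrow>
   (nat, nat \<Rightarrow> nat) superop \<Rightarrow> (nat set \<Rightarrow> (nat \<Rightarrow> nat \<Rightarrow> nat, nat) superop) \<Rightarrow> nat set \<Rightarrow>
   (nat \<times> nat) ket \<Rightarrow> (nat \<times> nat) oper" where
  "reduced_decoded_state K dA dB N m n F D T \<phi> =
     ptrace_snd (sys_power n (sys_B dB ({1..K} - T))) (decoded_state K dA dB N m n F D T \<phi>)"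

definition achievable_qss_rate ::
  "nat \<Rightarrow> nat \<Rightarrow> (nat \<Rightarrow> nat) \<Rightarrow> (nat, nat \<Rightarrow> nat) superop \<Rightarrow> nat set set \<Rightarrow> real \<Rightarrow> bool" where
  "achievable_qss_rate K dA dB N \<A> R \<longleftrightarrow> R \<ge> 0 \<and>
     (\<forall>\<epsilon>>0. \<forall>\<delta>>0. \<forall>\<^sub>F n in sequentially. \<exists>F D.
        qss_code dA dB \<A> (secret_dim n (R - \<delta>)) n F D \<and>
        (\<forall>T\<in>\<A>. \<forall>\<phi>\<in>unit_kets ({..<secret_dim n (R - \<delta>)} \<times> {..<secret_dim n (R - \<delta>)}).
           fidelity ({..<secret_dim n (R - \<delta>)} \<times> {..<secret_dim n (R - \<delta>)}) (ketbra \<phi>)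
             (reduced_decoded_state K dA dB N (secret_dim n (R - \<delta>)) n F D T \<phi>) \<ge> 1 - \<epsilon>))"

definition qss_capacity ::
  "nat \<Rightarrow> nat \<Rightarrow> (nat \<Rightarrow> nat) \<Rightarrow> (nat, nat \<Rightarrow> nat) superop \<Rightarrow> nat set set \<Rightarrow> ereal" where
  "qss_capacity K dA dB N \<A> = Sup (ereal ` {R. achievable_qss_rate K dA dB N \<A> R})"

end

theory Submission
  imports Defs "HOL-Real_Asymp.Real_Asymp"
begin

text \<open>
  Direct part: encoding with \<open>\<surd>\<rho>\<close> times random phases sends a maximally entangled state to an amplitude
  matrix \<open>M\<close> between output and reference with environment. The adjoint of the polar part of \<open>M\<close>
  decodes, and \<open>2 \<surd>Z \<ge> 3 Z - Z^2\<close> for \<open>Z = M\<^sup>\<dagger> M\<close> bounds the entanglement fidelity by second and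
  fourth moments of the phases. It is close to 1 for all \<open>T\<close> simultaneously once the code size times the
  largest output eigenvalue is small against the smallest environment eigenvalue; on typical
  subspaces this allows every rate below the coherent information. The estimate needs output and
  environment diagonal in the chosen bases, which is achieved by rotating the Kraus operators.
  Expurgation passes from entanglement fidelity to worst-case fidelity, and codes for blocks of
  \<open>k\<close> channel uses give codes for all large \<open>n\<close>.

  Converse: in a code of high fidelity some Kraus operator of the encoder, applied to a maximally
  entangled state, gives a pure input that every \<open>T\<close> decodes. The output is then nearly the product of
  the secret and a rest that is isometric to the environment, and perturbation bounds for the
  entropies of Gram operators compare the rate with the coherent information.
\<close>

section \<open>Complex vectors and matrices over finite index sets\<close>

text \<open>One encoder must serve every \<open>T \<in> \<A>\<close>, so losses are summed over
  \<open>T\<close> before anything is chosen: the phases, the expurgated subspace and, in the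
  converse, the Kraus operator. Random phases in the input eigenbasis replace a Haar average and
  need only finitely many moments. Their fourth moment splits into two pairings. One is bounded by
  Bessel's inequality and costs as much as a single second moment, so that (3 - 1) / 2 = 1 survives
  in the cubic bound. The other is the output purity divided by an environment eigenvalue; this
  ratio is why the rate is a difference of two entropies.

  The obstacle in the converse is that the maximum runs over pure inputs, with a reference as large
  as the input, while an encoder may be noisy and have a reference of another size. Dimensions grow
  exponentially in \<open>n\<close>, so an error \<open>t\<close> costs a multiple of
  \<open>n * t\<close>; hence \<open>t\<close> is fixed while \<open>n\<close> grows and is made
  small only afterwards.\<close>

definition ip :: "'i set \<Rightarrow> ('i \<Rightarrow> complex) \<Rightarrow> ('i \<Rightarrow> complex) \<Rightarrow> complex" where
  "ip I u v = (\<Sum>i\<in>I. cnj (u i) * v i)"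

definition nsq :: "'i set \<Rightarrow> ('i \<Rightarrow> complex) \<Rightarrow> real" where
  "nsq I v = (\<Sum>i\<in>I. (cmod (v i))^2)"

text \<open>Only entries on \<open>I\<close> count, so vectors may be arbitrary functions off
  \<open>I\<close>; the index set \<open>K\<close> is independent of \<open>I\<close> and may be
  smaller.\<close>

definition orthon :: "'k set \<Rightarrow> 'i set \<Rightarrow> ('k \<Rightarrow> 'i \<Rightarrow> complex) \<Rightarrow> bool" where
  "orthon K I u \<longleftrightarrow> (\<forall>k\<in>K. \<forall>l\<in>K. ip I (u k) (u l) = (if k = l then 1 else 0))"

lemma cmod_sq: "of_real ((cmod z)^2) = cnj z * z"
  by (metis complex_norm_square mult.commute of_real_power)

lemma cmod_sq': "(of_real (cmod z))^2 = cnj z * z"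
  using cmod_sq[of z] by simp

lemma ip_self: "ip I v v = of_real (nsq I v)"
  by (simp add: ip_def nsq_def cmod_sq')

lemma nsq_ip: "nsq I v = Re (ip I v v)"
  by (simp add: ip_self)

lemma nsq_nonneg [simp]: "0 \<le> nsq I v"
  by (simp add: nsq_def sum_nonneg)

lemma nsq_eq_0: "finite I \<Longrightarrow> nsq I v = 0 \<longleftrightarrow> (\<forall>i\<in>I. v i = 0)"
  by (simp add: nsq_def sum_nonneg_eq_0_iff)

lemma nsq_scale: "nsq I (\<lambda>i. c * v i) = (cmod c)^2 * nsq I v"
  by (simp add: nsq_def norm_mult power_mult_distrib sum_distrib_left)

lemma nsq_cong: "(\<And>i. i \<in> I \<Longrightarrow> u i = v i) \<Longrightarrow> nsq I u = nsq I v"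
  by (simp add: nsq_def)

lemma ip_cong:
  "(\<And>i. i \<in> I \<Longrightarrow> u i = u' i) \<Longrightarrow> (\<And>i. i \<in> I \<Longrightarrow> v i = v' i) \<Longrightarrow> ip I u v = ip I u' v'"
  by (simp add: ip_def)

lemma ip_commute: "ip I u v = cnj (ip I v u)"
  by (simp add: ip_def mult.commute)

lemma ip_add_right: "ip I u (\<lambda>i. v i + w i) = ip I u v + ip I u w"
  by (simp add: ip_def algebra_simps sum.distrib)

lemma ip_add_left: "ip I (\<lambda>i. v i + w i) u = ip I v u + ip I w u"
  by (simp add: ip_def algebra_simps sum.distrib)

lemma ip_diff_right: "ip I u (\<lambda>i. v i - w i) = ip I u v - ip I u w"
  by (simp add: ip_def algebra_simps sum_subtractf)

lemma ip_diff_left: "ip I (\<lambda>i. v i - w i) u = ip I v u - ip I w u"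
  by (simp add: ip_def algebra_simps sum_subtractf)

lemma ip_scale_right: "ip I u (\<lambda>i. c * v i) = c * ip I u v"
  by (simp add: ip_def algebra_simps sum_distrib_left)

lemma ip_scale_left: "ip I (\<lambda>i. c * v i) u = cnj c * ip I v u"
  by (simp add: ip_def algebra_simps sum_distrib_left)

lemma ip_sum_right: "ip I u (\<lambda>i. \<Sum>k\<in>K. v k i) = (\<Sum>k\<in>K. ip I u (v k))"
  unfolding ip_def by (simp add: sum_distrib_left) (rule sum.swap)

lemma ip_sum_left: "ip I (\<lambda>i. \<Sum>k\<in>K. v k i) u = (\<Sum>k\<in>K. ip I (v k) u)"
  unfolding ip_def by (simp add: sum_distrib_right) (rule sum.swap)

lemma nsq_diff: "nsq I (\<lambda>i. u i - v i) = nsq I u - 2 * Re (ip I u v) + nsq I v"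
proof -
  have "ip I (\<lambda>i. u i - v i) (\<lambda>i. u i - v i) = ip I u u - ip I u v - cnj (ip I u v) + ip I v v"
    by (simp add: ip_diff_left ip_diff_right flip: ip_commute[of I v u])
  then show ?thesis by (simp add: nsq_ip)
qed

lemma nsq_add: "nsq I (\<lambda>i. u i + v i) = nsq I u + 2 * Re (ip I u v) + nsq I v"
proof -
  have "ip I (\<lambda>i. u i + v i) (\<lambda>i. u i + v i) = ip I u u + ip I u v + cnj (ip I u v) + ip I v v"
    by (simp add: ip_add_left ip_add_right flip: ip_commute[of I v u])
  then show ?thesis by (simp add: nsq_ip)
qed

lemma cauchy_schwarz_ip: "(cmod (ip I u v))^2 \<le> nsq I u * nsq I v"
proof -
  have "cmod (ip I u v) \<le> (\<Sum>i\<in>I. cmod (u i) * cmod (v i))"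
    unfolding ip_def by (rule order_trans[OF norm_sum]) (simp add: norm_mult)
  then have "(cmod (ip I u v))^2 \<le> (\<Sum>i\<in>I. cmod (u i) * cmod (v i))^2"
    by (simp add: power_mono)
  also have "\<dots> \<le> (\<Sum>i\<in>I. (cmod (u i))^2) * (\<Sum>i\<in>I. (cmod (v i))^2)"
    by (rule Cauchy_Schwarz_ineq_sum)
  finally show ?thesis by (simp add: nsq_def)
qed

lemma orthonD: "orthon K I u \<Longrightarrow> k \<in> K \<Longrightarrow> l \<in> K \<Longrightarrow> ip I (u k) (u l) = (if k = l then 1 else 0)"
  by (simp add: orthon_def)

lemma orthon_nsq: "orthon K I u \<Longrightarrow> k \<in> K \<Longrightarrow> nsq I (u k) = 1"
  by (simp add: nsq_ip orthonD)

lemma orthon_subset: "orthon K I u \<Longrightarrow> L \<subseteq> K \<Longrightarrow> orthon L I u"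
  unfolding orthon_def by blast

lemma orthon_ip_comb:
  assumes "finite K" "orthon K I u" "k \<in> K"
  shows "ip I (u k) (\<lambda>i. \<Sum>l\<in>K. c l * u l i) = c k" (is "?lhs = _")
proof -
  have "?lhs = (\<Sum>l\<in>K. c l * (if k = l then 1 else 0))"
    using assms by (simp add: ip_sum_right ip_scale_right orthonD)
  also have "\<dots> = (\<Sum>l\<in>K. if k = l then c l else 0)" by (rule sum.cong) auto
  also have "\<dots> = c k" using assms by simp
  finally show ?thesis .
qed

lemma nsq_orthon_comb:
  assumes "finite K" "orthon K I u"
  shows "nsq I (\<lambda>i. \<Sum>k\<in>K. c k * u k i) = (\<Sum>k\<in>K. (cmod (c k))^2)"
proof -
  have "ip I (\<lambda>i. \<Sum>k\<in>K. c k * u k i) (\<lambda>i. \<Sum>k\<in>K. c k * u k i) = (\<Sum>k\<in>K. cnj (c k) * c k)"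
    using assms by (simp add: ip_sum_left ip_scale_left orthon_ip_comb)
  also have "\<dots> = of_real (\<Sum>k\<in>K. (cmod (c k))^2)"
    by (simp add: cmod_sq')
  finally show ?thesis by (simp add: nsq_ip)
qed

text \<open>Pythagoras. The equality, beyond Bessel's inequality, is what turns a tight Bessel sum
  into an expansion.\<close>

lemma nsq_orthon_residual:
  assumes "finite K" "orthon K I u"
  shows "nsq I (\<lambda>i. v i - (\<Sum>k\<in>K. ip I (u k) v * u k i))
    = nsq I v - (\<Sum>k\<in>K. (cmod (ip I (u k) v))^2)"
proof -
  have "ip I v (\<lambda>i. \<Sum>k\<in>K. ip I (u k) v * u k i) = (\<Sum>k\<in>K. of_real ((cmod (ip I (u k) v))^2))"
    unfolding ip_sum_right ip_scale_right
    by (intro sum.cong refl) (metis cmod_sq ip_commute mult.commute)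
  then have "Re (ip I v (\<lambda>i. \<Sum>k\<in>K. ip I (u k) v * u k i)) = (\<Sum>k\<in>K. (cmod (ip I (u k) v))^2)"
    by simp
  then show ?thesis
    using assms by (simp add: nsq_diff nsq_orthon_comb)
qed

lemma bessel:
  assumes "finite K" "orthon K I u"
  shows "(\<Sum>k\<in>K. (cmod (ip I (u k) v))^2) \<le> nsq I v"
  using nsq_orthon_residual[OF assms, of v]
    nsq_nonneg[of I "\<lambda>i. v i - (\<Sum>k\<in>K. ip I (u k) v * u k i)"] by linarith

lemma ip_delta_right:
  assumes "finite I" "i \<in> I"
  shows "ip I u (\<lambda>j. if j = i then 1 else 0) = cnj (u i)"
  unfolding ip_def using assms by (simp add: sum.delta if_distrib cong: if_cong)

lemma nsq_delta:
  assumes "finite I" "i \<in> I"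
  shows "nsq I (\<lambda>j. if j = i then 1 else 0) = 1" (is "?lhs = _")
proof -
  have "?lhs = (\<Sum>j\<in>I. if j = i then 1 else 0)"
    unfolding nsq_def by (rule sum.cong) auto
  then show ?thesis using assms by simp
qed

lemma bessel_column:
  assumes "finite K" "orthon K I u" "finite I" "i \<in> I"
  shows "(\<Sum>k\<in>K. (cmod (u k i))^2) \<le> 1"
  using bessel[OF assms(1,2), of "\<lambda>j. if j = i then 1 else 0"] assms
  by (simp add: ip_delta_right nsq_delta)

lemma orthon_sum_nsq:
  assumes "orthon K I u"
  shows "(\<Sum>i\<in>I. \<Sum>k\<in>K. (cmod (u k i))^2) = card K" (is "?lhs = _")
proof -
  have "?lhs = (\<Sum>k\<in>K. nsq I (u k))"
    unfolding nsq_def by (rule sum.swap)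
  then show ?thesis using assms by (simp add: orthon_nsq)
qed

text \<open>By Bessel every column sum of squared entries is at most 1, and together they give
  \<open>card K = card I\<close>, so each equals 1. The residual of a basis vector then has norm 0,
  which is the completeness relation.\<close>

lemma orthon_complete:
  assumes "finite K" "finite I" "orthon K I u" "card K = card I" "i \<in> I" "j \<in> I"
  shows "(\<Sum>k\<in>K. u k i * cnj (u k j)) = (if i = j then 1 else 0)"
proof -
  have 1: "(\<Sum>k\<in>K. (cmod (u k l))^2) = 1" (is "?lhs = _") if "l \<in> I" for l
  proof (rule ccontr)
    assume "(\<Sum>k\<in>K. (cmod (u k l))^2) \<noteq> 1"
    then have "?lhs < 1"
      using bessel_column[OF assms(1,3,2) that] by simp
    then have "(\<Sum>i\<in>I. \<Sum>k\<in>K. (cmod (u k i))^2) < (\<Sum>i\<in>I. 1)"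
      using bessel_column[OF assms(1,3,2)] that assms(2)
      by (intro sum_strict_mono_ex1) auto
    then show False using orthon_sum_nsq[OF assms(3)] assms(4) by simp
  qed
  let ?d = "\<lambda>l. if l = j then (1::complex) else 0"
  have ipd: "ip I (u k) ?d = cnj (u k j)" for k
    by (rule ip_delta_right[OF assms(2,6)])
  have "(\<Sum>k\<in>K. (cmod (ip I (u k) ?d))^2) = 1"
    unfolding ipd complex_mod_cnj by (rule 1[OF assms(6)])
  then have "nsq I (\<lambda>l. ?d l - (\<Sum>k\<in>K. ip I (u k) ?d * u k l)) = 0"
    unfolding nsq_orthon_residual[OF assms(1,3), of ?d] nsq_delta[OF assms(2,6)] by linarith
  then have "\<forall>l\<in>I. ?d l - (\<Sum>k\<in>K. ip I (u k) ?d * u k l) = 0"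
    unfolding nsq_eq_0[OF assms(2)] .
  from bspec[OF this assms(5)] have "(\<Sum>k\<in>K. ip I (u k) ?d * u k i) = ?d i"
    by (simp only: right_minus_eq)
  then show ?thesis unfolding ipd by (simp only: mult.commute)
qed

section \<open>Matrices, positivity and spectral decompositions\<close>

definition mv :: "'j set \<Rightarrow> ('i \<Rightarrow> 'j \<Rightarrow> complex) \<Rightarrow> ('j \<Rightarrow> complex) \<Rightarrow> 'i \<Rightarrow> complex" where
  "mv J M v = (\<lambda>i. \<Sum>j\<in>J. M i j * v j)"

definition hermitian :: "'i set \<Rightarrow> 'i oper \<Rightarrow> bool" where
  "hermitian I X \<longleftrightarrow> (\<forall>i\<in>I. \<forall>j\<in>I. X i j = cnj (X j i))"

definition psd :: "'i set \<Rightarrow> 'i oper \<Rightarrow> bool" where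
  "psd I X \<longleftrightarrow> (\<forall>v. ip I v (mv I X v) \<in> \<real>\<^sub>\<ge>\<^sub>0)"

text \<open>The eigenvectors carry their own index set \<open>K\<close>, so an operator of low rank
  can be described by its nonzero eigenvalues alone. Dual Gram operators and rank-one operators are
  treated in this way.\<close>

definition spec :: "'i set \<Rightarrow> 'i oper \<Rightarrow> 'k set \<Rightarrow> ('k \<Rightarrow> 'i \<Rightarrow> complex) \<Rightarrow> ('k \<Rightarrow> real) \<Rightarrow> bool" where
  "spec I X K u d \<longleftrightarrow> finite K \<and> orthon K I u \<and>
     (\<forall>i\<in>I. \<forall>j\<in>I. X i j = (\<Sum>k\<in>K. of_real (d k) * u k i * cnj (u k j)))"

lemma mv_cong: "(\<And>j. j \<in> J \<Longrightarrow> v j = w j) \<Longrightarrow> mv J M v = mv J M w"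
  by (simp add: mv_def)

lemma mv_add: "mv J M (\<lambda>j. v j + w j) = (\<lambda>i. mv J M v i + mv J M w i)"
  by (simp add: mv_def algebra_simps sum.distrib)

lemma mv_scale: "mv J M (\<lambda>j. c * v j) = (\<lambda>i. c * mv J M v i)"
  by (simp add: mv_def algebra_simps sum_distrib_left)

lemma mv_sum: "mv J M (\<lambda>j. \<Sum>k\<in>K. v k j) = (\<lambda>i. \<Sum>k\<in>K. mv J M (v k) i)"
  by (rule ext) (simp add: mv_def sum_distrib_left sum.swap[of _ K J])

lemma mv_delta: "finite J \<Longrightarrow> a \<in> J \<Longrightarrow> mv J M (\<lambda>j. if j = a then 1 else 0) = (\<lambda>i. M i a)"
proof (rule ext)
  fix i assume a: "finite J" "a \<in> J"
  have "mv J M (\<lambda>j. if j = a then 1 else 0) i = (\<Sum>j\<in>J. if j = a then M i j else 0)"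
    unfolding mv_def by (rule sum.cong) auto
  then show "mv J M (\<lambda>j. if j = a then 1 else 0) i = M i a" using a by simp
qed

lemma ip_delta_left: "finite I \<Longrightarrow> a \<in> I \<Longrightarrow> ip I (\<lambda>j. if j = a then 1 else 0) v = v a"
proof -
  assume a: "finite I" "a \<in> I"
  have "ip I (\<lambda>j. if j = a then 1 else 0) v = (\<Sum>j\<in>I. if j = a then v j else 0)"
    unfolding ip_def by (rule sum.cong) auto
  then show ?thesis using a by simp
qed

lemma ip_mv: "ip I w (mv J M v) = (\<Sum>i\<in>I. \<Sum>j\<in>J. cnj (w i) * M i j * v j)"
  by (simp add: ip_def mv_def sum_distrib_left mult.assoc)

lemma ip_mv_adjoint: "ip I w (mv J M v) = ip J (mv I (\<lambda>j i. cnj (M i j)) w) v"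
  unfolding ip_mv unfolding ip_def mv_def cnj_sum sum_distrib_right
  by (subst sum.swap) (intro sum.cong refl, simp)

lemma hermitian_ip:
  assumes "hermitian I X"
  shows "ip I w (mv I X v) = ip I (mv I X w) v"
proof -
  have "mv I (\<lambda>j i. cnj (X i j)) w i = mv I X w i" if "i \<in> I" for i
    unfolding mv_def
  proof (rule sum.cong)
    fix j assume "j \<in> I"
    then have "X i j = cnj (X j i)" using assms that unfolding hermitian_def by blast
    then show "cnj (X j i) * w j = X i j * w j" by simp
  qed simp
  then show ?thesis unfolding ip_mv_adjoint by (intro ip_cong) auto
qed

lemma continuous_on_coord: "continuous_on S (\<lambda>v::'i \<Rightarrow> complex. v i)"
  using continuous_on_product_coordinates by (rule continuous_on_subset) auto

text \<open>The type \<open>'i\<close> may be infinite. Forcing the entries off \<open>I\<close> to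
  be 0 places the set in a product of closed discs and singletons, compact by Tychonoff, and the
  other conditions are closed. The constraints indexed by \<open>J\<close> serve the successive
  search for eigenvectors.\<close>

lemma compact_unit_sphere:
  fixes I :: "'i set" and J :: "'j set"
  assumes "finite I"
  shows "compact {v::'i \<Rightarrow> complex. (\<forall>i. i \<notin> I \<longrightarrow> v i = 0) \<and> nsq I v = 1 \<and> (\<forall>k\<in>J. ip I (u k) v = 0)}"
    (is "compact ?S")
proof -
  let ?P = "PiE UNIV (\<lambda>i::'i. if i \<in> I then cball (0::complex) 1 else {0})"
  have "compactin (product_topology (\<lambda>i. euclidean) UNIV) ?P"
    by (subst compactin_PiE) auto
  then have cP: "compact ?P"
    by (simp add: euclidean_product_topology)
  let ?F = "\<Inter>k\<in>J. {v. ip I (u k) v = 0}"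
  have "closed {v::'i \<Rightarrow> complex. nsq I v = 1}"
    unfolding nsq_def
    by (intro closed_Collect_eq continuous_intros continuous_on_coord)
  moreover have "closed {v::'i \<Rightarrow> complex. ip I (u k) v = 0}" for k
    unfolding ip_def
    by (intro closed_Collect_eq continuous_intros continuous_on_coord)
  then have "closed (\<Inter>k\<in>J. {v::'i \<Rightarrow> complex. ip I (u k) v = 0})"
    by blast
  ultimately have "closed ({v::'i \<Rightarrow> complex. nsq I v = 1} \<inter> ?F)"
    by (rule closed_Int)
  from compact_Int_closed[OF cP this]
  have c: "compact (?P \<inter> ({v::'i \<Rightarrow> complex. nsq I v = 1} \<inter> ?F))" .
  have "?S = ?P \<inter> ({v. nsq I v = 1} \<inter> ?F)"
  proof (intro equalityI subsetI)
    fix v assume v: "v \<in> ?S"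
    have "cmod (v i) \<le> 1" if "i \<in> I" for i
    proof -
      have "(cmod (v i))^2 \<le> nsq I v"
        unfolding nsq_def using assms that by (intro member_le_sum) auto
      then show ?thesis using v by (simp add: power_le_one_iff)
    qed
    then show "v \<in> ?P \<inter> ({v. nsq I v = 1} \<inter> ?F)"
      using v by (auto simp: PiE_iff)
  next
    fix v assume v: "v \<in> ?P \<inter> ({v. nsq I v = 1} \<inter> ?F)"
    then have "v i \<in> (if i \<in> I then cball 0 1 else {0})" for i by (auto simp: PiE_iff)
    then have "v i = 0" if "i \<notin> I" for i using that by (metis singletonD)
    then show "v \<in> ?S" using v by auto
  qed
  then show ?thesis using c by simp
qed

text \<open>The column sums of squares add up to \<open>card J < card I\<close>, so some basis
  vector has a Bessel sum below 1. Its residual is nonzero and is normalised.\<close>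

lemma orthon_extend:
  assumes fin: "finite I" "finite J" and o: "orthon J I u" and less: "card J < card I"
  obtains v where "\<forall>i. i \<notin> I \<longrightarrow> v i = 0" "nsq I v = 1" "\<forall>k\<in>J. ip I (u k) v = 0"
proof -
  have "\<exists>i\<in>I. (\<Sum>k\<in>J. (cmod (u k i))^2) < 1"
  proof (rule ccontr)
    assume "\<not> ?thesis"
    then have "(\<Sum>i\<in>I. 1) \<le> (\<Sum>i\<in>I. \<Sum>k\<in>J. (cmod (u k i))^2)"
      by (intro sum_mono) (auto simp: not_less)
    then show False using orthon_sum_nsq[OF o] less by simp
  qed
  then obtain a where a: "a \<in> I" "(\<Sum>k\<in>J. (cmod (u k a))^2) < 1" by blast
  let ?e = "\<lambda>j. if j = a then (1::complex) else 0"
  define r where "r i = ?e i - (\<Sum>k\<in>J. ip I (u k) ?e * u k i)" for i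
  have ipd: "ip I (u k) ?e = cnj (u k a)" for k
    by (rule ip_delta_right[OF fin(1) a(1)])
  have "nsq I r = 1 - (\<Sum>k\<in>J. (cmod (ip I (u k) ?e))^2)"
    unfolding r_def nsq_orthon_residual[OF fin(2) o, of ?e] nsq_delta[OF fin(1) a(1)] ..
  also have "\<dots> = 1 - (\<Sum>k\<in>J. (cmod (u k a))^2)"
    unfolding ipd complex_mod_cnj ..
  finally have pos: "nsq I r > 0" using a(2) by linarith
  have orth: "ip I (u k) r = 0" if "k \<in> J" for k
    unfolding r_def ip_diff_right
    using orthon_ip_comb[OF fin(2) o that, of "\<lambda>k. ip I (u k) ?e"] by simp
  define c where "c = complex_of_real (1 / sqrt (nsq I r))"
  define v where "v i = (if i \<in> I then c * r i else 0)" for i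
  have "nsq I v = nsq I (\<lambda>i. c * r i)" by (rule nsq_cong) (simp add: v_def)
  also have "\<dots> = 1" unfolding nsq_scale c_def using pos by (simp add: norm_divide power_divide)
  finally have "nsq I v = 1" .
  moreover have "ip I (u k) v = 0" if "k \<in> J" for k
  proof -
    have "ip I (u k) v = ip I (u k) (\<lambda>i. c * r i)" by (rule ip_cong) (simp_all add: v_def)
    then show ?thesis using orth[OF that] by (simp add: ip_scale_right)
  qed
  ultimately show ?thesis using that[of v] by (simp add: v_def)
qed

lemma Re_complex_of_real_mult: "Re (of_real r * z) = r * Re z"
  by simp

text \<open>The eigenvector maximises the quadratic form on the orthogonal complement of the previous ones.\<close>

lemma eigenvector_extend:
  assumes fin: "finite I" "finite J" and h: "hermitian I X" and o: "orthon J I u"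
    and eig: "\<And>k i. k \<in> J \<Longrightarrow> i \<in> I \<Longrightarrow> mv I X (u k) i = complex_of_real (d k) * u k i"
    and less: "card J < card I"
  obtains v l where "nsq I v = 1" "\<forall>k\<in>J. ip I (u k) v = 0"
    "\<forall>i\<in>I. mv I X v i = complex_of_real l * v i"
proof -
  let ?S = "{v. (\<forall>i. i \<notin> I \<longrightarrow> v i = 0) \<and> nsq I v = 1 \<and> (\<forall>k\<in>J. ip I (u k) v = 0)}"
  define f where "f v = Re (ip I v (mv I X v))" for v
  have "continuous_on ?S f"
    unfolding f_def ip_mv by (intro continuous_intros continuous_on_coord)
  moreover have "?S \<noteq> {}"
  proof (rule orthon_extend[OF fin o less])
    fix v assume "\<forall>i. i \<notin> I \<longrightarrow> v i = 0" "nsq I v = 1" "\<forall>k\<in>J. ip I (u k) v = 0"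
    then have "v \<in> ?S" by simp
    then show "?S \<noteq> {}" by (intro notI) (simp only: empty_iff)
  qed
  ultimately have "\<exists>v\<in>?S. \<forall>w\<in>?S. f w \<le> f v"
    by (intro continuous_attains_sup compact_unit_sphere fin)
  then obtain v where vS: "v \<in> ?S" and vmax: "\<forall>w\<in>?S. f w \<le> f v" by (elim bexE)
  have v: "nsq I v = 1" "\<forall>k\<in>J. ip I (u k) v = 0" using vS by simp_all
  define l where "l = f v"
  have f_le: "f w \<le> l * nsq I w" if w: "\<forall>k\<in>J. ip I (u k) w = 0" for w
  proof (cases "nsq I w = 0")
    case True
    then have "w i = 0" if "i \<in> I" for i using that nsq_eq_0[OF fin(1)] by blast
    then have "f w = 0" unfolding f_def ip_mv by simp
    then show ?thesis using True by simp
  next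
    case False
    then have pos: "nsq I w > 0" using nsq_nonneg[of I w] by linarith
    define c where "c = complex_of_real (1 / sqrt (nsq I w))"
    define w' where "w' i = (if i \<in> I then c * w i else 0)" for i
    have "nsq I w' = nsq I (\<lambda>i. c * w i)" by (rule nsq_cong) (simp add: w'_def)
    also have "\<dots> = 1" unfolding nsq_scale c_def using pos by (simp add: norm_divide power_divide)
    finally have "nsq I w' = 1" .
    moreover have "ip I (u k) w' = 0" if "k \<in> J" for k
    proof -
      have "ip I (u k) w' = ip I (u k) (\<lambda>i. c * w i)" by (rule ip_cong) (simp_all add: w'_def)
      then show ?thesis using w that by (simp add: ip_scale_right)
    qed
    ultimately have "w' \<in> ?S" by (simp add: w'_def)
    with vmax have "f w' \<le> l" unfolding l_def by (rule bspec)
    moreover have "mv I X w' = mv I X (\<lambda>i. c * w i)" by (rule mv_cong) (simp add: w'_def)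
    then have "ip I w' (mv I X w') = ip I (\<lambda>i. c * w i) (\<lambda>i. c * mv I X w i)"
      by (intro ip_cong) (simp_all add: w'_def mv_scale)
    then have e: "ip I w' (mv I X w') = cnj c * c * ip I w (mv I X w)"
      unfolding ip_scale_left ip_scale_right by (simp only: mult.assoc)
    have "1 / sqrt (nsq I w) * (1 / sqrt (nsq I w)) = 1 / nsq I w" using pos by simp
    then have cc: "cnj c * c = complex_of_real (1 / nsq I w)"
      unfolding c_def by (simp only: complex_cnj_complex_of_real flip: of_real_mult)
    have "f w' = 1 / nsq I w * f w" unfolding f_def e cc by (rule Re_complex_of_real_mult)
    then have "f w' = f w / nsq I w" by simp
    ultimately show ?thesis using pos by (simp add: field_simps)
  qed
  \<comment> \<open>The residual of the eigenvalue equation. It is orthogonal to the earlier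
    eigenvectors, so \<open>v + t y\<close> is an admissible competitor, and a nonzero
    \<open>y\<close> would make the quadratic form grow to first order in \<open>t\<close>.\<close>
  define y where "y i = mv I X v i - complex_of_real l * v i" for i
  have y_orth: "ip I (u k) y = 0" if k: "k \<in> J" for k
  proof -
    have "ip I (u k) (mv I X v) = ip I (\<lambda>i. complex_of_real (d k) * u k i) v"
      unfolding hermitian_ip[OF h] using eig[OF k] by (intro ip_cong) auto
    then show ?thesis
      unfolding y_def using v(2) k by (simp add: ip_diff_right ip_scale_right ip_scale_left)
  qed
  have "nsq I y = 0"
  proof (rule ccontr)
    assume "nsq I y \<noteq> 0"
    then have pos: "nsq I y > 0" using nsq_nonneg[of I y] by linarith
    define c where "c = f y - l * nsq I y"
    \<comment> \<open>Small enough that the second-order term \<open>t^2 * c\<close> cannot cancel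
      the linear gain \<open>2 * t * nsq I y\<close>.\<close>
    define t where "t = nsq I y / (\<bar>c\<bar> + 1)"
    have t: "t > 0" using pos by (simp add: t_def)
    define w where "w i = v i + complex_of_real t * y i" for i
    have "\<forall>k\<in>J. ip I (u k) w = 0"
      unfolding w_def using v(2) y_orth by (simp add: ip_add_right ip_scale_right)
    from f_le[OF this] have 1: "f w \<le> l * nsq I w" .
    have a: "Re (ip I v (mv I X y)) = Re (ip I y (mv I X v))"
      unfolding hermitian_ip[OF h, of v y] by (subst ip_commute) simp
    have 2: "f w = f v + 2 * t * Re (ip I y (mv I X v)) + t^2 * f y"
      unfolding f_def w_def mv_add mv_scale ip_add_left ip_add_right ip_scale_left ip_scale_right
      using a by (simp add: algebra_simps power2_eq_square)
    have b: "Re (ip I v y) = Re (ip I y v)" by (subst ip_commute) simp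
    have 3: "nsq I w = 1 + 2 * t * Re (ip I y v) + t^2 * nsq I y"
      unfolding w_def nsq_add ip_scale_right nsq_scale using v(1) b by simp
    have "ip I y y = ip I y (mv I X v) - complex_of_real l * ip I y v"
      unfolding ip_scale_right[symmetric] ip_diff_right[symmetric] y_def ..
    then have 4: "nsq I y = Re (ip I y (mv I X v)) - l * Re (ip I y v)"
      by (simp add: nsq_ip)
    have "2 * t * nsq I y + t^2 * c \<le> 0"
      using 1 unfolding 2 3 4 c_def l_def by (simp add: algebra_simps)
    then have "t * (2 * nsq I y + t * c) \<le> 0" by (simp add: algebra_simps power2_eq_square)
    then have 5: "2 * nsq I y + t * c \<le> 0" using t by (simp add: mult_le_0_iff)
    have "t * \<bar>c\<bar> \<le> t * (\<bar>c\<bar> + 1)" using t by simp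
    also have "\<dots> = nsq I y" by (simp add: t_def)
    finally have "\<bar>t * c\<bar> \<le> nsq I y" using t by (simp add: abs_mult)
    then show False using 5 pos by linarith
  qed
  then have "\<forall>i\<in>I. y i = 0" using nsq_eq_0[OF fin(1)] by blast
  then have "\<forall>i\<in>I. mv I X v i = complex_of_real l * v i" by (simp add: y_def)
  then show ?thesis using that v by blast
qed

theorem spectral:
  assumes fin: "finite I" and h: "hermitian I X"
  obtains u d where "spec I X I u d"
proof -
  have "\<exists>u d. orthon J I u \<and> (\<forall>k\<in>J. \<forall>i\<in>I. mv I X (u k) i = of_real (d k) * u k i)"
    if "finite J" "J \<subseteq> I" for J
    using that
  proof (induction J rule: finite_induct)
    case empty
    show ?case by (simp add: orthon_def)
  next
    case (insert a J)
    then obtain u and d :: "'a \<Rightarrow> real" where u: "orthon J I u"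
      "\<And>k i. k \<in> J \<Longrightarrow> i \<in> I \<Longrightarrow> mv I X (u k) i = of_real (d k) * u k i" by blast
    have "card J < card I"
      using insert fin by (intro psubset_card_mono) auto
    from eigenvector_extend[OF fin insert(1) h u this]
    obtain v l where v: "nsq I v = 1" "\<forall>k\<in>J. ip I (u k) v = 0"
      "\<forall>i\<in>I. mv I X v i = of_real l * v i" by metis
    have ka: "k \<noteq> a" if "k \<in> J" for k using that insert(2) by blast
    have "ip I v (u k) = 0" if "k \<in> J" for k using v(2) that by (subst ip_commute) simp
    then have "orthon (insert a J) I (u(a := v))"
      using u(1) v(1,2) insert(2) orthon_nsq[OF u(1)] by (auto simp: orthon_def ip_self)
    moreover have "\<forall>k\<in>insert a J. \<forall>i\<in>I. mv I X ((u(a := v)) k) i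
        = of_real ((d(a := l)) k) * (u(a := v)) k i"
      using u(2) v(3) ka by simp
    ultimately show ?case by blast
  qed
  from this[OF fin] obtain u d where u: "orthon I I u"
    "\<And>k i. k \<in> I \<Longrightarrow> i \<in> I \<Longrightarrow> mv I X (u k) i = of_real (d k) * u k i" by blast
  have "X i j = (\<Sum>k\<in>I. of_real (d k) * u k i * cnj (u k j))" if ij: "i \<in> I" "j \<in> I" for i j
  proof -
    have "X i j = mv I X (\<lambda>l. if l = j then 1 else 0) i"
      using mv_delta[OF fin ij(2), of X] by simp
    also have "\<dots> = mv I X (\<lambda>l. \<Sum>k\<in>I. u k l * cnj (u k j)) i"
      by (rule fun_cong[OF mv_cong]) (simp add: orthon_complete[OF fin fin u(1) refl _ ij(2)])
    also have "\<dots> = (\<Sum>k\<in>I. cnj (u k j) * mv I X (u k) i)"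
      by (simp add: mult.commute[of _ "cnj _"] mv_sum mv_scale)
    also have "\<dots> = (\<Sum>k\<in>I. of_real (d k) * u k i * cnj (u k j))"
      using u(2) ij by (intro sum.cong) (auto simp: mult.commute mult.left_commute)
    finally show ?thesis .
  qed
  then show ?thesis using that[of u d] u(1) fin by (simp add: spec_def)
qed

lemma specD:
  assumes "spec I X K u d"
  shows "finite K" "orthon K I u"
    "\<And>i j. i \<in> I \<Longrightarrow> j \<in> I \<Longrightarrow> X i j = (\<Sum>k\<in>K. of_real (d k) * u k i * cnj (u k j))"
  using assms by (auto simp: spec_def)

lemma spec_mv:
  assumes "spec I X K u d" "i \<in> I"
  shows "mv I X v i = (\<Sum>k\<in>K. of_real (d k) * ip I (u k) v * u k i)"
proof -
  have "mv I X v i = (\<Sum>j\<in>I. \<Sum>k\<in>K. of_real (d k) * u k i * cnj (u k j) * v j)"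
    unfolding mv_def using specD(3)[OF assms(1,2)] by (simp add: sum_distrib_right)
  also have "\<dots> = (\<Sum>k\<in>K. \<Sum>j\<in>I. of_real (d k) * u k i * cnj (u k j) * v j)"
    by (rule sum.swap)
  also have "\<dots> = (\<Sum>k\<in>K. of_real (d k) * ip I (u k) v * u k i)"
    unfolding ip_def sum_distrib_left sum_distrib_right
    by (intro sum.cong refl) (simp only: ac_simps)
  finally show ?thesis .
qed

lemma spec_eigen:
  assumes s: "spec I X K u d" and k: "k \<in> K" and i: "i \<in> I"
  shows "mv I X (u k) i = of_real (d k) * u k i"
proof -
  have "mv I X (u k) i = (\<Sum>l\<in>K. if l = k then of_real (d l) * u l i else 0)"
    unfolding spec_mv[OF s i] using orthonD[OF specD(2)[OF s] _ k] by (intro sum.cong) auto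
  then show ?thesis using specD(1)[OF s] k by simp
qed

lemma spec_form:
  assumes s: "spec I X K u d"
  shows "ip I v (mv I X v) = of_real (\<Sum>k\<in>K. d k * (cmod (ip I (u k) v))^2)"
proof -
  have "ip I v (mv I X v) = ip I v (\<lambda>i. \<Sum>k\<in>K. of_real (d k) * ip I (u k) v * u k i)"
    by (intro ip_cong refl spec_mv[OF s])
  also have "\<dots> = (\<Sum>k\<in>K. of_real (d k) * (ip I (u k) v * ip I v (u k)))"
    by (simp add: ip_sum_right ip_scale_right mult.assoc)
  also have "\<dots> = (\<Sum>k\<in>K. of_real (d k) * of_real ((cmod (ip I (u k) v))^2))"
  proof (intro sum.cong refl)
    fix k
    have "ip I v (u k) = cnj (ip I (u k) v)" by (rule ip_commute)
    then show "of_real (d k) * (ip I (u k) v * ip I v (u k))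
        = of_real (d k) * of_real ((cmod (ip I (u k) v))^2)"
      by (simp only: cmod_sq mult.commute)
  qed
  finally show ?thesis by (simp only: of_real_sum of_real_mult)
qed

lemma spec_eigenvalue:
  assumes s: "spec I X K u d" and k: "k \<in> K"
  shows "ip I (u k) (mv I X (u k)) = of_real (d k)"
proof -
  have "ip I (u k) (mv I X (u k)) = ip I (u k) (\<lambda>i. of_real (d k) * u k i)"
    by (intro ip_cong refl spec_eigen[OF s k])
  then show ?thesis using orthonD[OF specD(2)[OF s] k k] by (simp add: ip_scale_right)
qed

lemma spec_hermitian:
  assumes s: "spec I X K u d"
  shows "hermitian I X"
  unfolding hermitian_def
proof (intro ballI)
  fix i j assume "i \<in> I" "j \<in> I"
  then show "X i j = cnj (X j i)"
    by (simp add: specD(3)[OF s]) (intro sum.cong refl, simp)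
qed

lemma orthon_expand:
  assumes "finite K" "finite I" "orthon K I u" "card K = card I" "i \<in> I"
  shows "(\<Sum>k\<in>K. ip I (u k) v * u k i) = v i" (is "?lhs = _")
proof -
  have "?lhs = (\<Sum>k\<in>K. \<Sum>j\<in>I. v j * (u k i * cnj (u k j)))"
    unfolding ip_def sum_distrib_right by (intro sum.cong refl) (simp only: ac_simps)
  also have "\<dots> = (\<Sum>j\<in>I. v j * (\<Sum>k\<in>K. u k i * cnj (u k j)))"
    unfolding sum_distrib_left by (rule sum.swap)
  also have "\<dots> = (\<Sum>j\<in>I. if i = j then v j else 0)"
    using orthon_complete[OF assms] by (intro sum.cong) auto
  also have "\<dots> = v i" using assms by simp
  finally show ?thesis .
qed

lemma parseval:
  assumes "finite K" "finite I" "orthon K I u" "card K = card I"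
  shows "(\<Sum>k\<in>K. (cmod (ip I (u k) v))^2) = nsq I v"
proof -
  have "nsq I v = nsq I (\<lambda>i. \<Sum>k\<in>K. ip I (u k) v * u k i)"
    by (rule nsq_cong) (simp add: orthon_expand[OF assms])
  then show ?thesis using nsq_orthon_comb[OF assms(1,3)] by simp
qed

text \<open>Eigenvectors for different eigenvalues are orthogonal, so
  \<open>a k l \<noteq> 0\<close> forces \<open>d k = e l\<close>. Columns of \<open>a\<close> sum
  to 1 because \<open>u\<close> is a full basis. Rows are known to sum to 1 only where
  \<open>d k \<noteq> 0\<close>, since \<open>w\<close> may omit the kernel; there
  \<open>f 0 = 0\<close> takes over.\<close>

lemma spec_sum_unique_full:
  assumes fin: "finite I" and s: "spec I X I u d" and t: "spec I X L w e" and f0: "f 0 = 0"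
  shows "(\<Sum>k\<in>I. f (d k)) = (\<Sum>l\<in>L. f (e l) :: real)"
proof -
  define a where "a k l = (cmod (ip I (u k) (w l)))^2" for k l
  note oL = specD(1,2)[OF t] and oI = specD(2)[OF s]
  have eq: "d k = e l" if kl: "k \<in> I" "l \<in> L" and nz: "a k l \<noteq> 0" for k l
  proof -
    have "ip I (u k) (mv I X (w l)) = ip I (u k) (\<lambda>i. of_real (e l) * w l i)"
      by (intro ip_cong refl spec_eigen[OF t kl(2)])
    moreover have "ip I (u k) (mv I X (w l)) = ip I (\<lambda>i. of_real (d k) * u k i) (w l)"
      unfolding hermitian_ip[OF spec_hermitian[OF s]]
      by (intro ip_cong refl spec_eigen[OF s kl(1)])
    ultimately have "of_real (e l) * ip I (u k) (w l) = of_real (d k) * ip I (u k) (w l)"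
      unfolding ip_scale_right ip_scale_left complex_cnj_complex_of_real by (rule trans[OF sym])
    then show ?thesis using nz by (auto simp: a_def)
  qed
  have col: "(\<Sum>k\<in>I. a k l) = 1" if "l \<in> L" for l
    unfolding a_def parseval[OF fin fin oI refl] by (rule orthon_nsq[OF oL(2) that])
  have row: "(\<Sum>l\<in>L. a k l) = 1" if k: "k \<in> I" and nz: "d k \<noteq> 0" for k
  proof -
    have "of_real (d k) = ip I (u k) (mv I X (u k))"
      by (rule spec_eigenvalue[OF s k, symmetric])
    also have "\<dots> = of_real (\<Sum>l\<in>L. e l * (cmod (ip I (w l) (u k)))^2)"
      by (rule spec_form[OF t])
    finally have "d k = (\<Sum>l\<in>L. e l * (cmod (ip I (w l) (u k)))^2)"
      by (simp only: of_real_eq_iff)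
    also have "\<dots> = (\<Sum>l\<in>L. e l * a k l)"
      unfolding a_def by (subst ip_commute) simp
    also have "\<dots> = (\<Sum>l\<in>L. d k * a k l)"
      using eq[OF k] by (intro sum.cong) fastforce+
    finally have "d k = d k * (\<Sum>l\<in>L. a k l)" by (simp add: sum_distrib_left)
    then show ?thesis using nz by simp
  qed
  have "(\<Sum>l\<in>L. f (e l)) = (\<Sum>l\<in>L. \<Sum>k\<in>I. f (e l) * a k l)"
    by (intro sum.cong refl) (simp add: col flip: sum_distrib_left)
  also have "\<dots> = (\<Sum>l\<in>L. \<Sum>k\<in>I. f (d k) * a k l)"
    using eq by (intro sum.cong refl) fastforce
  also have "\<dots> = (\<Sum>k\<in>I. \<Sum>l\<in>L. f (d k) * a k l)" by (rule sum.swap)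
  also have "\<dots> = (\<Sum>k\<in>I. f (d k))"
  proof (intro sum.cong refl)
    fix k assume k: "k \<in> I"
    show "(\<Sum>l\<in>L. f (d k) * a k l) = f (d k)"
      using row[OF k] f0 by (cases "d k = 0") (simp_all flip: sum_distrib_left)
  qed
  finally show ?thesis ..
qed

lemma spec_sum_unique:
  assumes fin: "finite I" and s: "spec I X K u d" and t: "spec I X L w e" and f0: "f 0 = (0::real)"
  shows "(\<Sum>k\<in>K. f (d k)) = (\<Sum>l\<in>L. f (e l))"
proof -
  obtain v g where "spec I X I v g"
    using spectral[OF fin spec_hermitian[OF s]] by blast
  from spec_sum_unique_full[where f = f, OF fin this s f0]
    spec_sum_unique_full[where f = f, OF fin this t f0]
  show ?thesis by simp
qed

text \<open>Polarisation: the form is real on sums of two basis vectors with coefficients 1 and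
  \<open>\<i>\<close>, which compares the imaginary and the real parts of the two off-diagonal
  entries.\<close>

lemma psd_hermitian:
  assumes fin: "finite I" and p: "psd I X"
  shows "hermitian I X"
  unfolding hermitian_def
proof (intro ballI)
  fix a b assume ab: "a \<in> I" "b \<in> I"
  let ?e = "\<lambda>a i. if i = a then (1::complex) else 0"
  have q: "ip I (\<lambda>i. ?e a i + c * ?e b i) (mv I X (\<lambda>i. ?e a i + c * ?e b i))
      = X a a + c * X a b + cnj c * X b a + cnj c * c * X b b" for c
    unfolding mv_add mv_scale ip_add_left ip_add_right ip_scale_left ip_scale_right
      mv_delta[OF fin ab(1)] mv_delta[OF fin ab(2)] ip_delta_left[OF fin ab(1)] ip_delta_left[OF fin ab(2)]
    by (simp add: algebra_simps)
  have r: "Im (ip I v (mv I X v)) = 0" for v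
    using p nonneg_Reals_subset_Reals complex_is_Real_iff unfolding psd_def by blast
  have "Im (X a a) = 0" "Im (X b b) = 0"
    using r[of "?e a"] r[of "?e b"]
    unfolding mv_delta[OF fin ab(1)] mv_delta[OF fin ab(2)] ip_delta_left[OF fin ab(1)] ip_delta_left[OF fin ab(2)] .
  moreover from r[of "\<lambda>i. ?e a i + 1 * ?e b i"]
  have "Im (X a a + 1 * X a b + cnj 1 * X b a + cnj 1 * 1 * X b b) = 0" unfolding q .
  moreover from r[of "\<lambda>i. ?e a i + \<i> * ?e b i"]
  have "Im (X a a + \<i> * X a b + cnj \<i> * X b a + cnj \<i> * \<i> * X b b) = 0" unfolding q .
  ultimately show "X a b = cnj (X b a)" by (simp add: complex_eq_iff)
qed

lemma psd_spec_nonneg: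
  assumes "psd I X" "spec I X K u d" "k \<in> K"
  shows "0 \<le> d k"
  using assms(1) spec_eigenvalue[OF assms(2,3)] unfolding psd_def
  by (metis complex_nonneg_Reals_iff Re_complex_of_real)

lemma psd_spectral:
  assumes "finite I" "psd I X"
  obtains u d where "spec I X I u d" "\<And>k. k \<in> I \<Longrightarrow> 0 \<le> d k"
  using spectral[OF assms(1) psd_hermitian[OF assms]] psd_spec_nonneg[OF assms(2)] by metis

lemma spec_trace:
  assumes s: "spec I X K u d" and "finite I"
  shows "(\<Sum>i\<in>I. X i i) = of_real (\<Sum>k\<in>K. d k)"
proof -
  have "(\<Sum>i\<in>I. X i i) = (\<Sum>i\<in>I. \<Sum>k\<in>K. of_real (d k) * (cnj (u k i) * u k i))"
    by (simp add: specD(3)[OF s] mult.assoc mult.commute[of "cnj _"])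
  also have "\<dots> = (\<Sum>k\<in>K. of_real (d k) * ip I (u k) (u k))"
    unfolding ip_def sum_distrib_left by (rule sum.swap)
  also have "\<dots> = (\<Sum>k\<in>K. of_real (d k))"
    using orthonD[OF specD(2)[OF s]] by (intro sum.cong) auto
  finally show ?thesis by simp
qed

section \<open>Contractions\<close>

text \<open>Encoders and decoders are built as contractions, which is what polar decompositions
  yield. The Kraus operators that complete them to channels are added only at the end.\<close>

definition contr :: "'i set \<Rightarrow> 'j set \<Rightarrow> ('i \<Rightarrow> 'j \<Rightarrow> complex) \<Rightarrow> bool" where
  "contr I J M \<longleftrightarrow> (\<forall>v. nsq I (mv J M v) \<le> nsq J v)"

lemma contrD: "contr I J M \<Longrightarrow> nsq I (mv J M v) \<le> nsq J v"
  by (simp add: contr_def)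

lemma contr_orthon:
  assumes "finite K" "orthon K I u"
  shows "contr K I (\<lambda>k i. cnj (u k i))" "contr I K (\<lambda>i k. u k i)"
proof -
  show "contr K I (\<lambda>k i. cnj (u k i))"
    using bessel[OF assms] by (simp add: contr_def nsq_def mv_def ip_def)
  show "contr I K (\<lambda>i k. u k i)"
    using nsq_orthon_comb[OF assms] by (simp add: contr_def mv_def mult.commute nsq_def)
qed

lemma mv_comp: "mv I M (mv J N v) = mv J (\<lambda>i j. \<Sum>k\<in>I. M i k * N k j) v"
proof (rule ext)
  fix i
  have "mv I M (mv J N v) i = (\<Sum>k\<in>I. \<Sum>j\<in>J. M i k * N k j * v j)"
    by (simp add: mv_def sum_distrib_left mult.assoc)
  also have "\<dots> = (\<Sum>j\<in>J. \<Sum>k\<in>I. M i k * N k j * v j)" by (rule sum.swap)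
  finally show "mv I M (mv J N v) i = mv J (\<lambda>i j. \<Sum>k\<in>I. M i k * N k j) v i"
    by (simp add: mv_def sum_distrib_right)
qed

lemma contr_comp:
  assumes "contr H I M" "contr I J N"
  shows "contr H J (\<lambda>i j. \<Sum>k\<in>I. M i k * N k j)"
  unfolding contr_def mv_comp[symmetric]
  using contrD[OF assms(1)] contrD[OF assms(2)] order_trans by blast

text \<open>For \<open>y = M\<^sup>\<dagger> w\<close> Cauchy-Schwarz gives |y|^4 = |<w, M y>|^2
  \<le> |w|^2 |M y|^2 \<le> |w|^2 |y|^2, and a factor |y|^2 cancels.\<close>

lemma contr_adjoint:
  assumes "contr I J M"
  shows "contr J I (\<lambda>j i. cnj (M i j))"
  unfolding contr_def
proof
  fix w
  define y where "y = mv I (\<lambda>j i. cnj (M i j)) w"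
  have "of_real (nsq J y) = ip J (mv I (\<lambda>j i. cnj (M i j)) w) y"
    by (simp add: y_def ip_self)
  also have "\<dots> = ip I w (mv J M y)" by (rule ip_mv_adjoint[symmetric])
  finally have "nsq J y = cmod (ip I w (mv J M y))"
    using nsq_nonneg[of J y] by (metis abs_of_nonneg norm_of_real)
  then have "(nsq J y)^2 \<le> nsq I w * nsq I (mv J M y)"
    using cauchy_schwarz_ip[of I w "mv J M y"] by simp
  also have "\<dots> \<le> nsq I w * nsq J y"
    using contrD[OF assms] by (intro mult_left_mono) auto
  finally have "nsq J y * nsq J y \<le> nsq I w * nsq J y" by (simp add: power2_eq_square)
  then show "nsq J y \<le> nsq I w"
    using nsq_nonneg[of J y] nsq_nonneg[of I w] by (cases "nsq J y = 0") auto
qed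

lemma contr_column:
  assumes "contr I J M" "finite J" "j \<in> J"
  shows "(\<Sum>i\<in>I. (cmod (M i j))^2) \<le> 1"
  using contrD[OF assms(1), of "\<lambda>i. if i = j then 1 else 0"]
  unfolding mv_delta[OF assms(2,3)] nsq_delta[OF assms(2,3)] by (simp add: nsq_def)

lemma contr_row:
  assumes "contr I J M" "finite I" "i \<in> I"
  shows "(\<Sum>j\<in>J. (cmod (M i j))^2) \<le> 1"
  using contr_column[OF contr_adjoint[OF assms(1)] assms(2,3)] by simp

text \<open>The two sides are tangent at \<open>d = 1\<close>, so nothing is lost to first order
  near isometries. Degree two in \<open>d\<close> keeps the bound within fourth moments of the
  phases.\<close>

lemma sqrt_ge_cubic:
  assumes "0 \<le> (d::real)"
  shows "(3 * d - d^2) / 2 \<le> sqrt d"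
proof -
  define s where "s = sqrt d"
  have s: "0 \<le> s" "d = s^2" using assms by (simp_all add: s_def)
  have "0 \<le> s * (s - 1)^2 * (s + 2)" using s(1) by simp
  also have "\<dots> = 2 * s - (3 * d - d^2)" unfolding s(2) by algebra
  finally show ?thesis by (simp add: s_def)
qed

lemma gram_hermitian: "hermitian I (\<lambda>i i'. \<Sum>j\<in>J. cnj (M j i) * M j i')"
  unfolding hermitian_def by (simp add: mult.commute)

section \<open>Polar decomposition\<close>

text \<open>
  \<open>V\<close> is the adjoint of the partial isometry in the polar decomposition of \<open>M\<close>, so that \<open>V M\<close> is
  the square root of \<open>Z = M\<^sup>\<dagger> M\<close>, and \<open>2 \<surd>Z \<ge> 3 Z - Z^2\<close>.
\<close>

lemma polar_contraction:
  assumes fin: "finite I" "finite J"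
  obtains V where "contr I J V"
    "\<And>i. i \<in> I \<Longrightarrow> (3 * (\<Sum>j\<in>J. (cmod (M j i))^2) - (\<Sum>i'\<in>I. (cmod (\<Sum>j\<in>J. cnj (M j i') * M j i))^2)) / 2
      \<le> Re (\<Sum>j\<in>J. V i j * M j i)"
proof -
  define Z where "Z i i' = (\<Sum>j\<in>J. cnj (M j i) * M j i')" for i i'
  have hZ: "hermitian I Z" unfolding Z_def by (rule gram_hermitian)
  obtain u d where s: "spec I Z I u d" using spectral[OF fin(1) hZ] by blast
  note o = specD(2)[OF s]
  define f where "f k = mv I M (u k)" for k
  have Zf: "mv J (\<lambda>i j. cnj (M j i)) (f k) = mv I Z (u k)" for k
    unfolding f_def Z_def by (rule mv_comp)
  have fip: "ip J (f k) (f l) = (if k = l then of_real (d k) else 0)" if "k \<in> I" "l \<in> I" for k l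
  proof -
    have "ip J (f l) (f k) = ip I (mv J (\<lambda>i j. cnj (M j i)) (f l)) (u k)"
      unfolding f_def[of k] by (rule ip_mv_adjoint)
    also have "\<dots> = ip I (\<lambda>i. of_real (d l) * u l i) (u k)"
      unfolding Zf by (intro ip_cong refl spec_eigen[OF s that(2)])
    also have "\<dots> = of_real (d l) * (if l = k then 1 else 0)"
      using orthonD[OF o that(2,1)] by (simp add: ip_scale_left)
    finally have "ip J (f l) (f k) = of_real (d l) * (if l = k then 1 else 0)" .
    then show ?thesis by (subst ip_commute) auto
  qed
  have d0: "0 \<le> d k" if "k \<in> I" for k
    using fip[OF that that] ip_self[of J "f k"] nsq_nonneg[of J "f k"] by simp
  \<comment> \<open>The \<open>f k\<close> are orthogonal with squared lengths \<open>d k\<close>.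
    Off the kernel they normalise to left singular vectors of \<open>M\<close>, and \<open>V\<close>
    sends these back to the right singular vectors.\<close>
  define P where "P = {k\<in>I. d k > 0}"
  have P: "finite P" "P \<subseteq> I" using fin by (auto simp: P_def)
  define g where "g k j = of_real (1 / sqrt (d k)) * f k j" for k j
  have og: "orthon P J g"
    unfolding orthon_def
  proof (intro ballI)
    fix k l assume kl: "k \<in> P" "l \<in> P"
    have "ip J (g k) (g l) = of_real (1 / sqrt (d k)) * (of_real (1 / sqrt (d l)) * ip J (f k) (f l))"
      unfolding g_def ip_scale_left ip_scale_right complex_cnj_complex_of_real ..
    also have "\<dots> = (if k = l then 1 else 0)"
    proof (cases "k = l")
      case True
      have "1 / sqrt (d k) * (1 / sqrt (d k) * d k) = 1"
        using kl by (simp add: P_def)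
      moreover have "ip J (f k) (f l) = of_real (d k)" using True fip[of k k] kl P by auto
      ultimately show ?thesis using True by (simp only: if_True refl of_real_1 flip: of_real_mult)
    next
      case False
      then show ?thesis using fip[of k l] kl P by auto
    qed
    finally show "ip J (g k) (g l) = (if k = l then 1 else 0)" .
  qed
  define V where "V i j = (\<Sum>k\<in>P. u k i * cnj (g k j))" for i j
  let ?F = "\<lambda>i. \<Sum>i'\<in>I. (cmod (\<Sum>j\<in>J. cnj (M j i') * M j i))^2"
  have "contr I J V"
    unfolding V_def
    by (rule contr_comp[OF contr_orthon(2)[OF P(1) orthon_subset[OF o P(2)]] contr_orthon(1)[OF P(1) og]])
  moreover have "(3 * (\<Sum>j\<in>J. (cmod (M j i))^2) - (?F i)) / 2
      \<le> Re (\<Sum>j\<in>J. V i j * M j i)" if i: "i \<in> I" for i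
  proof -
    have fM: "(\<Sum>j\<in>J. cnj (f k j) * M j i) = of_real (d k) * cnj (u k i)" (is "?lhs = _") if "k \<in> I" for k
    proof -
      have "?lhs = cnj (mv J (\<lambda>i j. cnj (M j i)) (f k) i)"
        by (simp add: mv_def mult.commute)
      then show ?thesis unfolding Zf spec_eigen[OF s that i] by simp
    qed
    have "(\<Sum>j\<in>J. V i j * M j i) = (\<Sum>k\<in>P. u k i * (of_real (1 / sqrt (d k)) * (\<Sum>j\<in>J. cnj (f k j) * M j i)))"
      unfolding V_def g_def sum_distrib_left sum_distrib_right
      by (subst sum.swap) (intro sum.cong refl, simp)
    also have "\<dots> = (\<Sum>k\<in>P. of_real (sqrt (d k) * (cmod (u k i))^2))"
    proof (intro sum.cong refl)
      fix k assume k: "k \<in> P"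
      then have kI: "k \<in> I" and dk: "d k > 0" by (auto simp: P_def)
      have "1 / sqrt (d k) * d k = sqrt (d k)" using dk by (simp add: real_div_sqrt)
      then have "of_real (1 / sqrt (d k)) * (of_real (d k) * cnj (u k i))
          = of_real (sqrt (d k)) * cnj (u k i)"
        by (simp only: mult.assoc[symmetric] flip: of_real_mult)
      then have "u k i * (of_real (1 / sqrt (d k)) * (of_real (d k) * cnj (u k i)))
          = of_real (sqrt (d k)) * (cnj (u k i) * u k i)" by (simp only: ac_simps)
      then show "u k i * (of_real (1 / sqrt (d k)) * (\<Sum>j\<in>J. cnj (f k j) * M j i))
          = of_real (sqrt (d k) * (cmod (u k i))^2)"
        unfolding fM[OF kI] by (simp only: of_real_mult cmod_sq)
    qed
    also have "\<dots> = of_real (\<Sum>k\<in>P. sqrt (d k) * (cmod (u k i))^2)" by (simp only: of_real_sum)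
    also have "(\<Sum>k\<in>P. sqrt (d k) * (cmod (u k i))^2) = (\<Sum>k\<in>I. sqrt (d k) * (cmod (u k i))^2)"
    proof (intro sum.mono_neutral_left fin P ballI)
      fix k assume "k \<in> I - P"
      then have "d k = 0" using d0[of k] by (auto simp: P_def)
      then show "sqrt (d k) * (cmod (u k i))^2 = 0" by simp
    qed
    finally have 1: "Re (\<Sum>j\<in>J. V i j * M j i) = (\<Sum>k\<in>I. sqrt (d k) * (cmod (u k i))^2)"
      by simp
    have "of_real (\<Sum>j\<in>J. (cmod (M j i))^2) = Z i i"
      by (simp only: Z_def cmod_sq of_real_sum)
    also have "\<dots> = (\<Sum>k\<in>I. of_real (d k * (cmod (u k i))^2))"
      unfolding specD(3)[OF s i i]
      by (simp only: of_real_mult cmod_sq mult.assoc mult.commute[of "cnj _"])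
    finally have 2: "(\<Sum>j\<in>J. (cmod (M j i))^2) = (\<Sum>k\<in>I. d k * (cmod (u k i))^2)"
      by (simp only: of_real_eq_iff flip: of_real_sum)
    have "?F i = nsq I (\<lambda>i'. Z i' i)"
      by (simp add: nsq_def Z_def)
    also have "\<dots> = nsq I (\<lambda>i'. \<Sum>k\<in>I. (of_real (d k) * cnj (u k i)) * u k i')"
      using specD(3)[OF s _ i] by (intro nsq_cong) (simp add: ac_simps)
    also have "\<dots> = (\<Sum>k\<in>I. (d k)^2 * (cmod (u k i))^2)"
      unfolding nsq_orthon_comb[OF fin(1) o] by (simp add: norm_mult power_mult_distrib)
    finally have 3: "?F i = (\<Sum>k\<in>I. (d k)^2 * (cmod (u k i))^2)" .
    have "(3 * (\<Sum>k\<in>I. d k * (cmod (u k i))^2) - (\<Sum>k\<in>I. (d k)^2 * (cmod (u k i))^2)) / 2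
        = (\<Sum>k\<in>I. (3 * d k - (d k)^2) / 2 * (cmod (u k i))^2)"
      unfolding sum_distrib_left sum_subtractf[symmetric] sum_divide_distrib
      by (intro sum.cong refl) (simp add: algebra_simps diff_divide_distrib)
    also have "\<dots> \<le> (\<Sum>k\<in>I. sqrt (d k) * (cmod (u k i))^2)"
      by (intro sum_mono mult_right_mono sqrt_ge_cubic d0) auto
    finally show ?thesis unfolding 1 2 3 .
  qed
  ultimately show ?thesis using that by blast
qed

section \<open>Random phases\<close>

text \<open>A sum of two powers exceeds its larger term and is at most twice that term. A strictly
  larger top exponent would therefore outweigh the other side, so the top exponents agree and
  cancel.\<close>

lemma pow2_sidon:
  fixes a b c d :: nat
  assumes "(2::nat) ^ a + 2 ^ b = 2 ^ c + 2 ^ d"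
  shows "a = c \<and> b = d \<or> a = d \<and> b = c"
proof -
  have max_le: "max x y \<le> max z w" if e: "(2::nat) ^ x + 2 ^ y = 2 ^ z + 2 ^ w" for x y z w :: nat
  proof (rule ccontr)
    assume "\<not> max x y \<le> max z w"
    then have "Suc (max z w) \<le> max x y" by (simp only: not_le Suc_le_eq)
    then have "(2::nat) ^ Suc (max z w) \<le> 2 ^ max x y" by (intro power_increasing) auto
    moreover have "(2::nat) ^ z \<le> 2 ^ max z w" "(2::nat) ^ w \<le> 2 ^ max z w"
      by (intro power_increasing; simp)+
    moreover have "(2::nat) ^ max x y < 2 ^ x + 2 ^ y" by (simp add: max_def)
    ultimately show False using e by simp
  qed
  have "max a b = max c d" using max_le[OF assms] max_le[OF assms[symmetric]] by (rule antisym)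
  then consider "a = c" | "a = d" | "b = c" | "b = d" by (auto simp: max_def split: if_splits)
  then show ?thesis using assms by cases auto
qed

text \<open>One fourth-moment identity covers everything: the values are unimodular, so
  \<open>y = w\<close> gives the second moments.\<close>

definition phases :: "'x set \<Rightarrow> nat \<Rightarrow> (nat \<Rightarrow> 'x \<Rightarrow> complex) \<Rightarrow> bool" where
  "phases X N \<theta> \<longleftrightarrow> N > 0 \<and> (\<forall>t x. cmod (\<theta> t x) = 1) \<and>
      (\<forall>x\<in>X. \<forall>y\<in>X. \<forall>z\<in>X. \<forall>w\<in>X. (\<Sum>t<N. \<theta> t x * \<theta> t y * (cnj (\<theta> t z) * cnj (\<theta> t w)))
          = (if x = z \<and> y = w \<or> x = w \<and> y = z then of_nat N else 0))"

lemma phasesD: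
  assumes "phases X N \<theta>"
  shows "N > 0" "\<And>t x. cmod (\<theta> t x) = 1"
    "\<And>x y z w. x \<in> X \<Longrightarrow> y \<in> X \<Longrightarrow> z \<in> X \<Longrightarrow> w \<in> X \<Longrightarrow>
      (\<Sum>t<N. \<theta> t x * \<theta> t y * (cnj (\<theta> t z) * cnj (\<theta> t w)))
        = (if x = z \<and> y = w \<or> x = w \<and> y = z then of_nat N else 0)"
  using assms unfolding phases_def by blast+

text \<open>
  A finite average that reproduces the second and fourth moments of independent uniform phases:
  distinct powers of two form a Sidon set.
\<close>

lemma phases_exist:
  fixes X :: "'x set"
  assumes "finite X"
  shows "\<exists>N (\<theta> :: nat \<Rightarrow> 'x \<Rightarrow> complex). phases X N \<theta>"
proof -
  obtain g :: "'x \<Rightarrow> nat" and M where g: "g ` X = {i. i < M}" "inj_on g X"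
    using finite_imp_inj_to_nat_seg[OF assms] by blast
  \<comment> \<open>The exponents are below \<open>M\<close>, so the difference \<open>D\<close> of
    two sums of two powers satisfies \<open>\<bar>D\<bar> < N\<close>. The root of unity
    \<open>\<omega>\<close> is then 1 only for \<open>D = 0\<close>, and the geometric sum vanishes
    otherwise.\<close>
  define N :: nat where "N = 2 ^ Suc M"
  define \<theta> where "\<theta> t x = cis (2 * pi * real t * (2 ^ g x) / real N)" for t x
  have N: "N > 0" by (simp add: N_def)
  have "(\<Sum>t<N. \<theta> t x * \<theta> t y * (cnj (\<theta> t z) * cnj (\<theta> t w)))
        = (if x = z \<and> y = w \<or> x = w \<and> y = z then of_nat N else 0)"
    if X: "x \<in> X" "y \<in> X" "z \<in> X" "w \<in> X" for x y z w
  proof -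
    define D :: int where "D = 2 ^ g x + 2 ^ g y - 2 ^ g z - 2 ^ g w"
    define \<omega> where "\<omega> = cis (2 * pi * of_int D / real N)"
    have trm: "\<theta> t x * \<theta> t y * (cnj (\<theta> t z) * cnj (\<theta> t w)) = \<omega> ^ t" for t
      unfolding \<theta>_def \<omega>_def cis_cnj cis_mult Complex.DeMoivre D_def
      by (rule arg_cong[where f = cis]) (use N in \<open>simp add: field_simps\<close>)
    have wN: "\<omega> ^ N = 1"
    proof -
      have "\<omega> ^ N = cis (2 * pi * of_int D)" unfolding \<omega>_def Complex.DeMoivre using N by simp
      then show ?thesis by (simp add: cis_multiple_2pi)
    qed
    have g_lt: "g x < M" "g y < M" "g z < M" "g w < M" using g(1) X by blast+
    have le: "(2::int) ^ g v * 2 \<le> 2 ^ M" if "g v < M" for v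
      using that by (metis Suc_leI mult.commute one_le_numeral power_Suc power_increasing)
    have bound: "\<bar>D\<bar> < int N"
    proof -
      have "(2::int) ^ g v > 0" for v by simp
      then show ?thesis
        using le[OF g_lt(1)] le[OF g_lt(2)] le[OF g_lt(3)] le[OF g_lt(4)]
        unfolding D_def N_def abs_less_iff by (simp, smt (verit))
    qed
    show ?thesis
    proof (cases "D = 0")
      case True
      then have "int (2 ^ g x + 2 ^ g y) = int (2 ^ g z + 2 ^ g w)" by (simp add: D_def)
      then have "(2::nat) ^ g x + 2 ^ g y = 2 ^ g z + 2 ^ g w" by (simp only: of_nat_eq_iff)
      from pow2_sidon[OF this] have "x = z \<and> y = w \<or> x = w \<and> y = z"
        using g(2) X by (auto dest: inj_onD)
      moreover have "\<omega> = 1" using True by (simp add: \<omega>_def)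
      ultimately show ?thesis by (simp add: trm)
    next
      case False
      have "\<omega> \<noteq> 1"
      proof
        assume "\<omega> = 1"
        then have "cos (2 * pi * of_int D / real N) = 1" by (simp add: \<omega>_def complex_eq_iff)
        then obtain j :: int where "2 * pi * of_int D / real N = of_int j * 2 * pi"
          using cos_one_2pi_int by blast
        then have "real_of_int D = of_int j * real N" using N by (simp add: field_simps)
        then have "D = j * int N" by (metis of_int_eq_iff of_int_mult of_int_of_nat_eq)
        then show False using False bound by (cases "j = 0") (auto simp: abs_mult)
      qed
      then have "(\<Sum>t<N. \<omega> ^ t) = 0" using wN by (simp add: sum_gp_strict)
      moreover have "\<not> (x = z \<and> y = w \<or> x = w \<and> y = z)" using False by (auto simp: D_def)
      ultimately show ?thesis unfolding trm by (simp only: if_False)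
    qed
  qed
  then have "phases X N \<theta>" unfolding phases_def using N by (simp add: \<theta>_def)
  then show ?thesis by blast
qed

lemma cmod_sum_sq:
  "of_real ((cmod (\<Sum>i\<in>I. y i))^2) = (\<Sum>i\<in>I. \<Sum>j\<in>I. y i * cnj (y j))"
  unfolding cmod_sq cnj_sum sum_product by (subst sum.swap) (simp add: mult.commute)

lemma average_sq:
  assumes fin: "finite I"
    and \<phi>: "\<And>i j. i \<in> I \<Longrightarrow> j \<in> I \<Longrightarrow> (\<Sum>t\<in>\<T>. \<phi> t i * cnj (\<phi> t j)) = of_nat N * c i j"
  shows "of_real (\<Sum>t\<in>\<T>. (cmod (\<Sum>i\<in>I. y i * \<phi> t i))^2)
    = of_nat N * (\<Sum>i\<in>I. \<Sum>j\<in>I. y i * cnj (y j) * c i j)" (is "?lhs = _")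
proof -
  have "?lhs
      = (\<Sum>t\<in>\<T>. \<Sum>i\<in>I. \<Sum>j\<in>I. y i * cnj (y j) * (\<phi> t i * cnj (\<phi> t j)))"
    unfolding of_real_sum cmod_sum_sq by (intro sum.cong refl) simp
  also have "\<dots> = (\<Sum>i\<in>I. \<Sum>j\<in>I. \<Sum>t\<in>\<T>. y i * cnj (y j) * (\<phi> t i * cnj (\<phi> t j)))"
    by (rule trans, rule sum.swap, intro sum.cong refl sum.swap)
  also have "\<dots> = (\<Sum>i\<in>I. \<Sum>j\<in>I. of_nat N * (y i * cnj (y j) * c i j))"
    by (intro sum.cong refl, subst sum_distrib_left[symmetric]) (simp add: \<phi> mult.left_commute)
  finally show ?thesis by (simp only: sum_distrib_left)
qed

lemma phase_moment2:
  assumes fin: "finite A" and p: "\<And>a. a \<in> A \<Longrightarrow> 0 \<le> p a" and s: "s \<in> S"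
    and ph: "phases (S \<times> A) N \<theta>"
  shows "(\<Sum>t<N. (cmod (\<Sum>a\<in>A. g a * (complex_of_real (sqrt (p a)) * \<theta> t (s, a))))^2)
    = real N * (\<Sum>a\<in>A. p a * (cmod (g a))^2)"
proof -
  note unit = phasesD(2)[OF ph] and mom = phasesD(3)[OF ph]
  have sq: "\<theta> t x * cnj (\<theta> t x) = 1" for t x
    using unit[of t x] by (simp add: complex_norm_square[symmetric])
  have m2: "(\<Sum>t<N. \<theta> t (s, a) * cnj (\<theta> t (s, b))) = of_nat N * (if a = b then 1 else 0)" (is "?lhs = _")
    if "a \<in> A" "b \<in> A" for a b
  proof -
    have "?lhs
        = (\<Sum>t<N. \<theta> t (s, a) * \<theta> t (s, b) * (cnj (\<theta> t (s, b)) * cnj (\<theta> t (s, b))))"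
      by (intro sum.cong refl) (metis (no_types, lifting) mult.assoc mult.left_neutral mult.commute sq)
    then show ?thesis using mom[of "(s, a)" "(s, b)" "(s, b)" "(s, b)"] s that by auto
  qed
  let ?F = "\<Sum>a\<in>A. \<Sum>b\<in>A. g a * complex_of_real (sqrt (p a)) * cnj (g b * complex_of_real (sqrt (p b))) * (if a = b then 1 else 0)"
  let ?G = "\<Sum>t<N. (cmod (\<Sum>a\<in>A. g a * complex_of_real (sqrt (p a)) * \<theta> t (s, a)))^2"
  have "complex_of_real ?G
    = of_nat N * ?F"
    by (rule average_sq[OF fin m2])
  also have "?F
      = (\<Sum>a\<in>A. \<Sum>b\<in>A. if a = b then g a * complex_of_real (sqrt (p a)) * cnj (g a * complex_of_real (sqrt (p a))) else 0)"
    by (intro sum.cong refl) auto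
  also have "\<dots> = (\<Sum>a\<in>A. g a * complex_of_real (sqrt (p a)) * cnj (g a * complex_of_real (sqrt (p a))))"
    using fin by simp
  also have "\<dots> = complex_of_real (\<Sum>a\<in>A. p a * (cmod (g a))^2)"
    unfolding of_real_sum complex_norm_square[symmetric]
    using p by (intro sum.cong refl) (simp add: norm_mult power_mult_distrib mult.commute)
  finally have "complex_of_real ?G
      = complex_of_real (real N * (\<Sum>a\<in>A. p a * (cmod (g a))^2))"
    by (simp only: of_real_mult of_real_of_nat_eq)
  then show ?thesis by (simp only: of_real_eq_iff mult.assoc)
qed

text \<open>Two pairings of the four phases survive. Pairing each \<open>\<theta>\<close> with the
  conjugate in its own factor requires \<open>s = s'\<close> and gives the squared diagonal sum;
  pairing across the two factors gives the sum of all squared entries. Their common terms are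
  subtracted once and dropped, hence the inequality.\<close>

lemma phase_moment4:
  assumes fin: "finite A" and p: "\<And>a. a \<in> A \<Longrightarrow> 0 \<le> p a" and s: "s \<in> S" "s' \<in> S"
    and ph: "phases (S \<times> A) N \<theta>"
  shows "(\<Sum>t<N. (cmod (\<Sum>a'\<in>A. \<Sum>a\<in>A. cnj (complex_of_real (sqrt (p a')) * \<theta> t (s', a')) * Q a' a
      * (complex_of_real (sqrt (p a)) * \<theta> t (s, a))))^2)
    \<le> real N * ((\<Sum>a'\<in>A. \<Sum>a\<in>A. p a' * p a * (cmod (Q a' a))^2)
        + (if s = s' then (cmod (\<Sum>a\<in>A. complex_of_real (p a) * Q a a))^2 else 0))"
proof -
  note mom = phasesD(3)[OF ph]
  let ?r = "\<lambda>a. complex_of_real (sqrt (p a))"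
  define y where "y = (\<lambda>(a', a). ?r a' * ?r a * Q a' a)"
  define \<phi> where "\<phi> t = (\<lambda>(a', a). \<theta> t (s, a) * cnj (\<theta> t (s', a')))" for t
  define d :: "'a \<times> 'a \<Rightarrow> complex" where "d = (\<lambda>(a', a). if a = a' then 1 else 0)"
  define z :: complex where "z = (if s = s' then 1 else 0)"
  \<comment> \<open>Inclusion-exclusion over the two pairings.\<close>
  define c where "c i j = z * d i * d j + (if i = j then 1 else 0) - z * d i * (if i = j then 1 else 0)" for i j
  have av: "(\<Sum>t<N. \<phi> t i * cnj (\<phi> t j)) = of_nat N * c i j" (is "?lhs1 = _") if ij: "i \<in> A \<times> A" "j \<in> A \<times> A" for i j
  proof -
    obtain a' a where i: "i = (a', a)" by (cases i)
    obtain b' b where j: "j = (b', b)" by (cases j)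
    have "?lhs1
        = (\<Sum>t<N. \<theta> t (s, a) * \<theta> t (s', b') * (cnj (\<theta> t (s', a')) * cnj (\<theta> t (s, b))))"
      unfolding \<phi>_def i j by (intro sum.cong refl) simp
    also have "\<dots> = (if (s, a) = (s', a') \<and> (s', b') = (s, b) \<or> (s, a) = (s, b) \<and> (s', b') = (s', a')
        then of_nat N else 0)"
      using ij s unfolding i j by (intro mom) auto
    also have "\<dots> = of_nat N * c i j"
      unfolding c_def z_def d_def i j
      by (cases "s = s'"; cases "a = a'"; cases "b = b'"; cases "a = b"; cases "a' = b'") simp_all
    finally show ?thesis .
  qed
  have pair: "(\<Sum>a'\<in>A. \<Sum>a\<in>A. f a' a) = (\<Sum>i\<in>A \<times> A. case i of (a', a) \<Rightarrow> f a' a)" for f :: "'a \<Rightarrow> 'a \<Rightarrow> complex"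
    by (rule sum.cartesian_product)
  have diag: "(\<Sum>i\<in>A \<times> A. d i * f i) = (\<Sum>a\<in>A. f (a, a))" (is "?lhs2 = _") for f :: "'a \<times> 'a \<Rightarrow> complex"
  proof -
    have "?lhs2 = (\<Sum>i\<in>A \<times> A. case i of (a', a) \<Rightarrow> if a' = a then f (a, a) else 0)"
      by (intro sum.cong refl) (auto simp: d_def)
    also have "\<dots> = (\<Sum>a\<in>A. f (a, a))"
      unfolding sum.cartesian_product[symmetric] using fin by simp
    finally show ?thesis .
  qed
  have yd: "y (a, a) = complex_of_real (p a) * Q a a" if "a \<in> A" for a
    using p[OF that] by (simp add: y_def flip: of_real_mult)
  have fin2: "finite (A \<times> A)" using fin by simp
  let ?lhs = "\<Sum>t<N. (cmod (\<Sum>i\<in>A \<times> A. y i * \<phi> t i))^2"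
  let ?H = "\<Sum>i\<in>A \<times> A. (cmod (y i))^2"
  let ?F = "(if s = s' then 1 else 0) * (cmod (\<Sum>a\<in>A. y (a, a)))^2 + ?H - (if s = s' then 1 else 0) * (\<Sum>a\<in>A. (cmod (y (a, a)))^2)"
  let ?G = "\<Sum>i\<in>A \<times> A. \<Sum>j\<in>A \<times> A. if i = j then y i * cnj (y j) else 0"
  have "complex_of_real ?lhs = of_nat N * (\<Sum>i\<in>A \<times> A. \<Sum>j\<in>A \<times> A. y i * cnj (y j) * c i j)"
    by (rule average_sq[OF fin2 av])
  also have "(\<Sum>i\<in>A \<times> A. \<Sum>j\<in>A \<times> A. y i * cnj (y j) * c i j)
      = z * (\<Sum>i\<in>A \<times> A. \<Sum>j\<in>A \<times> A. (d i * y i) * (d j * cnj (y j)))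
        + ?G
        - z * (\<Sum>i\<in>A \<times> A. \<Sum>j\<in>A \<times> A. if i = j then d i * y i * cnj (y j) else 0)"
    unfolding sum_distrib_left sum.distrib[symmetric] sum_subtractf[symmetric] c_def
    by (intro sum.cong refl) (simp add: algebra_simps)
  also have "(\<Sum>i\<in>A \<times> A. \<Sum>j\<in>A \<times> A. (d i * y i) * (d j * cnj (y j)))
      = (\<Sum>a\<in>A. y (a, a)) * cnj (\<Sum>a\<in>A. y (a, a))"
    unfolding sum_product[symmetric] diag by simp
  also have "?G = (\<Sum>i\<in>A \<times> A. y i * cnj (y i))"
    using fin2 by simp
  also have "(\<Sum>i\<in>A \<times> A. \<Sum>j\<in>A \<times> A. if i = j then d i * y i * cnj (y j) else 0) = (\<Sum>a\<in>A. y (a, a) * cnj (y (a, a)))"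
    using fin2 diag[of "\<lambda>i. y i * cnj (y i)"] by (simp add: mult.assoc)
  finally have "complex_of_real ?lhs = complex_of_real (real N * ?F)"
    unfolding complex_norm_square[symmetric] z_def by simp
  then have "?lhs = real N * ?F"
    by (simp only: of_real_eq_iff)
  also have "\<dots> \<le> real N * (?H + (if s = s' then (cmod (\<Sum>a\<in>A. y (a, a)))^2 else 0))"
    by (intro mult_left_mono) (auto simp: sum_nonneg)
  also have "(\<Sum>a\<in>A. y (a, a)) = (\<Sum>a\<in>A. complex_of_real (p a) * Q a a)"
    by (intro sum.cong refl yd)
  also have "?H = (\<Sum>i\<in>A \<times> A. case i of (a', a) \<Rightarrow> p a' * p a * (cmod (Q a' a))^2)"
    using p by (intro sum.cong refl) (auto simp: y_def norm_mult power_mult_distrib)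
  also have "\<dots> = (\<Sum>a'\<in>A. \<Sum>a\<in>A. p a' * p a * (cmod (Q a' a))^2)"
    by (rule sum.cartesian_product[symmetric])
  also have "?lhs = (\<Sum>t<N. (cmod (\<Sum>a'\<in>A. \<Sum>a\<in>A. cnj (?r a' * \<theta> t (s', a')) * Q a' a * (?r a * \<theta> t (s, a))))^2)"
  proof (intro sum.cong refl arg_cong[where f = "\<lambda>x. (cmod x)^2"])
    fix t
    show "(\<Sum>i\<in>A \<times> A. y i * \<phi> t i) = (\<Sum>a'\<in>A. \<Sum>a\<in>A. cnj (?r a' * \<theta> t (s', a')) * Q a' a * (?r a * \<theta> t (s, a)))"
      unfolding pair by (intro sum.cong refl) (auto simp: y_def \<phi>_def)
  qed
  finally show ?thesis .
qed

section \<open>Diagonalised channels\<close>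

lemma sum_Times: "(\<Sum>x\<in>A \<times> B. f x) = (\<Sum>a\<in>A. \<Sum>b\<in>B. f (a, b))"
  by (simp add: sum.cartesian_product)

text \<open>
  Kraus operators \<open>k e\<close> of a channel, written in bases in which the input state, the output state and
  the environment state are all diagonal, with eigenvalues \<open>p\<close>, \<open>q\<close> and \<open>w\<close>.
\<close>

definition coding ::
  "'a set \<Rightarrow> 'b set \<Rightarrow> 'e set \<Rightarrow> ('e \<Rightarrow> 'b \<Rightarrow> 'a \<Rightarrow> complex) \<Rightarrow>
   ('a \<Rightarrow> real) \<Rightarrow> ('e \<Rightarrow> real) \<Rightarrow> ('b \<Rightarrow> real) \<Rightarrow> bool" where
  "coding A B E k p w q \<longleftrightarrow> finite A \<and> finite B \<and> finite E \<and> (\<forall>a\<in>A. 0 \<le> p a) \<and> sum p A = 1 \<and>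
     (\<forall>a\<in>A. \<forall>a'\<in>A. (\<Sum>e\<in>E. \<Sum>b\<in>B. cnj (k e b a) * k e b a') = (if a = a' then 1 else 0)) \<and>
     (\<forall>e\<in>E. \<forall>e'\<in>E. (\<Sum>b\<in>B. \<Sum>a\<in>A. of_real (p a) * (k e b a * cnj (k e' b a)))
        = (if e = e' then of_real (w e) else 0)) \<and>
     (\<forall>b\<in>B. \<forall>b'\<in>B. (\<Sum>e\<in>E. \<Sum>a\<in>A. of_real (p a) * (k e b a * cnj (k e b' a)))
        = (if b = b' then of_real (q b) else 0))"

lemma codingD:
  assumes "coding A B E k p w q"
  shows "finite A" "finite B" "finite E" "\<And>a. a \<in> A \<Longrightarrow> 0 \<le> p a" "sum p A = 1"
    "\<And>a a'. a \<in> A \<Longrightarrow> a' \<in> A \<Longrightarrow>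
      (\<Sum>e\<in>E. \<Sum>b\<in>B. cnj (k e b a) * k e b a') = (if a = a' then 1 else 0)"
    "\<And>e e'. e \<in> E \<Longrightarrow> e' \<in> E \<Longrightarrow>
      (\<Sum>b\<in>B. \<Sum>a\<in>A. of_real (p a) * (k e b a * cnj (k e' b a)))
        = (if e = e' then of_real (w e) else 0)"
    "\<And>b b'. b \<in> B \<Longrightarrow> b' \<in> B \<Longrightarrow>
      (\<Sum>e\<in>E. \<Sum>a\<in>A. of_real (p a) * (k e b a * cnj (k e b' a)))
        = (if b = b' then of_real (q b) else 0)"
  using assms unfolding coding_def by blast+

lemma weighted_cmod_sq: "of_real r * (z * cnj z) = of_real (r * (cmod z)^2)"
  by (simp only: of_real_mult cmod_sq mult.commute)

lemma coding_sums:
  assumes c: "coding A B E k p w q"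
  shows "\<And>a. a \<in> A \<Longrightarrow> (\<Sum>e\<in>E. \<Sum>b\<in>B. (cmod (k e b a))^2) = 1"
    "\<And>e. e \<in> E \<Longrightarrow> (\<Sum>b\<in>B. \<Sum>a\<in>A. p a * (cmod (k e b a))^2) = w e"
    "\<And>b. b \<in> B \<Longrightarrow> (\<Sum>e\<in>E. \<Sum>a\<in>A. p a * (cmod (k e b a))^2) = q b"
proof -
  fix a assume "a \<in> A"
  from codingD(6)[OF c this this]
  have "complex_of_real (\<Sum>e\<in>E. \<Sum>b\<in>B. (cmod (k e b a))^2) = complex_of_real 1"
    by (simp only: of_real_sum cmod_sq of_real_1 if_True refl)
  then show "(\<Sum>e\<in>E. \<Sum>b\<in>B. (cmod (k e b a))^2) = 1" by (simp only: of_real_eq_iff)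
next
  fix e assume "e \<in> E"
  from codingD(7)[OF c this this]
  show "(\<Sum>b\<in>B. \<Sum>a\<in>A. p a * (cmod (k e b a))^2) = w e"
    by (simp only: weighted_cmod_sq of_real_sum[symmetric] if_True refl of_real_eq_iff)
next
  fix b assume "b \<in> B"
  from codingD(8)[OF c this this]
  show "(\<Sum>e\<in>E. \<Sum>a\<in>A. p a * (cmod (k e b a))^2) = q b"
    by (simp only: weighted_cmod_sq of_real_sum[symmetric] if_True refl of_real_eq_iff)
qed

lemma coding_total:
  assumes c: "coding A B E k p w q"
  shows "(\<Sum>e\<in>E. \<Sum>b\<in>B. \<Sum>a\<in>A. p a * (cmod (k e b a))^2) = 1" (is "?lhs = _")
proof -
  have "?lhs = (\<Sum>a\<in>A. \<Sum>e\<in>E. \<Sum>b\<in>B. p a * (cmod (k e b a))^2)"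
    by (rule trans, rule sum.cong[OF refl], rule sum.swap, rule sum.swap)
  also have "\<dots> = (\<Sum>a\<in>A. p a)"
    by (intro sum.cong refl) (simp add: coding_sums(1)[OF c] flip: sum_distrib_left)
  finally show ?thesis using codingD(5)[OF c] by simp
qed

lemma coding_nonneg:
  assumes c: "coding A B E k p w q"
  shows "\<And>e. e \<in> E \<Longrightarrow> 0 \<le> w e" "\<And>b. b \<in> B \<Longrightarrow> 0 \<le> q b" "sum w E = 1" "sum q B = 1"
proof -
  show "0 \<le> w e" if "e \<in> E" for e
    unfolding coding_sums(2)[OF c that, symmetric] using codingD(4)[OF c] by (intro sum_nonneg) auto
  show "0 \<le> q b" if "b \<in> B" for b
    unfolding coding_sums(3)[OF c that, symmetric] using codingD(4)[OF c] by (intro sum_nonneg) auto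
  have "sum w E = (\<Sum>e\<in>E. \<Sum>b\<in>B. \<Sum>a\<in>A. p a * (cmod (k e b a))^2)"
    by (intro sum.cong refl) (simp add: coding_sums(2)[OF c])
  then show "sum w E = 1" using coding_total[OF c] by simp
  have "sum q B = (\<Sum>b\<in>B. \<Sum>e\<in>E. \<Sum>a\<in>A. p a * (cmod (k e b a))^2)"
    by (intro sum.cong refl) (simp add: coding_sums(3)[OF c])
  also have "\<dots> = (\<Sum>e\<in>E. \<Sum>b\<in>B. \<Sum>a\<in>A. p a * (cmod (k e b a))^2)" by (rule sum.swap)
  finally show "sum q B = 1" using coding_total[OF c] by simp
qed

text \<open>The numbers \<open>p a * (cmod (k e b a))^2\<close> form a joint distribution of
  \<open>e\<close>, \<open>b\<close> and \<open>a\<close> with marginals \<open>w\<close>,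
  \<open>q\<close> and \<open>p\<close>; this is the union bound.\<close>

lemma coding_truncated_mass:
  assumes c: "coding A B E k p w q" and sub: "A0 \<subseteq> A" "B0 \<subseteq> B" "E0 \<subseteq> E"
  shows "1 - sum p (A - A0) - sum w (E - E0) - sum q (B - B0)
    \<le> (\<Sum>e\<in>E0. \<Sum>b\<in>B0. \<Sum>a\<in>A0. p a * (cmod (k e b a))^2)"
proof -
  note fin = codingD(1-3)[OF c]
  define g where "g = (\<lambda>(e, b, a). p a * (cmod (k e b a))^2)"
  have g0: "0 \<le> g x" if "x \<in> E \<times> B \<times> A" for x using codingD(4)[OF c] that by (auto simp: g_def)
  define U V W where "U = (E - E0) \<times> B \<times> A" and "V = E \<times> (B - B0) \<times> A" and "W = E \<times> B \<times> (A - A0)"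
  note UVW = U_def V_def W_def
  have finU: "finite U" "finite V" "finite W" "finite (E0 \<times> B0 \<times> A0)"
    using fin finite_subset[OF sub(1) fin(1)] finite_subset[OF sub(2) fin(2)] finite_subset[OF sub(3) fin(3)]
    unfolding UVW by auto
  have un: "sum g (X \<union> Y) \<le> sum g X + sum g Y" if "finite X" "finite Y" "X \<subseteq> E \<times> B \<times> A" "Y \<subseteq> E \<times> B \<times> A" for X Y
  proof -
    have "0 \<le> sum g (X \<inter> Y)" using that g0 by (intro sum_nonneg) blast
    then show ?thesis using that by (simp add: sum_Un)
  qed
  have "sum g (E \<times> B \<times> A) \<le> sum g (E0 \<times> B0 \<times> A0 \<union> (U \<union> (V \<union> W)))"
    using finU g0 sub unfolding UVW by (intro sum_mono2) auto
  also have "\<dots> \<le> sum g (E0 \<times> B0 \<times> A0) + sum g (U \<union> (V \<union> W))"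
    using finU sub by (intro un) (auto simp: UVW)
  also have "sum g (U \<union> (V \<union> W)) \<le> sum g U + sum g (V \<union> W)"
    using finU by (intro un) (auto simp: UVW)
  also have "sum g (V \<union> W) \<le> sum g V + sum g W" using finU by (intro un) (auto simp: UVW)
  finally have "sum g (E \<times> B \<times> A) \<le> sum g (E0 \<times> B0 \<times> A0) + (sum g U + (sum g V + sum g W))" by simp
  moreover have "sum g (E \<times> B \<times> A) = 1" using coding_total[OF c] by (simp add: g_def sum_Times)
  moreover have "sum g U = sum w (E - E0)"
    unfolding U_def sum_Times using coding_sums(2)[OF c] by (intro sum.cong) (auto simp: g_def)
  moreover have "sum g V = sum q (B - B0)"
    unfolding V_def sum_Times using coding_sums(3)[OF c]
    by (subst sum.swap, intro sum.cong) (auto simp: g_def)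
  moreover have "sum g W = (\<Sum>a\<in>A - A0. \<Sum>e\<in>E. \<Sum>b\<in>B. p a * (cmod (k e b a))^2)"
    unfolding W_def sum_Times g_def prod.case by (rule trans[OF sum.cong[OF refl sum.swap] sum.swap])
  then have "sum g W = sum p (A - A0)"
    using coding_sums(1)[OF c] by (simp flip: sum_distrib_left)
  ultimately show ?thesis by (simp add: g_def sum_Times)
qed

text \<open>The vectors \<open>k e \<surd>\<rho> / \<surd>(w e)\<close> are orthonormal for the Hilbert-Schmidt inner product.\<close>

lemma coding_coherent_term:
  assumes c: "coding A B E k p w q" and sub: "A0 \<subseteq> A" "B0 \<subseteq> B" "E0 \<subseteq> E"
    and w0: "\<And>e. e \<in> E0 \<Longrightarrow> 0 < w e"
  shows "(\<Sum>e\<in>E0. \<Sum>e'\<in>E0. 1 / w e' *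
      (cmod (\<Sum>a\<in>A0. of_real (p a) * (\<Sum>b\<in>B0. cnj (k e' b a) * k e b a)))^2)
    \<le> (\<Sum>e\<in>E0. \<Sum>b\<in>B0. \<Sum>a\<in>A0. p a * (cmod (k e b a))^2)"
proof (intro sum_mono)
  fix e assume e: "e \<in> E0"
  note fin = codingD(1-3)[OF c]
  let ?r = "\<lambda>a. complex_of_real (sqrt (p a))" and ?s = "\<lambda>e. complex_of_real (1 / sqrt (w e))"
  have rr: "?r a * ?r a = of_real (p a)" if "a \<in> A" for a
    using codingD(4)[OF c that] by (simp flip: of_real_mult)
  define v where "v e' = (\<lambda>(b, a). ?s e' * (?r a * k e' b a))" for e'
  \<comment> \<open>Only the vector under test is truncated. Its inner products with the full
    vectors \<open>v e'\<close> already are the truncated sums, so Bessel applies although truncated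
    Kraus operators need not be orthogonal.\<close>
  define y where "y = (\<lambda>(b, a). if b \<in> B0 \<and> a \<in> A0 then ?r a * k e b a else 0)"
  let ?z = "\<lambda>e'. \<Sum>a\<in>A0. of_real (p a) * (\<Sum>b\<in>B0. cnj (k e' b a) * k e b a)"
  have o: "orthon E0 (B \<times> A) v"
    unfolding orthon_def
  proof (intro ballI)
    fix f g assume fg: "f \<in> E0" "g \<in> E0"
    then have FG: "f \<in> E" "g \<in> E" using sub by auto
    have "ip (B \<times> A) (v f) (v g) = (\<Sum>b\<in>B. \<Sum>a\<in>A. ?s f * ?s g * (of_real (p a) * (k g b a * cnj (k f b a))))"
      unfolding ip_def sum_Times v_def by (intro sum.cong refl) (simp add: rr[symmetric])
    also have "\<dots> = ?s f * ?s g * (if g = f then of_real (w g) else 0)"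
      unfolding sum_distrib_left[symmetric] codingD(7)[OF c FG(2,1)] ..
    also have "\<dots> = (if f = g then 1 else 0)"
    proof (cases "f = g")
      case True
      have "1 / sqrt (w g) * (1 / sqrt (w g)) * w g = 1" using w0[OF fg(2)] by simp
      then show ?thesis using True by (simp only: if_True refl of_real_1 flip: of_real_mult)
    qed auto
    finally show "ip (B \<times> A) (v f) (v g) = (if f = g then 1 else 0)" .
  qed
  have finE0: "finite E0" using sub fin finite_subset by blast
  have ipvy: "(cmod (ip (B \<times> A) (v e') y))^2 = 1 / w e' * (cmod (?z e'))^2" if e': "e' \<in> E0" for e'
  proof -
    have "ip (B \<times> A) (v e') y = (\<Sum>x\<in>B0 \<times> A0. cnj (v e' x) * y x)"
      unfolding ip_def using sub fin by (intro sum.mono_neutral_right) (auto simp: y_def split: if_splits)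
    also have "\<dots> = (\<Sum>b\<in>B0. \<Sum>a\<in>A0. ?s e' * (of_real (p a) * (cnj (k e' b a) * k e b a)))"
      unfolding sum_Times v_def y_def using sub(1) by (intro sum.cong refl) (auto simp: rr[symmetric])
    also have "\<dots> = ?s e' * ?z e'" unfolding sum_distrib_left by (rule sum.swap)
    finally show ?thesis
      using w0[OF e'] by (simp add: norm_mult power_mult_distrib norm_divide power_divide)
  qed
  have "(\<Sum>e'\<in>E0. 1 / w e' * (cmod (?z e'))^2) = (\<Sum>e'\<in>E0. (cmod (ip (B \<times> A) (v e') y))^2)"
    by (intro sum.cong refl ipvy[symmetric])
  also have "\<dots> \<le> nsq (B \<times> A) y" by (rule bessel[OF finE0 o])
  also have "nsq (B \<times> A) y = (\<Sum>x\<in>B0 \<times> A0. (cmod (y x))^2)"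
    unfolding nsq_def using sub fin by (intro sum.mono_neutral_right) (auto simp: y_def split: if_splits)
  also have "\<dots> = (\<Sum>b\<in>B0. \<Sum>a\<in>A0. p a * (cmod (k e b a))^2)"
    unfolding sum_Times y_def using codingD(4)[OF c] sub by (intro sum.cong refl) (auto simp: norm_mult power_mult_distrib)
  finally show "(\<Sum>e'\<in>E0. 1 / w e' * (cmod (?z e'))^2) \<le> (\<Sum>b\<in>B0. \<Sum>a\<in>A0. p a * (cmod (k e b a))^2)" .
qed

text \<open>Both sides are the trace of the square of the weighted sum of the projections onto the
  \<open>y i\<close>, expanded in these vectors on the left and in the diagonal form on the
  right.\<close>

lemma purity_identity:
  assumes fin: "finite B"
    and diag: "\<And>b b'. b \<in> B \<Longrightarrow> b' \<in> B \<Longrightarrow>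
      (\<Sum>i\<in>I. of_real (r i) * (y i b * cnj (y i b'))) = (if b = b' then of_real (q b) else 0)"
  shows "(\<Sum>i\<in>I. \<Sum>j\<in>I. r j * r i * (cmod (\<Sum>b\<in>B. cnj (y j b) * y i b))^2) = (\<Sum>b\<in>B. (q b)^2)"
proof -
  let ?R = "\<lambda>b b'. \<Sum>i\<in>I. of_real (r i) * (y i b * cnj (y i b'))"
  have "of_real (\<Sum>i\<in>I. \<Sum>j\<in>I. r j * r i * (cmod (\<Sum>b\<in>B. cnj (y j b) * y i b))^2)
      = (\<Sum>i\<in>I. \<Sum>j\<in>I. \<Sum>b\<in>B. \<Sum>b'\<in>B. (of_real (r i) * (y i b * cnj (y i b'))) *
          (of_real (r j) * (y j b' * cnj (y j b))))"
    unfolding of_real_sum of_real_mult cmod_sum_sq sum_distrib_left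
    by (intro sum.cong refl) simp
  also have "\<dots> = (\<Sum>b\<in>B. \<Sum>b'\<in>B. \<Sum>i\<in>I. \<Sum>j\<in>I. (of_real (r i) * (y i b * cnj (y i b'))) * (of_real (r j) * (y j b' * cnj (y j b))))"
    by (rule trans[rotated], rule trans[OF sum.swap], rule sum.cong[OF refl], rule sum.swap, intro sum.cong refl, subst sum.swap, intro sum.cong refl, rule sum.swap)
  also have "\<dots> = (\<Sum>b\<in>B. \<Sum>b'\<in>B. ?R b b' * ?R b' b)"
    by (simp only: sum_product)
  also have "\<dots> = (\<Sum>b\<in>B. \<Sum>b'\<in>B. if b = b' then of_real ((q b)^2) else 0)"
    using diag by (intro sum.cong refl) (auto simp: power2_eq_square)
  also have "\<dots> = of_real (\<Sum>b\<in>B. (q b)^2)" using fin by simp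
  finally show ?thesis by (simp only: of_real_eq_iff)
qed

text \<open>The weights \<open>1 / w e'\<close> are replaced by \<open>1 / be\<close>; all terms
  being nonnegative, the sums then extend to all of \<open>E\<close> and \<open>A\<close>. What
  remains is the purity of the output restricted to \<open>B0\<close>, at most its largest
  eigenvalue.\<close>

lemma coding_incoherent_term:
  assumes c: "coding A B E k p w q" and sub: "A0 \<subseteq> A" "B0 \<subseteq> B" "E0 \<subseteq> E"
    and be: "0 < be" "\<And>e. e \<in> E0 \<Longrightarrow> be \<le> w e" and ga0: "0 \<le> ga" and ga: "\<And>b. b \<in> B0 \<Longrightarrow> q b \<le> ga"
  shows "(\<Sum>e\<in>E0. \<Sum>e'\<in>E0. 1 / w e' *
      (\<Sum>a'\<in>A0. \<Sum>a\<in>A0. p a' * p a * (cmod (\<Sum>b\<in>B0. cnj (k e' b a') * k e b a))^2)) \<le> ga / be"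
proof -
  note fin = codingD(1-3)[OF c]
  have p0: "0 \<le> p a" if "a \<in> A" for a using codingD(4)[OF c that] .
  define g where "g j i = p (snd j) * p (snd i) * (cmod (\<Sum>b\<in>B0. cnj (k (fst j) b (snd j)) * k (fst i) b (snd i)))^2" for i j
  have g0: "0 \<le> g j i" if "i \<in> E \<times> A" "j \<in> E \<times> A" for i j using p0 that by (auto simp: g_def)
  have subs: "E0 \<times> A0 \<subseteq> E \<times> A" using sub by auto
  have finEA: "finite (E \<times> A)" using fin by simp
  have "(\<Sum>e\<in>E0. \<Sum>e'\<in>E0. 1 / w e' * (\<Sum>a'\<in>A0. \<Sum>a\<in>A0. g (e', a') (e, a)))
      = (\<Sum>i\<in>E0 \<times> A0. \<Sum>j\<in>E0 \<times> A0. 1 / w (fst j) * g j i)"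
    unfolding sum_Times fst_conv sum_distrib_left
    by (rule sum.cong[OF refl], rule trans[OF sum.cong[OF refl sum.swap] sum.swap])
  also have "\<dots> \<le> (\<Sum>i\<in>E0 \<times> A0. \<Sum>j\<in>E0 \<times> A0. 1 / be * g j i)"
    using be subs by (intro sum_mono mult_right_mono frac_le g0) auto
  also have "\<dots> \<le> (\<Sum>i\<in>E0 \<times> A0. \<Sum>j\<in>E \<times> A. 1 / be * g j i)"
    using subs finEA be g0 by (intro sum_mono sum_mono2) auto
  also have "\<dots> \<le> (\<Sum>i\<in>E \<times> A. \<Sum>j\<in>E \<times> A. 1 / be * g j i)"
    using subs finEA be g0 by (intro sum_mono2 sum_nonneg) auto
  also have "\<dots> = 1 / be * (\<Sum>i\<in>E \<times> A. \<Sum>j\<in>E \<times> A. g j i)"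
    by (simp only: sum_distrib_left)
  also have "(\<Sum>i\<in>E \<times> A. \<Sum>j\<in>E \<times> A. g j i) = (\<Sum>b\<in>B0. (q b)^2)"
    unfolding g_def
  proof (rule purity_identity)
    show "finite B0" using sub fin finite_subset by blast
    fix b b' assume "b \<in> B0" "b' \<in> B0"
    then have "b \<in> B" "b' \<in> B" using sub by auto
    from codingD(8)[OF c this]
    show "(\<Sum>i\<in>E \<times> A. of_real (p (snd i)) * (k (fst i) b (snd i) * cnj (k (fst i) b' (snd i))))
        = (if b = b' then of_real (q b) else 0)"
      by (simp add: sum_Times)
  qed
  also have "(\<Sum>b\<in>B0. (q b)^2) \<le> (\<Sum>b\<in>B0. ga * q b)"
    unfolding power2_eq_square using ga coding_nonneg(2)[OF c] sub by (intro sum_mono mult_right_mono) auto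
  also have "\<dots> \<le> ga"
  proof -
    have "sum q B0 \<le> sum q B"
      using sub fin coding_nonneg(2)[OF c] by (intro sum_mono2) auto
    then show ?thesis using ga0 coding_nonneg(4)[OF c]
      by (simp add: mult_left_le flip: sum_distrib_left)
  qed
  finally show ?thesis using be unfolding g_def by (simp add: divide_right_mono)
qed

lemma nsq_extend_zero:
  assumes "J0 \<subseteq> J" "finite J"
  shows "nsq J (\<lambda>j. if j \<in> J0 then v j else 0) = nsq J0 v"
proof -
  have "nsq J0 v = (\<Sum>j\<in>J0. (cmod (if j \<in> J0 then v j else 0))^2)" by (simp add: nsq_def)
  also have "\<dots> = nsq J (\<lambda>j. if j \<in> J0 then v j else 0)"
    unfolding nsq_def using assms by (intro sum.mono_neutral_left) (auto split: if_splits)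
  finally show ?thesis ..
qed

lemma mv_extend_zero:
  assumes "J0 \<subseteq> J" "finite J"
  shows "mv J M (\<lambda>j. if j \<in> J0 then v j else 0) = mv J0 M v"
proof (rule ext)
  fix i
  have "mv J0 M v i = (\<Sum>j\<in>J0. M i j * (if j \<in> J0 then v j else 0))" by (simp add: mv_def)
  also have "\<dots> = mv J M (\<lambda>j. if j \<in> J0 then v j else 0) i"
    unfolding mv_def using assms by (intro sum.mono_neutral_left) (auto split: if_splits)
  finally show "mv J M (\<lambda>j. if j \<in> J0 then v j else 0) i = mv J0 M v i" ..
qed

lemma nsq_mono: "I0 \<subseteq> I \<Longrightarrow> finite I \<Longrightarrow> nsq I0 v \<le> nsq I v"
  unfolding nsq_def by (intro sum_mono2) auto

lemma contr_subset:
  assumes "contr I J M" "I0 \<subseteq> I" "J0 \<subseteq> J" "finite I" "finite J"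
  shows "contr I0 J0 M"
  unfolding contr_def
proof
  fix v
  have "nsq I0 (mv J0 M v) \<le> nsq I (mv J0 M v)" by (rule nsq_mono[OF assms(2,4)])
  also have "\<dots> = nsq I (mv J M (\<lambda>j. if j \<in> J0 then v j else 0))"
    by (simp add: mv_extend_zero[OF assms(3,5)])
  also have "\<dots> \<le> nsq J (\<lambda>j. if j \<in> J0 then v j else 0)" by (rule contrD[OF assms(1)])
  also have "\<dots> = nsq J0 v" by (rule nsq_extend_zero[OF assms(3,5)])
  finally show "nsq I0 (mv J0 M v) \<le> nsq J0 v" .
qed

lemma contr_extend_zero:
  assumes "contr I0 J0 M" "I0 \<subseteq> I" "J0 \<subseteq> J" "finite I" "finite J"
  shows "contr I J (\<lambda>i j. if i \<in> I0 \<and> j \<in> J0 then M i j else 0)"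
  unfolding contr_def
proof
  fix v
  let ?F = "\<lambda>i j. if i \<in> I0 \<and> j \<in> J0 then M i j else 0"
  have "mv J ?F v = (\<lambda>i. if i \<in> I0 then mv J0 M v i else 0)"
  proof (rule ext)
    fix i
    have "mv J ?F v i
        = (\<Sum>j\<in>J0. (if i \<in> I0 \<and> j \<in> J0 then M i j else 0) * v j)"
      unfolding mv_def using assms by (intro sum.mono_neutral_right) (auto split: if_splits)
    then show "mv J ?F v i = (if i \<in> I0 then mv J0 M v i else 0)"
      by (simp add: mv_def)
  qed
  then have "nsq I (mv J ?F v) = nsq I0 (mv J0 M v)"
    by (simp add: nsq_extend_zero[OF assms(2,4)])
  also have "\<dots> \<le> nsq J0 v" by (rule contrD[OF assms(1)])
  also have "\<dots> \<le> nsq J v" by (rule nsq_mono[OF assms(3,5)])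
  finally show "nsq I (mv J ?F v) \<le> nsq J v" .
qed

lemma contr_cnj:
  assumes "contr I J M"
  shows "contr I J (\<lambda>i j. cnj (M i j))"
  unfolding contr_def
proof
  fix v
  have "mv J (\<lambda>i j. cnj (M i j)) v = (\<lambda>i. cnj (mv J M (\<lambda>j. cnj (v j)) i))"
    by (rule ext) (simp add: mv_def)
  then have "nsq I (mv J (\<lambda>i j. cnj (M i j)) v) = nsq I (mv J M (\<lambda>j. cnj (v j)))"
    by (simp add: nsq_def)
  also have "\<dots> \<le> nsq J (\<lambda>j. cnj (v j))" by (rule contrD[OF assms])
  finally show "nsq I (mv J (\<lambda>i j. cnj (M i j)) v) \<le> nsq J v" by (simp add: nsq_def)
qed

lemma contr_transpose:
  assumes "contr I J M"
  shows "contr J I (\<lambda>j i. M i j)"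
  using contr_cnj[OF contr_adjoint[OF assms]] by simp

lemma coding_contr:
  assumes c: "coding A B E k p w q"
  shows "contr (E \<times> B) A (\<lambda>(e, b) a. k e b a)"
proof -
  have "orthon A (E \<times> B) (\<lambda>a (e, b). k e b a)"
    unfolding orthon_def ip_def using codingD(6)[OF c] by (simp add: sum_Times)
  from contr_orthon(2)[OF codingD(1)[OF c] this] show ?thesis
    by (simp add: case_prod_unfold)
qed

section \<open>Random codes\<close>

text \<open>The columns of the amplitude matrix are rescaled by \<open>1 / sqrt (w e)\<close>, which
  makes it nearly isometric for a good code. Since \<open>polar_contraction\<close> bounds each
  diagonal entry separately, the inequality for column \<open>(s, e)\<close> can be multiplied by
  \<open>w e\<close> before summing.\<close>

lemma decoder_polar:
  fixes n :: "'e \<Rightarrow> 'b \<Rightarrow> 's \<Rightarrow> complex"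
  assumes fin: "finite S" "finite E0" "finite B0" and w: "\<And>e. e \<in> E0 \<Longrightarrow> 0 < w e"
  obtains V where "contr (S \<times> E0) B0 V"
    "(3 * (\<Sum>s\<in>S. \<Sum>e\<in>E0. \<Sum>b\<in>B0. (cmod (n e b s))^2)
        - (\<Sum>s\<in>S. \<Sum>s'\<in>S. \<Sum>e\<in>E0. \<Sum>e'\<in>E0. 1 / w e' * (cmod (\<Sum>b\<in>B0. cnj (n e' b s') * n e b s))^2)) / 2
      \<le> Re (\<Sum>s\<in>S. \<Sum>e\<in>E0. \<Sum>b\<in>B0. of_real (sqrt (w e)) * V (s, e) b * n e b s)"
proof -
  define M where "M b = (\<lambda>(s, e). of_real (1 / sqrt (w e)) * n e b s)" for b
  obtain V where V: "contr (S \<times> E0) B0 V"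
    "\<And>i. i \<in> S \<times> E0 \<Longrightarrow> (3 * (\<Sum>b\<in>B0. (cmod (M b i))^2) - (\<Sum>i'\<in>S \<times> E0. (cmod (\<Sum>b\<in>B0. cnj (M b i') * M b i))^2)) / 2
      \<le> Re (\<Sum>b\<in>B0. V i b * M b i)"
    using polar_contraction[OF finite_cartesian_product[OF fin(1,2)] fin(3)] by blast
  define Y where "Y s e s' e' = 1 / w e' * (cmod (\<Sum>b\<in>B0. cnj (n e' b s') * n e b s))^2" for s e s' e'
  let ?F = "\<lambda>e s. 3 * (\<Sum>b\<in>B0. (cmod (n e b s))^2) - (\<Sum>s'\<in>S. \<Sum>e'\<in>E0. Y s e s' e')"
  let ?G = "\<lambda>e s. \<Sum>b\<in>B0. of_real (sqrt (w e)) * V (s, e) b * n e b s"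
  let ?H = "\<lambda>s e. \<Sum>i'\<in>S \<times> E0. (cmod (\<Sum>b\<in>B0. cnj (M b i') * M b (s, e)))^2"
  have main: "?F e s / 2
      \<le> Re (?G e s)" if s: "s \<in> S" and e: "e \<in> E0" for s e
  proof -
    have we: "0 < w e" using w[OF e] .
    have 1: "w e * (\<Sum>b\<in>B0. (cmod (M b (s, e)))^2) = (\<Sum>b\<in>B0. (cmod (n e b s))^2)"
      unfolding sum_distrib_left using we
      by (intro sum.cong refl) (simp add: M_def norm_mult norm_divide power_mult_distrib power_divide)
    have 2: "w e * ?H s e = (\<Sum>s'\<in>S. \<Sum>e'\<in>E0. Y s e s' e')"
      unfolding sum_distrib_left sum_Times
    proof (intro sum.cong refl)
      fix s' e' assume e': "e' \<in> E0"
      have "(\<Sum>b\<in>B0. cnj (M b (s', e')) * M b (s, e))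
          = of_real (1 / sqrt (w e')) * of_real (1 / sqrt (w e)) * (\<Sum>b\<in>B0. cnj (n e' b s') * n e b s)"
        unfolding sum_distrib_left M_def by (intro sum.cong refl) simp
      then show "w e * (cmod (\<Sum>b\<in>B0. cnj (M b (s', e')) * M b (s, e)))^2 = Y s e s' e'"
        using we w[OF e'] by (simp add: Y_def norm_mult norm_divide power_mult_distrib power_divide)
    qed
    have "Re (?G e s)
        = Re (of_real (w e) * (\<Sum>b\<in>B0. V (s, e) b * M b (s, e)))"
    proof (intro arg_cong[where f = Re])
      have r: "w e * (1 / sqrt (w e)) = sqrt (w e)" using we by (simp add: real_div_sqrt)
      have X: "of_real (w e) * (V (s, e) b * M b (s, e))
          = of_real (w e * (1 / sqrt (w e))) * V (s, e) b * n e b s" for b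
        unfolding M_def of_real_mult by simp
      show "?G e s
          = of_real (w e) * (\<Sum>b\<in>B0. V (s, e) b * M b (s, e))"
        by (simp only: X r sum_distrib_left)
    qed
    also have "\<dots> = w e * Re (\<Sum>b\<in>B0. V (s, e) b * M b (s, e))" by (rule Re_complex_of_real_mult)
    also have "\<dots> \<ge> w e * ((3 * (\<Sum>b\<in>B0. (cmod (M b (s, e)))^2)
        - (?H s e)) / 2)"
      using we V(2)[of "(s, e)"] s e by (intro mult_left_mono) auto
    also have "w e * ((3 * (\<Sum>b\<in>B0. (cmod (M b (s, e)))^2)
        - (?H s e)) / 2)
        = ?F e s / 2"
      unfolding 1[symmetric] 2[symmetric] by (simp add: algebra_simps)
    finally show ?thesis .
  qed
  have sw: "(\<Sum>s\<in>S. \<Sum>s'\<in>S. \<Sum>e\<in>E0. \<Sum>e'\<in>E0. Y s e s' e') = (\<Sum>s\<in>S. \<Sum>e\<in>E0. \<Sum>s'\<in>S. \<Sum>e'\<in>E0. Y s e s' e')"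
    by (intro sum.cong refl sum.swap)
  have "(3 * (\<Sum>s\<in>S. \<Sum>e\<in>E0. \<Sum>b\<in>B0. (cmod (n e b s))^2) - (\<Sum>s\<in>S. \<Sum>s'\<in>S. \<Sum>e\<in>E0. \<Sum>e'\<in>E0. Y s e s' e')) / 2
      = (\<Sum>s\<in>S. \<Sum>e\<in>E0. (?F e s) / 2)"
    unfolding sw sum_distrib_left sum_subtractf[symmetric] sum_divide_distrib ..
  also have "\<dots> \<le> (\<Sum>s\<in>S. \<Sum>e\<in>E0. Re (?G e s))"
    by (intro sum_mono main)
  finally show ?thesis using that[OF V(1)] unfolding Y_def by simp
qed

text \<open>The right-hand side is the squared Hilbert-Schmidt distance of
  \<open>C\<^sup>\<dagger> C\<close> from the identity. It arises from |U|^2 - 2 Re <U, C> + |C|^2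
  through the cubic bound, each column of \<open>U\<close> having norm at most 1.\<close>

lemma encoder_polar:
  fixes C :: "'a \<Rightarrow> 's \<Rightarrow> complex"
  assumes fin: "finite S" "finite A"
  obtains U where "contr A S U"
    "(\<Sum>s\<in>S. \<Sum>a\<in>A. (cmod (C a s - U a s))^2) \<le> real (card S) - 2 * (\<Sum>s\<in>S. \<Sum>a\<in>A. (cmod (C a s))^2)
      + (\<Sum>s\<in>S. \<Sum>s'\<in>S. (cmod (\<Sum>a\<in>A. cnj (C a s') * C a s))^2)"
proof -
  let ?F = "\<lambda>s. \<Sum>s'\<in>S. (cmod (\<Sum>a\<in>A. cnj (C a s') * C a s))^2"
  obtain V where V: "contr S A V"
    "\<And>s. s \<in> S \<Longrightarrow> (3 * (\<Sum>a\<in>A. (cmod (C a s))^2) - (?F s)) / 2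
      \<le> Re (\<Sum>a\<in>A. V s a * C a s)"
    using polar_contraction[OF fin] by blast
  define U where "U a s = cnj (V s a)" for a s
  have "contr A S U" unfolding U_def by (rule contr_adjoint[OF V(1)])
  moreover have "(\<Sum>s\<in>S. \<Sum>a\<in>A. (cmod (C a s - U a s))^2) \<le> (\<Sum>s\<in>S. 1 - 2 * (\<Sum>a\<in>A. (cmod (C a s))^2)
      + (?F s))"
  proof (rule sum_mono)
    fix s assume s: "s \<in> S"
    have "(\<Sum>a\<in>A. (cmod (C a s - U a s))^2) = nsq A (\<lambda>a. U a s - C a s)"
      by (simp add: nsq_def norm_minus_commute)
    also have "\<dots> = nsq A (\<lambda>a. U a s) - 2 * Re (ip A (\<lambda>a. U a s) (\<lambda>a. C a s)) + nsq A (\<lambda>a. C a s)"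
      by (rule nsq_diff)
    also have "nsq A (\<lambda>a. U a s) \<le> 1"
      using contr_column[OF \<open>contr A S U\<close> fin(1) s] by (simp add: nsq_def)
    also have "ip A (\<lambda>a. U a s) (\<lambda>a. C a s) = (\<Sum>a\<in>A. V s a * C a s)"
      by (simp add: ip_def U_def)
    finally have "(\<Sum>a\<in>A. (cmod (C a s - U a s))^2) \<le> 1 - 2 * Re (\<Sum>a\<in>A. V s a * C a s) + nsq A (\<lambda>a. C a s)"
      by simp
    then show "(\<Sum>a\<in>A. (cmod (C a s - U a s))^2) \<le> 1 - 2 * (\<Sum>a\<in>A. (cmod (C a s))^2)
        + ?F s"
      using V(2)[OF s] by (simp add: nsq_def)
  qed
  then have "(\<Sum>s\<in>S. \<Sum>a\<in>A. (cmod (C a s - U a s))^2) \<le> real (card S) - 2 * (\<Sum>s\<in>S. \<Sum>a\<in>A. (cmod (C a s))^2)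
      + (\<Sum>s\<in>S. \<Sum>s'\<in>S. (cmod (\<Sum>a\<in>A. cnj (C a s') * C a s))^2)"
    by (simp add: sum.distrib sum_subtractf sum_distrib_left)
  ultimately show ?thesis using that by blast
qed

text \<open>Controls how the overlap changes when the random encoder is replaced by a contraction.
  Each vector \<open>G s\<close> has norm at most 1: the rows of \<open>V\<close> are bounded by 1,
  the weights sum to at most 1, and the transposed Kraus isometry is a contraction.\<close>

lemma trace_pairing_bound:
  assumes c: "coding A B E k p w q" and sub: "A0 \<subseteq> A" "B0 \<subseteq> B" "E0 \<subseteq> E"
    and V: "contr (S \<times> E0) B0 V" and fin: "finite S"
  shows "(cmod (\<Sum>s\<in>S. \<Sum>e\<in>E0. \<Sum>b\<in>B0. of_real (sqrt (w e)) * V (s, e) b * (\<Sum>a\<in>A0. k e b a * D a s)))^2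
    \<le> real (card S) * (\<Sum>s\<in>S. \<Sum>a\<in>A0. (cmod (D a s))^2)"
proof -
  note finc = codingD(1-3)[OF c]
  have fin0: "finite A0" "finite B0" "finite E0" using sub finc finite_subset by blast+
  have w0: "0 \<le> w e" if "e \<in> E0" for e using coding_nonneg(1)[OF c] sub that by blast
  define h where "h s = (\<lambda>(e, b). of_real (sqrt (w e)) * V (s, e) b)" for s
  define G where "G s a = mv (E0 \<times> B0) (\<lambda>a (e, b). k e b a) (h s) a" for s a
  have "contr A (E \<times> B) (\<lambda>a x. (case x of (e, b) \<Rightarrow> \<lambda>a. k e b a) a)"
    by (rule contr_transpose[OF coding_contr[OF c]])
  then have "contr A (E \<times> B) (\<lambda>a (e, b). k e b a)" by (simp add: case_prod_unfold)
  from contr_subset[OF this sub(1), of "E0 \<times> B0"] have ct: "contr A0 (E0 \<times> B0) (\<lambda>a (e, b). k e b a)"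
    using sub finc by auto
  have G1: "nsq A0 (G s) \<le> 1" if s: "s \<in> S" for s
  proof -
    have "nsq A0 (G s) \<le> nsq (E0 \<times> B0) (h s)"
      unfolding G_def using contrD[OF ct, of "h s"] by simp
    also have "\<dots> = (\<Sum>e\<in>E0. w e * (\<Sum>b\<in>B0. (cmod (V (s, e) b))^2))"
      unfolding nsq_def sum_Times h_def using w0
      by (intro sum.cong refl) (simp add: norm_mult power_mult_distrib sum_distrib_left)
    also have "\<dots> \<le> (\<Sum>e\<in>E0. w e * 1)"
    proof (intro sum_mono mult_left_mono w0)
      fix e assume "e \<in> E0"
      then show "(\<Sum>b\<in>B0. (cmod (V (s, e) b))^2) \<le> 1"
        using contr_row[OF V, of "(s, e)"] s fin fin0 by simp
    qed
    also have "\<dots> \<le> sum w E"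
      unfolding mult_1_right using sub finc coding_nonneg(1)[OF c] by (intro sum_mono2) auto
    finally show ?thesis using coding_nonneg(3)[OF c] by simp
  qed
  let ?F = "\<Sum>s\<in>S. \<Sum>e\<in>E0. \<Sum>b\<in>B0. of_real (sqrt (w e)) * V (s, e) b * (\<Sum>a\<in>A0. k e b a * D a s)"
  have "?F
      = (\<Sum>s\<in>S. \<Sum>x\<in>E0 \<times> B0. \<Sum>a\<in>A0. h s x * (case x of (e, b) \<Rightarrow> k e b a) * D a s)"
    unfolding sum_Times sum_distrib_left h_def by (intro sum.cong refl) simp
  also have "\<dots> = (\<Sum>s\<in>S. \<Sum>a\<in>A0. \<Sum>x\<in>E0 \<times> B0. h s x * (case x of (e, b) \<Rightarrow> k e b a) * D a s)"
    by (intro sum.cong refl sum.swap)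
  also have "\<dots> = (\<Sum>s\<in>S. \<Sum>a\<in>A0. G s a * D a s)"
    unfolding G_def mv_def sum_distrib_right
    by (intro sum.cong refl) (simp add: case_prod_unfold mult.commute)
  also have "\<dots> = ip (S \<times> A0) (\<lambda>(s, a). cnj (G s a)) (\<lambda>(s, a). D a s)"
    unfolding ip_def sum_Times by simp
  finally have eq: "?F
      = ip (S \<times> A0) (\<lambda>(s, a). cnj (G s a)) (\<lambda>(s, a). D a s)" .
  have n1: "nsq (S \<times> A0) (\<lambda>(s, a). cnj (G s a)) \<le> real (card S)" (is "?lhs \<le> _")
  proof -
    have "?lhs = (\<Sum>s\<in>S. nsq A0 (G s))"
      by (simp add: nsq_def sum_Times)
    also have "\<dots> \<le> (\<Sum>s\<in>S. 1)" by (intro sum_mono G1)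
    finally show ?thesis by simp
  qed
  have n2: "nsq (S \<times> A0) (\<lambda>(s, a). D a s) = (\<Sum>s\<in>S. \<Sum>a\<in>A0. (cmod (D a s))^2)"
    by (simp add: nsq_def sum_Times)
  show ?thesis unfolding eq
    using cauchy_schwarz_ip[of "S \<times> A0" "\<lambda>(s, a). cnj (G s a)" "\<lambda>(s, a). D a s"]
      mult_right_mono[OF n1 nsq_nonneg[of "S \<times> A0" "\<lambda>(s, a). D a s"]] unfolding n2 by linarith
qed

text \<open>The fourth moment with the identity for \<open>Q\<close>. The case \<open>s = s'\<close>
  completes the square to \<open>(1 - sum p A0)^2\<close>; the crossed pairing leaves the sum of the
  \<open>p a * p a\<close>, at most \<open>al\<close>.\<close>

lemma average_encoder:
  assumes fin: "finite A0" "finite S" and p0: "\<And>a. a \<in> A0 \<Longrightarrow> 0 \<le> p a"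
    and al: "\<And>a. a \<in> A0 \<Longrightarrow> p a \<le> al" and al0: "0 \<le> al" and p1: "sum p A0 \<le> 1"
    and ph: "phases (S \<times> A0) N \<theta>"
    and C: "\<And>t a s. C t a s = of_real (sqrt (p a)) * \<theta> t (s, a)"
  shows "(\<Sum>t<N. real (card S) - 2 * (\<Sum>s\<in>S. \<Sum>a\<in>A0. (cmod (C t a s))^2)
      + (\<Sum>s\<in>S. \<Sum>s'\<in>S. (cmod (\<Sum>a\<in>A0. cnj (C t a s') * C t a s))^2))
    \<le> real N * real (card S) * ((1 - sum p A0)^2 + real (card S) * al)"
proof -
  note unit = phasesD(2)[OF ph]
  define m where "m = real (card S)"
  have c1: "(\<Sum>s\<in>S. \<Sum>a\<in>A0. (cmod (C t a s))^2) = m * sum p A0" for t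
    using p0 by (simp add: C norm_mult unit m_def)
  let ?F = "\<lambda>t s' s. \<Sum>a\<in>A0. cnj (C t a s') * C t a s"
  let ?G = "\<lambda>s s'. if s = s' then (sum p A0)^2 else 0"
  have c2: "(\<Sum>t<N. (cmod (?F t s' s))^2)
      \<le> real N * (al + (?G s s'))" (is "?lhs \<le> _") if s: "s \<in> S" "s' \<in> S" for s s'
  proof -
    let ?d = "\<lambda>a' a. if a' = a then 1 else (0::complex)"
    have "(\<Sum>a'\<in>A0. \<Sum>a\<in>A0. cnj (C t a' s') * ?d a' a * C t a s) = ?F t s' s" (is "?lhs2 = _") for t
    proof -
      have "?lhs2
          = (\<Sum>a'\<in>A0. \<Sum>a\<in>A0. if a' = a then cnj (C t a' s') * C t a' s else 0)"
        by (intro sum.cong refl) auto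
      then show ?thesis using fin by simp
    qed
    then have "?lhs
        = (\<Sum>t<N. (cmod (\<Sum>a'\<in>A0. \<Sum>a\<in>A0. cnj (C t a' s') * ?d a' a * C t a s))^2)" by simp
    also have "\<dots> \<le> real N * ((\<Sum>a'\<in>A0. \<Sum>a\<in>A0. p a' * p a * (cmod (?d a' a))^2)
        + (if s = s' then (cmod (\<Sum>a\<in>A0. of_real (p a) * ?d a a))^2 else 0))"
      unfolding C by (rule phase_moment4[OF fin(1) p0 s ph])
    also have "(\<Sum>a'\<in>A0. \<Sum>a\<in>A0. p a' * p a * (cmod (?d a' a))^2) = (\<Sum>a'\<in>A0. \<Sum>a\<in>A0. if a' = a then p a * p a else 0)"
      by (intro sum.cong refl) auto
    also have "\<dots> = (\<Sum>a\<in>A0. p a * p a)" using fin by simp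
    also have "(\<Sum>a\<in>A0. of_real (p a) * ?d a a) = of_real (sum p A0)" by simp
    also have "real N * ((\<Sum>a\<in>A0. p a * p a) + (if s = s' then (cmod (of_real (sum p A0)))^2 else 0))
        \<le> real N * (al + (?G s s'))"
    proof -
      have "(\<Sum>a\<in>A0. p a * p a) \<le> (\<Sum>a\<in>A0. al * p a)" using al p0 by (intro sum_mono mult_right_mono) auto
      also have "\<dots> \<le> al" using p1 al0 by (simp add: mult_left_le flip: sum_distrib_left)
      finally show ?thesis
        unfolding norm_of_real power2_abs by (intro mult_left_mono add_mono) auto
    qed
    finally show ?thesis .
  qed
  have "(\<Sum>t<N. \<Sum>s\<in>S. \<Sum>s'\<in>S. (cmod (?F t s' s))^2)
      = (\<Sum>s\<in>S. \<Sum>s'\<in>S. \<Sum>t<N. (cmod (?F t s' s))^2)"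
    by (subst sum.swap, intro sum.cong refl, rule sum.swap)
  also have "\<dots> \<le> (\<Sum>s\<in>S. \<Sum>s'\<in>S. real N * (al + (?G s s')))"
    by (intro sum_mono c2)
  also have "\<dots> = real N * (\<Sum>s\<in>S. \<Sum>s'\<in>S. al + (?G s s'))"
    by (simp only: sum_distrib_left)
  also have "(\<Sum>s\<in>S. \<Sum>s'\<in>S. al + (?G s s')) = m * (m * al + (sum p A0)^2)"
    using fin by (simp add: sum.distrib m_def algebra_simps)
  finally have 3: "(\<Sum>t<N. \<Sum>s\<in>S. \<Sum>s'\<in>S. (cmod (?F t s' s))^2)
      \<le> real N * (m * (m * al + (sum p A0)^2))" .
  show ?thesis
    using 3 unfolding c1 sum.distrib sum_subtractf m_def[symmetric]
    by (simp add: algebra_simps power2_eq_square)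
qed

text \<open>Per secret label, the second moment is the truncated mass \<open>\<tau>\<close>, and the
  weighted fourth moment is at most \<open>\<tau>\<close> from the coherent pairing plus
  \<open>card S * ga / be\<close> from the other. Hence
  \<open>(3 * \<tau> - \<tau>) / 2 = \<tau>\<close> remains, minus half the second term.\<close>

lemma average_decoder:
  assumes c: "coding A B E k p w q" and sub: "A0 \<subseteq> A" "B0 \<subseteq> B" "E0 \<subseteq> E" and finS: "finite S"
    and be: "0 < be" "\<And>e. e \<in> E0 \<Longrightarrow> be \<le> w e" and ga0: "0 \<le> ga" and ga: "\<And>b. b \<in> B0 \<Longrightarrow> q b \<le> ga"
    and ph: "phases (S \<times> A0) N \<theta>"
    and C: "\<And>t a s. C t a s = of_real (sqrt (p a)) * \<theta> t (s, a)"
    and n: "\<And>t e b s. n t e b s = (\<Sum>a\<in>A0. k e b a * C t a s)"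
  shows "real N * real (card S) * ((\<Sum>e\<in>E0. \<Sum>b\<in>B0. \<Sum>a\<in>A0. p a * (cmod (k e b a))^2) - real (card S) * ga / (2 * be))
    \<le> (\<Sum>t<N. (3 * (\<Sum>s\<in>S. \<Sum>e\<in>E0. \<Sum>b\<in>B0. (cmod (n t e b s))^2)
        - (\<Sum>s\<in>S. \<Sum>s'\<in>S. \<Sum>e\<in>E0. \<Sum>e'\<in>E0. 1 / w e' * (cmod (\<Sum>b\<in>B0. cnj (n t e' b s') * n t e b s))^2)) / 2)"
proof -
  note finc = codingD(1-3)[OF c]
  have fin0: "finite A0" using sub finc finite_subset by blast
  have p0: "0 \<le> p a" if "a \<in> A0" for a using codingD(4)[OF c] sub that by blast
  have w0: "0 < w e" if "e \<in> E0" for e using be that by force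
  define m where "m = real (card S)"
  define \<tau> where "\<tau> = (\<Sum>e\<in>E0. \<Sum>b\<in>B0. \<Sum>a\<in>A0. p a * (cmod (k e b a))^2)"
  define Q where "Q e' e a' a = (\<Sum>b\<in>B0. cnj (k e' b a') * k e b a)" for e' e a' a
  define x2 where "x2 e e' = (\<Sum>a'\<in>A0. \<Sum>a\<in>A0. p a' * p a * (cmod (Q e' e a' a))^2)" for e e'
  define x1 where "x1 e e' = (cmod (\<Sum>a\<in>A0. of_real (p a) * Q e' e a a))^2" for e e'
  let ?H = "\<Sum>t<N. \<Sum>s\<in>S. \<Sum>e\<in>E0. \<Sum>b\<in>B0. (cmod (n t e b s))^2"
  have "?H
      = (\<Sum>s\<in>S. \<Sum>e\<in>E0. \<Sum>b\<in>B0. \<Sum>t<N. (cmod (n t e b s))^2)"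
    by (subst sum.swap, intro sum.cong refl, subst sum.swap, intro sum.cong refl, rule sum.swap)
  also have "\<dots> = (\<Sum>s\<in>S. \<Sum>e\<in>E0. \<Sum>b\<in>B0. real N * (\<Sum>a\<in>A0. p a * (cmod (k e b a))^2))"
    unfolding n C by (intro sum.cong refl phase_moment2[OF fin0 p0 _ ph])
  also have "\<dots> = real N * m * \<tau>"
    by (simp add: \<tau>_def m_def flip: sum_distrib_left)
  finally have 1: "?H = real N * m * \<tau>" .
  let ?L = "\<lambda>t e' s' e s. \<Sum>b\<in>B0. cnj (n t e' b s') * n t e b s"
  have nn: "?L t e' s' e s
      = (\<Sum>a'\<in>A0. \<Sum>a\<in>A0. cnj (C t a' s') * Q e' e a' a * C t a s)" (is "?lhs = _") for t e' e s' s
  proof -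
    have "?lhs
        = (\<Sum>b\<in>B0. \<Sum>a'\<in>A0. \<Sum>a\<in>A0. cnj (C t a' s') * (cnj (k e' b a') * k e b a) * C t a s)"
      unfolding n cnj_sum sum_product by (intro sum.cong refl) simp
    also have "\<dots> = (\<Sum>a'\<in>A0. \<Sum>a\<in>A0. \<Sum>b\<in>B0. cnj (C t a' s') * (cnj (k e' b a') * k e b a) * C t a s)"
      by (subst sum.swap, intro sum.cong refl, rule sum.swap)
    finally show ?thesis by (simp only: Q_def sum_distrib_left sum_distrib_right)
  qed
  have mm: "(\<Sum>t<N. (cmod (?L t e' s' e s))^2)
      \<le> real N * (x2 e e' + (if s = s' then x1 e e' else 0))" if "s \<in> S" "s' \<in> S" for e e' s s'
    unfolding nn C x2_def x1_def by (rule phase_moment4[OF fin0 p0 that ph])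
  let ?F = "\<lambda>x2. \<Sum>e\<in>E0. \<Sum>e'\<in>E0. 1 / w e' * x2 e e'"
  let ?G = "\<Sum>t<N. \<Sum>s\<in>S. \<Sum>s'\<in>S. \<Sum>e\<in>E0. \<Sum>e'\<in>E0. 1 / w e' * (cmod (?L t e' s' e s))^2"
  have "?G
      = (\<Sum>s\<in>S. \<Sum>s'\<in>S. \<Sum>e\<in>E0. \<Sum>e'\<in>E0. \<Sum>t<N. 1 / w e' * (cmod (?L t e' s' e s))^2)"
    by (subst sum.swap, intro sum.cong refl, subst sum.swap, intro sum.cong refl, subst sum.swap,
        intro sum.cong refl, rule sum.swap)
  also have "\<dots> \<le> (\<Sum>s\<in>S. \<Sum>s'\<in>S. \<Sum>e\<in>E0. \<Sum>e'\<in>E0. real N * (1 / w e' * x2 e e' + (if s = s' then 1 / w e' * x1 e e' else 0)))"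
  proof (intro sum_mono)
    fix s s' e e' assume a: "s \<in> S" "s' \<in> S" "e \<in> E0" "e' \<in> E0"
    have "(\<Sum>t<N. 1 / w e' * (cmod (?L t e' s' e s))^2)
        \<le> 1 / w e' * (real N * (x2 e e' + (if s = s' then x1 e e' else 0)))"
      unfolding sum_distrib_left[symmetric] using w0[OF a(4)] by (intro mult_left_mono mm a) auto
    also have "\<dots> = real N * (1 / w e' * x2 e e' + (if s = s' then 1 / w e' * x1 e e' else 0))"
      by (simp add: algebra_simps)
    finally show "(\<Sum>t<N. 1 / w e' * (cmod (?L t e' s' e s))^2)
        \<le> real N * (1 / w e' * x2 e e' + (if s = s' then 1 / w e' * x1 e e' else 0))" .
  qed
  also have "\<dots> = real N * (\<Sum>s\<in>S. \<Sum>s'\<in>S. (?F x2)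
      + (if s = s' then \<Sum>e\<in>E0. \<Sum>e'\<in>E0. 1 / w e' * x1 e e' else 0))"
    unfolding sum_distrib_left[symmetric] sum.distrib
    by (intro arg_cong2[where f = "(*)"] arg_cong2[where f = "(+)"] sum.cong refl) auto
  also have "(\<Sum>s\<in>S. \<Sum>s'\<in>S. (?F x2)
      + (if s = s' then \<Sum>e\<in>E0. \<Sum>e'\<in>E0. 1 / w e' * x1 e e' else 0))
      = m * (m * ?F x2 + (?F x1))"
    using finS by (simp add: sum.distrib m_def algebra_simps)
  also have "real N * (m * (m * ?F x2 + (?F x1)))
      \<le> real N * (m * (m * (ga / be) + \<tau>))"
  proof (intro mult_left_mono add_mono)
    show "?F x2 \<le> ga / be"
      unfolding x2_def Q_def by (rule coding_incoherent_term[OF c sub be ga0 ga])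
    show "?F x1 \<le> \<tau>"
      unfolding x1_def Q_def \<tau>_def by (rule coding_coherent_term[OF c sub w0])
  qed (simp_all add: m_def)
  finally have 2: "?G
      \<le> real N * (m * (m * (ga / be) + \<tau>))" .
  have "real N * m * (\<tau> - m * ga / (2 * be)) = (3 * (real N * m * \<tau>) - real N * (m * (m * (ga / be) + \<tau>))) / 2"
    by (simp add: field_simps)
  also have "\<dots> \<le> (3 * ?H
        - ?G) / 2"
    using 2 unfolding 1 by simp
  finally show ?thesis
    unfolding m_def \<tau>_def by (simp only: sum_divide_distrib[symmetric] sum_subtractf sum_distrib_left)
qed

text \<open>The matrix element of 1 (x) \<open>G\<close> in the vector \<open>\<phi>\<close>; its
  squared modulus is what a Kraus operator \<open>G\<close> contributes to the fidelity.\<close>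

definition amp :: "'r set \<Rightarrow> 's set \<Rightarrow> ('s \<Rightarrow> 's \<Rightarrow> complex) \<Rightarrow> ('r \<times> 's \<Rightarrow> complex) \<Rightarrow> complex" where
  "amp R S G \<phi> = (\<Sum>r\<in>R. ip S (\<lambda>s. \<phi> (r, s)) (mv S G (\<lambda>s. \<phi> (r, s))))"

text \<open>A Kraus operator of decoder after channel after encoder: \<open>e\<close> labels the
  environment and \<open>h\<close> the Kraus operators of the decoder, carried as a second output
  component of \<open>V\<close>.\<close>

definition code_op ::
  "'a set \<Rightarrow> 'b set \<Rightarrow> ('s \<times> 'h \<Rightarrow> 'b \<Rightarrow> complex) \<Rightarrow> ('e \<Rightarrow> 'b \<Rightarrow> 'a \<Rightarrow> complex) \<Rightarrow>
   ('a \<Rightarrow> 's \<Rightarrow> complex) \<Rightarrow> 'e \<Rightarrow> 'h \<Rightarrow> 's \<Rightarrow> 's \<Rightarrow> complex" where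
  "code_op A B V k U e h s s' = (\<Sum>b\<in>B. V (s, h) b * (\<Sum>a\<in>A. k e b a * U a s'))"

lemma ex_le_average:
  fixes F :: "nat \<Rightarrow> real"
  assumes "(\<Sum>t<N. F t) \<le> real N * x" "N > 0"
  shows "\<exists>t<N. F t \<le> x"
proof (rule ccontr)
  assume "\<not> ?thesis"
  then have "x < F t" if "t < N" for t using that not_le by metis
  then have "(\<Sum>t<N. x) < (\<Sum>t<N. F t)" using assms(2) by (intro sum_strict_mono) auto
  then show False using assms(1) by simp
qed

text \<open>All losses are added over \<open>T\<close> and averaged together, so one choice of
  phases serves every \<open>T\<close>. Replacing \<open>C t\<close> by a contraction costs
  \<open>sqrt (m * D t)\<close>; bounding this by \<open>(x * D t + m / x) / 2\<close> makes it
  linear in \<open>D t\<close>, hence open to averaging, with \<open>x\<close> left free for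
  tuning.\<close>

lemma averaged_code:
  fixes E :: "'t \<Rightarrow> 'e set" and B :: "'t \<Rightarrow> 'b set" and k :: "'t \<Rightarrow> 'e \<Rightarrow> 'b \<Rightarrow> 'a \<Rightarrow> complex"
    and S :: "'s set"
  assumes finT: "finite \<T>" and c: "\<And>T. T \<in> \<T> \<Longrightarrow> coding A (B T) (E T) (k T) p (w T) (q T)"
    and nT: "\<T> \<noteq> {}"
    and sub: "A0 \<subseteq> A" "\<And>T. T \<in> \<T> \<Longrightarrow> B0 T \<subseteq> B T" "\<And>T. T \<in> \<T> \<Longrightarrow> E0 T \<subseteq> E T"
    and finS: "finite S" and S0: "S \<noteq> {}"
    and al0: "0 \<le> al" and al: "\<And>a. a \<in> A0 \<Longrightarrow> p a \<le> al"
    and be: "\<And>T. T \<in> \<T> \<Longrightarrow> 0 < be T" "\<And>T e. T \<in> \<T> \<Longrightarrow> e \<in> E0 T \<Longrightarrow> be T \<le> w T e"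
    and ga: "\<And>T. T \<in> \<T> \<Longrightarrow> 0 \<le> ga T" "\<And>T b. T \<in> \<T> \<Longrightarrow> b \<in> B0 T \<Longrightarrow> q T b \<le> ga T"
    and mu: "sum p (A - A0) \<le> \<mu>" "\<And>T. T \<in> \<T> \<Longrightarrow> sum (w T) (E T - E0 T) \<le> \<mu>"
      "\<And>T. T \<in> \<T> \<Longrightarrow> sum (q T) (B T - B0 T) \<le> \<mu>"
    and x0: "0 < x"
    and m: "m = real (card S)"
    and \<kappa>: "\<kappa> = (\<Sum>T\<in>\<T>. 3 * \<mu> + m * ga T / (2 * be T)) + real (card \<T>) * (x * (\<mu> + m * al) + 1 / x) / 2"
  obtains U V where "contr A0 S U" "\<And>T. T \<in> \<T> \<Longrightarrow> contr (S \<times> E0 T) (B0 T) (V T)"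
    "(\<Sum>T\<in>\<T>. m - Re (\<Sum>s\<in>S. \<Sum>e\<in>E0 T. \<Sum>b\<in>B0 T.
        of_real (sqrt (w T e)) * V T (s, e) b * (\<Sum>a\<in>A0. k T e b a * U a s))) \<le> m * \<kappa>"
proof -
  obtain T0 where T0: "T0 \<in> \<T>" using nT by blast
  note finA = codingD(1)[OF c[OF T0]]
  have p0: "0 \<le> p a" if "a \<in> A" for a using codingD(4)[OF c[OF T0] that] .
  have p1: "sum p A = 1" using codingD(5)[OF c[OF T0]] .
  have finA0: "finite A0" using finA sub finite_subset by blast
  have fin0: "finite (B0 T)" "finite (E0 T)" if "T \<in> \<T>" for T
    using codingD(2,3)[OF c[OF that]] sub(2,3)[OF that] finite_subset by blast+
  have w0: "0 < w T e" if "T \<in> \<T>" "e \<in> E0 T" for T e using be(1)[OF that(1)] be(2)[OF that] by linarith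
  have m0: "m > 0" using finS S0 m by (simp add: card_gt_0_iff)
  obtain N and \<theta> :: "nat \<Rightarrow> 's \<times> 'a \<Rightarrow> complex" where ph: "phases (S \<times> A0) N \<theta>"
    using phases_exist[OF finite_cartesian_product[OF finS finA0]] by blast
  note N = phasesD(1)[OF ph]
  define C where "C t a s = of_real (sqrt (p a)) * \<theta> t (s, a)" for t a s
  define n where "n T t e b s = (\<Sum>a\<in>A0. k T e b a * C t a s)" for T t e b s
  define L where "L T t = (3 * (\<Sum>s\<in>S. \<Sum>e\<in>E0 T. \<Sum>b\<in>B0 T. (cmod (n T t e b s))^2)
        - (\<Sum>s\<in>S. \<Sum>s'\<in>S. \<Sum>e\<in>E0 T. \<Sum>e'\<in>E0 T. 1 / w T e' *
            (cmod (\<Sum>b\<in>B0 T. cnj (n T t e' b s') * n T t e b s))^2)) / 2" for T t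
  define D where "D t = real (card S) - 2 * (\<Sum>s\<in>S. \<Sum>a\<in>A0. (cmod (C t a s))^2)
      + (\<Sum>s\<in>S. \<Sum>s'\<in>S. (cmod (\<Sum>a\<in>A0. cnj (C t a s') * C t a s))^2)" for t
  define F where "F t = (\<Sum>T\<in>\<T>. m - L T t) + real (card \<T>) * (x * D t + m / x) / 2" for t
  have split: "sum p A = sum p (A - A0) + sum p A0" by (rule sum.subset_diff[OF sub(1) finA])
  have pA0: "0 \<le> sum p A0" "sum p A0 \<le> 1"
    using p0 sub(1) p1 split sum_nonneg[of "A - A0" p] by (auto intro!: sum_nonneg)
  have "(\<Sum>t<N. D t) \<le> real N * real (card S) * ((1 - sum p A0)^2 + real (card S) * al)"
    unfolding D_def
    by (rule average_encoder[OF finA0 finS _ al al0 pA0(2) ph C_def]) (use p0 sub(1) in auto)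
  also have "\<dots> \<le> real N * m * (\<mu> + m * al)"
  proof -
    have "(1 - sum p A0)^2 \<le> 1 - sum p A0"
      using pA0 by (simp add: power2_eq_square mult_left_le)
    also have "\<dots> \<le> \<mu>" using split p1 mu(1) by simp
    finally show ?thesis unfolding m by (intro mult_left_mono add_mono) auto
  qed
  finally have sumD: "(\<Sum>t<N. D t) \<le> real N * (m * (\<mu> + m * al))" by simp
  have sumL: "real N * (m * (1 - 3 * \<mu> - m * ga T / (2 * be T))) \<le> (\<Sum>t<N. L T t)" (is "?lhs \<le> _") if T: "T \<in> \<T>" for T
  proof -
    define \<tau> where "\<tau> = (\<Sum>e\<in>E0 T. \<Sum>b\<in>B0 T. \<Sum>a\<in>A0. p a * (cmod (k T e b a))^2)"
    have 1: "1 - 3 * \<mu> \<le> \<tau>"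
      using coding_truncated_mass[OF c[OF T] sub(1) sub(2,3)[OF T]] mu(1) mu(2,3)[OF T]
      unfolding \<tau>_def by linarith
    have "?lhs \<le> real N * (m * (\<tau> - m * ga T / (2 * be T)))"
      using 1 m0 by (intro mult_left_mono) auto
    also have "\<dots> = real N * m * (\<tau> - m * ga T / (2 * be T))" by simp
    also have "\<dots> \<le> (\<Sum>t<N. L T t)"
      unfolding L_def \<tau>_def m
      by (rule average_decoder[OF c[OF T] sub(1) sub(2,3)[OF T] finS be(1)[OF T] be(2)[OF T] ga(1)[OF T] ga(2)[OF T] ph C_def n_def])
    finally show ?thesis .
  qed
  have "(\<Sum>t<N. F t) = (\<Sum>T\<in>\<T>. \<Sum>t<N. m - L T t) + real (card \<T>) * (x * (\<Sum>t<N. D t) + real N * (m / x)) / 2"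
    unfolding F_def sum.distrib sum_divide_distrib[symmetric] sum_distrib_left[symmetric]
    by (subst sum.swap) simp
  also have "\<dots> \<le> (\<Sum>T\<in>\<T>. real N * (m * (3 * \<mu> + m * ga T / (2 * be T))))
      + real (card \<T>) * (x * (real N * (m * (\<mu> + m * al))) + real N * (m / x)) / 2"
  proof (intro add_mono sum_mono divide_right_mono mult_left_mono)
    fix T assume T: "T \<in> \<T>"
    show "(\<Sum>t<N. m - L T t) \<le> real N * (m * (3 * \<mu> + m * ga T / (2 * be T)))"
      using sumL[OF T] by (simp add: sum_subtractf algebra_simps)
  qed (use sumD x0 in auto)
  also have "\<dots> = real N * (m * \<kappa>)"
    unfolding \<kappa> sum_distrib_left[symmetric] by (simp add: algebra_simps add_divide_distrib)
  finally have "(\<Sum>t<N. F t) \<le> real N * (m * \<kappa>)" .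
  from ex_le_average[OF this N] obtain t where t: "F t \<le> m * \<kappa>" by blast
  obtain U where U: "contr A0 S U" "(\<Sum>s\<in>S. \<Sum>a\<in>A0. (cmod (C t a s - U a s))^2) \<le> D t"
    using encoder_polar[OF finS finA0, of "C t"] unfolding D_def by blast
  have "\<forall>T\<in>\<T>. \<exists>V. contr (S \<times> E0 T) (B0 T) V \<and>
     L T t \<le> Re (\<Sum>s\<in>S. \<Sum>e\<in>E0 T. \<Sum>b\<in>B0 T. of_real (sqrt (w T e)) * V (s, e) b * n T t e b s)"
  proof
    fix T assume T: "T \<in> \<T>"
    show "\<exists>V. contr (S \<times> E0 T) (B0 T) V \<and>
     L T t \<le> Re (\<Sum>s\<in>S. \<Sum>e\<in>E0 T. \<Sum>b\<in>B0 T. of_real (sqrt (w T e)) * V (s, e) b * n T t e b s)"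
      using decoder_polar[where n = "n T t" and w = "w T", OF finS fin0(2)[OF T] fin0(1)[OF T] w0[OF T]]
      unfolding L_def by blast
  qed
  from bchoice[OF this] obtain V where V: "\<And>T. T \<in> \<T> \<Longrightarrow> contr (S \<times> E0 T) (B0 T) (V T)"
    "\<And>T. T \<in> \<T> \<Longrightarrow> L T t \<le> Re (\<Sum>s\<in>S. \<Sum>e\<in>E0 T. \<Sum>b\<in>B0 T. of_real (sqrt (w T e)) * V T (s, e) b * n T t e b s)"
    by blast
  let ?F = "\<lambda>T. \<Sum>s\<in>S. \<Sum>e\<in>E0 T. \<Sum>b\<in>B0 T. of_real (sqrt (w T e)) * V T (s, e) b * (\<Sum>a\<in>A0. k T e b a * U a s)"
  have "(\<Sum>T\<in>\<T>. m - Re (?F T))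
      \<le> (\<Sum>T\<in>\<T>. (m - L T t) + (x * D t + m / x) / 2)"
  proof (rule sum_mono)
    fix T assume T: "T \<in> \<T>"
    define R where "R W = (\<Sum>s\<in>S. \<Sum>e\<in>E0 T. \<Sum>b\<in>B0 T.
        of_real (sqrt (w T e)) * V T (s, e) b * (\<Sum>a\<in>A0. k T e b a * W a s))" for W
    have "R (\<lambda>a s. C t a s - U a s) = R (C t) - R U"
      unfolding R_def by (simp add: algebra_simps sum_subtractf)
    moreover have "(cmod (R (\<lambda>a s. C t a s - U a s)))^2 \<le> m * D t" (is "?lhs2 \<le> _")
    proof -
      have "?lhs2 \<le> m * (\<Sum>s\<in>S. \<Sum>a\<in>A0. (cmod (C t a s - U a s))^2)"
        unfolding R_def m by (rule trace_pairing_bound[OF c[OF T] sub(1) sub(2,3)[OF T] V(1)[OF T] finS])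
      also have "\<dots> \<le> m * D t" using U(2) m0 by (intro mult_left_mono) auto
      finally show ?thesis .
    qed
    ultimately have 1: "(cmod (R (C t) - R U))^2 \<le> m * D t" by simp
    have "m * D t \<le> ((x * D t + m / x) / 2)^2"
    proof -
      have "0 \<le> (x * D t - m / x)^2" by simp
      then show ?thesis using x0 by (simp add: power2_eq_square field_simps)
    qed
    with 1 have "(cmod (R (C t) - R U))^2 \<le> ((x * D t + m / x) / 2)^2" by linarith
    moreover have "0 \<le> D t"
      by (rule order_trans[OF sum_nonneg[OF sum_nonneg] U(2)]) auto
    then have "0 \<le> (x * D t + m / x) / 2"
      by (intro divide_nonneg_nonneg add_nonneg_nonneg mult_nonneg_nonneg) (use x0 m0 in linarith)+
    ultimately have "cmod (R (C t) - R U) \<le> (x * D t + m / x) / 2"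
      by (rule power2_le_imp_le)
    then have "Re (R (C t)) - Re (R U) \<le> (x * D t + m / x) / 2"
      using complex_Re_le_cmod[of "R (C t) - R U"] by simp
    moreover have "L T t \<le> Re (R (C t))" using V(2)[OF T] unfolding R_def n_def .
    ultimately show "m - Re (?F T)
      \<le> (m - L T t) + (x * D t + m / x) / 2" unfolding R_def by linarith
  qed
  also have "\<dots> = F t" by (simp add: F_def sum.distrib)
  finally show ?thesis using that[OF U(1) V(1)] t by linarith
qed

section \<open>From average to worst-case fidelity\<close>

text \<open>Markov's inequality for eigenvalues. \<open>Y\<close> sums over \<open>T\<close> the
  identity minus the Hermitian part of \<open>Q T\<close>; it is positive with trace at most
  \<open>2 * m * \<kappa>\<close>, so at least \<open>m\<close> eigenvalues are at most
  \<open>2 * \<kappa>\<close>. On the span of their eigenvectors the bound holds for all vectors,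
  and each \<open>T\<close> is dominated by the sum.\<close>

lemma expurgation:
  fixes Q :: "'t \<Rightarrow> 's \<Rightarrow> 's \<Rightarrow> complex"
  assumes finT: "finite \<T>" and finS: "finite S" and card: "card S = 2 * m" and m0: "m > 0"
    and bnd: "\<And>T v. T \<in> \<T> \<Longrightarrow> Re (ip S v (mv S (Q T) v)) \<le> nsq S v"
    and tr: "(\<Sum>T\<in>\<T>. real (card S) - Re (\<Sum>s\<in>S. Q T s s)) \<le> real (card S) * \<kappa>"
  obtains u where "orthon {..<m} S u"
    "\<And>T y v. T \<in> \<T> \<Longrightarrow> v = (\<lambda>s. \<Sum>r<m. y r * u r s) \<Longrightarrow>
      (1 - 2 * \<kappa>) * nsq S v \<le> Re (ip S v (mv S (Q T) v))"
proof -
  define Y where "Y i j = (\<Sum>T\<in>\<T>. (if i = j then 1 else 0) - (Q T i j + cnj (Q T j i)) / 2)" for i j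
  let ?F = "\<lambda>v. \<Sum>T\<in>\<T>. nsq S v - Re (ip S v (mv S (Q T) v))"
  have form: "ip S v (mv S Y v) = complex_of_real (?F v)" for v
  proof -
    have id: "mv S (\<lambda>i j. if i = j then 1 else 0) v i = v i" (is "?lhs = _") if "i \<in> S" for i
    proof -
      have "?lhs = (\<Sum>j\<in>S. if i = j then v j else 0)"
        unfolding mv_def by (intro sum.cong refl) auto
      then show ?thesis using finS that by simp
    qed
    have "mv S Y v i = (\<Sum>T\<in>\<T>. mv S (\<lambda>i j. if i = j then 1 else 0) v i
        - (mv S (Q T) v i + mv S (\<lambda>i j. cnj (Q T j i)) v i) / 2)" for i
      unfolding mv_def Y_def sum_distrib_right
      by (subst sum.swap) (simp add: algebra_simps sum.distrib sum_subtractf add_divide_distrib sum_divide_distrib)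
    then have "ip S v (mv S Y v) = ip S v (\<lambda>i. \<Sum>T\<in>\<T>. v i
        - (1/2) * (mv S (Q T) v i + mv S (\<lambda>i j. cnj (Q T j i)) v i))"
      by (intro ip_cong) (simp_all add: id)
    also have "\<dots> = (\<Sum>T\<in>\<T>. ip S v v - (1/2) * (ip S v (mv S (Q T) v) + ip S v (mv S (\<lambda>i j. cnj (Q T j i)) v)))"
      unfolding ip_sum_right ip_diff_right ip_scale_right ip_add_right ..
    also have "\<dots> = (\<Sum>T\<in>\<T>. complex_of_real (nsq S v - Re (ip S v (mv S (Q T) v))))"
    proof (intro sum.cong refl)
      fix T
      have "ip S v (mv S (\<lambda>i j. cnj (Q T j i)) v) = ip S (mv S (Q T) v) v"
        unfolding ip_mv_adjoint by simp
      also have "\<dots> = cnj (ip S v (mv S (Q T) v))" by (rule ip_commute)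
      finally show "ip S v v - (1/2) * (ip S v (mv S (Q T) v) + ip S v (mv S (\<lambda>i j. cnj (Q T j i)) v))
          = complex_of_real (nsq S v - Re (ip S v (mv S (Q T) v)))"
        by (simp add: ip_self complex_add_cnj)
    qed
    finally show ?thesis by simp
  qed
  have nonneg: "0 \<le> nsq S v - Re (ip S v (mv S (Q T) v))" if "T \<in> \<T>" for T v
    using bnd[OF that, of v] by simp
  have "psd S Y"
    unfolding psd_def form nonneg_Reals_of_real_iff by (auto intro!: sum_nonneg nonneg)
  then obtain e d where s: "spec S Y S e d" and d0: "\<And>k. k \<in> S \<Longrightarrow> 0 \<le> d k"
    using psd_spectral[OF finS] by blast
  have "complex_of_real (\<Sum>k\<in>S. d k) = (\<Sum>i\<in>S. Y i i)" by (rule spec_trace[OF s finS, symmetric])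
  also have "\<dots> = (\<Sum>T\<in>\<T>. \<Sum>i\<in>S. 1 - (Q T i i + cnj (Q T i i)) / 2)"
    unfolding Y_def by (subst sum.swap) simp
  also have "\<dots> = complex_of_real (\<Sum>T\<in>\<T>. real (card S) - Re (\<Sum>s\<in>S. Q T s s))"
    by (simp add: complex_add_cnj sum_subtractf)
  finally have sumd: "(\<Sum>k\<in>S. d k) \<le> real (card S) * \<kappa>" using tr by (simp only: of_real_eq_iff)
  have k0: "0 \<le> \<kappa>"
  proof -
    have "0 \<le> (\<Sum>k\<in>S. d k)" by (intro sum_nonneg d0)
    then have "0 \<le> real (card S) * \<kappa>" using sumd by linarith
    then show ?thesis using card m0 by (simp add: zero_le_mult_iff)
  qed
  define G where "G = {k\<in>S. d k \<le> 2 * \<kappa>}"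
  have finG: "finite G" "G \<subseteq> S" using finS by (auto simp: G_def)
  have "m \<le> card G"
  proof (rule ccontr)
    assume "\<not> m \<le> card G"
    moreover have "card (S - G) = card S - card G" using finG finS by (intro card_Diff_subset) auto
    ultimately have lt: "m < card (S - G)" using card by simp
    then have ne: "S - G \<noteq> {}" by (metis card.empty not_less_zero)
    have "real (card S) * \<kappa> = real m * (2 * \<kappa>)" using card by simp
    also have "\<dots> \<le> real (card (S - G)) * (2 * \<kappa>)" using lt k0 by (intro mult_right_mono) auto
    also have "\<dots> = (\<Sum>k\<in>S - G. 2 * \<kappa>)" by simp
    also have "\<dots> < (\<Sum>k\<in>S - G. d k)"
      using finS ne by (intro sum_strict_mono) (auto simp: G_def)
    also have "\<dots> \<le> (\<Sum>k\<in>S. d k)" using finS d0 by (intro sum_mono2) auto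
    finally show False using sumd by simp
  qed
  then obtain H where H: "H \<subseteq> G" "card H = m" "finite H"
    using obtain_subset_with_card_n by metis
  obtain \<iota> where \<iota>: "bij_betw \<iota> {0..<m} H"
    using ex_bij_betw_nat_finite[OF H(3)] H(2) by blast
  define u where "u r = e (\<iota> r)" for r
  have \<iota>G: "\<iota> r \<in> G" "\<iota> r \<in> S" if "r < m" for r
  proof -
    have "\<iota> r \<in> H" using \<iota> that by (auto simp: bij_betw_def)
    then show "\<iota> r \<in> G" "\<iota> r \<in> S" using H(1) finG(2) by auto
  qed
  have \<iota>inj: "\<iota> r = \<iota> r' \<longleftrightarrow> r = r'" if "r < m" "r' < m" for r r'
    using \<iota> that by (auto simp: bij_betw_def inj_on_def)
  have "orthon {..<m} S u"
    using specD(2)[OF s] \<iota>G(2) \<iota>inj unfolding orthon_def u_def by simp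
  moreover have "(1 - 2 * \<kappa>) * nsq S v \<le> Re (ip S v (mv S (Q T) v))"
    if T: "T \<in> \<T>" and v: "v = (\<lambda>s. \<Sum>r<m. y r * u r s)" for T y v
  proof -
    have z: "ip S (e k) v = 0" if k: "k \<in> S" "k \<notin> G" for k
    proof -
      have "ip S (e k) v = (\<Sum>r<m. y r * ip S (e k) (u r))"
        unfolding v ip_sum_right ip_scale_right ..
      also have "\<dots> = 0"
      proof (intro sum.neutral ballI)
        fix r assume r: "r \<in> {..<m}"
        then have "\<iota> r \<in> G" "\<iota> r \<in> S" using \<iota>G by auto
        then show "y r * ip S (e k) (u r) = 0"
          using orthonD[OF specD(2)[OF s] k(1), of "\<iota> r"] k(2) by (auto simp: u_def)
      qed
      finally show ?thesis .
    qed
    have "nsq S v - Re (ip S v (mv S (Q T) v)) \<le> ?F v"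
      by (rule member_le_sum[OF T _ finT]) (use nonneg in auto)
    also have "complex_of_real \<dots> = complex_of_real (\<Sum>k\<in>S. d k * (cmod (ip S (e k) v))^2)"
      unfolding form[symmetric] by (rule spec_form[OF s])
    then have "?F v = (\<Sum>k\<in>S. d k * (cmod (ip S (e k) v))^2)"
      by (simp only: of_real_eq_iff)
    also have "(\<Sum>k\<in>S. d k * (cmod (ip S (e k) v))^2) \<le> (\<Sum>k\<in>S. 2 * \<kappa> * (cmod (ip S (e k) v))^2)"
    proof (rule sum_mono)
      fix k assume k: "k \<in> S"
      show "d k * (cmod (ip S (e k) v))^2 \<le> 2 * \<kappa> * (cmod (ip S (e k) v))^2"
      proof (cases "k \<in> G")
        case True
        then show ?thesis by (intro mult_right_mono) (auto simp: G_def)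
      qed (simp add: z k)
    qed
    also have "\<dots> = 2 * \<kappa> * nsq S v"
      unfolding sum_distrib_left[symmetric] parseval[OF finS finS specD(2)[OF s] refl] ..
    finally show ?thesis by (simp add: algebra_simps)
  qed
  ultimately show ?thesis using that by blast
qed

lemma mv_code_op:
  "mv S (code_op A B V k U e h) v s = (\<Sum>b\<in>B. V (s, h) b * (\<Sum>a\<in>A. k e b a * mv S U v a))"
proof -
  have "mv S (code_op A B V k U e h) v s = (\<Sum>s'\<in>S. \<Sum>b\<in>B. \<Sum>a\<in>A. V (s, h) b * (k e b a * (U a s' * v s')))"
    unfolding mv_def code_op_def sum_distrib_left sum_distrib_right
    by (intro sum.cong refl) (simp add: mult.assoc)
  also have "\<dots> = (\<Sum>b\<in>B. \<Sum>a\<in>A. \<Sum>s'\<in>S. V (s, h) b * (k e b a * (U a s' * v s')))"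
    by (subst sum.swap, intro sum.cong refl, rule sum.swap)
  finally show ?thesis unfolding mv_def sum_distrib_left .
qed

lemma weighted_cauchy_schwarz:
  assumes "\<And>e. e \<in> E \<Longrightarrow> 0 \<le> w e" "sum w E \<le> 1"
  shows "(cmod (\<Sum>e\<in>E. of_real (sqrt (w e)) * z e))^2 \<le> (\<Sum>e\<in>E. (cmod (z e))^2)" (is "?lhs \<le> _")
proof -
  have n: "nsq E (\<lambda>e. of_real (sqrt (w e))) \<le> 1"
    unfolding nsq_def using assms by simp
  have "?lhs
      = (cmod (ip E (\<lambda>e. of_real (sqrt (w e))) z))^2" by (simp add: ip_def)
  also have "\<dots> \<le> nsq E (\<lambda>e. of_real (sqrt (w e))) * nsq E z" by (rule cauchy_schwarz_ip)
  also have "\<dots> \<le> 1 * nsq E z" using n by (intro mult_right_mono) auto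
  finally show ?thesis by (simp add: nsq_def)
qed

lemma code_op_total:
  assumes k: "contr (E \<times> B) A (\<lambda>(e, b) a. k e b a)" and V: "contr (S \<times> H) B V" and U: "contr A S U"
    and fin: "finite E" "finite B" "finite A" "finite S" "finite H"
  shows "(\<Sum>e\<in>E. \<Sum>h\<in>H. nsq S (mv S (code_op A B V k U e h) v)) \<le> nsq S v" (is "?lhs \<le> _")
proof -
  define y where "y e b = (\<Sum>a\<in>A. k e b a * mv S U v a)" for e b
  have "(\<Sum>h\<in>H. nsq S (mv S (code_op A B V k U e h) v)) \<le> nsq B (y e)" (is "?lhs2 \<le> _") for e
  proof -
    have "?lhs2 = (\<Sum>h\<in>H. \<Sum>s\<in>S. (cmod (mv B V (y e) (s, h)))^2)"
      unfolding nsq_def mv_code_op y_def by (simp add: mv_def)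
    also have "\<dots> = nsq (S \<times> H) (mv B V (y e))"
      unfolding nsq_def sum_Times by (rule sum.swap)
    also have "\<dots> \<le> nsq B (y e)" by (rule contrD[OF V])
    finally show ?thesis .
  qed
  then have "?lhs \<le> (\<Sum>e\<in>E. nsq B (y e))"
    by (intro sum_mono)
  also have "\<dots> = nsq (E \<times> B) (mv A (\<lambda>(e, b) a. k e b a) (mv S U v))"
    by (simp add: nsq_def sum_Times y_def mv_def)
  also have "\<dots> \<le> nsq A (mv S U v)" by (rule contrD[OF k])
  also have "\<dots> \<le> nsq S v" by (rule contrD[OF U])
  finally show ?thesis .
qed

text \<open>Supplies the positivity that \<open>expurgation\<close> requires. \<open>Q\<close> keeps
  the Kraus operators whose side label equals the environment label, weighted by
  \<open>sqrt (w e)\<close>; Cauchy-Schwarz, used twice, bounds it by the total weight of all Kraus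
  operators of the code.\<close>

lemma matched_code_op_contraction:
  assumes c: "coding A B E k p w q" and sub: "A0 \<subseteq> A" "B0 \<subseteq> B" "E0 \<subseteq> E"
    and V: "contr (S \<times> E0) B0 V" and U: "contr A0 S U" and finS: "finite S"
    and Q: "Q = (\<lambda>s s'. \<Sum>e\<in>E0. of_real (sqrt (w e)) * code_op A0 B0 V k U e e s s')"
  shows "Re (ip S v (mv S Q v)) \<le> nsq S v"
proof -
  note finc = codingD(1-3)[OF c]
  have fin0: "finite A0" "finite B0" "finite E0" using sub finc finite_subset by blast+
  have kc: "contr (E0 \<times> B0) A0 (\<lambda>(e, b) a. k e b a)"
    by (rule contr_subset[OF coding_contr[OF c]]) (use sub finc in auto)
  have w0: "0 \<le> w e" if "e \<in> E0" for e using coding_nonneg(1)[OF c] sub that by blast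
  have "sum w E0 \<le> sum w E" using sub finc coding_nonneg(1)[OF c] by (intro sum_mono2) auto
  then have w1: "sum w E0 \<le> 1" using coding_nonneg(3)[OF c] by simp
  let ?P = "\<lambda>e h. code_op A0 B0 V k U e h"
  have mvQ: "mv S Q v = (\<lambda>s. \<Sum>e\<in>E0. of_real (sqrt (w e)) * mv S (?P e e) v s)"
  proof (rule ext)
    fix s
    show "mv S Q v s = (\<Sum>e\<in>E0. of_real (sqrt (w e)) * mv S (?P e e) v s)"
      unfolding Q mv_def sum_distrib_left sum_distrib_right
      by (subst sum.swap) (simp add: mult.assoc)
  qed
  have "ip S v (mv S Q v) = (\<Sum>e\<in>E0. of_real (sqrt (w e)) * ip S v (mv S (?P e e) v))"
    unfolding mvQ ip_sum_right ip_scale_right ..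
  then have "(cmod (ip S v (mv S Q v)))^2 \<le> (\<Sum>e\<in>E0. (cmod (ip S v (mv S (?P e e) v)))^2)"
    using weighted_cauchy_schwarz[OF w0 w1] by simp
  also have "\<dots> \<le> (\<Sum>e\<in>E0. nsq S v * nsq S (mv S (?P e e) v))"
    by (intro sum_mono cauchy_schwarz_ip)
  also have "\<dots> \<le> (\<Sum>e\<in>E0. nsq S v * (\<Sum>h\<in>E0. nsq S (mv S (?P e h) v)))"
    using fin0 by (intro sum_mono mult_left_mono member_le_sum) auto
  also have "\<dots> = nsq S v * (\<Sum>e\<in>E0. \<Sum>h\<in>E0. nsq S (mv S (?P e h) v))"
    by (simp only: sum_distrib_left)
  also have "\<dots> \<le> nsq S v * nsq S v"
    using code_op_total[OF kc V U fin0(3,2,1) finS fin0(3)] by (intro mult_left_mono) auto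
  finally have "(cmod (ip S v (mv S Q v)))^2 \<le> (nsq S v)^2" by (simp add: power2_eq_square)
  then have "cmod (ip S v (mv S Q v)) \<le> nsq S v" by (rule power2_le_imp_le) simp
  then show ?thesis using complex_Re_le_cmod order_trans by blast
qed

text \<open>The average code is built on \<open>2 * m\<close> dimensions because expurgation halves
  them. A state entangled with \<open>R\<close> is treated as one vector of the good subspace per
  label of \<open>R\<close>. \<open>(1 - 2 * \<kappa>)^2 \<ge> 1 - 4 * \<kappa>\<close> passes to
  squares, and the weighted amplitude is controlled by the terms with \<open>e = h\<close>, a part
  of the full sum.\<close>

theorem one_shot_code:
  fixes E :: "'t \<Rightarrow> 'e set" and B :: "'t \<Rightarrow> 'b set" and k :: "'t \<Rightarrow> 'e \<Rightarrow> 'b \<Rightarrow> 'a \<Rightarrow> complex"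
  assumes finT: "finite \<T>" and c: "\<And>T. T \<in> \<T> \<Longrightarrow> coding A (B T) (E T) (k T) p (w T) (q T)"
    and nT: "\<T> \<noteq> {}"
    and sub: "A0 \<subseteq> A" "\<And>T. T \<in> \<T> \<Longrightarrow> B0 T \<subseteq> B T" "\<And>T. T \<in> \<T> \<Longrightarrow> E0 T \<subseteq> E T"
    and m0: "m > 0"
    and al0: "0 \<le> al" and al: "\<And>a. a \<in> A0 \<Longrightarrow> p a \<le> al"
    and be: "\<And>T. T \<in> \<T> \<Longrightarrow> 0 < be T" "\<And>T e. T \<in> \<T> \<Longrightarrow> e \<in> E0 T \<Longrightarrow> be T \<le> w T e"
    and ga: "\<And>T. T \<in> \<T> \<Longrightarrow> 0 \<le> ga T" "\<And>T b. T \<in> \<T> \<Longrightarrow> b \<in> B0 T \<Longrightarrow> q T b \<le> ga T"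
    and mu: "sum p (A - A0) \<le> \<mu>" "\<And>T. T \<in> \<T> \<Longrightarrow> sum (w T) (E T - E0 T) \<le> \<mu>"
      "\<And>T. T \<in> \<T> \<Longrightarrow> sum (q T) (B T - B0 T) \<le> \<mu>"
    and x0: "0 < x"
    and \<kappa>: "\<kappa> = (\<Sum>T\<in>\<T>. 3 * \<mu> + real m * ga T / be T)
      + real (card \<T>) * (x * (\<mu> + 2 * real m * al) + 1 / x) / 2"
  obtains U V where "contr A {..<m} U" "\<And>T. T \<in> \<T> \<Longrightarrow> contr ({..<m} \<times> E T) (B T) (V T)"
    "\<And>(R :: 'r set) \<phi> T. finite R \<Longrightarrow> T \<in> \<T> \<Longrightarrow> nsq (R \<times> {..<m}) \<phi> = 1 \<Longrightarrow>
      1 - 4 * \<kappa> \<le> (\<Sum>e\<in>E T. \<Sum>h\<in>E T. (cmod (amp R {..<m} (code_op A (B T) (V T) (k T) U e h) \<phi>))^2)"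
proof -
  define S where "S = {..<2 * m}"
  have finS: "finite S" and cardS: "card S = 2 * m" by (auto simp: S_def)
  have "0 \<in> S" using m0 by (simp add: S_def)
  then have S0: "S \<noteq> {}" by blast
  obtain T0 where T0: "T0 \<in> \<T>" using nT by blast
  note finA = codingD(1)[OF c[OF T0]]
  have finA0: "finite A0" using finA sub finite_subset by blast
  note fin = codingD(2,3)[OF c]
  have fin0: "finite (B0 T)" "finite (E0 T)" if "T \<in> \<T>" for T
    using codingD(2,3)[OF c[OF that]] sub(2,3)[OF that] finite_subset by blast+
  have \<kappa>': "\<kappa> = (\<Sum>T\<in>\<T>. 3 * \<mu> + real (card S) * ga T / (2 * be T))
      + real (card \<T>) * (x * (\<mu> + real (card S) * al) + 1 / x) / 2"
    unfolding \<kappa> cardS by simp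
  obtain U V where U: "contr A0 S U" and V: "\<And>T. T \<in> \<T> \<Longrightarrow> contr (S \<times> E0 T) (B0 T) (V T)"
    and tr: "(\<Sum>T\<in>\<T>. real (card S) - Re (\<Sum>s\<in>S. \<Sum>e\<in>E0 T. \<Sum>b\<in>B0 T.
        of_real (sqrt (w T e)) * V T (s, e) b * (\<Sum>a\<in>A0. k T e b a * U a s))) \<le> real (card S) * \<kappa>"
    by (rule averaged_code[OF finT c nT sub finS S0 al0 al be ga mu x0 refl \<kappa>']) blast+
  let ?P = "\<lambda>T e h. code_op A0 (B0 T) (V T) (k T) U e h"
  define Q where "Q T = (\<lambda>s s'. \<Sum>e\<in>E0 T. of_real (sqrt (w T e)) * ?P T e e s s')" for T
  have bnd: "Re (ip S v (mv S (Q T) v)) \<le> nsq S v" if T: "T \<in> \<T>" for T v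
    by (rule matched_code_op_contraction[OF c[OF T] sub(1) sub(2,3)[OF T] V[OF T] U finS Q_def])
  have tr': "(\<Sum>T\<in>\<T>. real (card S) - Re (\<Sum>s\<in>S. Q T s s)) \<le> real (card S) * \<kappa>"
    using tr unfolding Q_def code_op_def by (simp add: sum_distrib_left mult.assoc)
  obtain u where u: "orthon {..<m} S u"
    and good: "\<And>T y v. T \<in> \<T> \<Longrightarrow> v = (\<lambda>s. \<Sum>r<m. y r * u r s) \<Longrightarrow>
      (1 - 2 * \<kappa>) * nsq S v \<le> Re (ip S v (mv S (Q T) v))"
    by (rule expurgation[OF finT finS cardS m0 bnd tr']) blast+
  \<comment> \<open>The good subspace receives the labels \<open>{..<m}\<close> on both sides:
    \<open>U1\<close> prepares its basis vectors and \<open>V1\<close> takes inner products with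
    them.\<close>
  define U1 where "U1 a r = (\<Sum>s\<in>S. U a s * u r s)" for a r
  have U1: "contr A0 {..<m} U1"
    unfolding U1_def by (rule contr_comp[OF U contr_orthon(2)[OF finite_lessThan u]])
  define U' where "U' a r = (if a \<in> A0 \<and> r \<in> {..<m} then U1 a r else 0)" for a r
  have U': "contr A {..<m} U'"
    unfolding U'_def by (rule contr_extend_zero[OF U1 sub(1)]) (use finA in auto)
  define V1 where "V1 T = (\<lambda>(r, h) b. \<Sum>s\<in>S. cnj (u r s) * V T (s, h) b)" for T
  have V1: "contr ({..<m} \<times> E0 T) (B0 T) (V1 T)" if T: "T \<in> \<T>" for T
    unfolding contr_def
  proof
    fix v
    have mv1: "mv (B0 T) (V1 T) v (r, h) = mv S (\<lambda>r s. cnj (u r s)) (\<lambda>s. mv (B0 T) (V T) v (s, h)) r" for r h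
      unfolding mv_def V1_def prod.case sum_distrib_left sum_distrib_right
      by (subst sum.swap) (simp add: mult.assoc)
    have "nsq ({..<m} \<times> E0 T) (mv (B0 T) (V1 T) v)
        = (\<Sum>h\<in>E0 T. nsq {..<m} (mv S (\<lambda>r s. cnj (u r s)) (\<lambda>s. mv (B0 T) (V T) v (s, h))))"
      unfolding nsq_def sum_Times mv1 by (rule sum.swap)
    also have "\<dots> \<le> (\<Sum>h\<in>E0 T. nsq S (\<lambda>s. mv (B0 T) (V T) v (s, h)))"
      by (intro sum_mono contrD[OF contr_orthon(1)[OF finite_lessThan u]])
    also have "\<dots> = nsq (S \<times> E0 T) (mv (B0 T) (V T) v)"
      unfolding nsq_def sum_Times by (rule sum.swap)
    also have "\<dots> \<le> nsq (B0 T) v" by (rule contrD[OF V[OF T]])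
    finally show "nsq ({..<m} \<times> E0 T) (mv (B0 T) (V1 T) v) \<le> nsq (B0 T) v" .
  qed
  define V' where "V' T i b = (if i \<in> {..<m} \<times> E0 T \<and> b \<in> B0 T then V1 T i b else 0)" for T i b
  have V': "contr ({..<m} \<times> E T) (B T) (V' T)" if T: "T \<in> \<T>" for T
    unfolding V'_def
    by (rule contr_extend_zero[OF V1[OF T]]) (use sub(2,3)[OF T] fin[OF T] in auto)
  have main: "1 - 4 * \<kappa> \<le> (\<Sum>e\<in>E T. \<Sum>h\<in>E T. (cmod (amp R {..<m} (code_op A (B T) (V' T) (k T) U' e h) \<phi>))^2)"
    if finR: "finite R" and T: "T \<in> \<T>" and \<phi>: "nsq (R \<times> {..<m}) \<phi> = 1" for R :: "'r set" and \<phi> T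
  proof -
    define v where "v r0 = (\<lambda>s. \<Sum>r<m. \<phi> (r0, r) * u r s)" for r0
    have nv: "(\<Sum>r0\<in>R. nsq S (v r0)) = 1"
    proof -
      have "nsq S (v r0) = (\<Sum>r<m. (cmod (\<phi> (r0, r)))^2)" for r0
        unfolding v_def by (rule nsq_orthon_comb[OF finite_lessThan u])
      then show ?thesis using \<phi> by (simp add: nsq_def[of "R \<times> _"] sum_Times)
    qed
    have mvU: "mv {..<m} U' (\<lambda>r. \<phi> (r0, r)) a = mv S U (v r0) a" (is "?lhs = _") if a: "a \<in> A0" for r0 a
    proof -
      have "?lhs = (\<Sum>r<m. \<Sum>s\<in>S. U a s * (\<phi> (r0, r) * u r s))"
        unfolding mv_def U'_def U1_def using a
        by (intro sum.cong refl) (simp add: sum_distrib_left sum_distrib_right ac_simps)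
      also have "\<dots> = (\<Sum>s\<in>S. \<Sum>r<m. U a s * (\<phi> (r0, r) * u r s))" by (rule sum.swap)
      finally show ?thesis by (simp add: mv_def v_def sum_distrib_left)
    qed
    have mvP: "mv {..<m} (code_op A (B T) (V' T) (k T) U' e e) (\<lambda>r. \<phi> (r0, r)) r
        = (\<Sum>s\<in>S. cnj (u r s) * mv S (?P T e e) (v r0) s)" (is "?lhs2 = _") if e: "e \<in> E0 T" and r: "r \<in> {..<m}" for e r0 r
    proof -
      have inner: "(\<Sum>a\<in>A. k T e b a * mv {..<m} U' (\<lambda>r. \<phi> (r0, r)) a)
          = (\<Sum>a\<in>A0. k T e b a * mv S U (v r0) a)" (is "?lhs3 = _") for b
      proof -
        have "mv {..<m} U' (\<lambda>r. \<phi> (r0, r)) a = 0" if "a \<notin> A0" for a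
          using that by (simp add: mv_def U'_def)
        then have "?lhs3
            = (\<Sum>a\<in>A0. k T e b a * mv {..<m} U' (\<lambda>r. \<phi> (r0, r)) a)"
          using finA sub(1) by (intro sum.mono_neutral_right) auto
        then show ?thesis by (simp add: mvU)
      qed
      have "?lhs2
          = (\<Sum>b\<in>B T. V' T (r, e) b * (\<Sum>a\<in>A0. k T e b a * mv S U (v r0) a))"
        unfolding mv_code_op inner ..
      also have "\<dots> = (\<Sum>b\<in>B0 T. V' T (r, e) b * (\<Sum>a\<in>A0. k T e b a * mv S U (v r0) a))"
        using fin(1)[OF T] sub(2)[OF T] by (intro sum.mono_neutral_right) (auto simp: V'_def)
      also have "\<dots> = (\<Sum>b\<in>B0 T. \<Sum>s\<in>S. cnj (u r s) * (V T (s, e) b * (\<Sum>a\<in>A0. k T e b a * mv S U (v r0) a)))"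
      proof (intro sum.cong refl)
        fix b assume "b \<in> B0 T"
        then have "V' T (r, e) b = (\<Sum>s\<in>S. cnj (u r s) * V T (s, e) b)"
          using e r by (simp add: V'_def V1_def)
        then show "V' T (r, e) b * (\<Sum>a\<in>A0. k T e b a * mv S U (v r0) a)
            = (\<Sum>s\<in>S. cnj (u r s) * (V T (s, e) b * (\<Sum>a\<in>A0. k T e b a * mv S U (v r0) a)))"
          by (simp only: sum_distrib_right mult.assoc)
      qed
      also have "\<dots> = (\<Sum>s\<in>S. \<Sum>b\<in>B0 T. cnj (u r s) * (V T (s, e) b * (\<Sum>a\<in>A0. k T e b a * mv S U (v r0) a)))"
        by (rule sum.swap)
      finally show ?thesis unfolding mv_code_op sum_distrib_left[symmetric] .
    qed
    have ampP: "amp R {..<m} (code_op A (B T) (V' T) (k T) U' e e) \<phi>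
        = (\<Sum>r0\<in>R. ip S (v r0) (mv S (?P T e e) (v r0)))" if e: "e \<in> E0 T" for e
      unfolding amp_def
    proof (intro sum.cong refl)
      fix r0
      have "ip {..<m} (\<lambda>r. \<phi> (r0, r)) (mv {..<m} (code_op A (B T) (V' T) (k T) U' e e) (\<lambda>r. \<phi> (r0, r)))
          = ip {..<m} (\<lambda>r. \<phi> (r0, r)) (\<lambda>r. \<Sum>s\<in>S. cnj (u r s) * mv S (?P T e e) (v r0) s)"
        by (intro ip_cong refl mvP[OF e])
      also have "\<dots> = (\<Sum>s\<in>S. \<Sum>r<m. cnj (\<phi> (r0, r) * u r s) * mv S (?P T e e) (v r0) s)"
        by (rule trans[rotated], rule sum.swap, simp add: ip_def sum_distrib_left mult.assoc)
      also have "\<dots> = ip S (v r0) (mv S (?P T e e) (v r0))"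
        unfolding ip_def by (subst (2) v_def) (simp add: sum_distrib_right)
      finally show "ip {..<m} (\<lambda>r. \<phi> (r0, r)) (mv {..<m} (code_op A (B T) (V' T) (k T) U' e e) (\<lambda>r. \<phi> (r0, r)))
          = ip S (v r0) (mv S (?P T e e) (v r0))" .
    qed
    have mvQ: "mv S (Q T) v = (\<lambda>s. \<Sum>e\<in>E0 T. of_real (sqrt (w T e)) * mv S (?P T e e) v s)" for v
    proof (rule ext)
      fix s
      show "mv S (Q T) v s = (\<Sum>e\<in>E0 T. of_real (sqrt (w T e)) * mv S (?P T e e) v s)"
        unfolding Q_def mv_def sum_distrib_left sum_distrib_right
        by (subst sum.swap) (simp add: mult.assoc)
    qed
    define z where "z = (\<Sum>e\<in>E0 T. of_real (sqrt (w T e)) * amp R {..<m} (code_op A (B T) (V' T) (k T) U' e e) \<phi>)"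
    have "z = (\<Sum>e\<in>E0 T. \<Sum>r0\<in>R. of_real (sqrt (w T e)) * ip S (v r0) (mv S (?P T e e) (v r0)))"
      unfolding z_def by (intro sum.cong refl) (simp add: ampP sum_distrib_left)
    also have "\<dots> = (\<Sum>r0\<in>R. ip S (v r0) (mv S (Q T) (v r0)))"
      unfolding mvQ ip_sum_right ip_scale_right by (rule sum.swap)
    finally have "Re z = (\<Sum>r0\<in>R. Re (ip S (v r0) (mv S (Q T) (v r0))))" by simp
    also have "\<dots> \<ge> (\<Sum>r0\<in>R. (1 - 2 * \<kappa>) * nsq S (v r0))"
      by (intro sum_mono good[OF T, where y = "\<lambda>r. \<phi> (_, r)"]) (simp add: v_def)
    also have "(\<Sum>r0\<in>R. (1 - 2 * \<kappa>) * nsq S (v r0)) = 1 - 2 * \<kappa>"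
      unfolding sum_distrib_left[symmetric] nv by simp
    finally have Rez: "1 - 2 * \<kappa> \<le> Re z" .
    have "1 - 4 * \<kappa> \<le> (cmod z)^2"
    proof (cases "0 \<le> 1 - 2 * \<kappa>")
      case True
      have "1 - 4 * \<kappa> \<le> (1 - 2 * \<kappa>)^2" by (simp add: power2_eq_square algebra_simps)
      also have "\<dots> \<le> (cmod z)^2"
        using True Rez complex_Re_le_cmod[of z] by (intro power_mono) auto
      finally show ?thesis .
    next
      case False
      then show ?thesis using zero_le_power2[of "cmod z"] by linarith
    qed
    also have "(cmod z)^2 \<le> (\<Sum>e\<in>E0 T. (cmod (amp R {..<m} (code_op A (B T) (V' T) (k T) U' e e) \<phi>))^2)"
      unfolding z_def
    proof (rule weighted_cauchy_schwarz)
      show "0 \<le> w T e" if "e \<in> E0 T" for e using coding_nonneg(1)[OF c[OF T]] sub(3)[OF T] that by blast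
      have "sum (w T) (E0 T) \<le> sum (w T) (E T)"
        using sub(3)[OF T] fin[OF T] coding_nonneg(1)[OF c[OF T]] by (intro sum_mono2) auto
      then show "sum (w T) (E0 T) \<le> 1" using coding_nonneg(3)[OF c[OF T]] by simp
    qed
    also have "\<dots> \<le> (\<Sum>e\<in>E T. (cmod (amp R {..<m} (code_op A (B T) (V' T) (k T) U' e e) \<phi>))^2)"
      using sub(3)[OF T] fin[OF T] by (intro sum_mono2) auto
    also have "\<dots> \<le> (\<Sum>e\<in>E T. \<Sum>h\<in>E T. (cmod (amp R {..<m} (code_op A (B T) (V' T) (k T) U' e h) \<phi>))^2)"
      using fin(2)[OF T] by (intro sum_mono member_le_sum) auto
    finally show ?thesis .
  qed
  show ?thesis by (rule that[OF U' V' main])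
qed

section \<open>Typical truncation of powers\<close>

definition kpow :: "nat \<Rightarrow> ('e \<Rightarrow> 'b \<Rightarrow> 'a \<Rightarrow> complex) \<Rightarrow> (nat \<Rightarrow> 'e) \<Rightarrow> (nat \<Rightarrow> 'b) \<Rightarrow> (nat \<Rightarrow> 'a) \<Rightarrow> complex" where
  "kpow n k e b a = (\<Prod>t<n. k (e t) (b t) (a t))"

definition ppow :: "nat \<Rightarrow> ('a \<Rightarrow> real) \<Rightarrow> (nat \<Rightarrow> 'a) \<Rightarrow> real" where
  "ppow n p x = (\<Prod>t<n. p (x t))"

definition shannon :: "'a set \<Rightarrow> ('a \<Rightarrow> real) \<Rightarrow> real" where
  "shannon X p = (\<Sum>x\<in>X. - (p x * log 2 (p x)))"

lemma finite_sys_power: "finite A \<Longrightarrow> finite (sys_power n A)"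
  by (simp add: sys_power_def finite_PiE)

lemma sys_powerD: "x \<in> sys_power n A \<Longrightarrow> t < n \<Longrightarrow> x t \<in> A"
  by (auto simp: sys_power_def)

lemma sys_power_eqI:
  assumes "x \<in> sys_power n A" "y \<in> sys_power n B" "\<And>t. t < n \<Longrightarrow> x t = y t"
  shows "x = y"
  using assms unfolding sys_power_def by (intro ext) (metis PiE_arb lessThan_iff)

lemma sum_sys_power:
  fixes f :: "nat \<Rightarrow> 'a \<Rightarrow> 'c::comm_semiring_1"
  assumes "finite A"
  shows "(\<Sum>x\<in>sys_power n A. \<Prod>t<n. f t (x t)) = (\<Prod>t<n. \<Sum>a\<in>A. f t a)"
  unfolding sys_power_def by (rule prod_sum_PiE[symmetric]) (use assms in auto)

lemma sum_sys_power2: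
  fixes f :: "nat \<Rightarrow> 'a \<Rightarrow> 'b \<Rightarrow> 'c::comm_semiring_1"
  assumes "finite A" "finite B"
  shows "(\<Sum>x\<in>sys_power n A. \<Sum>y\<in>sys_power n B. \<Prod>t<n. f t (x t) (y t)) = (\<Prod>t<n. \<Sum>a\<in>A. \<Sum>b\<in>B. f t a b)" (is "?lhs = _")
proof -
  have "?lhs
      = (\<Sum>x\<in>sys_power n A. \<Prod>t<n. \<Sum>b\<in>B. f t (x t) b)"
    by (intro sum.cong refl sum_sys_power[OF assms(2)])
  also have "\<dots> = (\<Prod>t<n. \<Sum>a\<in>A. \<Sum>b\<in>B. f t a b)" by (rule sum_sys_power[OF assms(1)])
  finally show ?thesis .
qed

lemma prod_delta_sys_power:
  fixes g :: "nat \<Rightarrow> 'c::comm_semiring_1"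
  assumes "x \<in> sys_power n A" "y \<in> sys_power n A"
  shows "(\<Prod>t<n. if x t = y t then g t else 0) = (if x = y then \<Prod>t<n. g t else 0)" (is "?lhs = _")
proof (cases "x = y")
  case False
  then obtain t where "t < n" "x t \<noteq> y t" using sys_power_eqI[OF assms] by blast
  then have "?lhs = 0"
    by (intro prod_zero) auto
  then show ?thesis using False by simp
qed simp

lemma coding_power:
  assumes c: "coding A B E k p w q"
  shows "coding (sys_power n A) (sys_power n B) (sys_power n E) (kpow n k) (ppow n p) (ppow n w) (ppow n q)"
proof -
  note fin = codingD(1-3)[OF c]
  have 1: "(\<Sum>e\<in>sys_power n E. \<Sum>b\<in>sys_power n B. cnj (kpow n k e b a) * kpow n k e b a') = (if a = a' then 1 else 0)" (is "?lhs = _")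
    if a: "a \<in> sys_power n A" "a' \<in> sys_power n A" for a a'
  proof -
    have "?lhs
        = (\<Sum>e\<in>sys_power n E. \<Sum>b\<in>sys_power n B. \<Prod>t<n. cnj (k (e t) (b t) (a t)) * k (e t) (b t) (a' t))"
      by (simp add: kpow_def prod.distrib)
    also have "\<dots> = (\<Prod>t<n. \<Sum>e\<in>E. \<Sum>b\<in>B. cnj (k e b (a t)) * k e b (a' t))"
      by (rule sum_sys_power2[OF fin(3,2)])
    also have "\<dots> = (\<Prod>t<n. if a t = a' t then 1 else 0)"
      using a by (intro prod.cong refl codingD(6)[OF c]) (auto dest: sys_powerD)
    finally show ?thesis by (simp add: prod_delta_sys_power[OF a])
  qed
  have 2: "(\<Sum>b\<in>sys_power n B. \<Sum>a\<in>sys_power n A. of_real (ppow n p a) * (kpow n k e b a * cnj (kpow n k e' b a)))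
        = (if e = e' then of_real (ppow n w e) else 0)" (is "?lhs2 = _")
    if e: "e \<in> sys_power n E" "e' \<in> sys_power n E" for e e'
  proof -
    have "?lhs2
        = (\<Sum>b\<in>sys_power n B. \<Sum>a\<in>sys_power n A. \<Prod>t<n. of_real (p (a t)) * (k (e t) (b t) (a t) * cnj (k (e' t) (b t) (a t))))"
      by (simp add: kpow_def ppow_def prod.distrib)
    also have "\<dots> = (\<Prod>t<n. \<Sum>b\<in>B. \<Sum>a\<in>A. of_real (p a) * (k (e t) b a * cnj (k (e' t) b a)))"
      by (rule sum_sys_power2[OF fin(2,1)])
    also have "\<dots> = (\<Prod>t<n. if e t = e' t then of_real (w (e t)) else 0)"
      using e by (intro prod.cong refl codingD(7)[OF c]) (auto dest: sys_powerD)
    finally show ?thesis by (simp add: prod_delta_sys_power[OF e] ppow_def)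
  qed
  have 3: "(\<Sum>e\<in>sys_power n E. \<Sum>a\<in>sys_power n A. of_real (ppow n p a) * (kpow n k e b a * cnj (kpow n k e b' a)))
        = (if b = b' then of_real (ppow n q b) else 0)" (is "?lhs3 = _")
    if b: "b \<in> sys_power n B" "b' \<in> sys_power n B" for b b'
  proof -
    have "?lhs3
        = (\<Sum>e\<in>sys_power n E. \<Sum>a\<in>sys_power n A. \<Prod>t<n. of_real (p (a t)) * (k (e t) (b t) (a t) * cnj (k (e t) (b' t) (a t))))"
      by (simp add: kpow_def ppow_def prod.distrib)
    also have "\<dots> = (\<Prod>t<n. \<Sum>e\<in>E. \<Sum>a\<in>A. of_real (p a) * (k e (b t) a * cnj (k e (b' t) a)))"
      by (rule sum_sys_power2[OF fin(3,1)])
    also have "\<dots> = (\<Prod>t<n. if b t = b' t then of_real (q (b t)) else 0)"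
      using b by (intro prod.cong refl codingD(8)[OF c]) (auto dest: sys_powerD)
    finally show ?thesis by (simp add: prod_delta_sys_power[OF b] ppow_def)
  qed
  have 4: "0 \<le> ppow n p a" if "a \<in> sys_power n A" for a
    unfolding ppow_def using sys_powerD[OF that] codingD(4)[OF c] by (intro prod_nonneg) auto
  have "(\<Sum>a\<in>sys_power n A. ppow n p a) = (\<Prod>t<n. sum p A)"
    unfolding ppow_def by (rule sum_sys_power[OF fin(1)])
  then have 5: "sum (ppow n p) (sys_power n A) = 1" using codingD(5)[OF c] by simp
  show ?thesis unfolding coding_def
    by (intro conjI ballI finite_sys_power fin 1 2 3 4 5)
qed

text \<open>One-sided typical sets are enough: the estimates use upper bounds on input and output
  eigenvalues and a lower bound on environment eigenvalues.\<close>

definition light :: "('x \<Rightarrow> real) \<Rightarrow> real \<Rightarrow> 'x set \<Rightarrow> nat \<Rightarrow> (nat \<Rightarrow> 'x) set" where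
  "light p c X n = {x \<in> sys_power n X. ppow n p x \<le> 2 powr (- real n * c)}"

definition heavy :: "('x \<Rightarrow> real) \<Rightarrow> real \<Rightarrow> 'x set \<Rightarrow> nat \<Rightarrow> (nat \<Rightarrow> 'x) set" where
  "heavy p c X n = {x \<in> sys_power n X. 2 powr (- real n * c) \<le> ppow n p x}"

lemma ppow_nonneg:
  assumes "\<And>x. x \<in> X \<Longrightarrow> 0 \<le> p x" "x \<in> sys_power n X"
  shows "0 \<le> ppow n p x"
  unfolding ppow_def using assms sys_powerD[OF assms(2)] by (intro prod_nonneg) auto

text \<open>The mean of \<open>g\<close> is the derivative at 0 of the moment generating function
  \<open>f\<close>, whose value there is 1. A negative mean gives \<open>f s < 1\<close> for some
  positive \<open>s\<close>, and the mass off \<open>G n\<close> is at most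
  \<open>f s ^ n\<close>.\<close>

lemma chernoff:
  fixes p g :: "'x \<Rightarrow> real"
  assumes fin: "finite X" and p: "\<And>x. x \<in> X \<Longrightarrow> 0 \<le> p x" "sum p X = 1" and neg: "(\<Sum>x\<in>X. p x * g x) < 0"
    and G: "\<And>n x. x \<in> sys_power n X \<Longrightarrow> x \<notin> G n \<Longrightarrow> 0 < ppow n p x \<Longrightarrow> 0 \<le> (\<Sum>t<n. g (x t))"
  shows "(\<lambda>n. sum (ppow n p) (sys_power n X - G n)) \<longlonglongrightarrow> 0"
proof -
  define f where "f s = (\<Sum>x\<in>X. p x * exp (s * g x))" for s
  have "(f has_real_derivative (\<Sum>x\<in>X. p x * (exp (0 * g x) * g x))) (at 0)"
    unfolding f_def by (auto intro!: derivative_eq_intros sum.cong)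
  then have "(f has_real_derivative (\<Sum>x\<in>X. p x * g x)) (at 0)" by simp
  from DERIV_neg_dec_right[OF this neg] obtain d where d: "d > 0" "\<And>h. 0 < h \<Longrightarrow> h < d \<Longrightarrow> f (0 + h) < f 0"
    by blast
  define s where "s = d / 2"
  have s: "s > 0" using d by (simp add: s_def)
  have "f s < f 0" using d(2)[of s] d(1) by (simp add: s_def)
  then have r1: "f s < 1" using p(2) by (simp add: f_def)
  have r0: "0 \<le> f s" unfolding f_def using p(1) by (intro sum_nonneg) auto
  note pp = ppow_nonneg[of X p, OF p(1)]
  have le: "sum (ppow n p) (sys_power n X - G n) \<le> f s ^ n" for n
  proof -
    let ?h = "\<lambda>x. ppow n p x * exp (s * (\<Sum>t<n. g (x t)))"
    have "sum (ppow n p) (sys_power n X - G n) \<le> sum ?h (sys_power n X - G n)"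
    proof (rule sum_mono)
      fix x assume x: "x \<in> sys_power n X - G n"
      show "ppow n p x \<le> ?h x"
      proof (cases "ppow n p x = 0")
        case False
        then have "1 \<le> exp (s * (\<Sum>t<n. g (x t)))" using s G pp[of x n] x by simp
        then show ?thesis using pp[of x n] x by (simp add: mult_le_cancel_left1)
      qed simp
    qed
    also have "\<dots> \<le> sum ?h (sys_power n X)" using pp finite_sys_power[OF fin] by (intro sum_mono2) auto
    also have "\<dots> = (\<Sum>x\<in>sys_power n X. \<Prod>t<n. p (x t) * exp (s * g (x t)))"
      by (simp add: ppow_def prod.distrib exp_sum sum_distrib_left)
    also have "\<dots> = (\<Prod>t<n. f s)" unfolding f_def by (rule sum_sys_power[OF fin])
    finally show ?thesis by simp
  qed
  show ?thesis
  proof (rule tendsto_sandwich[OF _ _ tendsto_const])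
    show "(\<lambda>n. f s ^ n) \<longlonglongrightarrow> 0" using r0 r1 by (intro LIMSEQ_power_zero) simp
  qed (use le pp in \<open>auto intro!: always_eventually sum_nonneg\<close>)
qed

lemma log_ppow:
  assumes p: "\<And>x. x \<in> X \<Longrightarrow> 0 \<le> p x" and x: "x \<in> sys_power n X" and pos: "0 < ppow n p x"
  shows "log 2 (ppow n p x) = (\<Sum>t<n. log 2 (p (x t)))"
proof -
  have nz: "p (x t) \<noteq> 0" if "t < n" for t
  proof
    assume "p (x t) = 0"
    then have "ppow n p x = 0" unfolding ppow_def using that by (intro prod_zero) auto
    then show False using pos by simp
  qed
  then have "ln (ppow n p x) = (\<Sum>t<n. ln (p (x t)))" unfolding ppow_def by (intro ln_prod) auto
  then show ?thesis by (simp add: log_def sum_divide_distrib)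
qed

text \<open>\<open>chernoff\<close> for plus or minus the deviation of \<open>log 2 (p x)\<close>
  from its mean \<open>- shannon X p\<close>, shifted by \<open>- \<delta>\<close>; both functions
  have mean \<open>- \<delta>\<close>.\<close>

lemma light_heavy_mass:
  fixes p :: "'x \<Rightarrow> real"
  assumes fin: "finite X" and p: "\<And>x. x \<in> X \<Longrightarrow> 0 \<le> p x" "sum p X = 1" and d: "0 < \<delta>"
  shows "(\<lambda>n. sum (ppow n p) (sys_power n X - light p (shannon X p - \<delta>) X n)) \<longlonglongrightarrow> 0" (is ?light)
    "(\<lambda>n. sum (ppow n p) (sys_power n X - heavy p (shannon X p + \<delta>) X n)) \<longlonglongrightarrow> 0" (is ?heavy)
proof -
  have ent: "(\<Sum>x\<in>X. p x * (c * (log 2 (p x) + shannon X p) - \<delta>)) < 0" for c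
  proof -
    have "(\<Sum>x\<in>X. p x * (c * (log 2 (p x) + shannon X p) - \<delta>))
        = c * ((\<Sum>x\<in>X. p x * log 2 (p x)) + sum p X * shannon X p) - sum p X * \<delta>"
      by (simp add: sum_distrib_left sum_distrib_right sum.distrib sum_subtractf algebra_simps)
    then show ?thesis using p(2) d by (simp add: shannon_def sum_negf)
  qed
  show ?light
  proof (rule chernoff[OF fin p ent[of 1]])
    fix n x assume x: "x \<in> sys_power n X" "x \<notin> light p (shannon X p - \<delta>) X n" "0 < ppow n p x"
    then have "- real n * (shannon X p - \<delta>) < log 2 (ppow n p x)" by (simp add: light_def less_log_iff)
    with log_ppow[OF p(1) x(1,3)] show "0 \<le> (\<Sum>t<n. 1 * (log 2 (p (x t)) + shannon X p) - \<delta>)"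
      by (simp add: sum.distrib sum_subtractf algebra_simps)
  qed
  show ?heavy
  proof (rule chernoff[OF fin p ent[of "-1"]])
    fix n x assume x: "x \<in> sys_power n X" "x \<notin> heavy p (shannon X p + \<delta>) X n" "0 < ppow n p x"
    then have "log 2 (ppow n p x) < - real n * (shannon X p + \<delta>)" by (simp add: heavy_def log_less_iff)
    with log_ppow[OF p(1) x(1,3)] show "0 \<le> (\<Sum>t<n. -1 * (log 2 (p (x t)) + shannon X p) - \<delta>)"
      by (simp add: sum.distrib sum_subtractf sum_negf algebra_simps)
  qed
qed

section \<open>Codes made of contractions\<close>

text \<open>A single Kraus operator \<open>U\<close> for the encoder, and for each \<open>T\<close>
  the Kraus operators of a decoder stacked over \<open>H T\<close>. In this form codes survive
  changes of basis, regrouping into blocks and completion to channels.\<close>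

definition good_code ::
  "'t set \<Rightarrow> 'a set \<Rightarrow> ('t \<Rightarrow> 'b set) \<Rightarrow> ('t \<Rightarrow> 'e set) \<Rightarrow> ('t \<Rightarrow> 'h set) \<Rightarrow>
   ('t \<Rightarrow> 'e \<Rightarrow> 'b \<Rightarrow> 'a \<Rightarrow> complex) \<Rightarrow> nat \<Rightarrow> real \<Rightarrow> bool" where
  "good_code \<T> A B E H k m \<epsilon> \<longleftrightarrow> (\<exists>U V. contr A {..<m} U \<and>
     (\<forall>T\<in>\<T>. contr ({..<m} \<times> H T) (B T) (V T)) \<and>
     (\<forall>T\<in>\<T>. \<forall>\<phi>. nsq ({..<m} \<times> {..<m}) \<phi> = 1 \<longrightarrow>
       1 - \<epsilon> \<le> (\<Sum>e\<in>E T. \<Sum>h\<in>H T.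
         (cmod (amp {..<m} {..<m} (code_op A (B T) (V T) (k T) U e h) \<phi>))^2)))"

lemma finite_uniform_gap:
  fixes f :: "'t \<Rightarrow> real"
  assumes "finite \<T>" "\<And>T. T \<in> \<T> \<Longrightarrow> r < f T"
  shows "\<exists>\<delta>>0. \<forall>T\<in>\<T>. r + \<delta> \<le> f T"
proof (cases "\<T> = {}")
  case False
  define \<delta> where "\<delta> = Min (f ` \<T>) - r"
  have "r < Min (f ` \<T>)" using assms False by (subst Min_gr_iff) auto
  then have "0 < \<delta>" by (simp add: \<delta>_def)
  moreover have "r + \<delta> \<le> f T" if "T \<in> \<T>" for T
    using assms(1) that by (simp add: \<delta>_def)
  ultimately show ?thesis by blast
qed (auto intro: exI[of _ 1])

lemma mv_op_sum: "mv S (\<lambda>s s'. \<Sum>i\<in>I. c i * G i s s') v s = (\<Sum>i\<in>I. c i * mv S (G i) v s)"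
  unfolding mv_def sum_distrib_left sum_distrib_right
  by (subst sum.swap) (simp add: mult.assoc)

lemma amp_op_sum: "amp R S (\<lambda>s s'. \<Sum>i\<in>I. c i * G i s s') \<phi> = (\<Sum>i\<in>I. c i * amp R S (G i) \<phi>)"
proof -
  have "mv S (\<lambda>s s'. \<Sum>i\<in>I. c i * G i s s') v = (\<lambda>s. \<Sum>i\<in>I. c i * mv S (G i) v s)" for v
    by (rule ext) (rule mv_op_sum)
  then show ?thesis
    unfolding amp_def by (simp add: ip_sum_right ip_scale_right sum_distrib_left sum.swap[of _ R])
qed

lemma amp_cong:
  assumes "\<And>s s'. s \<in> S \<Longrightarrow> s' \<in> S \<Longrightarrow> G s s' = G' s s'"
  shows "amp R S G \<phi> = amp R S G' \<phi>"
  unfolding amp_def using assms by (intro sum.cong refl ip_cong) (simp_all add: mv_def)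

text \<open>
  A code for the Kraus operators \<open>k1\<close> yields a code for \<open>k\<close> if the operators \<open>k1\<close> are mixtures of
  the operators \<open>k\<close> preceded by a contraction \<open>X\<close> and followed by a contraction \<open>Y\<close> with side
  output \<open>P\<close>.
\<close>

lemma good_code_transfer:
  fixes E :: "'t \<Rightarrow> 'e set" and B :: "'t \<Rightarrow> 'b set" and A :: "'a set" and H1 :: "'t \<Rightarrow> 'h set"
    and E1 :: "'t \<Rightarrow> 'e1 set" and B1 :: "'t \<Rightarrow> 'b1 set" and A1 :: "'a1 set" and P :: "'t \<Rightarrow> 'p set"
  assumes g: "good_code \<T> A1 B1 E1 H1 k1 m \<epsilon>"
    and X: "contr A A1 X"
    and Y: "\<And>T. T \<in> \<T> \<Longrightarrow> contr (B1 T \<times> P T) (B T) (Y T)"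
    and c: "\<And>T. T \<in> \<T> \<Longrightarrow> contr (E1 T) (E T \<times> P T) (c T)"
    and k1: "\<And>T e1 b1 a1. T \<in> \<T> \<Longrightarrow> e1 \<in> E1 T \<Longrightarrow> b1 \<in> B1 T \<Longrightarrow> a1 \<in> A1 \<Longrightarrow>
      k1 T e1 b1 a1 = (\<Sum>e\<in>E T. \<Sum>p\<in>P T. c T e1 (e, p) * (\<Sum>b\<in>B T. Y T (b1, p) b * (\<Sum>a\<in>A. k T e b a * X a a1)))"
  shows "good_code \<T> A B E (\<lambda>T. H1 T \<times> P T) k m \<epsilon>"
proof -
  obtain U1 V1 where U1: "contr A1 {..<m} U1" and V1: "\<And>T. T \<in> \<T> \<Longrightarrow> contr ({..<m} \<times> H1 T) (B1 T) (V1 T)"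
    and fid: "\<And>T \<phi>. T \<in> \<T> \<Longrightarrow> nsq ({..<m} \<times> {..<m}) \<phi> = 1 \<Longrightarrow>
       1 - \<epsilon> \<le> (\<Sum>e\<in>E1 T. \<Sum>h\<in>H1 T. (cmod (amp {..<m} {..<m} (code_op A1 (B1 T) (V1 T) (k1 T) U1 e h) \<phi>))^2)"
    using g unfolding good_code_def by blast
  define U where "U a s = (\<Sum>a1\<in>A1. X a a1 * U1 a1 s)" for a s
  \<comment> \<open>The new decoder applies \<open>Y\<close> and passes the result to the old one;
    \<open>p\<close> joins the labels of its Kraus operators.\<close>
  define V where "V T = (\<lambda>(s, (h, p)) b. \<Sum>b1\<in>B1 T. V1 T (s, h) b1 * Y T (b1, p) b)" for T
  have U: "contr A {..<m} U" unfolding U_def by (rule contr_comp[OF X U1])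
  let ?F = "\<lambda>T v p. \<lambda>b1. mv (B T) (Y T) v (b1, p)"
  have V: "contr ({..<m} \<times> (H1 T \<times> P T)) (B T) (V T)" if T: "T \<in> \<T>" for T
    unfolding contr_def
  proof
    fix v
    have mvV: "mv (B T) (V T) v (s, (h, p)) = mv (B1 T) (V1 T) (?F T v p) (s, h)" for s h p
      unfolding mv_def V_def prod.case sum_distrib_left sum_distrib_right
      by (subst sum.swap) (simp add: mult.assoc)
    have "nsq ({..<m} \<times> (H1 T \<times> P T)) (mv (B T) (V T) v)
        = (\<Sum>s<m. \<Sum>h\<in>H1 T. \<Sum>p\<in>P T. (cmod (mv (B1 T) (V1 T) (?F T v p) (s, h)))^2)"
      unfolding nsq_def sum_Times mvV ..
    also have "\<dots> = (\<Sum>p\<in>P T. \<Sum>s<m. \<Sum>h\<in>H1 T. (cmod (mv (B1 T) (V1 T) (?F T v p) (s, h)))^2)"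
      by (subst (2) sum.swap, intro sum.cong refl, rule sum.swap)
    also have "\<dots> = (\<Sum>p\<in>P T. nsq ({..<m} \<times> H1 T) (mv (B1 T) (V1 T) (?F T v p)))"
      unfolding nsq_def sum_Times ..
    also have "\<dots> \<le> (\<Sum>p\<in>P T. nsq (B1 T) (?F T v p))"
      by (intro sum_mono contrD[OF V1[OF T]])
    also have "\<dots> = nsq (B1 T \<times> P T) (mv (B T) (Y T) v)"
      unfolding nsq_def sum_Times by (rule sum.swap)
    also have "\<dots> \<le> nsq (B T) v" by (rule contrD[OF Y[OF T]])
    finally show "nsq ({..<m} \<times> (H1 T \<times> P T)) (mv (B T) (V T) v) \<le> nsq (B T) v" .
  qed
  have op: "code_op A1 (B1 T) (V1 T) (k1 T) U1 e1 h s s'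
      = (\<Sum>i\<in>E T \<times> P T. c T e1 i * code_op A (B T) (V T) (k T) U (fst i) (h, snd i) s s')" (is "?lhs = _")
    if T: "T \<in> \<T>" and e1: "e1 \<in> E1 T" for T e1 h s s'
  proof -
    define Z where "Z e p b1 a1 = (\<Sum>b\<in>B T. Y T (b1, p) b * (\<Sum>a\<in>A. k T e b a * X a a1))" for e p b1 a1
    have inner: "code_op A (B T) (V T) (k T) U e (h, p) s s' = (\<Sum>b1\<in>B1 T. \<Sum>a1\<in>A1. V1 T (s, h) b1 * Z e p b1 a1 * U1 a1 s')" (is "?lhs2 = _") for e p
    proof -
      have kU: "(\<Sum>a\<in>A. k T e b a * U a s') = (\<Sum>a1\<in>A1. (\<Sum>a\<in>A. k T e b a * X a a1) * U1 a1 s')" for b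
        unfolding U_def sum_distrib_left sum_distrib_right by (subst sum.swap) (simp add: mult.assoc)
      have "?lhs2
          = (\<Sum>b\<in>B T. \<Sum>b1\<in>B1 T. \<Sum>a1\<in>A1. V1 T (s, h) b1 * (Y T (b1, p) b * (\<Sum>a\<in>A. k T e b a * X a a1)) * U1 a1 s')"
        unfolding code_op_def kU V_def prod.case sum_product by (simp add: mult.assoc)
      also have "\<dots> = (\<Sum>b1\<in>B1 T. \<Sum>a1\<in>A1. \<Sum>b\<in>B T. V1 T (s, h) b1 * (Y T (b1, p) b * (\<Sum>a\<in>A. k T e b a * X a a1)) * U1 a1 s')"
        by (subst sum.swap, intro sum.cong refl, rule sum.swap)
      finally show ?thesis unfolding Z_def sum_distrib_left sum_distrib_right .
    qed
    have "?lhs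
        = (\<Sum>b1\<in>B1 T. \<Sum>a1\<in>A1. V1 T (s, h) b1 * (\<Sum>e\<in>E T. \<Sum>p\<in>P T. c T e1 (e, p) * Z e p b1 a1) * U1 a1 s')"
      unfolding code_op_def
    proof (intro sum.cong refl, subst sum_distrib_left, intro sum.cong refl)
      fix b1 a1 assume "b1 \<in> B1 T" "a1 \<in> A1"
      from k1[OF T e1 this] have "k1 T e1 b1 a1 = (\<Sum>e\<in>E T. \<Sum>p\<in>P T. c T e1 (e, p) * Z e p b1 a1)"
        unfolding Z_def .
      then show "V1 T (s, h) b1 * (k1 T e1 b1 a1 * U1 a1 s')
          = V1 T (s, h) b1 * (\<Sum>e\<in>E T. \<Sum>p\<in>P T. c T e1 (e, p) * Z e p b1 a1) * U1 a1 s'"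
        by (simp only: mult.assoc)
    qed
    also have "\<dots> = (\<Sum>b1\<in>B1 T. \<Sum>a1\<in>A1. \<Sum>i\<in>E T \<times> P T. c T e1 i * (V1 T (s, h) b1 * Z (fst i) (snd i) b1 a1 * U1 a1 s'))"
      unfolding sum_Times sum_distrib_left sum_distrib_right
      by (intro sum.cong refl) simp
    also have "\<dots> = (\<Sum>i\<in>E T \<times> P T. \<Sum>b1\<in>B1 T. \<Sum>a1\<in>A1. c T e1 i * (V1 T (s, h) b1 * Z (fst i) (snd i) b1 a1 * U1 a1 s'))"
      by (rule trans[OF sum.cong[OF refl sum.swap] sum.swap])
    also have "\<dots> = (\<Sum>i\<in>E T \<times> P T. c T e1 i * code_op A (B T) (V T) (k T) U (fst i) (h, snd i) s s')"
      unfolding inner sum_distrib_left ..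
    finally show ?thesis .
  qed
  show ?thesis
    unfolding good_code_def
  proof (intro exI[of _ U] exI[of _ V] conjI ballI allI impI U V)
    fix T and \<phi> :: "nat \<times> nat \<Rightarrow> complex" assume T: "T \<in> \<T>" and \<phi>: "nsq ({..<m} \<times> {..<m}) \<phi> = 1"
    \<comment> \<open>For each \<open>h\<close> the old amplitudes are the image of the new ones
      under the contraction \<open>c T\<close>, so the sum of squares can only be larger for the new
      code.\<close>
    define z where "z h i = amp {..<m} {..<m} (code_op A (B T) (V T) (k T) U (fst i) (h, snd i)) \<phi>" for h i
    have "(\<Sum>e\<in>E1 T. \<Sum>h\<in>H1 T. (cmod (amp {..<m} {..<m} (code_op A1 (B1 T) (V1 T) (k1 T) U1 e h) \<phi>))^2)
        = (\<Sum>h\<in>H1 T. \<Sum>e\<in>E1 T. (cmod (mv (E T \<times> P T) (c T) (z h) e))^2)"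
    proof (subst sum.swap, intro sum.cong refl)
      fix h e assume e: "e \<in> E1 T"
      have "amp {..<m} {..<m} (code_op A1 (B1 T) (V1 T) (k1 T) U1 e h) \<phi>
          = amp {..<m} {..<m} (\<lambda>s s'. \<Sum>i\<in>E T \<times> P T. c T e i * code_op A (B T) (V T) (k T) U (fst i) (h, snd i) s s') \<phi>"
        by (rule amp_cong) (rule op[OF T e])
      also have "\<dots> = mv (E T \<times> P T) (c T) (z h) e"
        unfolding amp_op_sum by (simp add: mv_def z_def)
      finally show "(cmod (amp {..<m} {..<m} (code_op A1 (B1 T) (V1 T) (k1 T) U1 e h) \<phi>))^2
          = (cmod (mv (E T \<times> P T) (c T) (z h) e))^2" by simp
    qed
    also have "\<dots> = (\<Sum>h\<in>H1 T. nsq (E1 T) (mv (E T \<times> P T) (c T) (z h)))" by (simp add: nsq_def)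
    also have "\<dots> \<le> (\<Sum>h\<in>H1 T. nsq (E T \<times> P T) (z h))" by (intro sum_mono contrD[OF c[OF T]])
    also have "\<dots> = (\<Sum>h\<in>H1 T. \<Sum>e\<in>E T. \<Sum>p\<in>P T. (cmod (amp {..<m} {..<m} (code_op A (B T) (V T) (k T) U e (h, p)) \<phi>))^2)"
      by (simp add: nsq_def sum_Times z_def)
    also have "\<dots> = (\<Sum>e\<in>E T. \<Sum>h\<in>H1 T \<times> P T. (cmod (amp {..<m} {..<m} (code_op A (B T) (V T) (k T) U e h) \<phi>))^2)"
      unfolding sum_Times by (rule sum.swap)
    finally show "1 - \<epsilon> \<le> (\<Sum>e\<in>E T. \<Sum>h\<in>H1 T \<times> P T. (cmod (amp {..<m} {..<m} (code_op A (B T) (V T) (k T) U e h) \<phi>))^2)"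
      using fid[OF T \<phi>] by linarith
  qed
qed

text \<open>Mixing over \<open>e\<close> with \<open>cnj (f e1 e)\<close> is the unitary freedom of
  Kraus representations, that is, a change of basis in the environment.\<close>

definition rotated ::
  "'a set \<Rightarrow> 'b set \<Rightarrow> 'e set \<Rightarrow> ('a1 \<Rightarrow> 'a \<Rightarrow> complex) \<Rightarrow> ('b1 \<Rightarrow> 'b \<Rightarrow> complex) \<Rightarrow> ('e1 \<Rightarrow> 'e \<Rightarrow> complex) \<Rightarrow>
   ('e \<Rightarrow> 'b \<Rightarrow> 'a \<Rightarrow> complex) \<Rightarrow> 'e1 \<Rightarrow> 'b1 \<Rightarrow> 'a1 \<Rightarrow> complex" where
  "rotated A B E u v f k e1 b1 a1 =
     (\<Sum>e\<in>E. cnj (f e1 e) * (\<Sum>b\<in>B. cnj (v b1 b) * (\<Sum>a\<in>A. k e b a * u a1 a)))"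

lemma orthon_power:
  assumes o: "orthon K I u" and fin: "finite I"
  shows "orthon (sys_power n K) (sys_power n I) (\<lambda>x y. \<Prod>t<n. u (x t) (y t))"
  unfolding orthon_def
proof (intro ballI)
  fix x x' assume x: "x \<in> sys_power n K" "x' \<in> sys_power n K"
  let ?F = "\<lambda>x. \<lambda>y. \<Prod>t<n. u (x t) (y t)"
  have "ip (sys_power n I) (?F x) (?F x')
      = (\<Sum>y\<in>sys_power n I. \<Prod>t<n. cnj (u (x t) (y t)) * u (x' t) (y t))"
    by (simp add: ip_def prod.distrib)
  also have "\<dots> = (\<Prod>t<n. ip I (u (x t)) (u (x' t)))"
    unfolding ip_def by (rule sum_sys_power[OF fin])
  also have "\<dots> = (\<Prod>t<n. if x t = x' t then 1 else 0)"
    using x by (intro prod.cong refl orthonD[OF o]) (auto dest: sys_powerD)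
  finally show "ip (sys_power n I) (?F x) (?F x') = (if x = x' then 1 else 0)"
    by (simp add: prod_delta_sys_power[OF x])
qed

lemma kpow_rotated:
  assumes fin: "finite A" "finite B" "finite E"
  shows "kpow n (rotated A B E u v f k) e1 b1 a1
    = rotated (sys_power n A) (sys_power n B) (sys_power n E) (\<lambda>x y. \<Prod>t<n. u (x t) (y t))
        (\<lambda>x y. \<Prod>t<n. v (x t) (y t)) (\<lambda>x y. \<Prod>t<n. f (x t) (y t)) (kpow n k) e1 b1 a1"
proof -
  have 1: "(\<Sum>a\<in>sys_power n A. kpow n k e b a * (\<Prod>t<n. u (a1 t) (a t))) = (\<Prod>t<n. \<Sum>a\<in>A. k (e t) (b t) a * u (a1 t) a)" for e b
    unfolding kpow_def prod.distrib[symmetric] by (rule sum_sys_power[OF fin(1)])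
  have 2: "(\<Sum>b\<in>sys_power n B. cnj (\<Prod>t<n. v (b1 t) (b t)) * (\<Prod>t<n. \<Sum>a\<in>A. k (e t) (b t) a * u (a1 t) a))
      = (\<Prod>t<n. \<Sum>b\<in>B. cnj (v (b1 t) b) * (\<Sum>a\<in>A. k (e t) b a * u (a1 t) a))" for e
    unfolding cnj_prod prod.distrib[symmetric] by (rule sum_sys_power[OF fin(2)])
  have 3: "(\<Sum>e\<in>sys_power n E. cnj (\<Prod>t<n. f (e1 t) (e t)) * (\<Prod>t<n. \<Sum>b\<in>B. cnj (v (b1 t) b) * (\<Sum>a\<in>A. k (e t) b a * u (a1 t) a)))
      = (\<Prod>t<n. \<Sum>e\<in>E. cnj (f (e1 t) e) * (\<Sum>b\<in>B. cnj (v (b1 t) b) * (\<Sum>a\<in>A. k e b a * u (a1 t) a)))"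
    unfolding cnj_prod prod.distrib[symmetric] by (rule sum_sys_power[OF fin(3)])
  show ?thesis by (simp only: rotated_def 1 2 3) (simp only: kpow_def rotated_def)
qed

text \<open>A change of bases needs no side output, hence the one-point set
  \<open>{()}\<close>.\<close>

lemma good_code_unrotate:
  fixes E :: "'t \<Rightarrow> 'e set" and B :: "'t \<Rightarrow> 'b set"
  assumes g: "good_code \<T> A B E H (\<lambda>T. rotated A (B T) (E T) u (v T) (f T) (k T)) m \<epsilon>"
    and fin: "finite A" "\<And>T. T \<in> \<T> \<Longrightarrow> finite (B T)" "\<And>T. T \<in> \<T> \<Longrightarrow> finite (E T)"
    and o: "orthon A A u" "\<And>T. T \<in> \<T> \<Longrightarrow> orthon (B T) (B T) (v T)" "\<And>T. T \<in> \<T> \<Longrightarrow> orthon (E T) (E T) (f T)"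
  shows "good_code \<T> A B E (\<lambda>T. H T \<times> {()}) k m \<epsilon>"
proof (rule good_code_transfer[OF g, where X = "\<lambda>a a1. u a1 a" and Y = "\<lambda>T (b1, p) b. cnj (v T b1 b)"
      and c = "\<lambda>T e1 (e, p). cnj (f T e1 e)"])
  show "contr A A (\<lambda>a a1. u a1 a)" by (rule contr_orthon(2)[OF fin(1) o(1)])
  fix T assume T: "T \<in> \<T>"
  have "orthon (B T \<times> {()}) (B T) (\<lambda>(b1, p). v T b1)" using o(2)[OF T] by (auto simp: orthon_def)
  from contr_orthon(1)[OF _ this] show "contr (B T \<times> {()}) (B T) (\<lambda>(b1, p) b. cnj (v T b1 b))"
    using fin(2)[OF T] by (simp add: case_prod_unfold)
  have "orthon (E T) (E T \<times> {()}) (\<lambda>e1 (e, p). f T e1 e)"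
    using o(3)[OF T] by (simp add: orthon_def ip_def sum_Times)
  from contr_orthon(1)[OF fin(3)[OF T] this] show "contr (E T) (E T \<times> {()}) (\<lambda>e1 (e, p). cnj (f T e1 e))"
    by (simp add: case_prod_unfold)
qed (simp add: rotated_def)

section \<open>Block codes\<close>

text \<open>A word of length \<open>q * k + d\<close> is \<open>q\<close> blocks of length \<open>k\<close> followed by a rest of length \<open>d\<close>.\<close>

definition blocks :: "nat \<Rightarrow> nat \<Rightarrow> (nat \<Rightarrow> 'a) \<Rightarrow> nat \<Rightarrow> nat \<Rightarrow> 'a" where
  "blocks q k x = (\<lambda>j\<in>{..<q}. \<lambda>i\<in>{..<k}. x (j * k + i))"

definition rest :: "nat \<Rightarrow> nat \<Rightarrow> (nat \<Rightarrow> 'a) \<Rightarrow> nat \<Rightarrow> 'a" where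
  "rest l d x = (\<lambda>i\<in>{..<d}. x (l + i))"

definition glue :: "nat \<Rightarrow> nat \<Rightarrow> nat \<Rightarrow> (nat \<Rightarrow> nat \<Rightarrow> 'a) \<Rightarrow> (nat \<Rightarrow> 'a) \<Rightarrow> nat \<Rightarrow> 'a" where
  "glue q k d z r = (\<lambda>t\<in>{..<q * k + d}. if t < q * k then z (t div k) (t mod k) else r (t - q * k))"

lemma block_index_less:
  assumes "(j::nat) < q" "i < k"
  shows "j * k + i < q * k"
proof -
  have "j * k + i < j * k + k" using assms(2) by simp
  also have "\<dots> = (j + 1) * k" by simp
  also have "\<dots> \<le> q * k" using assms(1) by (intro mult_right_mono) auto
  finally show ?thesis .
qed

lemma blocks_in:
  assumes "x \<in> sys_power (q * k + d) X"
  shows "blocks q k x \<in> sys_power q (sys_power k X)" "rest (q * k) d x \<in> sys_power d X"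
proof -
  have "x (j * k + i) \<in> X" if "j < q" "i < k" for j i
    using sys_powerD[OF assms, of "j * k + i"] block_index_less[OF that] by simp
  then show "blocks q k x \<in> sys_power q (sys_power k X)"
    unfolding sys_power_def blocks_def by (intro restrict_PiE_iff[THEN iffD2] ballI) auto
  show "rest (q * k) d x \<in> sys_power d X"
    unfolding sys_power_def rest_def using sys_powerD[OF assms] by (intro restrict_PiE_iff[THEN iffD2] ballI) auto
qed

lemma glue_in:
  assumes "z \<in> sys_power q (sys_power k X)" "r \<in> sys_power d X" "0 < k"
  shows "glue q k d z r \<in> sys_power (q * k + d) X"
proof -
  have "(if t < q * k then z (t div k) (t mod k) else r (t - q * k)) \<in> X" if "t < q * k + d" for t
  proof (cases "t < q * k")
    case True
    then have "t div k < q" using less_mult_imp_div_less by blast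
    moreover have "t mod k < k" using assms(3) by simp
    ultimately show ?thesis using True assms(1) sys_powerD[of z q "sys_power k X"] sys_powerD[of "z (t div k)" k X]
      by auto
  next
    case False
    then show ?thesis using that assms(2) sys_powerD[of r d X] by auto
  qed
  then show ?thesis by (auto simp: sys_power_def glue_def)
qed

lemma blocks_glue:
  assumes z: "z \<in> sys_power q (sys_power k X)" and r: "r \<in> sys_power d X" and k: "0 < k"
  shows "blocks q k (glue q k d z r) = z" "rest (q * k) d (glue q k d z r) = r"
proof -
  show "rest (q * k) d (glue q k d z r) = r"
  proof (rule ext)
    fix i show "rest (q * k) d (glue q k d z r) i = r i"
      using r by (cases "i < d") (auto simp: rest_def glue_def sys_power_def PiE_def extensional_def)
  qed
  show "blocks q k (glue q k d z r) = z"
  proof (intro ext)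
    fix j i
    show "blocks q k (glue q k d z r) j i = z j i"
    proof (cases "j < q")
      case True
      then have zj: "z j \<in> sys_power k X" using sys_powerD[OF z] by blast
      show ?thesis
      proof (cases "i < k")
        case i: True
        have "j * k + i < q * k" by (rule block_index_less[OF True i])
        then show ?thesis using True i k by (simp add: blocks_def glue_def)
      next
        case False
        then show ?thesis using zj True by (auto simp: blocks_def sys_power_def PiE_def extensional_def)
      qed
    next
      case False
      then have "z j = undefined" using z by (auto simp: sys_power_def PiE_def extensional_def)
      then show ?thesis using False by (simp add: blocks_def)
    qed
  qed
qed

lemma glue_blocks:
  assumes x: "x \<in> sys_power (q * k + d) X" and k: "0 < k"
  shows "glue q k d (blocks q k x) (rest (q * k) d x) = x"
proof (rule ext)
  fix t
  show "glue q k d (blocks q k x) (rest (q * k) d x) t = x t"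
  proof (cases "t < q * k + d")
    case t: True
    show ?thesis
    proof (cases "t < q * k")
      case True
      then have "t div k < q" using less_mult_imp_div_less by blast
      then show ?thesis using t True k by (simp add: glue_def blocks_def)
    next
      case False
      then show ?thesis using t by (auto simp: glue_def rest_def)
    qed
  next
    case False
    then show ?thesis using x by (auto simp: glue_def sys_power_def PiE_def extensional_def)
  qed
qed

lemma sum_blocks:
  assumes k: "0 < k"
  shows "(\<Sum>x\<in>sys_power (q * k + d) X. f (blocks q k x) (rest (q * k) d x))
    = (\<Sum>z\<in>sys_power q (sys_power k X). \<Sum>r\<in>sys_power d X. f z r)"
proof -
  have "(\<Sum>z\<in>sys_power q (sys_power k X). \<Sum>r\<in>sys_power d X. f z r)
      = (\<Sum>y\<in>sys_power q (sys_power k X) \<times> sys_power d X. f (fst y) (snd y))"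
    by (simp add: sum_Times)
  also have "\<dots> = (\<Sum>x\<in>sys_power (q * k + d) X. f (blocks q k x) (rest (q * k) d x))"
    by (rule sum.reindex_bij_witness[where i = "\<lambda>x. (blocks q k x, rest (q * k) d x)" and j = "\<lambda>y. glue q k d (fst y) (snd y)"])
      (auto simp: blocks_glue[OF _ _ k] glue_blocks[OF _ k] blocks_in glue_in[OF _ _ k])
  finally show ?thesis ..
qed

lemma sum_delta_pair:
  assumes "finite Z" "z \<in> Z"
  shows "(\<Sum>u\<in>Z. \<Sum>s\<in>R. if u = z then g s else 0) = (\<Sum>s\<in>R. g s)"
  using assms by (subst sum.swap) simp

lemma sum_delta_pair2:
  assumes "finite Z" "finite R" "z \<in> Z" "r \<in> R"
  shows "(\<Sum>u\<in>Z. \<Sum>s\<in>R. if u = z then (if s = r then c else 0) else 0) = c"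
  unfolding sum_delta_pair[OF assms(1,3)] using assms by simp

lemma prod_blocks:
  fixes g :: "nat \<Rightarrow> 'c::comm_monoid_mult"
  shows "(\<Prod>t<q * k + d. g t) = (\<Prod>j<q. \<Prod>i<k. g (j * k + i)) * (\<Prod>i<d. g (q * k + i))"
proof -
  have "(\<Prod>t<q * k + d. g t) = (\<Prod>t<q * k. g t) * (\<Prod>i<d. g (q * k + i))"
    by (induction d) (simp_all add: mult.assoc)
  moreover have "(\<Prod>t<q * k. g t) = (\<Prod>j<q. \<Prod>i<k. g (j * k + i))"
  proof (induction q)
    case (Suc q)
    have "(\<Prod>t<Suc q * k. g t) = (\<Prod>t<q * k + k. g t)" by (simp add: add.commute)
    also have "\<dots> = (\<Prod>t<q * k. g t) * (\<Prod>i<k. g (q * k + i))"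
    proof -
      have "(\<Prod>t<q * k + l. g t) = (\<Prod>t<q * k. g t) * (\<Prod>i<l. g (q * k + i))" for l
        by (induction l) (simp_all add: mult.assoc)
      then show ?thesis .
    qed
    finally show ?case using Suc by simp
  qed simp
  ultimately show ?thesis by simp
qed

lemma kpow_blocks:
  "kpow (q * k + d) K e b a = kpow q (kpow k K) (blocks q k e) (blocks q k b) (blocks q k a)
    * kpow d K (rest (q * k) d e) (rest (q * k) d b) (rest (q * k) d a)"
  unfolding kpow_def prod_blocks
  by (intro arg_cong2[where f = "(*)"] prod.cong refl) (simp_all add: blocks_def rest_def)

lemma sum_blocks_delta:
  assumes k: "0 < k" and fin: "finite A" and z: "z \<in> sys_power q (sys_power k A)" and r: "r \<in> sys_power d A"
  shows "(\<Sum>x\<in>sys_power (q * k + d) A. if blocks q k x = z \<and> rest (q * k) d x = r then c else 0) = (c :: complex)"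
proof -
  have "(\<Sum>x\<in>sys_power (q * k + d) A. if blocks q k x = z \<and> rest (q * k) d x = r then c else 0)
      = (\<Sum>u\<in>sys_power q (sys_power k A). \<Sum>s\<in>sys_power d A. if u = z then (if s = r then c else 0) else 0)"
    unfolding sum_blocks[OF k, where f = "\<lambda>u s. if u = z then (if s = r then c else 0) else 0", symmetric]
    by (intro sum.cong refl) auto
  also have "\<dots> = c"
    by (rule sum_delta_pair2[OF finite_sys_power[OF finite_sys_power[OF fin]] finite_sys_power[OF fin] z r])
  finally show ?thesis .
qed

text \<open>The encoder feeds the fixed letter \<open>a0\<close> into the rest positions, and the
  decoders move the outputs of these positions into the side output. The amplitudes
  \<open>\<kappa>\<close> of the rest have total weight 1, so the Kraus operators of the blocks are
  recovered exactly.\<close>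

lemma good_code_unblock:
  fixes E :: "'t \<Rightarrow> 'e set" and B :: "'t \<Rightarrow> 'b set" and A :: "'a set" and H :: "'t \<Rightarrow> 'h set"
  assumes g: "good_code \<T> (sys_power q (sys_power k A)) (\<lambda>T. sys_power q (sys_power k (B T)))
      (\<lambda>T. sys_power q (sys_power k (E T))) H (\<lambda>T. kpow q (kpow k (K T))) m \<epsilon>"
    and k: "0 < k" and fin: "finite A" "\<And>T. T \<in> \<T> \<Longrightarrow> finite (B T)" "\<And>T. T \<in> \<T> \<Longrightarrow> finite (E T)"
    and a0: "a0 \<in> A"
    and iso: "\<And>T a. T \<in> \<T> \<Longrightarrow> a \<in> A \<Longrightarrow> (\<Sum>e\<in>E T. \<Sum>b\<in>B T. cnj (K T e b a) * K T e b a) = 1"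
  shows "good_code \<T> (sys_power (q * k + d) A) (\<lambda>T. sys_power (q * k + d) (B T)) (\<lambda>T. sys_power (q * k + d) (E T))
      (\<lambda>T. H T \<times> sys_power d (B T)) (\<lambda>T. kpow (q * k + d) (K T)) m \<epsilon>"
proof -
  let ?n = "q * k + d" and ?b = "\<lambda>x. blocks q k x" and ?r = "\<lambda>x. rest (q * k) d x"
  let ?A = "sys_power ?n A" and ?B = "\<lambda>T. sys_power ?n (B T)" and ?E = "\<lambda>T. sys_power ?n (E T)"
  let ?A' = "sys_power q (sys_power k A)" and ?B' = "\<lambda>T. sys_power q (sys_power k (B T))"
    and ?E' = "\<lambda>T. sys_power q (sys_power k (E T))"
  let ?D = "\<lambda>T. sys_power d (B T)" and ?K = "\<lambda>T. kpow q (kpow k (K T))"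
  define r0 where "r0 = (\<lambda>i\<in>{..<d}. a0)"
  have r0: "r0 \<in> sys_power d A" using a0 by (simp add: r0_def sys_power_def)
  define \<kappa> where "\<kappa> T r p = kpow d (K T) r p r0" for T r p
  have finp: "finite (sys_power n A)" "T \<in> \<T> \<Longrightarrow> finite (sys_power n (B T))" "T \<in> \<T> \<Longrightarrow> finite (sys_power n (E T))" for n T
    using fin finite_sys_power by blast+
  have finpp: "finite ?A'" "T \<in> \<T> \<Longrightarrow> finite (?B' T)" "T \<in> \<T> \<Longrightarrow> finite (?E' T)" for T
    using finp finite_sys_power by blast+
  let ?\<kappa> = "\<lambda>T r. \<Sum>p\<in>?D T. cnj (\<kappa> T r p) * \<kappa> T r p"
  have \<kappa>1: "(\<Sum>r\<in>sys_power d (E T). ?\<kappa> T r) = 1" if T: "T \<in> \<T>" for T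
  proof -
    have "(\<Sum>r\<in>sys_power d (E T). ?\<kappa> T r)
        = (\<Sum>r\<in>sys_power d (E T). \<Sum>p\<in>?D T. \<Prod>t<d. cnj (K T (r t) (p t) (r0 t)) * K T (r t) (p t) (r0 t))"
      by (simp add: \<kappa>_def kpow_def prod.distrib)
    also have "\<dots> = (\<Prod>t<d. \<Sum>e\<in>E T. \<Sum>b\<in>B T. cnj (K T e b (r0 t)) * K T e b (r0 t))"
      by (rule sum_sys_power2[OF fin(3)[OF T] fin(2)[OF T]])
    also have "\<dots> = (\<Prod>t<d. 1)"
      using a0 by (intro prod.cong refl iso[OF T]) (auto simp: r0_def)
    finally show ?thesis by simp
  qed
  have sum\<kappa>: "(\<Sum>e\<in>?E T. if ?b e = z then x * ?\<kappa> T (?r e) else 0) = x" if T: "T \<in> \<T>" and z: "z \<in> ?E' T" for T z x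
  proof -
    have "(\<Sum>e\<in>?E T. if ?b e = z then x * ?\<kappa> T (?r e) else 0) = x * (\<Sum>r\<in>sys_power d (E T). ?\<kappa> T r)"
      unfolding sum_blocks[OF k, where f = "\<lambda>u r. if u = z then x * ?\<kappa> T r else 0"]
      by (subst sum_delta_pair) (use z finpp(3)[OF T] in \<open>auto simp: sum_distrib_left\<close>)
    then show ?thesis unfolding \<kappa>1[OF T] by simp
  qed
  define X where "X a z = (if ?b a = z \<and> ?r a = r0 then 1 else 0 :: complex)" for a :: "nat \<Rightarrow> 'a" and z
  define Y where "Y = (\<lambda>(z, p) (b :: nat \<Rightarrow> 'b). if ?b b = z \<and> ?r b = p then 1 else 0 :: complex)"
  \<comment> \<open>The conjugated amplitudes undo the rest: summed against \<open>\<kappa>\<close>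
    they give 1, and for the same reason the rows of \<open>c T\<close> are orthonormal.\<close>
  define c where "c T z = (\<lambda>(e, p). if ?b e = z then cnj (\<kappa> T (?r e) p) else 0)" for T z
  show ?thesis
  proof (rule good_code_transfer[OF g, where X = X and Y = "\<lambda>T. Y" and c = c])
    have o: "orthon ?A' ?A (\<lambda>z a. X a z)"
      unfolding orthon_def
    proof (intro ballI)
      fix z z' assume z: "z \<in> ?A'" "z' \<in> ?A'"
      have "ip ?A (\<lambda>a. X a z) (\<lambda>a. X a z') = (\<Sum>a\<in>?A. if ?b a = z \<and> ?r a = r0 then (if z = z' then 1 else 0) else 0)"
        unfolding ip_def X_def by (intro sum.cong refl) auto
      then show "ip ?A (\<lambda>a. X a z) (\<lambda>a. X a z') = (if z = z' then 1 else 0)"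
        unfolding sum_blocks_delta[OF k fin(1) z(1) r0] .
    qed
    show "contr ?A ?A' X" using contr_orthon(2)[OF finpp(1) o] .
    fix T assume T: "T \<in> \<T>"
    have "orthon (?B' T \<times> ?D T) (?B T) Y"
      unfolding orthon_def
    proof (intro ballI)
      fix y y' assume y: "y \<in> ?B' T \<times> ?D T" "y' \<in> ?B' T \<times> ?D T"
      then have y1: "fst y \<in> ?B' T" "snd y \<in> ?D T" by auto
      have "ip (?B T) (Y y) (Y y') = (\<Sum>b\<in>?B T. if ?b b = fst y \<and> ?r b = snd y then (if y = y' then 1 else 0) else 0)"
        unfolding ip_def Y_def by (intro sum.cong refl) (auto simp: prod_eq_iff split: prod.splits)
      then show "ip (?B T) (Y y) (Y y') = (if y = y' then 1 else 0)"
        unfolding sum_blocks_delta[OF k fin(2)[OF T] y1] .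
    qed
    from contr_orthon(1)[OF _ this] have "contr (?B' T \<times> ?D T) (?B T) (\<lambda>y b. cnj (Y y b))"
      using finp(2)[OF T] finpp(2)[OF T] by blast
    from contr_cnj[OF this] show "contr (?B' T \<times> ?D T) (?B T) Y" by simp
    have oc: "orthon (?E' T) (?E T \<times> ?D T) (c T)"
      unfolding orthon_def
    proof (intro ballI)
      fix z z' assume z: "z \<in> ?E' T" "z' \<in> ?E' T"
      have "ip (?E T \<times> ?D T) (c T z) (c T z') = (\<Sum>e\<in>?E T. if ?b e = z then (if z = z' then 1 else 0) * ?\<kappa> T (?r e) else 0)"
        unfolding ip_def sum_Times c_def by (intro sum.cong refl) (auto simp: mult.commute)
      then show "ip (?E T \<times> ?D T) (c T z) (c T z') = (if z = z' then 1 else 0)"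
        unfolding sum\<kappa>[OF T z(1)] .
    qed
    from contr_cnj[OF contr_orthon(1)[OF finpp(3)[OF T] oc]]
    show "contr (?E' T) (?E T \<times> ?D T) (c T)" by simp
    fix z b a assume z: "z \<in> ?E' T" and b: "b \<in> ?B' T" and a: "a \<in> ?A'"
    have Xs: "(\<Sum>x\<in>?A. kpow ?n (K T) e y x * X x a) = ?K T (?b e) (?b y) a * \<kappa> T (?r e) (?r y)" for e y
    proof -
      have "(\<Sum>x\<in>?A. kpow ?n (K T) e y x * X x a)
          = (\<Sum>x\<in>?A. if ?b x = a \<and> ?r x = r0 then ?K T (?b e) (?b y) a * \<kappa> T (?r e) (?r y) else 0)"
        by (intro sum.cong refl) (auto simp: kpow_blocks X_def \<kappa>_def)
      then show ?thesis unfolding sum_blocks_delta[OF k fin(1) a r0] .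
    qed
    have Ys: "(\<Sum>y\<in>?B T. Y (b, p) y * (?K T (?b e) (?b y) a * \<kappa> T (?r e) (?r y))) = ?K T (?b e) b a * \<kappa> T (?r e) p"
      if p: "p \<in> ?D T" for p e
    proof -
      have "(\<Sum>y\<in>?B T. Y (b, p) y * (?K T (?b e) (?b y) a * \<kappa> T (?r e) (?r y)))
          = (\<Sum>y\<in>?B T. if ?b y = b \<and> ?r y = p then ?K T (?b e) b a * \<kappa> T (?r e) p else 0)"
        by (intro sum.cong refl) (auto simp: Y_def)
      then show ?thesis unfolding sum_blocks_delta[OF k fin(2)[OF T] b p] .
    qed
    have "(\<Sum>e\<in>?E T. \<Sum>p\<in>?D T. c T z (e, p) * (\<Sum>y\<in>?B T. Y (b, p) y * (\<Sum>x\<in>?A. kpow ?n (K T) e y x * X x a)))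
        = (\<Sum>e\<in>?E T. if ?b e = z then ?K T z b a * ?\<kappa> T (?r e) else 0)"
      unfolding Xs c_def by (intro sum.cong refl) (auto simp: Ys sum_distrib_left intro!: sum.cong)
    then show "?K T z b a = (\<Sum>e\<in>?E T. \<Sum>p\<in>?D T. c T z (e, p) *
          (\<Sum>y\<in>?B T. Y (b, p) y * (\<Sum>x\<in>?A. kpow ?n (K T) e y x * X x a)))"
      unfolding sum\<kappa>[OF T z] ..
  qed
qed

section \<open>Entropies of output and environment\<close>

definition kraus_iso :: "'a set \<Rightarrow> 'b set \<Rightarrow> 'e set \<Rightarrow> ('e \<Rightarrow> 'b \<Rightarrow> 'a \<Rightarrow> complex) \<Rightarrow> bool" where
  "kraus_iso A B E K \<longleftrightarrow> finite A \<and> finite B \<and> finite E \<and>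
     (\<forall>a\<in>A. \<forall>a'\<in>A. (\<Sum>e\<in>E. \<Sum>b\<in>B. cnj (K e b a) * K e b a') = (if a = a' then 1 else 0))"

lemma kraus_isoD:
  assumes "kraus_iso A B E K"
  shows "finite A" "finite B" "finite E"
    "\<And>a a'. a \<in> A \<Longrightarrow> a' \<in> A \<Longrightarrow> (\<Sum>e\<in>E. \<Sum>b\<in>B. cnj (K e b a) * K e b a') = (if a = a' then 1 else 0)"
  using assms unfolding kraus_iso_def by blast+

definition eta :: "real \<Rightarrow> real" where
  "eta x = - (x * log 2 x)"

text \<open>The entropy of an operator of any trace, read off from any diagonalisation on
  \<open>I\<close>; \<open>spec_sum_unique\<close> justifies \<open>THE\<close>.\<close>

definition Ent :: "'i set \<Rightarrow> 'i oper \<Rightarrow> real" where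
  "Ent I X = (THE s. \<exists>u d. spec I X I u d \<and> s = (\<Sum>k\<in>I. eta (d k)))"

lemma eta_0 [simp]: "eta 0 = 0" by (simp add: eta_def)

lemma shannon_eta: "shannon X p = (\<Sum>x\<in>X. eta (p x))"
  by (simp add: shannon_def eta_def)

lemma Ent_spec:
  assumes fin: "finite I" and s: "spec I X K u d"
  shows "Ent I X = (\<Sum>k\<in>K. eta (d k))"
proof -
  obtain v e where v: "spec I X I v e" using spectral[OF fin spec_hermitian[OF s]] by blast
  have "Ent I X = (\<Sum>k\<in>I. eta (e k))"
    unfolding Ent_def
  proof (rule the_equality)
    show "\<exists>u d. spec I X I u d \<and> (\<Sum>k\<in>I. eta (e k)) = (\<Sum>k\<in>I. eta (d k))" using v by blast
    fix s assume "\<exists>u d. spec I X I u d \<and> s = (\<Sum>k\<in>I. eta (d k))"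
    then obtain u d where "spec I X I u d" "s = (\<Sum>k\<in>I. eta (d k))" by blast
    then show "s = (\<Sum>k\<in>I. eta (e k))"
      using spec_sum_unique[where f = eta, OF fin _ v eta_0] by simp
  qed
  also have "\<dots> = (\<Sum>k\<in>K. eta (d k))" by (rule spec_sum_unique[where f = eta, OF fin v s eta_0])
  finally show ?thesis .
qed

lemma parseval_ip:
  assumes "finite K" "finite I" "orthon K I u" "card K = card I"
  shows "(\<Sum>k\<in>K. cnj (ip I (u k) x) * ip I (u k) y) = ip I x y"
proof -
  have "ip I x y = ip I x (\<lambda>i. \<Sum>k\<in>K. ip I (u k) y * u k i)"
    by (rule ip_cong) (simp_all add: orthon_expand[OF assms])
  also have "\<dots> = (\<Sum>k\<in>K. ip I (u k) y * ip I x (u k))"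
    by (simp only: ip_sum_right ip_scale_right)
  also have "\<dots> = (\<Sum>k\<in>K. cnj (ip I (u k) x) * ip I (u k) y)"
  proof (intro sum.cong refl)
    fix k
    have "ip I x (u k) = cnj (ip I (u k) x)" by (rule ip_commute)
    then show "ip I (u k) y * ip I x (u k) = cnj (ip I (u k) x) * ip I (u k) y" by simp
  qed
  finally show ?thesis ..
qed

lemma ip_outer_sum:
  "(\<Sum>l\<in>L. c l * (ip I u (x l) * cnj (ip I v (x l))))
    = ip I u (mv I (\<lambda>i j. \<Sum>l\<in>L. c l * (x l i * cnj (x l j))) v)"
proof -
  have "(\<Sum>l\<in>L. c l * (ip I u (x l) * cnj (ip I v (x l))))
      = (\<Sum>l\<in>L. \<Sum>i\<in>I. \<Sum>j\<in>I. cnj (u i) * (c l * (x l i * cnj (x l j))) * v j)"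
    unfolding ip_def cnj_sum sum_product unfolding sum_distrib_left by (intro sum.cong refl) simp
  also have "\<dots> = (\<Sum>i\<in>I. \<Sum>j\<in>I. \<Sum>l\<in>L. cnj (u i) * (c l * (x l i * cnj (x l j))) * v j)"
    by (subst sum.swap, intro sum.cong refl, rule sum.swap)
  finally show ?thesis unfolding ip_mv sum_distrib_left sum_distrib_right .
qed

lemma spec_ip:
  assumes "spec I X K u d" "k \<in> K" "l \<in> K"
  shows "ip I (u k) (mv I X (u l)) = (if k = l then of_real (d k) else 0)"
proof -
  have "ip I (u k) (mv I X (u l)) = ip I (u k) (\<lambda>i. of_real (d l) * u l i)"
    by (intro ip_cong refl spec_eigen[OF assms(1,3)])
  then show ?thesis using orthonD[OF specD(2)[OF assms(1)] assms(2,3)] by (simp add: ip_scale_right)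
qed

text \<open>The vector on environment, output and reference that the isometry with Kraus operators
  \<open>K\<close> makes of \<open>\<phi>\<close>; \<open>out_mat\<close> and \<open>env_mat\<close>
  are its marginals.\<close>

definition out_amp :: "'a set \<Rightarrow> ('e \<Rightarrow> 'b \<Rightarrow> 'a \<Rightarrow> complex) \<Rightarrow> ('r \<times> 'a \<Rightarrow> complex) \<Rightarrow> 'e \<Rightarrow> 'b \<Rightarrow> 'r \<Rightarrow> complex" where
  "out_amp A K \<phi> e b r = (\<Sum>a\<in>A. K e b a * \<phi> (r, a))"

definition out_mat :: "'r set \<Rightarrow> 'a set \<Rightarrow> 'e set \<Rightarrow> ('e \<Rightarrow> 'b \<Rightarrow> 'a \<Rightarrow> complex) \<Rightarrow> ('r \<times> 'a \<Rightarrow> complex) \<Rightarrow> 'b oper" where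
  "out_mat R A E K \<phi> b b' = (\<Sum>e\<in>E. \<Sum>r\<in>R. out_amp A K \<phi> e b r * cnj (out_amp A K \<phi> e b' r))"

definition env_mat :: "'r set \<Rightarrow> 'a set \<Rightarrow> 'b set \<Rightarrow> ('e \<Rightarrow> 'b \<Rightarrow> 'a \<Rightarrow> complex) \<Rightarrow> ('r \<times> 'a \<Rightarrow> complex) \<Rightarrow> 'e oper" where
  "env_mat R A B K \<phi> e e' = (\<Sum>b\<in>B. \<Sum>r\<in>R. out_amp A K \<phi> e b r * cnj (out_amp A K \<phi> e' b r))"

text \<open>After the sum over the reference only the reduced operator on \<open>A\<close> is left,
  and it may be replaced by its spectral form.\<close>

lemma out_amp_spec:
  assumes s: "spec A (\<lambda>a a'. \<Sum>r\<in>R. \<phi> (r, a) * cnj (\<phi> (r, a'))) A u p"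
  shows "(\<Sum>r\<in>R. out_amp A K \<phi> e b r * cnj (out_amp A K \<phi> e' b' r))
    = (\<Sum>a\<in>A. of_real (p a) * ((\<Sum>x\<in>A. K e b x * u a x) * cnj (\<Sum>x\<in>A. K e' b' x * u a x)))" (is "?lhs = _")
proof -
  have "?lhs
      = (\<Sum>r\<in>R. \<Sum>x\<in>A. \<Sum>x'\<in>A. K e b x * cnj (K e' b' x') * (\<phi> (r, x) * cnj (\<phi> (r, x'))))"
    unfolding out_amp_def cnj_sum sum_product by (intro sum.cong refl) simp
  also have "\<dots> = (\<Sum>x\<in>A. \<Sum>x'\<in>A. \<Sum>r\<in>R. K e b x * cnj (K e' b' x') * (\<phi> (r, x) * cnj (\<phi> (r, x'))))"
    by (subst sum.swap, intro sum.cong refl, rule sum.swap)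
  also have "\<dots> = (\<Sum>x\<in>A. \<Sum>x'\<in>A. K e b x * cnj (K e' b' x') * (\<Sum>a\<in>A. of_real (p a) * u a x * cnj (u a x')))"
    unfolding sum_distrib_left[symmetric] by (intro sum.cong refl) (simp add: specD(3)[OF s])
  also have "\<dots> = (\<Sum>x\<in>A. \<Sum>x'\<in>A. \<Sum>a\<in>A. of_real (p a) * ((K e b x * u a x) * cnj (K e' b' x' * u a x')))"
    unfolding sum_distrib_left by (intro sum.cong refl) simp
  also have "\<dots> = (\<Sum>a\<in>A. \<Sum>x\<in>A. \<Sum>x'\<in>A. of_real (p a) * ((K e b x * u a x) * cnj (K e' b' x' * u a x')))"
    by (rule trans, rule sum.cong[OF refl], rule sum.swap, rule sum.swap)
  finally show ?thesis unfolding cnj_sum sum_product unfolding sum_distrib_left .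
qed

lemma kraus_iso_ip:
  assumes k: "kraus_iso B S H D"
  shows "(\<Sum>h\<in>H. \<Sum>s\<in>S. (\<Sum>b\<in>B. D h s b * x b) * cnj (\<Sum>b\<in>B. D h s b * y b)) = (\<Sum>b\<in>B. x b * cnj (y b))" (is "?lhs = _")
proof -
  note fin = kraus_isoD(1-3)[OF k]
  have "?lhs = (\<Sum>b\<in>B. \<Sum>b'\<in>B. \<Sum>l\<in>H \<times> S. x b * cnj (y b') * (cnj (D (fst l) (snd l) b') * D (fst l) (snd l) b))"
    unfolding cnj_sum sum_product
    by (rule trans[rotated], rule trans[OF sum.swap], rule sum.cong[OF refl], rule sum.swap, simp add: sum_Times ac_simps)
  also have "\<dots> = (\<Sum>b\<in>B. \<Sum>b'\<in>B. if b' = b then x b * cnj (y b) else 0)"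
    unfolding sum_distrib_left[symmetric] sum_Times using kraus_isoD(4)[OF k] by (intro sum.cong refl) simp
  also have "\<dots> = (\<Sum>b\<in>B. x b * cnj (y b))" using fin by simp
  finally show ?thesis .
qed

text \<open>Input, output and environment are separate systems, so all three can be diagonalised at
  once. By Parseval the rotation of a system drops out of every sum over that system, so each
  marginal only sees its own rotation.\<close>

lemma rotated_coding:
  assumes ki: "kraus_iso A B E K" and \<phi>: "nsq (R \<times> A) \<phi> = 1"
    and su: "spec A (\<lambda>a a'. \<Sum>r\<in>R. \<phi> (r, a) * cnj (\<phi> (r, a'))) A u p"
    and p0: "\<And>a. a \<in> A \<Longrightarrow> 0 \<le> p a"
    and sv: "spec B (out_mat R A E K \<phi>) B v q"
    and sf: "spec E (env_mat R A B K \<phi>) E f w"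
  shows "coding A B E (rotated A B E u v f K) p w q"
proof -
  note fin = kraus_isoD(1-3)[OF ki]
  note ou = specD(2)[OF su] and ov = specD(2)[OF sv] and of = specD(2)[OF sf]
  define k1 where "k1 e b a = (\<Sum>x\<in>A. K e b x * u a x)" for e b a
  define k2 where "k2 e b' a = ip B (v b') (\<lambda>b. k1 e b a)" for e b' a
  define k3 where "k3 e' b' a = ip E (f e') (\<lambda>e. k2 e b' a)" for e' b' a
  have k3: "rotated A B E u v f K = k3"
    by (intro ext) (simp add: rotated_def k3_def k2_def k1_def ip_def)
  have pv_f: "(\<Sum>e'\<in>E. cnj (k3 e' b a) * k3 e' b' a') = (\<Sum>e\<in>E. cnj (k2 e b a) * k2 e b' a')" for b a b' a'
    unfolding k3_def using parseval_ip[OF fin(3,3) of refl] by (simp add: ip_def)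
  have pv_v: "(\<Sum>b'\<in>B. cnj (k2 e b' a) * k2 e' b' a') = (\<Sum>b\<in>B. cnj (k1 e b a) * k1 e' b a')" for e a e' a'
    unfolding k2_def using parseval_ip[OF fin(2,2) ov refl] by (simp add: ip_def)
  have iso: "(\<Sum>e\<in>E. \<Sum>b\<in>B. cnj (k3 e b a) * k3 e b a') = (if a = a' then 1 else 0)" (is "?lhs = _") if a: "a \<in> A" "a' \<in> A" for a a'
  proof -
    have "?lhs = (\<Sum>b\<in>B. \<Sum>e\<in>E. cnj (k3 e b a) * k3 e b a')" by (rule sum.swap)
    also have "\<dots> = (\<Sum>b\<in>B. \<Sum>e\<in>E. cnj (k2 e b a) * k2 e b a')" unfolding pv_f ..
    also have "\<dots> = (\<Sum>e\<in>E. \<Sum>b\<in>B. cnj (k2 e b a) * k2 e b a')" by (rule sum.swap)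
    also have "\<dots> = (\<Sum>e\<in>E. \<Sum>b\<in>B. cnj (k1 e b a) * k1 e b a')" unfolding pv_v ..
    also have "\<dots> = ip A (u a) (u a')"
      using kraus_iso_ip[OF ki, of "u a'" "u a"] unfolding k1_def by (simp add: ip_def mult.commute)
    finally show ?thesis using orthonD[OF ou a] by simp
  qed
  let ?G = "\<lambda>k2. \<lambda>e e'. \<Sum>y\<in>B \<times> A. of_real (p (snd y)) * (k2 e (fst y) (snd y) * cnj (k2 e' (fst y) (snd y)))"
  have env: "(\<Sum>b\<in>B. \<Sum>a\<in>A. of_real (p a) * (k3 e1 b a * cnj (k3 e2 b a))) = (if e1 = e2 then of_real (w e1) else 0)" (is "?lhs2 = _")
    if e: "e1 \<in> E" "e2 \<in> E" for e1 e2
  proof -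
    have "?lhs2
        = (\<Sum>y\<in>B \<times> A. of_real (p (snd y)) * (ip E (f e1) (\<lambda>e. k2 e (fst y) (snd y)) * cnj (ip E (f e2) (\<lambda>e. k2 e (fst y) (snd y)))))"
      by (simp add: sum_Times k3_def)
    also have "\<dots> = ip E (f e1) (mv E (?G k2) (f e2))"
      by (rule ip_outer_sum)
    also have "?G k2
        = env_mat R A B K \<phi>"
    proof (intro ext)
      fix e e'
      have "(\<Sum>y\<in>B \<times> A. of_real (p (snd y)) * (k2 e (fst y) (snd y) * cnj (k2 e' (fst y) (snd y))))
          = (\<Sum>a\<in>A. \<Sum>b\<in>B. of_real (p a) * (cnj (k2 e' b a) * k2 e b a))"
        unfolding sum_Times by (subst sum.swap) (simp add: mult.commute)
      also have "\<dots> = (\<Sum>a\<in>A. \<Sum>b\<in>B. of_real (p a) * (cnj (k1 e' b a) * k1 e b a))"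
        unfolding sum_distrib_left[symmetric] pv_v ..
      also have "\<dots> = (\<Sum>b\<in>B. \<Sum>a\<in>A. of_real (p a) * (k1 e b a * cnj (k1 e' b a)))"
        by (subst sum.swap) (simp add: mult.commute)
      finally show "(\<Sum>y\<in>B \<times> A. of_real (p (snd y)) * (k2 e (fst y) (snd y) * cnj (k2 e' (fst y) (snd y))))
          = env_mat R A B K \<phi> e e'"
        unfolding env_mat_def out_amp_spec[OF su] k1_def .
    qed
    finally show ?thesis using spec_ip[OF sf e] by simp
  qed
  let ?F = "\<lambda>b b'. \<Sum>y\<in>A \<times> E. of_real (p (fst y)) * (k1 (snd y) b (fst y) * cnj (k1 (snd y) b' (fst y)))"
  have out: "(\<Sum>e\<in>E. \<Sum>a\<in>A. of_real (p a) * (k3 e b1 a * cnj (k3 e b2 a))) = (if b1 = b2 then of_real (q b1) else 0)" (is "?lhs3 = _")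
    if b: "b1 \<in> B" "b2 \<in> B" for b1 b2
  proof -
    have "?lhs3
        = (\<Sum>a\<in>A. \<Sum>e\<in>E. of_real (p a) * (cnj (k3 e b2 a) * k3 e b1 a))"
      by (subst sum.swap) (simp add: mult.commute)
    also have "\<dots> = (\<Sum>a\<in>A. \<Sum>e\<in>E. of_real (p a) * (cnj (k2 e b2 a) * k2 e b1 a))"
      unfolding sum_distrib_left[symmetric] pv_f ..
    also have "\<dots> = (\<Sum>y\<in>A \<times> E. of_real (p (fst y)) * (ip B (v b1) (\<lambda>b. k1 (snd y) b (fst y)) * cnj (ip B (v b2) (\<lambda>b. k1 (snd y) b (fst y)))))"
      by (simp add: sum_Times k2_def mult.commute)
    also have "\<dots> = ip B (v b1) (mv B ?F (v b2))"
      by (rule ip_outer_sum)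
    also have "?F
        = out_mat R A E K \<phi>"
    proof (intro ext)
      fix b b'
      show "(\<Sum>y\<in>A \<times> E. of_real (p (fst y)) * (k1 (snd y) b (fst y) * cnj (k1 (snd y) b' (fst y)))) = out_mat R A E K \<phi> b b'"
        unfolding out_mat_def out_amp_spec[OF su] k1_def sum_Times fst_conv snd_conv by (rule sum.swap)
    qed
    finally show ?thesis using spec_ip[OF sv b] by simp
  qed
  have "of_real (sum p A) = (\<Sum>a\<in>A. \<Sum>r\<in>R. \<phi> (r, a) * cnj (\<phi> (r, a)))"
    using spec_trace[OF su fin(1)] by simp
  also have "\<dots> = of_real (nsq (R \<times> A) \<phi>)"
    unfolding nsq_def sum_Times of_real_sum complex_norm_square by (rule sum.swap)
  finally have "sum p A = 1" unfolding \<phi> of_real_eq_iff .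
  then show ?thesis
    unfolding coding_def k3 by (intro conjI ballI fin p0 iso env out)
qed

lemma gram_psd: "psd I (\<lambda>i j. \<Sum>l\<in>L. x l i * cnj (x l j))"
  unfolding psd_def
proof
  fix v
  have "ip I v (mv I (\<lambda>i j. \<Sum>l\<in>L. x l i * cnj (x l j)) v)
      = (\<Sum>l\<in>L. 1 * (ip I v (x l) * cnj (ip I v (x l))))"
    unfolding ip_outer_sum by simp
  also have "\<dots> = of_real (\<Sum>l\<in>L. (cmod (ip I v (x l)))^2)"
    unfolding of_real_sum complex_norm_square by simp
  finally show "ip I v (mv I (\<lambda>i j. \<Sum>l\<in>L. x l i * cnj (x l j)) v) \<in> \<real>\<^sub>\<ge>\<^sub>0"
    by (simp only: nonneg_Reals_of_real_iff) (simp add: sum_nonneg)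
qed

lemma psd_cong:
  assumes "\<And>i j. i \<in> I \<Longrightarrow> j \<in> I \<Longrightarrow> X i j = Y i j"
  shows "psd I X = psd I Y"
proof -
  have "ip I v (mv I X v) = ip I v (mv I Y v)" for v
    using assms by (intro ip_cong) (simp_all add: mv_def)
  then show ?thesis by (simp add: psd_def)
qed

lemma out_mat_psd: "psd B (out_mat R A E K \<phi>)"
proof -
  have "out_mat R A E K \<phi> = (\<lambda>b b'. \<Sum>y\<in>E \<times> R. out_amp A K \<phi> (fst y) b (snd y) * cnj (out_amp A K \<phi> (fst y) b' (snd y)))"
    by (intro ext) (simp add: out_mat_def sum_Times)
  then show ?thesis using gram_psd[of B "\<lambda>y b. out_amp A K \<phi> (fst y) b (snd y)" "E \<times> R"] by simp
qed

lemma env_mat_psd: "psd E (env_mat R A B K \<phi>)"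
proof -
  have "env_mat R A B K \<phi> = (\<lambda>e e'. \<Sum>y\<in>B \<times> R. out_amp A K \<phi> e (fst y) (snd y) * cnj (out_amp A K \<phi> e' (fst y) (snd y)))"
    by (intro ext) (simp add: env_mat_def sum_Times)
  then show ?thesis using gram_psd[of E "\<lambda>y e. out_amp A K \<phi> e (fst y) (snd y)" "B \<times> R"] by simp
qed

lemma kraus_iso_power:
  assumes "kraus_iso A B E K"
  shows "kraus_iso (sys_power n A) (sys_power n B) (sys_power n E) (kpow n K)"
proof -
  note fin = kraus_isoD(1-3)[OF assms]
  have "(\<Sum>e\<in>sys_power n E. \<Sum>b\<in>sys_power n B. cnj (kpow n K e b a) * kpow n K e b a') = (if a = a' then 1 else 0)" (is "?lhs = _")
    if a: "a \<in> sys_power n A" "a' \<in> sys_power n A" for a a'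
  proof -
    have "?lhs
        = (\<Sum>e\<in>sys_power n E. \<Sum>b\<in>sys_power n B. \<Prod>t<n. cnj (K (e t) (b t) (a t)) * K (e t) (b t) (a' t))"
      by (simp add: kpow_def prod.distrib)
    also have "\<dots> = (\<Prod>t<n. \<Sum>e\<in>E. \<Sum>b\<in>B. cnj (K e b (a t)) * K e b (a' t))"
      by (rule sum_sys_power2[OF fin(3,2)])
    also have "\<dots> = (\<Prod>t<n. if a t = a' t then 1 else 0)"
      using a by (intro prod.cong refl kraus_isoD(4)[OF assms]) (auto dest: sys_powerD)
    finally show ?thesis by (simp add: prod_delta_sys_power[OF a])
  qed
  then show ?thesis unfolding kraus_iso_def by (intro conjI ballI finite_sys_power fin)
qed

section \<open>Spectral functions and fidelity\<close>

lemma op_diag_conj: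
  assumes "finite I"
  shows "op_mult I (op_mult I U (op_diag I d)) (op_adjoint U) i j
    = (\<Sum>k\<in>I. of_real (d k) * U i k * cnj (U j k))"
proof -
  have "op_mult I U (op_diag I d) i k = U i k * of_real (d k)" if "k \<in> I" for k
  proof -
    have "op_mult I U (op_diag I d) i k = (\<Sum>l\<in>I. if l = k then U i k * of_real (d k) else 0)"
      unfolding op_mult_def op_diag_def by (intro sum.cong refl) auto
    then show ?thesis using assms that by simp
  qed
  then show ?thesis
    unfolding op_mult_def[of I "op_mult I U (op_diag I d)"] op_adjoint_def
    by (intro sum.cong refl) (simp add: mult.commute)
qed

lemma op_unitary_orthon:
  assumes "op_unitary I U"
  shows "orthon I I (\<lambda>k i. U i k)"
  unfolding orthon_def
proof (intro ballI)
  fix k l assume kl: "k \<in> I" "l \<in> I"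
  have "ip I (\<lambda>i. U i k) (\<lambda>i. U i l) = op_mult I (op_adjoint U) U k l"
    by (simp add: ip_def op_mult_def op_adjoint_def)
  also have "\<dots> = op_one I k l" using assms by (simp add: op_unitary_def)
  finally show "ip I (\<lambda>i. U i k) (\<lambda>i. U i l) = (if k = l then 1 else 0)"
    using kl by (simp add: op_one_def op_diag_def)
qed

lemma spec_unitary:
  assumes fin: "finite I" and s: "spec I X I u d" and X: "X \<in> opers I"
  defines "U \<equiv> \<lambda>i k. if i \<in> I \<and> k \<in> I then u k i else 0"
  shows "op_unitary I U" "X = op_mult I (op_mult I U (op_diag I d)) (op_adjoint U)"
proof -
  have 1: "op_mult I (op_adjoint U) U k l = op_one I k l" for k l
  proof (cases "k \<in> I \<and> l \<in> I")
    case True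
    then have "op_mult I (op_adjoint U) U k l = ip I (u k) (u l)"
      by (simp add: ip_def op_mult_def op_adjoint_def U_def)
    then show ?thesis using True orthonD[OF specD(2)[OF s]] by (simp add: op_one_def op_diag_def)
  qed (auto simp: op_mult_def op_adjoint_def U_def op_one_def op_diag_def)
  have 2: "op_mult I U (op_adjoint U) i j = op_one I i j" for i j
  proof (cases "i \<in> I \<and> j \<in> I")
    case True
    then have "op_mult I U (op_adjoint U) i j = (\<Sum>k\<in>I. u k i * cnj (u k j))"
      by (simp add: op_mult_def op_adjoint_def U_def)
    then show ?thesis using True orthon_complete[OF fin fin specD(2)[OF s] refl] by (simp add: op_one_def op_diag_def)
  qed (auto simp: op_mult_def op_adjoint_def U_def op_one_def op_diag_def)
  show "op_unitary I U"
    unfolding op_unitary_def using 1 2 by (auto simp: opers_def U_def intro!: ext)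
  show "X = op_mult I (op_mult I U (op_diag I d)) (op_adjoint U)"
  proof (intro ext)
    fix i j
    show "X i j = op_mult I (op_mult I U (op_diag I d)) (op_adjoint U) i j"
    proof (cases "i \<in> I \<and> j \<in> I")
      case True
      then show ?thesis unfolding op_diag_conj[OF fin] using specD(3)[OF s] by (simp add: U_def)
    next
      case False
      then have "X i j = 0" using X by (auto simp: opers_def)
      then show ?thesis unfolding op_diag_conj[OF fin] using False by (auto simp: U_def)
    qed
  qed
qed

text \<open>\<open>SOME\<close> hides which diagonalisation was taken; a common eigenbasis of
  \<open>X\<close> and \<open>op_fun f I X\<close> is what is extracted here.\<close>

lemma op_fun_spec:
  assumes fin: "finite I" and h: "hermitian I X" and X: "X \<in> opers I"
  shows "\<exists>u d. spec I X I u d \<and> spec I (op_fun f I X) I u (\<lambda>k. f (d k)) \<and> op_fun f I X \<in> opers I"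
proof -
  let ?P = "\<lambda>B. \<exists>U d. op_unitary I U \<and> X = op_mult I (op_mult I U (op_diag I d)) (op_adjoint U) \<and>
     B = op_mult I (op_mult I U (op_diag I (\<lambda>i. f (d i)))) (op_adjoint U)"
  obtain u0 d0 where "spec I X I u0 d0" using spectral[OF fin h] by blast
  from spec_unitary[OF fin this X] have "\<exists>B. ?P B" by blast
  then have "?P (op_fun f I X)" unfolding op_fun_def by (rule someI_ex)
  then obtain U d where U: "op_unitary I U" "X = op_mult I (op_mult I U (op_diag I d)) (op_adjoint U)"
    "op_fun f I X = op_mult I (op_mult I U (op_diag I (\<lambda>i. f (d i)))) (op_adjoint U)" by blast
  have "spec I X I (\<lambda>k i. U i k) d"
    unfolding spec_def by (intro conjI fin op_unitary_orthon[OF U(1)] ballI, subst U(2), rule op_diag_conj[OF fin])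
  moreover have "spec I (op_fun f I X) I (\<lambda>k i. U i k) (\<lambda>k. f (d k))"
    unfolding spec_def U(3) by (intro conjI fin op_unitary_orthon[OF U(1)] ballI op_diag_conj[OF fin])
  moreover have "U i k = 0" if "i \<notin> I" for i k
    using U(1) that by (simp add: op_unitary_def opers_def)
  then have "op_fun f I X \<in> opers I"
    unfolding U(3) opers_def op_diag_conj[OF fin] by (auto intro!: sum.neutral)
  ultimately show ?thesis by blast
qed

lemma spec_mult:
  assumes s: "spec I X K u d" and t: "spec I Y K u e"
  shows "spec I (op_mult I X Y) K u (\<lambda>k. d k * e k)"
proof -
  have "op_mult I X Y i j = (\<Sum>k\<in>K. of_real (d k * e k) * u k i * cnj (u k j))" if i: "i \<in> I" and j: "j \<in> I" for i j
  proof -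
    have "ip I (u k) (\<lambda>l. Y l j) = of_real (e k) * cnj (u k j)" if k: "k \<in> K" for k
    proof -
      have "ip I (u k) (\<lambda>l. Y l j) = cnj (mv I Y (u k) j)"
        unfolding ip_def mv_def cnj_sum
      proof (intro sum.cong refl)
        fix l assume "l \<in> I"
        then have "Y l j = cnj (Y j l)" using spec_hermitian[OF t] j unfolding hermitian_def by blast
        then show "cnj (u k l) * Y l j = cnj (Y j l * u k l)" by simp
      qed
      then show ?thesis using spec_eigen[OF t k j] by simp
    qed
    then have "mv I X (\<lambda>l. Y l j) i = (\<Sum>k\<in>K. of_real (d k) * (of_real (e k) * cnj (u k j)) * u k i)"
      unfolding spec_mv[OF s i] by (intro sum.cong refl) simp
    then show ?thesis by (simp add: op_mult_def mv_def ac_simps)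
  qed
  then show ?thesis using specD(1,2)[OF s] by (simp add: spec_def)
qed

lemma vn_entropy_Ent:
  assumes fin: "finite I" and h: "hermitian I X" and X: "X \<in> opers I"
  shows "vn_entropy I X = Ent I X"
proof -
  obtain u d where s: "spec I X I u d" "spec I (op_fun (log 2) I X) I u (\<lambda>k. log 2 (d k))"
    using op_fun_spec[OF fin h X] by blast
  have "op_trace I (op_mult I X (op_fun (log 2) I X)) = of_real (\<Sum>k\<in>I. d k * log 2 (d k))"
    unfolding op_trace_def by (rule spec_trace[OF spec_mult[OF s] fin])
  then have "vn_entropy I X = - (\<Sum>k\<in>I. d k * log 2 (d k))"
    by (simp add: vn_entropy_def)
  also have "\<dots> = Ent I X" unfolding Ent_spec[OF fin s(1)] by (simp add: eta_def sum_negf)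
  finally show ?thesis .
qed

lemma ketbra_hermitian: "hermitian I (ketbra v)"
  by (simp add: hermitian_def ketbra_def)

lemma ketbra_opers: "(\<And>i. i \<notin> I \<Longrightarrow> v i = 0) \<Longrightarrow> ketbra v \<in> opers I"
  by (auto simp: opers_def ketbra_def)

lemma mv_ketbra: "mv I (ketbra v) x i = v i * ip I v x"
  by (simp add: mv_def ketbra_def ip_def sum_distrib_left mult.assoc)

lemma unit_ketsD:
  assumes "\<phi> \<in> unit_kets I"
  shows "\<And>i. i \<notin> I \<Longrightarrow> \<phi> i = 0" "nsq I \<phi> = 1"
  using assms by (auto simp: unit_kets_def nsq_def)

text \<open>For a unit vector both the eigenvalue and its square equal the squared overlap of the
  eigenvector with \<open>\<phi>\<close>. The eigenvalues are thus 0 or 1, which \<open>sqrt\<close>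
  fixes.\<close>

lemma op_sqrt_ketbra:
  assumes fin: "finite I" and \<phi>: "\<phi> \<in> unit_kets I"
  shows "op_sqrt I (ketbra \<phi>) = ketbra \<phi>"
proof -
  have X: "ketbra \<phi> \<in> opers I" by (rule ketbra_opers[OF unit_ketsD(1)[OF \<phi>]])
  obtain u d where s: "spec I (ketbra \<phi>) I u d" "spec I (op_sqrt I (ketbra \<phi>)) I u (\<lambda>k. sqrt (d k))"
    and O: "op_sqrt I (ketbra \<phi>) \<in> opers I"
    using op_fun_spec[OF fin ketbra_hermitian X] unfolding op_sqrt_def by blast
  have "sqrt (d k) = d k" if k: "k \<in> I" for k
  proof -
    have "nsq I (mv I (ketbra \<phi>) (u k)) = nsq I (\<lambda>i. of_real (d k) * u k i)"
      by (rule nsq_cong) (rule spec_eigen[OF s(1) k])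
    then have "(d k)^2 = nsq I (mv I (ketbra \<phi>) (u k))"
      using orthon_nsq[OF specD(2)[OF s(1)] k] by (simp add: nsq_scale)
    also have "\<dots> = nsq I (\<lambda>i. ip I \<phi> (u k) * \<phi> i)"
      by (rule nsq_cong) (simp add: mv_ketbra mult.commute)
    also have "\<dots> = (cmod (ip I \<phi> (u k)))^2"
      using unit_ketsD(2)[OF \<phi>] by (simp add: nsq_scale)
    finally have 1: "(d k)^2 = (cmod (ip I \<phi> (u k)))^2" .
    have "of_real (d k) = ip I (u k) (mv I (ketbra \<phi>) (u k))"
      by (rule spec_eigenvalue[OF s(1) k, symmetric])
    also have "\<dots> = ip I (u k) (\<lambda>i. ip I \<phi> (u k) * \<phi> i)"
      by (rule ip_cong) (simp_all add: mv_ketbra mult.commute)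
    also have "\<dots> = ip I \<phi> (u k) * cnj (ip I \<phi> (u k))"
      unfolding ip_scale_right using ip_commute[of I "u k" \<phi>] by simp
    finally have "d k = (cmod (ip I \<phi> (u k)))^2"
      unfolding complex_norm_square[symmetric] of_real_eq_iff .
    then have "(d k)^2 = d k" using 1 by simp
    then have "d k = 0 \<or> d k = 1" by (simp add: power2_eq_square)
    then show ?thesis by auto
  qed
  then have "op_sqrt I (ketbra \<phi>) i j = ketbra \<phi> i j" if "i \<in> I" "j \<in> I" for i j
    using specD(3)[OF s(1) that] specD(3)[OF s(2) that] by simp
  moreover have "op_sqrt I (ketbra \<phi>) i j = 0" "ketbra \<phi> i j = 0" if "\<not> (i \<in> I \<and> j \<in> I)" for i j
    using O X that by (auto simp: opers_def)
  ultimately show ?thesis by (intro ext) metis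
qed

text \<open>The rank-one operator has a spectral decomposition over a one-point index set, or over
  the empty one if \<open>w\<close> is 0 on \<open>I\<close>; uniqueness of spectral sums transfers
  the result to the basis behind \<open>op_sqrt\<close>.\<close>

lemma trace_op_sqrt_ketbra:
  assumes fin: "finite I" and w: "\<And>i. i \<notin> I \<Longrightarrow> w i = 0"
  shows "op_trace I (op_sqrt I (ketbra w)) = complex_of_real (sqrt (nsq I w))" (is "?lhs = _")
proof -
  have wop: "ketbra w \<in> opers I" by (rule ketbra_opers) (rule w)
  obtain u d where s: "spec I (ketbra w) I u d" "spec I (op_sqrt I (ketbra w)) I u (\<lambda>k. sqrt (d k))"
    using op_fun_spec[OF fin ketbra_hermitian wop] unfolding op_sqrt_def by blast
  have "?lhs = complex_of_real (\<Sum>k\<in>I. sqrt (d k))"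
    unfolding op_trace_def by (rule spec_trace[OF s(2) fin])
  also have "(\<Sum>k\<in>I. sqrt (d k)) = sqrt (nsq I w)"
  proof (cases "nsq I w = 0")
    case True
    then have "ketbra w i j = 0" if "i \<in> I" for i j
      using nsq_eq_0[OF fin] that by (simp add: ketbra_def)
    then have "spec I (ketbra w) ({} :: unit set) (\<lambda>_ _. 0) (\<lambda>_. 0)"
      by (simp add: spec_def orthon_def)
    from spec_sum_unique[where f = sqrt, OF fin s(1) this] show ?thesis using True by simp
  next
    case False
    then have pos: "0 < nsq I w" using nsq_nonneg[of I w] by linarith
    define c where "c = complex_of_real (1 / sqrt (nsq I w))"
    have "nsq I (\<lambda>i. c * w i) = 1"
      unfolding nsq_scale c_def using pos by (simp add: norm_divide power_divide)
    then have o: "orthon {()} I (\<lambda>_ i. c * w i)" by (simp add: orthon_def ip_self)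
    have "1 / sqrt (nsq I w) * (1 / sqrt (nsq I w)) * nsq I w = 1" using pos by simp
    then have "c * cnj c * complex_of_real (nsq I w) = 1"
      unfolding c_def complex_cnj_complex_of_real by (simp only: of_real_1 flip: of_real_mult)
    then have e: "complex_of_real (nsq I w) * (c * x) * cnj (c * y) = x * cnj y" for x y
      by (simp add: mult.commute mult.left_commute) (simp add: mult.assoc[symmetric])
    have "spec I (ketbra w) {()} (\<lambda>_ i. c * w i) (\<lambda>_. nsq I w)"
      unfolding spec_def using o e by (simp add: ketbra_def)
    from spec_sum_unique[where f = sqrt, OF fin s(1) this] show ?thesis by simp
  qed
  finally show ?thesis .
qed

text \<open>With \<open>w\<close> the image of \<open>\<phi>\<close> under the root of
  \<open>\<sigma>\<close>, the product inside the trace norm is |\<phi>><w|. Its trace norm is the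
  length of \<open>w\<close>, and the squared length is the expectation of \<open>\<sigma>\<close>
  in \<open>\<phi>\<close>.\<close>

theorem fidelity_ketbra:
  assumes fin: "finite I" and \<phi>: "\<phi> \<in> unit_kets I" and psd: "psd I \<sigma>" and op: "\<sigma> \<in> opers I"
  shows "fidelity I (ketbra \<phi>) \<sigma> = Re (ip I \<phi> (mv I \<sigma> \<phi>))" (is "?lhs = _")
proof -
  obtain u d where s: "spec I \<sigma> I u d" "spec I (op_sqrt I \<sigma>) I u (\<lambda>k. sqrt (d k))" and O: "op_sqrt I \<sigma> \<in> opers I"
    using op_fun_spec[OF fin psd_hermitian[OF fin psd] op] unfolding op_sqrt_def by blast
  define S where "S = op_sqrt I \<sigma>"
  define w where "w = mv I S \<phi>"
  have w0: "w i = 0" if "i \<notin> I" for i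
    using O that by (simp add: w_def mv_def S_def opers_def)
  have hS: "hermitian I S" unfolding S_def by (rule spec_hermitian[OF s(2)])
  have X: "op_mult I (ketbra \<phi>) S i j = \<phi> i * cnj (w j)" for i j
  proof (cases "j \<in> I")
    case True
    have "op_mult I (ketbra \<phi>) S i j = (\<Sum>k\<in>I. \<phi> i * cnj (S j k * \<phi> k))"
      unfolding op_mult_def ketbra_def
    proof (intro sum.cong refl)
      fix k assume "k \<in> I"
      then have "S k j = cnj (S j k)" using hS True unfolding hermitian_def by blast
      then show "\<phi> i * cnj (\<phi> k) * S k j = \<phi> i * cnj (S j k * \<phi> k)" by simp
    qed
    then show ?thesis by (simp only: w_def mv_def cnj_sum sum_distrib_left)
  next
    case False
    then have "S k j = 0" for k using O by (simp add: S_def opers_def)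
    then show ?thesis using w0[OF False] by (simp add: op_mult_def)
  qed
  have X': "op_mult I (ketbra \<phi>) S = (\<lambda>i j. \<phi> i * cnj (w j))" by (intro ext X)
  let ?F = "op_mult I (ketbra \<phi>) S"
  have "op_mult I (op_adjoint ?F) ?F = ketbra w"
  proof (intro ext)
    fix i j
    have "op_mult I (op_adjoint ?F) ?F i j
        = (\<Sum>k\<in>I. (w i * cnj (w j)) * (cnj (\<phi> k) * \<phi> k))"
      unfolding X' op_adjoint_def unfolding op_mult_def by (intro sum.cong refl) simp
    also have "\<dots> = w i * cnj (w j) * ip I \<phi> \<phi>" by (simp only: ip_def sum_distrib_left)
    finally show "op_mult I (op_adjoint ?F) ?F i j = ketbra w i j"
      using unit_ketsD(2)[OF \<phi>] by (simp add: ip_self ketbra_def)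
  qed
  then have "trace_norm I ?F = sqrt (nsq I w)"
    unfolding trace_norm_def using trace_op_sqrt_ketbra[OF fin w0] by simp
  then have "?lhs = nsq I w"
    unfolding fidelity_def op_sqrt_ketbra[OF fin \<phi>] S_def by simp
  also have "nsq I w = nsq I (\<lambda>i. \<Sum>k\<in>I. (of_real (sqrt (d k)) * ip I (u k) \<phi>) * u k i)"
    unfolding w_def S_def by (rule nsq_cong) (rule spec_mv[OF s(2)])
  also have "\<dots> = (\<Sum>k\<in>I. d k * (cmod (ip I (u k) \<phi>))^2)"
    unfolding nsq_orthon_comb[OF fin specD(2)[OF s(1)]]
    using psd_spec_nonneg[OF psd s(1)] by (intro sum.cong refl) (simp add: norm_mult power_mult_distrib)
  also have "\<dots> = Re (ip I \<phi> (mv I \<sigma> \<phi>))" unfolding spec_form[OF s(1)] by simp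
  finally show ?thesis .
qed

lemma fidelity_gram:
  assumes fin: "finite I" and \<phi>: "\<phi> \<in> unit_kets I"
    and \<sigma>: "\<And>i j. \<sigma> i j = (if i \<in> I \<and> j \<in> I then \<Sum>l\<in>L. x l i * cnj (x l j) else 0)"
  shows "fidelity I (ketbra \<phi>) \<sigma> = (\<Sum>l\<in>L. (cmod (ip I \<phi> (x l)))^2)" (is "?lhs = _")
proof -
  have "psd I \<sigma> = psd I (\<lambda>i j. \<Sum>l\<in>L. x l i * cnj (x l j))" by (rule psd_cong) (simp add: \<sigma>)
  then have "psd I \<sigma>" using gram_psd[of I x L] by simp
  moreover have "\<sigma> \<in> opers I" by (simp add: opers_def \<sigma>)
  ultimately have "?lhs = Re (ip I \<phi> (mv I \<sigma> \<phi>))"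
    by (rule fidelity_ketbra[OF fin \<phi>])
  also have "ip I \<phi> (mv I \<sigma> \<phi>) = ip I \<phi> (mv I (\<lambda>i j. \<Sum>l\<in>L. 1 * (x l i * cnj (x l j))) \<phi>)"
    by (intro ip_cong refl) (simp add: mv_def \<sigma>)
  also have "\<dots> = (\<Sum>l\<in>L. 1 * (ip I \<phi> (x l) * cnj (ip I \<phi> (x l))))"
    by (rule ip_outer_sum[symmetric])
  also have "\<dots> = of_real (\<Sum>l\<in>L. (cmod (ip I \<phi> (x l)))^2)"
    unfolding of_real_sum complex_norm_square by simp
  finally show ?thesis by simp
qed

section \<open>Entropies of Gram operators\<close>

definition gram :: "'l set \<Rightarrow> ('l \<Rightarrow> 'i \<Rightarrow> complex) \<Rightarrow> 'i oper" where
  "gram L x = (\<lambda>i j. \<Sum>l\<in>L. x l i * cnj (x l j))"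

lemma psd_gram: "psd I (gram L x)"
  unfolding gram_def by (rule gram_psd)

lemma gram_form: "ip I u (mv I (gram L x) v) = (\<Sum>l\<in>L. ip I u (x l) * cnj (ip I v (x l)))"
  using ip_outer_sum[of "\<lambda>_. 1" I u x v L] by (simp add: gram_def)

lemma gram_trace: "(\<Sum>i\<in>I. gram L x i i) = of_real (\<Sum>l\<in>L. nsq I (x l))"
  unfolding gram_def nsq_def of_real_sum complex_norm_square by (rule sum.swap)

lemma gram_eigenvalue:
  assumes fin: "finite I" and s: "spec I (gram L x) I u d" and k: "k \<in> I"
  shows "d k = (\<Sum>l\<in>L. (cmod (ip I (u k) (x l)))^2)"
proof -
  have "of_real (d k) = (\<Sum>l\<in>L. ip I (u k) (x l) * cnj (ip I (u k) (x l)))"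
    using spec_eigenvalue[OF s k] by (simp only: gram_form)
  also have "\<dots> = of_real (\<Sum>l\<in>L. (cmod (ip I (u k) (x l)))^2)"
    by (simp only: of_real_sum complex_norm_square)
  finally show ?thesis by (simp only: of_real_eq_iff)
qed

lemma gram_dual_orthon:
  assumes fin: "finite I" and s: "spec I (gram L x) I u d"
  shows "orthon {k\<in>I. 0 < d k} L (\<lambda>k l. of_real (1 / sqrt (d k)) * ip I (u k) (x l))"
  unfolding orthon_def
proof (intro ballI)
  fix k k' assume "k \<in> {k\<in>I. 0 < d k}" "k' \<in> {k\<in>I. 0 < d k}"
  then have k: "k \<in> I" "k' \<in> I" "0 < d k" "0 < d k'" by auto
  let ?c = "\<lambda>k. of_real (1 / sqrt (d k))"
  have "ip L (\<lambda>l. ?c k * ip I (u k) (x l)) (\<lambda>l. ?c k' * ip I (u k') (x l))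
      = ?c k * ?c k' * (\<Sum>l\<in>L. ip I (u k') (x l) * cnj (ip I (u k) (x l)))"
    unfolding ip_def[of L] sum_distrib_left by (intro sum.cong refl) simp
  also have "\<dots> = ?c k * ?c k' * (if k' = k then of_real (d k') else 0)"
    unfolding gram_form[symmetric] spec_ip[OF s k(2,1)] ..
  also have "\<dots> = (if k = k' then 1 else 0)"
  proof (cases "k = k'")
    case True
    have "1 / sqrt (d k') * (1 / sqrt (d k')) * d k' = 1" using k(4) by simp
    then show ?thesis using True by (simp only: if_True refl of_real_1 flip: of_real_mult)
  qed auto
  finally show "ip L (\<lambda>l. ?c k * ip I (u k) (x l)) (\<lambda>l. ?c k' * ip I (u k') (x l)) = (if k = k' then 1 else 0)" .
qed

text \<open>Schmidt decomposition: \<open>x l i\<close> is a vector on two systems, and its two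
  marginals share their nonzero spectrum. Complex conjugation, which the dual Gram operator leaves
  out, does not affect eigenvalues.\<close>

lemma Ent_gram_dual:
  assumes fin: "finite I" "finite L"
  shows "Ent I (gram L x) = Ent L (gram I (\<lambda>i l. x l i))"
proof -
  obtain u d where s: "spec I (gram L x) I u d" and d0: "\<And>k. k \<in> I \<Longrightarrow> 0 \<le> d k"
    using psd_spectral[OF fin(1) psd_gram] by blast
  define K where "K = {k\<in>I. 0 < d k}"
  define y where "y k l = complex_of_real (1 / sqrt (d k)) * ip I (u k) (x l)" for k l
  have o: "orthon K L y" unfolding K_def y_def by (rule gram_dual_orthon[OF fin(1) s])
  have "gram I (\<lambda>i l. x l i) l l' = (\<Sum>k\<in>K. complex_of_real (d k) * y k l * cnj (y k l'))" (is "?lhs = _") if l: "l \<in> L" "l' \<in> L" for l l'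
  proof -
    have "?lhs = ip I (x l') (x l)"
      by (simp add: gram_def ip_def mult.commute)
    also have "\<dots> = (\<Sum>k\<in>I. cnj (ip I (u k) (x l')) * ip I (u k) (x l))"
      by (rule parseval_ip[OF fin(1,1) specD(2)[OF s] refl, symmetric])
    also have "\<dots> = (\<Sum>k\<in>K. cnj (ip I (u k) (x l')) * ip I (u k) (x l))"
    proof (intro sum.mono_neutral_right fin ballI)
      fix k assume k: "k \<in> I - K"
      then have "d k = 0" using d0[of k] by (auto simp: K_def)
      then have "(\<Sum>l\<in>L. (cmod (ip I (u k) (x l)))^2) = 0"
        using gram_eigenvalue[OF fin(1) s, of k] k by simp
      then have "(cmod (ip I (u k) (x l)))^2 = 0"
        using sum_nonneg_eq_0_iff[of L "\<lambda>l. (cmod (ip I (u k) (x l)))^2"] fin(2) l(1) by simp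
      then show "cnj (ip I (u k) (x l')) * ip I (u k) (x l) = 0" by simp
    qed (auto simp: K_def)
    also have "\<dots> = (\<Sum>k\<in>K. complex_of_real (d k) * y k l * cnj (y k l'))"
    proof (intro sum.cong refl)
      fix k assume "k \<in> K"
      then have "d k * (1 / sqrt (d k)) * (1 / sqrt (d k)) = 1" by (simp add: K_def)
      then have "complex_of_real (d k) * complex_of_real (1 / sqrt (d k)) * complex_of_real (1 / sqrt (d k)) = 1"
        by (simp only: of_real_1 flip: of_real_mult)
      then have "(complex_of_real (d k) * complex_of_real (1 / sqrt (d k)) * complex_of_real (1 / sqrt (d k)))
          * (ip I (u k) (x l) * cnj (ip I (u k) (x l'))) = cnj (ip I (u k) (x l')) * ip I (u k) (x l)"
        by (simp only: mult_1_left mult.commute)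
      then show "cnj (ip I (u k) (x l')) * ip I (u k) (x l) = complex_of_real (d k) * y k l * cnj (y k l')"
        unfolding y_def by (simp only: complex_cnj_mult complex_cnj_complex_of_real ac_simps)
    qed
    finally show ?thesis .
  qed
  moreover have "finite K" using fin by (simp add: K_def)
  ultimately have "spec L (gram I (\<lambda>i l. x l i)) K y d" using o by (simp add: spec_def)
  then have "Ent L (gram I (\<lambda>i l. x l i)) = (\<Sum>k\<in>K. eta (d k))" by (rule Ent_spec[OF fin(2)])
  also have "\<dots> = (\<Sum>k\<in>I. eta (d k))"
  proof (intro sum.mono_neutral_left fin ballI)
    fix k assume "k \<in> I - K"
    then have "d k = 0" using d0[of k] by (auto simp: K_def)
    then show "eta (d k) = 0" by simp
  qed (auto simp: K_def)
  finally show ?thesis unfolding Ent_spec[OF fin(1) s] ..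
qed

lemma ln_ge_one_minus_inverse: "0 < x \<Longrightarrow> 1 - 1 / x \<le> ln (x::real)"
  using ln_le_minus_one[of "1 / x"] by (simp add: ln_div)

text \<open>The matrix \<open>c l k\<close> has the ensemble weights and the eigenvalues as
  marginals. Because the normalised dual vectors are orthonormal, the sums of
  \<open>c l k / d k\<close> over \<open>k\<close> are at most 1, and
  \<open>ln z \<ge> 1 - 1 / z\<close> then compares the two entropies.\<close>

lemma Ent_le_ensemble:
  assumes fin: "finite I" "finite L"
  shows "Ent I (gram L x) \<le> (\<Sum>l\<in>L. eta (nsq I (x l)))"
proof -
  obtain u d where s: "spec I (gram L x) I u d" and d0: "\<And>k. k \<in> I \<Longrightarrow> 0 \<le> d k"
    using psd_spectral[OF fin(1) psd_gram] by blast
  define c where "c l k = (cmod (ip I (u k) (x l)))^2" for l k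
  have dk: "d k = (\<Sum>l\<in>L. c l k)" if "k \<in> I" for k
    unfolding c_def by (rule gram_eigenvalue[OF fin(1) s that])
  have ql: "nsq I (x l) = (\<Sum>k\<in>I. c l k)" for l
    unfolding c_def by (rule parseval[OF fin(1,1) specD(2)[OF s] refl, symmetric])
  have le: "c l k \<le> d k" "c l k \<le> nsq I (x l)" if "l \<in> L" "k \<in> I" for l k
  proof -
    show "c l k \<le> d k" unfolding dk[OF that(2)] using that fin by (intro member_le_sum) (auto simp: c_def)
    show "c l k \<le> nsq I (x l)" unfolding ql using that fin by (intro member_le_sum) (auto simp: c_def)
  qed
  have col: "(\<Sum>k\<in>I. c l k / d k) \<le> 1" if l: "l \<in> L" for l
  proof -
    define K where "K = {k\<in>I. 0 < d k}"
    have "(\<Sum>k\<in>I. c l k / d k) = (\<Sum>k\<in>K. c l k / d k)"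
      using fin d0 by (intro sum.mono_neutral_right) (auto simp: K_def le_less)
    also have "\<dots> = (\<Sum>k\<in>K. (cmod (of_real (1 / sqrt (d k)) * ip I (u k) (x l)))^2)"
      by (intro sum.cong refl) (simp add: K_def c_def norm_mult norm_divide power_mult_distrib power_divide)
    also have "\<dots> \<le> 1"
      using bessel_column[OF _ gram_dual_orthon[OF fin(1) s] fin(2) l] fin by (simp add: K_def)
    finally show ?thesis .
  qed
  have key: "- (\<Sum>k\<in>I. c l k * ln (d k)) \<le> - (nsq I (x l) * ln (nsq I (x l)))" if l: "l \<in> L" for l
  proof -
    define q where "q = nsq I (x l)"
    have q0: "0 \<le> q" by (simp add: q_def)
    have "c l k - q * (c l k / d k) \<le> c l k * (ln (d k) - ln q)" if k: "k \<in> I" for k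
    proof (cases "c l k = 0")
      case False
      then have pos: "0 < c l k" by (simp add: c_def)
      have dq: "0 < d k" "0 < q" using pos le[OF l k] unfolding q_def by linarith+
      have "1 - 1 / (d k / q) \<le> ln (d k / q)" by (rule ln_ge_one_minus_inverse) (use dq in simp)
      then have "1 - q / d k \<le> ln (d k) - ln q" using dq by (simp add: ln_div)
      then have "c l k * (1 - q / d k) \<le> c l k * (ln (d k) - ln q)" using pos by (intro mult_left_mono) auto
      then show ?thesis by (simp add: algebra_simps)
    qed simp
    then have "(\<Sum>k\<in>I. c l k - q * (c l k / d k)) \<le> (\<Sum>k\<in>I. c l k * (ln (d k) - ln q))" by (rule sum_mono)
    moreover have "(\<Sum>k\<in>I. c l k - q * (c l k / d k)) = q - q * (\<Sum>k\<in>I. c l k / d k)"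
      unfolding sum_subtractf sum_distrib_left[symmetric] by (simp only: q_def ql)
    moreover have "q * (\<Sum>k\<in>I. c l k / d k) \<le> q" using col[OF l] q0 by (simp add: mult_left_le)
    moreover have "(\<Sum>k\<in>I. c l k * (ln (d k) - ln q)) = (\<Sum>k\<in>I. c l k * ln (d k)) - q * ln q"
      unfolding right_diff_distrib sum_subtractf sum_distrib_right[symmetric] by (simp only: q_def ql)
    ultimately show ?thesis unfolding q_def by linarith
  qed
  have "Ent I (gram L x) = - (\<Sum>k\<in>I. d k * ln (d k)) / ln 2"
    unfolding Ent_spec[OF fin(1) s] by (simp add: eta_def log_def sum_negf sum_divide_distrib)
  also have "(\<Sum>k\<in>I. d k * ln (d k)) = (\<Sum>k\<in>I. \<Sum>l\<in>L. c l k * ln (d k))"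
    by (intro sum.cong refl) (simp add: dk flip: sum_distrib_right)
  also have "\<dots> = (\<Sum>l\<in>L. \<Sum>k\<in>I. c l k * ln (d k))" by (rule sum.swap)
  also have "- \<dots> / ln 2 = (\<Sum>l\<in>L. - (\<Sum>k\<in>I. c l k * ln (d k))) / ln 2" by (simp add: sum_negf)
  also have "\<dots> \<le> (\<Sum>l\<in>L. - (nsq I (x l) * ln (nsq I (x l)))) / ln 2"
    by (intro divide_right_mono sum_mono key) auto
  also have "\<dots> = (\<Sum>l\<in>L. eta (nsq I (x l)))"
    by (simp add: eta_def log_def sum_divide_distrib)
  finally show ?thesis .
qed

section \<open>Entropy inequalities for operators of arbitrary trace\<close>

definition rtr :: "'i set \<Rightarrow> 'i oper \<Rightarrow> real" where
  "rtr I X = Re (\<Sum>i\<in>I. X i i)"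

lemma rtr_spec: "finite I \<Longrightarrow> spec I X K u d \<Longrightarrow> rtr I X = (\<Sum>k\<in>K. d k)"
  by (simp add: rtr_def spec_trace)

lemma rtr_gram: "rtr I (gram L x) = (\<Sum>l\<in>L. nsq I (x l))"
  by (simp add: rtr_def gram_trace)

lemma Ent_cong:
  assumes "\<And>i j. i \<in> I \<Longrightarrow> j \<in> I \<Longrightarrow> X i j = Y i j"
  shows "Ent I X = Ent I Y"
proof -
  have "spec I X I u d \<longleftrightarrow> spec I Y I u d" for u d
    using assms by (auto simp: spec_def)
  then show ?thesis by (simp add: Ent_def)
qed

lemma psd_add:
  assumes "psd I X" "psd I Y"
  shows "psd I (\<lambda>i j. X i j + Y i j)"
proof -
  have "mv I (\<lambda>i j. X i j + Y i j) v = (\<lambda>i. mv I X v i + mv I Y v i)" for v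
    by (rule ext) (simp add: mv_def algebra_simps sum.distrib)
  then show ?thesis using assms unfolding psd_def by (simp add: ip_add_right nonneg_Reals_add_I)
qed

lemma psd_scale:
  assumes "psd I X" "0 \<le> c"
  shows "psd I (\<lambda>i j. of_real c * X i j)"
proof -
  have "mv I (\<lambda>i j. of_real c * X i j) v = (\<lambda>i. of_real c * mv I X v i)" for v
    by (rule ext) (simp add: mv_def sum_distrib_left mult.assoc)
  then show ?thesis using assms unfolding psd_def by (simp add: ip_scale_right nonneg_Reals_mult_I)
qed

lemma psd_is_gram:
  assumes fin: "finite I" and s: "spec I X I u d" and d0: "\<And>k. k \<in> I \<Longrightarrow> 0 \<le> d k"
  shows "\<And>i j. i \<in> I \<Longrightarrow> j \<in> I \<Longrightarrow> X i j = gram I (\<lambda>k i. complex_of_real (sqrt (d k)) * u k i) i j"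
    "\<And>k. k \<in> I \<Longrightarrow> nsq I (\<lambda>i. complex_of_real (sqrt (d k)) * u k i) = d k"
proof -
  fix i j assume ij: "i \<in> I" "j \<in> I"
  show "X i j = gram I (\<lambda>k i. complex_of_real (sqrt (d k)) * u k i) i j"
    unfolding specD(3)[OF s ij] gram_def
  proof (intro sum.cong refl)
    fix k assume "k \<in> I"
    then have "complex_of_real (d k) = complex_of_real (sqrt (d k)) * complex_of_real (sqrt (d k))"
      using d0 by (simp flip: of_real_mult)
    then show "complex_of_real (d k) * u k i * cnj (u k j)
        = complex_of_real (sqrt (d k)) * u k i * cnj (complex_of_real (sqrt (d k)) * u k j)" by simp
  qed
next
  fix k assume "k \<in> I"
  then show "nsq I (\<lambda>i. complex_of_real (sqrt (d k)) * u k i) = d k"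
    unfolding nsq_scale orthon_nsq[OF specD(2)[OF s] \<open>k \<in> I\<close>] using d0 by simp
qed

text \<open>The weighted eigenvectors of \<open>X\<close> and of \<open>Y\<close> together form an
  ensemble for the sum, and \<open>Ent_le_ensemble\<close> bounds its entropy by that of all the
  eigenvalues.\<close>

lemma Ent_subadditive:
  assumes fin: "finite I" and X: "psd I X" and Y: "psd I Y"
  shows "Ent I (\<lambda>i j. X i j + Y i j) \<le> Ent I X + Ent I Y" (is "?lhs \<le> _")
proof -
  obtain u d where s: "spec I X I u d" and d0: "\<And>k. k \<in> I \<Longrightarrow> 0 \<le> d k" using psd_spectral[OF fin X] by blast
  obtain v e where t: "spec I Y I v e" and e0: "\<And>k. k \<in> I \<Longrightarrow> 0 \<le> e k" using psd_spectral[OF fin Y] by blast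
  define x where "x = case_sum (\<lambda>k i. of_real (sqrt (d k)) * u k i) (\<lambda>k i. of_real (sqrt (e k)) * v k i)"
  have "?lhs = Ent I (gram (I <+> I) x)"
  proof (rule Ent_cong)
    fix i j assume "i \<in> I" "j \<in> I"
    then show "X i j + Y i j = gram (I <+> I) x i j"
      using psd_is_gram(1)[OF fin s d0] psd_is_gram(1)[OF fin t e0] fin
      by (simp add: gram_def sum.Plus x_def)
  qed
  also have "\<dots> \<le> (\<Sum>l\<in>I <+> I. eta (nsq I (x l)))" using fin by (intro Ent_le_ensemble) auto
  also have "\<dots> = (\<Sum>k\<in>I. eta (d k)) + (\<Sum>k\<in>I. eta (e k))"
    using fin by (simp add: sum.Plus x_def psd_is_gram(2)[OF fin s d0] psd_is_gram(2)[OF fin t e0] cong: sum.cong)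
  also have "\<dots> = Ent I X + Ent I Y" unfolding Ent_spec[OF fin s] Ent_spec[OF fin t] ..
  finally show ?thesis .
qed

text \<open>Klein's inequality: relative entropy is nonnegative, with the traces of \<open>X\<close>
  and of \<open>Z\<close> carried along in place of normalisation. The squared overlaps
  \<open>D\<close> are doubly stochastic, and \<open>az\<close> makes \<open>z j\<close> positive
  wherever \<open>X\<close> has weight.\<close>

lemma Ent_gibbs:
  assumes fin: "finite I" and X: "psd I X" and t: "spec I Z I f z"
    and a: "\<And>j. j \<in> I \<Longrightarrow> a j = Re (ip I (f j) (mv I X (f j)))"
    and az: "\<And>j. j \<in> I \<Longrightarrow> a j \<le> z j" and z0: "\<And>j. j \<in> I \<Longrightarrow> 0 \<le> z j" and zpos: "0 < sum z I"
  shows "Ent I X - eta (rtr I X) - rtr I X * log 2 (sum z I) \<le> - (\<Sum>j\<in>I. a j * log 2 (z j))"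
proof -
  obtain e x where s: "spec I X I e x" and x0: "\<And>k. k \<in> I \<Longrightarrow> 0 \<le> x k" using psd_spectral[OF fin X] by blast
  define D where "D i j = (cmod (ip I (e i) (f j)))^2" for i j
  have D0: "0 \<le> D i j" for i j by (simp add: D_def)
  have aj: "a j = (\<Sum>i\<in>I. x i * D i j)" if "j \<in> I" for j
    unfolding a[OF that] spec_form[OF s] D_def by simp
  have D1: "(\<Sum>i\<in>I. D i j) = 1" if "j \<in> I" for j
    unfolding D_def parseval[OF fin fin specD(2)[OF s] refl] by (rule orthon_nsq[OF specD(2)[OF t] that])
  have D2: "(\<Sum>j\<in>I. D i j) = 1" if "i \<in> I" for i
  proof -
    have "D i j = (cmod (ip I (f j) (e i)))^2" for j
      unfolding D_def by (subst ip_commute) simp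
    then have "(\<Sum>j\<in>I. D i j) = nsq I (e i)"
      using parseval[OF fin fin specD(2)[OF t] refl, of "e i"] by simp
    then show ?thesis using orthon_nsq[OF specD(2)[OF s] that] by simp
  qed
  define X1 where "X1 = rtr I X"
  define Z1 where "Z1 = sum z I"
  have X1: "X1 = (\<Sum>i\<in>I. x i)" unfolding X1_def by (rule rtr_spec[OF fin s])
  have trm: "x i * D i j - D i j * z j * (X1 / Z1) + x i * D i j * (ln X1 - ln Z1) \<le> x i * D i j * (ln (x i) - ln (z j))"
    if ij: "i \<in> I" "j \<in> I" for i j
  proof (cases "x i * D i j = 0")
    case True
    have "0 \<le> D i j * z j * (X1 / Z1)"
      using D0 z0[OF ij(2)] zpos x0 by (intro mult_nonneg_nonneg divide_nonneg_nonneg) (auto simp: X1 Z1_def intro!: sum_nonneg)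
    then show ?thesis unfolding True by simp
  next
    case False
    then have pos: "0 < x i" "0 < D i j" using x0[OF ij(1)] D0[of i j] by (auto simp: less_le)
    have "x i * D i j \<le> a j" unfolding aj[OF ij(2)]
      using ij fin x0 D0 by (intro member_le_sum[of i I "\<lambda>i. x i * D i j"]) auto
    then have zj: "0 < z j" using az[OF ij(2)] pos mult_pos_pos[OF pos] by linarith
    have "x i \<le> X1" unfolding X1 using ij fin x0 by (intro member_le_sum) auto
    then have X1p: "0 < X1" using pos by linarith
    have Zp: "0 < Z1" using zpos by (simp add: Z1_def)
    define y where "y = x i * Z1 / (z j * X1)"
    have "0 < y" using pos zj X1p Zp by (simp add: y_def)
    then have "1 - 1 / y \<le> ln y" by (rule ln_ge_one_minus_inverse)
    also have "ln y = ln (x i) - ln (z j) - (ln X1 - ln Z1)"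
      using pos zj X1p Zp by (simp add: y_def ln_div ln_mult)
    finally have "x i * D i j * (1 - 1 / y) \<le> x i * D i j * (ln (x i) - ln (z j) - (ln X1 - ln Z1))"
      using pos by (intro mult_left_mono) auto
    moreover have "x i * D i j * (1 / y) = D i j * z j * (X1 / Z1)"
      using pos zj X1p Zp by (simp add: y_def field_simps)
    ultimately show ?thesis by (simp add: algebra_simps)
  qed
  let ?F = "\<Sum>i\<in>I. \<Sum>j\<in>I. x i * D i j - D i j * z j * (X1 / Z1) + x i * D i j * (ln X1 - ln Z1)"
  let ?G = "\<Sum>i\<in>I. x i * ln (x i)"
  let ?H = "\<Sum>j\<in>I. a j * ln (z j)"
  have "?F
      \<le> (\<Sum>i\<in>I. \<Sum>j\<in>I. x i * D i j * (ln (x i) - ln (z j)))"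
    by (intro sum_mono trm)
  moreover have "(\<Sum>i\<in>I. \<Sum>j\<in>I. x i * D i j * (ln (x i) - ln (z j)))
      = ?G - ?H"
  proof -
    have "(\<Sum>i\<in>I. \<Sum>j\<in>I. x i * D i j * ln (x i)) = ?G"
    proof (intro sum.cong refl)
      fix i assume "i \<in> I"
      have "(\<Sum>j\<in>I. x i * D i j * ln (x i)) = x i * ln (x i) * (\<Sum>j\<in>I. D i j)"
        by (simp add: sum_distrib_left ac_simps)
      then show "(\<Sum>j\<in>I. x i * D i j * ln (x i)) = x i * ln (x i)" by (simp add: D2[OF \<open>i \<in> I\<close>])
    qed
    moreover have "(\<Sum>i\<in>I. \<Sum>j\<in>I. x i * D i j * ln (z j)) = ?H"
      by (subst sum.swap, intro sum.cong refl) (simp add: aj sum_distrib_right)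
    ultimately show ?thesis by (simp add: right_diff_distrib sum_subtractf)
  qed
  moreover have "?F
      = X1 * (ln X1 - ln Z1)"
  proof -
    have 1: "(\<Sum>i\<in>I. \<Sum>j\<in>I. x i * D i j) = X1"
      unfolding X1 by (intro sum.cong refl) (simp add: D2 flip: sum_distrib_left)
    have "(\<Sum>i\<in>I. \<Sum>j\<in>I. D i j * z j) = (\<Sum>j\<in>I. \<Sum>i\<in>I. D i j * z j)" by (rule sum.swap)
    also have "\<dots> = Z1" unfolding Z1_def by (intro sum.cong refl) (simp add: D1 flip: sum_distrib_right)
    finally have 2: "(\<Sum>i\<in>I. \<Sum>j\<in>I. D i j * z j) = Z1" .
    show ?thesis
      unfolding sum.distrib sum_subtractf sum_distrib_right[symmetric] 1 2 using zpos by (simp add: Z1_def)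
  qed
  ultimately have "X1 * (ln X1 - ln Z1) \<le> ?G - ?H" by linarith
  then have "X1 * (ln X1 - ln Z1) / ln 2 \<le> (?G - ?H) / ln 2"
    by (intro divide_right_mono) auto
  then show ?thesis
    unfolding Ent_spec[OF fin s] X1_def[symmetric] Z1_def[symmetric]
    by (simp add: eta_def log_def sum_negf sum_divide_distrib diff_divide_distrib right_diff_distrib)
qed

lemma rtr_nonneg:
  assumes "finite I" "psd I X"
  shows "0 \<le> rtr I X"
proof -
  obtain u d where s: "spec I X I u d" and d0: "\<And>k. k \<in> I \<Longrightarrow> 0 \<le> d k" using psd_spectral[OF assms] by blast
  show ?thesis unfolding rtr_spec[OF assms(1) s] using d0 by (rule sum_nonneg)
qed

lemma rtr_add: "rtr I (\<lambda>i j. X i j + Y i j) = rtr I X + rtr I Y"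
  by (simp add: rtr_def sum.distrib)

lemma rtr_scale: "rtr I (\<lambda>i j. of_real c * X i j) = c * rtr I X"
  by (simp add: rtr_def sum_distrib_left)

text \<open>Nonnegativity of entropy without normalisation: every eigenvalue is at most the
  trace.\<close>

lemma Ent_ge_eta_trace:
  assumes fin: "finite I" and X: "psd I X"
  shows "eta (rtr I X) \<le> Ent I X"
proof -
  obtain u d where s: "spec I X I u d" and d0: "\<And>k. k \<in> I \<Longrightarrow> 0 \<le> d k" using psd_spectral[OF fin X] by blast
  have "eta (rtr I X) = (\<Sum>k\<in>I. - (d k * log 2 (rtr I X)))"
    by (simp add: eta_def sum_negf rtr_spec[OF fin s] sum_distrib_right)
  also have "\<dots> \<le> (\<Sum>k\<in>I. eta (d k))"
  proof (rule sum_mono)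
    fix k assume k: "k \<in> I"
    show "- (d k * log 2 (rtr I X)) \<le> eta (d k)"
    proof (cases "d k = 0")
      case False
      then have pos: "0 < d k" using d0[OF k] by simp
      have "d k \<le> rtr I X" unfolding rtr_spec[OF fin s] using k fin d0 by (intro member_le_sum) auto
      then have "log 2 (d k) \<le> log 2 (rtr I X)" using pos by simp
      then show ?thesis using pos by (simp add: eta_def)
    qed simp
  qed
  finally show ?thesis unfolding Ent_spec[OF fin s] .
qed

text \<open>Gibbs' inequality against the uniform distribution; \<open>eta (rtr I X)\<close>
  corrects for the trace.\<close>

lemma Ent_le_log_card:
  assumes fin: "finite I" and ne: "I \<noteq> {}" and X: "psd I X"
  shows "Ent I X \<le> rtr I X * log 2 (real (card I)) + eta (rtr I X)"
proof -
  obtain u d where s: "spec I X I u d" and d0: "\<And>k. k \<in> I \<Longrightarrow> 0 \<le> d k" using psd_spectral[OF fin X] by blast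
  define n where "n = real (card I)"
  define x where "x = rtr I X"
  have n: "0 < n" using fin ne by (simp add: n_def card_gt_0_iff)
  have x: "x = (\<Sum>k\<in>I. d k)" unfolding x_def by (rule rtr_spec[OF fin s])
  have trm: "- (d k * ln (d k)) \<le> x / n - d k + d k * (ln n - ln x)" if k: "k \<in> I" for k
  proof (cases "d k = 0")
    case True
    have "0 \<le> x / n" using n d0 by (auto simp: x intro!: divide_nonneg_pos sum_nonneg)
    then show ?thesis using True by simp
  next
    case False
    then have pos: "0 < d k" using d0[OF k] by simp
    have "d k \<le> x" unfolding x using k fin d0 by (intro member_le_sum) auto
    then have xp: "0 < x" using pos by linarith
    define y where "y = d k * n / x"
    have "0 < y" using pos xp n by (simp add: y_def)
    then have "1 - 1 / y \<le> ln y" by (rule ln_ge_one_minus_inverse)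
    also have "ln y = ln (d k) + ln n - ln x" using pos xp n by (simp add: y_def ln_div ln_mult)
    finally have "d k * (1 - 1 / y) \<le> d k * (ln (d k) + ln n - ln x)" using pos by (intro mult_left_mono) auto
    moreover have "d k * (1 / y) = x / n" using pos xp n by (simp add: y_def)
    ultimately show ?thesis by (simp add: algebra_simps)
  qed
  have "(\<Sum>k\<in>I. - (d k * ln (d k))) \<le> (\<Sum>k\<in>I. x / n - d k + d k * (ln n - ln x))"
    by (intro sum_mono trm)
  also have "\<dots> = x * (ln n - ln x)"
    unfolding sum.distrib sum_subtractf sum_distrib_right[symmetric] x[symmetric] using n by (simp add: n_def)
  finally have "(\<Sum>k\<in>I. - (d k * ln (d k))) / ln 2 \<le> x * (ln n - ln x) / ln 2"
    by (intro divide_right_mono) auto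
  then show ?thesis
    unfolding Ent_spec[OF fin s] x_def[symmetric] n_def[symmetric]
    by (simp add: eta_def log_def sum_divide_distrib diff_divide_distrib right_diff_distrib)
qed

lemma eta_mult:
  assumes "0 \<le> c" "0 \<le> x"
  shows "eta (c * x) = c * eta x + x * eta c"
proof (cases "c = 0 \<or> x = 0")
  case False
  then have "0 < c" "0 < x" using assms by auto
  then show ?thesis by (simp add: eta_def log_mult algebra_simps)
qed auto

lemma Ent_scale:
  assumes fin: "finite I" and X: "psd I X" and c: "0 \<le> c"
  shows "Ent I (\<lambda>i j. of_real c * X i j) = c * Ent I X + rtr I X * eta c"
proof -
  obtain u d where s: "spec I X I u d" and d0: "\<And>k. k \<in> I \<Longrightarrow> 0 \<le> d k" using psd_spectral[OF fin X] by blast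
  have "spec I (\<lambda>i j. of_real c * X i j) I u (\<lambda>k. c * d k)"
    using s by (simp add: spec_def sum_distrib_left mult.assoc)
  from Ent_spec[OF fin this] show ?thesis
    unfolding Ent_spec[OF fin s] rtr_spec[OF fin s]
    using d0 c by (simp add: eta_mult sum.distrib sum_distrib_left sum_distrib_right cong: sum.cong)
qed

text \<open>Concavity of entropy, rewritten for unnormalised operators. \<open>Ent_gibbs\<close> is
  applied to \<open>X\<close> and to \<open>Y\<close> against the spectrum of their sum, whose own
  entropy splits into the same two cross terms. Trace 0 is separate, as no logarithm of it is
  available.\<close>

lemma Ent_superadditive:
  assumes fin: "finite I" and X: "psd I X" and Y: "psd I Y"
  shows "Ent I X - eta (rtr I X) + (Ent I Y - eta (rtr I Y)) + eta (rtr I X + rtr I Y) \<le> Ent I (\<lambda>i j. X i j + Y i j)"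
proof -
  let ?Z = "\<lambda>i j. X i j + Y i j"
  obtain f z where t: "spec I ?Z I f z" and z0: "\<And>k. k \<in> I \<Longrightarrow> 0 \<le> z k"
    using psd_spectral[OF fin psd_add[OF X Y]] by blast
  define a where "a j = Re (ip I (f j) (mv I X (f j)))" for j
  define b where "b j = Re (ip I (f j) (mv I Y (f j)))" for j
  have nn: "0 \<le> Re (ip I v (mv I W v))" if "psd I W" for v W
    using that complex_nonneg_Reals_iff unfolding psd_def by blast
  have zab: "z j = a j + b j" if j: "j \<in> I" for j
  proof -
    have "of_real (z j) = ip I (f j) (mv I ?Z (f j))" by (rule spec_eigenvalue[OF t j, symmetric])
    also have "mv I ?Z (f j) = (\<lambda>i. mv I X (f j) i + mv I Y (f j) i)"
      by (rule ext) (simp add: mv_def algebra_simps sum.distrib)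
    finally have "of_real (z j) = ip I (f j) (mv I X (f j)) + ip I (f j) (mv I Y (f j))"
      by (simp only: ip_add_right)
    then show ?thesis unfolding a_def b_def by (metis Re_complex_of_real plus_complex.sel(1))
  qed
  have a0: "0 \<le> a j" and b0: "0 \<le> b j" for j unfolding a_def b_def by (intro nn X Y)+
  have tz: "sum z I = rtr I X + rtr I Y" using rtr_spec[OF fin t] rtr_add by metis
  show ?thesis
  proof (cases "sum z I = 0")
    case True
    then have r: "rtr I X = 0" "rtr I Y = 0" using tz rtr_nonneg[OF fin X] rtr_nonneg[OF fin Y] by linarith+
    have zero: "Ent I W \<le> 0" if W: "psd I W" "rtr I W = 0" for W
    proof -
      obtain u d where s: "spec I W I u d" and d0: "\<And>k. k \<in> I \<Longrightarrow> 0 \<le> d k" using psd_spectral[OF fin W(1)] by blast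
      have "(\<Sum>k\<in>I. d k) = 0" using rtr_spec[OF fin s] W(2) by simp
      then have "d k = 0" if "k \<in> I" for k using sum_nonneg_eq_0_iff[OF fin, of d] d0 that by blast
      then show ?thesis unfolding Ent_spec[OF fin s] by simp
    qed
    have "eta (rtr I ?Z) \<le> Ent I ?Z" by (rule Ent_ge_eta_trace[OF fin psd_add[OF X Y]])
    then have "0 \<le> Ent I ?Z" unfolding rtr_add r by simp
    then show ?thesis using zero[OF X r(1)] zero[OF Y r(2)] r by simp
  next
    case False
    then have zpos: "0 < sum z I" using sum_nonneg[of I z] z0 by force
    have 1: "Ent I X - eta (rtr I X) - rtr I X * log 2 (sum z I) \<le> - (\<Sum>j\<in>I. a j * log 2 (z j))"
      by (rule Ent_gibbs[OF fin X t _ _ z0 zpos]) (auto simp: a_def[symmetric] zab b0)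
    have 2: "Ent I Y - eta (rtr I Y) - rtr I Y * log 2 (sum z I) \<le> - (\<Sum>j\<in>I. b j * log 2 (z j))"
      by (rule Ent_gibbs[OF fin Y t _ _ z0 zpos]) (auto simp: b_def[symmetric] zab a0)
    have "Ent I ?Z = - (\<Sum>j\<in>I. a j * log 2 (z j)) - (\<Sum>j\<in>I. b j * log 2 (z j))"
      unfolding Ent_spec[OF fin t] sum_negf[symmetric] sum_subtractf[symmetric]
    proof (intro sum.cong refl)
      fix j assume "j \<in> I"
      then have "z j * log 2 (z j) = a j * log 2 (z j) + b j * log 2 (z j)"
        by (subst zab) (simp_all add: distrib_right)
      then show "eta (z j) = - (a j * log 2 (z j)) - b j * log 2 (z j)" by (simp add: eta_def)
    qed
    moreover have "eta (rtr I X + rtr I Y) = - (rtr I X * log 2 (sum z I)) - rtr I Y * log 2 (sum z I)"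
      by (simp add: eta_def tz algebra_simps)
    ultimately show ?thesis using 1 2 by linarith
  qed
qed

text \<open>
  For \<open>u = v + w\<close> one has \<open>|u\<rangle>\<langle>u| + (1/t - 1) |w\<rangle>\<langle>w| \<ge> (1 - t) |v\<rangle>\<langle>v|\<close>, so that sub- and
  superadditivity of the entropy compare the entropies of the two families.
\<close>

lemma Ent_gram_perturbation:
  assumes fin: "finite I" "finite L" and ne: "I \<noteq> {}" and t: "0 < t" "t < 1"
    and u: "\<And>l i. l \<in> L \<Longrightarrow> i \<in> I \<Longrightarrow> u l i = v l i + w l i"
    and r: "r = (\<Sum>l\<in>L. nsq I (u l))" and s: "s = (\<Sum>l\<in>L. nsq I (v l))"
    and p: "p = (1 / t - 1) * (\<Sum>l\<in>L. nsq I (w l))"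
  shows "(1 - t) * Ent I (gram L v) - (1 - t) * eta s + eta (r + p)
    \<le> Ent I (gram L u) + p * log 2 (real (card I)) + eta p"
proof -
  define \<kappa> where "\<kappa> = 1 / t - 1"
  have \<kappa>: "0 \<le> \<kappa>" using t by (simp add: \<kappa>_def)
  let ?R = "gram L u" and ?S = "gram L v" and ?W = "gram L w"
  let ?kW = "\<lambda>i j. of_real \<kappa> * ?W i j" and ?aS = "\<lambda>i j. of_real (1 - t) * ?S i j"
  \<comment> \<open>The slack of the operator inequality. It is positive, so its normalised entropy
    may be dropped after superadditivity.\<close>
  define D where "D i j = ?R i j + ?kW i j - ?aS i j" for i j
  have pR: "psd I ?R" and pS: "psd I ?S" and pW: "psd I ?W" by (rule psd_gram)+
  have pkW: "psd I ?kW" by (rule psd_scale[OF pW \<kappa>])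
  have paS: "psd I ?aS" by (rule psd_scale[OF pS]) (use t in simp)
  let ?F = "\<lambda>g. \<Sum>l\<in>L. (cmod (ip I g (u l)))^2 + \<kappa> * (cmod (ip I g (w l)))^2 - (1 - t) * (cmod (ip I g (v l)))^2"
  have pD: "psd I D"
    unfolding psd_def
  proof
    fix g
    have "mv I D g = (\<lambda>i. mv I ?R g i + of_real \<kappa> * mv I ?W g i - of_real (1 - t) * mv I ?S g i)"
      unfolding D_def mv_def by (rule ext) (simp add: algebra_simps sum.distrib sum_subtractf sum_distrib_left)
    then have "ip I g (mv I D g) = ip I g (mv I ?R g) + of_real \<kappa> * ip I g (mv I ?W g)
        - of_real (1 - t) * ip I g (mv I ?S g)"
      by (simp only: ip_diff_right ip_add_right ip_scale_right)
    also have "\<dots> = of_real (?F g)"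
      unfolding gram_form complex_norm_square[symmetric]
      by (simp add: sum.distrib sum_subtractf sum_distrib_left)
    finally have e: "ip I g (mv I D g) = of_real (?F g)" .
    have "0 \<le> (cmod (ip I g (u l)))^2 + \<kappa> * (cmod (ip I g (w l)))^2 - (1 - t) * (cmod (ip I g (v l)))^2" if l: "l \<in> L" for l
    proof -
      define x where "x = ip I g (v l)"
      define y where "y = ip I g (w l)"
      have "ip I g (u l) = ip I g (\<lambda>i. v l i + w l i)" by (intro ip_cong refl u[OF l])
      then have xy: "ip I g (u l) = x + y" by (simp only: ip_add_right x_def y_def)
      \<comment> \<open>Completing the square: this quotient is exactly the difference of the two
        sides, which fixes the weight \<open>1 / t - 1\<close>.\<close>
      have "0 \<le> (cmod (of_real t * x + y))^2 / t" using t by simp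
      also have "\<dots> = (cmod (x + y))^2 + \<kappa> * (cmod y)^2 - (1 - t) * (cmod x)^2"
        using t unfolding cmod_power2 \<kappa>_def by (simp add: field_simps power2_eq_square)
      finally show ?thesis unfolding xy x_def y_def .
    qed
    then show "ip I g (mv I D g) \<in> \<real>\<^sub>\<ge>\<^sub>0"
      unfolding e nonneg_Reals_of_real_iff by (intro sum_nonneg)
  qed
  have sumeq: "(\<lambda>i j. ?R i j + ?kW i j) = (\<lambda>i j. ?aS i j + D i j)" by (intro ext) (simp add: D_def)
  have rR: "rtr I ?R = r" unfolding rtr_gram r ..
  have rS: "rtr I ?S = s" unfolding rtr_gram s ..
  have rkW: "rtr I ?kW = p" unfolding rtr_scale rtr_gram p \<kappa>_def ..
  have raS: "rtr I ?aS = (1 - t) * s" unfolding rtr_scale rS ..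
  have "rtr I ?aS + rtr I D = rtr I ?R + rtr I ?kW" unfolding rtr_add[symmetric] sumeq ..
  then have tot: "rtr I ?aS + rtr I D = r + p" unfolding rR rkW .
  have s0: "0 \<le> s" using rtr_nonneg[OF fin(1) pS] rS by simp
  have 1: "Ent I (\<lambda>i j. ?R i j + ?kW i j) \<le> Ent I ?R + Ent I ?kW" by (rule Ent_subadditive[OF fin(1) pR pkW])
  have 2: "Ent I ?kW \<le> p * log 2 (real (card I)) + eta p"
    using Ent_le_log_card[OF fin(1) ne pkW] unfolding rkW .
  have 3: "Ent I ?aS - eta (rtr I ?aS) + (Ent I D - eta (rtr I D)) + eta (rtr I ?aS + rtr I D)
      \<le> Ent I (\<lambda>i j. ?aS i j + D i j)" by (rule Ent_superadditive[OF fin(1) paS pD])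
  have 4: "eta (rtr I D) \<le> Ent I D" by (rule Ent_ge_eta_trace[OF fin(1) pD])
  have 5: "Ent I ?aS = (1 - t) * Ent I ?S + s * eta (1 - t)"
    using Ent_scale[OF fin(1) pS, of "1 - t"] t unfolding rS by simp
  have 6: "eta (rtr I ?aS) = (1 - t) * eta s + s * eta (1 - t)"
    unfolding raS using t s0 by (intro eta_mult) auto
  show ?thesis using 1 2 3 4 5 6 unfolding tot sumeq[symmetric] by linarith
qed

text \<open>\<open>S\<close> is maximally mixed and independent of \<open>H\<close>, so each
  \<open>d k\<close> splits into \<open>card S\<close> equal parts. In the converse the additional
  logarithm becomes the rate of the code.\<close>

lemma Ent_tensor_max_mixed:
  fixes S :: "'s set" and H :: "'h set"
  assumes fin: "finite S" "finite H" and ne: "S \<noteq> {}" and s: "spec H X H u d" and d0: "\<And>k. k \<in> H \<Longrightarrow> 0 \<le> d k"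
  shows "Ent (S \<times> H) (\<lambda>(s, h) (s', h'). (if s = s' then X h h' / of_real (real (card S)) else 0))
    = Ent H X + rtr H X * log 2 (real (card S))"
proof -
  define m where "m = real (card S)"
  have m: "0 < m" using fin ne by (simp add: m_def card_gt_0_iff)
  define v where "v = (\<lambda>(s0 :: 's, k) (s, h). if s = s0 then u k h else 0)"
  have o: "orthon (S \<times> H) (S \<times> H) v"
    unfolding orthon_def
  proof (intro ballI)
    fix x y assume xy: "x \<in> S \<times> H" "y \<in> S \<times> H"
    obtain s0 k s1 l where x: "x = (s0, k)" and y: "y = (s1, l)" by (cases x, cases y) blast
    have "ip (S \<times> H) (v x) (v y) = (\<Sum>s\<in>S. if s = s0 then (if s0 = s1 then ip H (u k) (u l) else 0) else 0)"
      unfolding ip_def sum_Times x y v_def by (intro sum.cong refl) auto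
    also have "\<dots> = (if x = y then 1 else 0)"
      using xy fin orthonD[OF specD(2)[OF s]] unfolding x y by auto
    finally show "ip (S \<times> H) (v x) (v y) = (if x = y then 1 else 0)" .
  qed
  have "spec (S \<times> H) (\<lambda>(s, h) (s', h'). (if s = s' then X h h' / of_real m else 0)) (S \<times> H) v (\<lambda>(s0, k). d k / m)"
    unfolding spec_def
  proof (intro conjI o ballI)
    fix x y assume xy: "x \<in> S \<times> H" "y \<in> S \<times> H"
    obtain s1 h s2 h' where x: "x = (s1, h)" and y: "y = (s2, h')" by (cases x, cases y) blast
    have "(\<Sum>z\<in>S \<times> H. of_real (case z of (s0, k) \<Rightarrow> d k / m) * v z x * cnj (v z y))
        = (\<Sum>s0\<in>S. if s0 = s1 then (if s1 = s2 then \<Sum>k\<in>H. of_real (d k) * u k h * cnj (u k h') / of_real m else 0) else 0)"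
      unfolding sum_Times x y v_def by (intro sum.cong refl) auto
    also have "\<dots> = (if s1 = s2 then (\<Sum>k\<in>H. of_real (d k) * u k h * cnj (u k h')) / of_real m else 0)"
      using xy fin unfolding x by (simp add: sum_divide_distrib)
    finally show "(case x of (s, h) \<Rightarrow> \<lambda>(s', h'). (if s = s' then X h h' / of_real m else 0)) y
        = (\<Sum>z\<in>S \<times> H. of_real (case z of (s0, k) \<Rightarrow> d k / m) * v z x * cnj (v z y))"
      using specD(3)[OF s, of h h'] xy unfolding x y by simp
  qed (use fin in simp)
  from Ent_spec[OF _ this] have "Ent (S \<times> H) (\<lambda>(s, h) (s', h'). (if s = s' then X h h' / of_real m else 0))
      = (\<Sum>s0\<in>S. \<Sum>k\<in>H. eta (d k / m))"
    using fin by (simp add: sum_Times)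
  also have "\<dots> = (\<Sum>k\<in>H. m * eta (d k / m))" by (simp add: m_def sum_distrib_left)
  also have "\<dots> = (\<Sum>k\<in>H. eta (d k) + d k * log 2 m)"
  proof (intro sum.cong refl)
    fix k assume "k \<in> H"
    then show "m * eta (d k / m) = eta (d k) + d k * log 2 m"
      using d0[of k] m by (cases "d k = 0") (auto simp: eta_def log_divide algebra_simps)
  qed
  also have "\<dots> = Ent H X + rtr H X * log 2 m"
    unfolding Ent_spec[OF fin(2) s] rtr_spec[OF fin(2) s] by (simp add: sum.distrib sum_distrib_right)
  finally show ?thesis unfolding m_def .
qed

text \<open>The classical subadditivity of Shannon entropy for a joint distribution
  \<open>J\<close>, by \<open>ln z \<le> z - 1\<close>.\<close>

lemma eta_subadditive:
  fixes J :: "'e \<Rightarrow> 'a \<Rightarrow> real"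
  assumes fin: "finite E" "finite A" and J0: "\<And>e a. e \<in> E \<Longrightarrow> a \<in> A \<Longrightarrow> 0 \<le> J e a"
    and w: "\<And>e. e \<in> E \<Longrightarrow> (\<Sum>a\<in>A. J e a) = w e" and p: "\<And>a. a \<in> A \<Longrightarrow> (\<Sum>e\<in>E. J e a) = p a"
    and p1: "sum p A = 1"
  shows "(\<Sum>e\<in>E. \<Sum>a\<in>A. eta (J e a)) \<le> (\<Sum>e\<in>E. eta (w e)) + (\<Sum>a\<in>A. eta (p a))"
proof -
  have le: "eta (J e a) + J e a * log 2 (w e) + J e a * log 2 (p a) \<le> (w e * p a - J e a) / ln 2"
    if ea: "e \<in> E" "a \<in> A" for e a
  proof -
    have wp: "J e a \<le> w e" "J e a \<le> p a"
      unfolding w[OF ea(1), symmetric] p[OF ea(2), symmetric] using fin ea J0 by (auto intro!: member_le_sum)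
    show ?thesis
    proof (cases "J e a = 0")
      case True
      then show ?thesis using wp by simp
    next
      case False
      then have pos: "0 < J e a" "0 < w e" "0 < p a" using J0[OF ea] wp by auto
      have "ln (w e * p a / J e a) \<le> w e * p a / J e a - 1" using pos by (intro ln_le_minus_one) simp
      then have "J e a * ln (w e * p a / J e a) \<le> J e a * (w e * p a / J e a - 1)"
        using pos by (intro mult_left_mono) auto
      then have "J e a * (ln (w e) + ln (p a) - ln (J e a)) \<le> w e * p a - J e a"
        using pos by (simp add: ln_mult ln_div right_diff_distrib)
      then have "J e a * (ln (w e) + ln (p a) - ln (J e a)) / ln 2 \<le> (w e * p a - J e a) / ln 2"
        by (rule divide_right_mono) simp
      then show ?thesis by (simp add: eta_def log_def algebra_simps add_divide_distrib diff_divide_distrib)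
    qed
  qed
  let ?F = "\<Sum>e\<in>E. \<Sum>a\<in>A. eta (J e a) + J e a * log 2 (w e) + J e a * log 2 (p a)"
  have "?F
      \<le> (\<Sum>e\<in>E. \<Sum>a\<in>A. (w e * p a - J e a) / ln 2)" by (intro sum_mono le)
  also have "\<dots> = (\<Sum>e\<in>E. w e * sum p A - w e) / ln 2"
    by (simp add: sum_subtractf w sum_distrib_left flip: sum_divide_distrib cong: sum.cong)
  also have "\<dots> = 0" using p1 by simp
  also have "?F
      = (\<Sum>e\<in>E. \<Sum>a\<in>A. eta (J e a)) + (\<Sum>e\<in>E. w e * log 2 (w e)) + (\<Sum>a\<in>A. \<Sum>e\<in>E. J e a * log 2 (p a))"
    unfolding sum.distrib by (simp add: w sum.swap[of _ A E] flip: sum_distrib_right)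
  also have "\<dots> = (\<Sum>e\<in>E. \<Sum>a\<in>A. eta (J e a)) - (\<Sum>e\<in>E. eta (w e)) - (\<Sum>a\<in>A. eta (p a))"
    by (simp add: p eta_def sum_negf flip: sum_distrib_right)
  finally show ?thesis by simp
qed

text \<open>The output is a mixture over \<open>(e, a)\<close>, so its entropy is at most that of
  the joint weights, whose marginals are \<open>w\<close> and \<open>p\<close>. Consequently a rate
  below the entropy difference is below the input entropy as well, which controls the error of the
  encoder.\<close>

lemma coding_entropy_triangle:
  assumes c: "coding A B E k p w q"
  shows "shannon B q \<le> shannon A p + shannon E w"
proof -
  note fin = codingD(1-3)[OF c]
  define x where "x = (\<lambda>(e, a) b. complex_of_real (sqrt (p a)) * k e b a)"
  define J where "J e a = p a * (\<Sum>b\<in>B. (cmod (k e b a))^2)" for e a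
  have g: "gram (E \<times> A) x b b' = (if b = b' then of_real (q b) else 0)" if "b \<in> B" "b' \<in> B" for b b'
  proof -
    have "gram (E \<times> A) x b b' = (\<Sum>e\<in>E. \<Sum>a\<in>A. of_real (sqrt (p a)) * of_real (sqrt (p a)) * (k e b a * cnj (k e b' a)))"
      unfolding gram_def x_def sum_Times by (intro sum.cong refl) (simp add: ac_simps)
    also have "\<dots> = (\<Sum>e\<in>E. \<Sum>a\<in>A. of_real (p a) * (k e b a * cnj (k e b' a)))"
      using codingD(4)[OF c] by (intro sum.cong refl) (simp flip: of_real_mult)
    finally show ?thesis using codingD(8)[OF c that] by simp
  qed
  have "(\<Sum>i\<in>B. cnj (if i = k then 1 else 0) * (if i = l then 1 else 0))
      = (\<Sum>i\<in>B. if i = l then (if k = l then 1 else 0 :: complex) else 0)" for k l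
    by (intro sum.cong refl) auto
  then have "orthon B B (\<lambda>b i. if i = b then 1 else 0)"
    unfolding orthon_def ip_def using fin by simp
  moreover have "(\<Sum>k\<in>B. of_real (q k) * (if i = k then 1 else 0) * cnj (if j = k then 1 else 0)) = gram (E \<times> A) x i j"
    if ij: "i \<in> B" "j \<in> B" for i j
  proof -
    have "(\<Sum>k\<in>B. of_real (q k) * (if i = k then 1 else 0) * cnj (if j = k then 1 else 0))
        = (\<Sum>k\<in>B. if k = i then (if i = j then complex_of_real (q i) else 0) else 0)"
      by (intro sum.cong refl) auto
    then show ?thesis using fin ij by (simp add: g)
  qed
  ultimately have "spec B (gram (E \<times> A) x) B (\<lambda>b i. if i = b then 1 else 0) q"
    unfolding spec_def using fin by simp
  then have "shannon B q = Ent B (gram (E \<times> A) x)"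
    unfolding shannon_eta by (rule Ent_spec[OF fin(2), symmetric])
  also have "\<dots> \<le> (\<Sum>l\<in>E \<times> A. eta (nsq B (x l)))"
    using fin by (intro Ent_le_ensemble) auto
  also have "\<dots> = (\<Sum>e\<in>E. \<Sum>a\<in>A. eta (J e a))"
    unfolding sum_Times using codingD(4)[OF c]
    by (intro sum.cong refl arg_cong[where f = eta])
       (simp add: nsq_def x_def J_def norm_mult power_mult_distrib sum_distrib_left)
  also have "\<dots> \<le> (\<Sum>e\<in>E. eta (w e)) + (\<Sum>a\<in>A. eta (p a))"
  proof (rule eta_subadditive)
    show "(\<Sum>a\<in>A. J e a) = w e" if "e \<in> E" for e
      unfolding coding_sums(2)[OF c that, symmetric] J_def sum_distrib_left by (rule sum.swap)
    show "(\<Sum>e\<in>E. J e a) = p a" if "a \<in> A" for a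
      using coding_sums(1)[OF c that] by (simp add: J_def flip: sum_distrib_left)
    show "0 \<le> J e a" if "e \<in> E" "a \<in> A" for e a
      unfolding J_def using codingD(4)[OF c that(2)] by (intro mult_nonneg_nonneg sum_nonneg) auto
  qed (use fin codingD(5)[OF c] in auto)
  finally show ?thesis by (simp add: shannon_eta)
qed

section \<open>Codes below the coherent information\<close>

text \<open>Truncation errors vanish by typicality and both eigenvalue ratios by a strictly negative
  exponent, the input ratio thanks to \<open>coding_entropy_triangle\<close>. All bounds depend on
  \<open>m\<close> only through \<open>2 powr (real n * r)\<close>, so one threshold for
  \<open>n\<close> serves all \<open>m\<close>.\<close>

theorem asymptotic_code:
  fixes E :: "'t \<Rightarrow> 'e set" and B :: "'t \<Rightarrow> 'b set" and k :: "'t \<Rightarrow> 'e \<Rightarrow> 'b \<Rightarrow> 'a \<Rightarrow> complex"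
  assumes finT: "finite \<T>" and nT: "\<T> \<noteq> {}"
    and c: "\<And>T. T \<in> \<T> \<Longrightarrow> coding A (B T) (E T) (k T) p (w T) (q T)"
    and rate: "\<And>T. T \<in> \<T> \<Longrightarrow> r < shannon (B T) (q T) - shannon (E T) (w T)"
    and eps: "0 < \<epsilon>"
  shows "\<forall>\<^sub>F n in sequentially. \<forall>m. 0 < m \<and> real m \<le> 2 powr (real n * r) \<longrightarrow>
    good_code \<T> (sys_power n A) (\<lambda>T. sys_power n (B T)) (\<lambda>T. sys_power n (E T)) (\<lambda>T. sys_power n (E T))
      (\<lambda>T. kpow n (k T)) m \<epsilon>"
proof -
  obtain \<delta>3 where d3: "0 < \<delta>3" "\<And>T. T \<in> \<T> \<Longrightarrow> r + \<delta>3 \<le> shannon (B T) (q T) - shannon (E T) (w T)"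
    using finite_uniform_gap[where f = "\<lambda>T. shannon (B T) (q T) - shannon (E T) (w T)", OF finT rate] by blast
  \<comment> \<open>Output and environment truncation each spend one \<open>\<delta>\<close> of the
    gap; the third drives the exponential decay.\<close>
  define \<delta> where "\<delta> = \<delta>3 / 3"
  have d: "0 < \<delta>" using d3 by (simp add: \<delta>_def)
  have gap: "r + 3 * \<delta> \<le> shannon (B T) (q T) - shannon (E T) (w T)" if "T \<in> \<T>" for T
    using d3(2)[OF that] by (simp add: \<delta>_def)
  obtain T0 where T0: "T0 \<in> \<T>" using nT by blast
  have gapA: "r + 3 * \<delta> \<le> shannon A p"
    using gap[OF T0] coding_entropy_triangle[OF c[OF T0]] by linarith
  note cA = codingD(1,4,5)[OF c[OF T0]]
  define al where "al n = 2 powr (- real n * (shannon A p - \<delta>))" for n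
  define be where "be T n = 2 powr (- real n * (shannon (E T) (w T) + \<delta>))" for T n
  define ga where "ga T n = 2 powr (- real n * (shannon (B T) (q T) - \<delta>))" for T n
  define A0 where "A0 = light p (shannon A p - \<delta>) A"
  define B0 where "B0 T = light (q T) (shannon (B T) (q T) - \<delta>) (B T)" for T
  define E0 where "E0 T = heavy (w T) (shannon (E T) (w T) + \<delta>) (E T)" for T
  define \<mu>A where "\<mu>A n = sum (ppow n p) (sys_power n A - A0 n)" for n
  define \<mu>B where "\<mu>B T n = sum (ppow n (q T)) (sys_power n (B T) - B0 T n)" for T n
  define \<mu>E where "\<mu>E T n = sum (ppow n (w T)) (sys_power n (E T) - E0 T n)" for T n
  define \<mu> where "\<mu> n = \<mu>A n + (\<Sum>T\<in>\<T>. \<mu>B T n + \<mu>E T n)" for n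
  define \<eta> where "\<eta> n = (2 powr (- \<delta>)) ^ n" for n :: nat
  \<comment> \<open>This leaves \<open>\<epsilon> / 8\<close> as the limit of \<open>K\<close>,
    below the \<open>\<epsilon> / 4\<close> that the loss \<open>4 * \<kappa>\<close>
    permits.\<close>
  define x where "x = 4 * real (card \<T>) / \<epsilon>"
  have cT: "0 < real (card \<T>)" using finT nT by (simp add: card_gt_0_iff)
  have x0: "0 < x" using cT eps by (simp add: x_def)
  define K where "K n = (\<Sum>T\<in>\<T>. 3 * \<mu> n + \<eta> n) + real (card \<T>) * (x * (\<mu> n + 2 * \<eta> n) + 1 / x) / 2" for n
  have "(\<lambda>n. \<mu>A n + (\<Sum>T\<in>\<T>. \<mu>B T n + \<mu>E T n)) \<longlonglongrightarrow> 0 + (\<Sum>T\<in>\<T>. 0 + 0)"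
    unfolding \<mu>A_def \<mu>B_def \<mu>E_def A0_def B0_def E0_def
    by (intro tendsto_add tendsto_sum light_heavy_mass[OF _ _ _ d] cA codingD(2,3)[OF c] coding_nonneg[OF c])
  then have mu0: "\<mu> \<longlonglongrightarrow> 0" by (simp add: \<mu>_def[abs_def])
  have eta0: "\<eta> \<longlonglongrightarrow> 0"
    unfolding \<eta>_def[abs_def] using d by (intro LIMSEQ_power_zero) (simp add: powr_less_one)
  have "(\<lambda>n. (\<Sum>T\<in>\<T>. 3 * \<mu> n + \<eta> n) + real (card \<T>) * (x * (\<mu> n + 2 * \<eta> n) + 1 / x) / 2)
      \<longlonglongrightarrow> (\<Sum>T\<in>\<T>. 3 * 0 + 0) + real (card \<T>) * (x * (0 + 2 * 0) + 1 / x) / 2"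
    by (intro tendsto_intros mu0 eta0) auto
  then have "K \<longlonglongrightarrow> \<epsilon> / 8"
    using cT eps by (simp add: K_def[abs_def] x_def)
  then have "\<forall>\<^sub>F n in sequentially. K n < \<epsilon> / 4"
    using eps by (intro order_tendstoD(2)) auto
  then show ?thesis
  proof (rule eventually_mono, intro allI impI)
    fix n m assume Kn: "K n < \<epsilon> / 4" and m: "0 < m \<and> real m \<le> 2 powr (real n * r)"
    have eta: "\<eta> n = 2 powr (- real n * \<delta>)"
      by (simp add: \<eta>_def powr_power mult.commute)
    have mun: "0 \<le> \<mu>A n" "\<And>T. T \<in> \<T> \<Longrightarrow> 0 \<le> \<mu>B T n" "\<And>T. T \<in> \<T> \<Longrightarrow> 0 \<le> \<mu>E T n"
      unfolding \<mu>A_def \<mu>B_def \<mu>E_def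
      using ppow_nonneg[OF cA(2)] ppow_nonneg[OF coding_nonneg(2)[OF c]] ppow_nonneg[OF coding_nonneg(1)[OF c]]
      by (auto intro!: sum_nonneg)
    have muT: "\<mu>B T n + \<mu>E T n \<le> (\<Sum>T\<in>\<T>. \<mu>B T n + \<mu>E T n)" if "T \<in> \<T>" for T
      using finT that mun by (intro member_le_sum) auto
    have mu: "\<mu>A n \<le> \<mu> n" "\<And>T. T \<in> \<T> \<Longrightarrow> \<mu>E T n \<le> \<mu> n" "\<And>T. T \<in> \<T> \<Longrightarrow> \<mu>B T n \<le> \<mu> n"
      using muT[OF T0] muT mun T0 unfolding \<mu>_def by fastforce+
    define \<kappa> where "\<kappa> = (\<Sum>T\<in>\<T>. 3 * \<mu> n + real m * ga T n / be T n)
        + real (card \<T>) * (x * (\<mu> n + 2 * real m * al n) + 1 / x) / 2"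
    have b1: "real m * ga T n / be T n \<le> \<eta> n" if T: "T \<in> \<T>" for T
    proof -
      have "real m * ga T n / be T n \<le> 2 powr (real n * r) * ga T n / be T n"
        using m by (intro divide_right_mono mult_right_mono) (auto simp: ga_def be_def)
      also have "\<dots> = 2 powr (real n * (r + 2 * \<delta> - (shannon (B T) (q T) - shannon (E T) (w T))))"
        unfolding ga_def be_def powr_add[symmetric] powr_diff[symmetric] by (simp add: algebra_simps)
      also have "\<dots> \<le> 2 powr (real n * (- \<delta>))"
        using gap[OF T] by (intro powr_mono mult_left_mono) auto
      finally show ?thesis by (simp add: eta)
    qed
    have b2: "real m * al n \<le> \<eta> n"
    proof -
      have "real m * al n \<le> 2 powr (real n * r) * al n"
        using m by (intro mult_right_mono) (auto simp: al_def)
      also have "\<dots> = 2 powr (real n * (r + \<delta> - shannon A p))"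
        unfolding al_def powr_add[symmetric] by (simp add: algebra_simps)
      also have "\<dots> \<le> 2 powr (real n * (- \<delta>))"
        using gapA d by (intro powr_mono mult_left_mono) auto
      finally show ?thesis by (simp add: eta)
    qed
    have "\<kappa> \<le> K n"
      unfolding \<kappa>_def K_def
    proof (intro add_mono sum_mono divide_right_mono mult_left_mono)
      show "2 * real m * al n \<le> 2 * \<eta> n" using b2 by simp
    qed (use b1 x0 in auto)
    then have kap: "4 * \<kappa> \<le> \<epsilon>" using Kn by simp
    have sub: "A0 n \<subseteq> sys_power n A" "\<And>T. T \<in> \<T> \<Longrightarrow> B0 T n \<subseteq> sys_power n (B T)" "\<And>T. T \<in> \<T> \<Longrightarrow> E0 T n \<subseteq> sys_power n (E T)"
      and bnds: "\<And>a. a \<in> A0 n \<Longrightarrow> ppow n p a \<le> al n"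
      "\<And>T e. T \<in> \<T> \<Longrightarrow> e \<in> E0 T n \<Longrightarrow> be T n \<le> ppow n (w T) e"
      "\<And>T b. T \<in> \<T> \<Longrightarrow> b \<in> B0 T n \<Longrightarrow> ppow n (q T) b \<le> ga T n"
      and pos: "0 < m" "0 \<le> al n" "\<And>T. T \<in> \<T> \<Longrightarrow> 0 < be T n" "\<And>T. T \<in> \<T> \<Longrightarrow> 0 \<le> ga T n"
      using m by (auto simp: A0_def B0_def E0_def light_def heavy_def al_def be_def ga_def)
    show "good_code \<T> (sys_power n A) (\<lambda>T. sys_power n (B T)) (\<lambda>T. sys_power n (E T)) (\<lambda>T. sys_power n (E T))
      (\<lambda>T. kpow n (k T)) m \<epsilon>"
    proof (rule one_shot_code[OF finT coding_power[OF c] nT sub pos(1,2) bnds(1) pos(3) bnds(2) pos(4) bnds(3)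
          mu[unfolded \<mu>A_def \<mu>B_def \<mu>E_def] x0 \<kappa>_def])
      fix U V
      assume UV: "contr (sys_power n A) {..<m} U"
        "\<And>T. T \<in> \<T> \<Longrightarrow> contr ({..<m} \<times> sys_power n (E T)) (sys_power n (B T)) (V T)"
        "\<And>(R :: nat set) \<phi> T. finite R \<Longrightarrow> T \<in> \<T> \<Longrightarrow> nsq (R \<times> {..<m}) \<phi> = 1 \<Longrightarrow>
          1 - 4 * \<kappa> \<le> (\<Sum>e\<in>sys_power n (E T). \<Sum>h\<in>sys_power n (E T).
            (cmod (amp R {..<m} (code_op (sys_power n A) (sys_power n (B T)) (V T) (kpow n (k T)) U e h) \<phi>))^2)"
      show ?thesis
        unfolding good_code_def
        using UV(1,2) order_trans[OF _ UV(3)[OF finite_lessThan]] kap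
        by (intro exI[of _ U] exI[of _ V]) force
    qed
  qed
qed

text \<open>One block is diagonalised and product bases serve its powers. The threshold concerns the
  number \<open>q\<close> of blocks only and is uniform in the rest \<open>d\<close>, so all large
  block lengths \<open>q * k + d\<close> are covered.\<close>

theorem direct_coding:
  fixes E :: "'t \<Rightarrow> 'e set" and B :: "'t \<Rightarrow> 'b set" and A :: "'a set" and R :: "'r set"
  assumes finT: "finite \<T>" and nT: "\<T> \<noteq> {}"
    and ki: "\<And>T. T \<in> \<T> \<Longrightarrow> kraus_iso A (B T) (E T) (K T)" and a0: "a0 \<in> A" and k: "0 < k"
    and \<phi>: "nsq (R \<times> sys_power k A) \<phi> = 1"
    and rate: "\<And>T. T \<in> \<T> \<Longrightarrow> r < Ent (sys_power k (B T)) (out_mat R (sys_power k A) (sys_power k (E T)) (kpow k (K T)) \<phi>)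
      - Ent (sys_power k (E T)) (env_mat R (sys_power k A) (sys_power k (B T)) (kpow k (K T)) \<phi>)"
    and eps: "0 < \<epsilon>"
  shows "\<forall>\<^sub>F q in sequentially. \<forall>m d. 0 < m \<and> real m \<le> 2 powr (real q * r) \<longrightarrow>
    good_code \<T> (sys_power (q * k + d) A) (\<lambda>T. sys_power (q * k + d) (B T)) (\<lambda>T. sys_power (q * k + d) (E T))
      (\<lambda>T. (sys_power q (sys_power k (E T)) \<times> {()}) \<times> sys_power d (B T)) (\<lambda>T. kpow (q * k + d) (K T)) m \<epsilon>"
proof -
  let ?A = "sys_power k A" and ?B = "\<lambda>T. sys_power k (B T)" and ?E = "\<lambda>T. sys_power k (E T)"
  let ?K = "\<lambda>T. kpow k (K T)"
  obtain T0 where T0: "T0 \<in> \<T>" using nT by blast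
  have finA: "finite A" and finA': "finite ?A" using kraus_isoD(1)[OF ki[OF T0]] finite_sys_power by blast+
  note finBE = kraus_isoD(2,3)[OF ki]
  have kik: "kraus_iso ?A (?B T) (?E T) (?K T)" if "T \<in> \<T>" for T by (rule kraus_iso_power[OF ki[OF that]])
  note finBE' = kraus_isoD(2,3)[OF kik]
  have "psd ?A (\<lambda>a a'. \<Sum>r\<in>R. \<phi> (r, a) * cnj (\<phi> (r, a')))" by (rule gram_psd)
  then obtain u p where su: "spec ?A (\<lambda>a a'. \<Sum>r\<in>R. \<phi> (r, a) * cnj (\<phi> (r, a'))) ?A u p"
    and p0: "\<And>a. a \<in> ?A \<Longrightarrow> 0 \<le> p a"
    using psd_spectral[OF finA'] by blast
  have "\<forall>T\<in>\<T>. \<exists>v y. spec (?B T) (out_mat R ?A (?E T) (?K T) \<phi>) (?B T) v y"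
    using psd_spectral[OF finBE'(1) out_mat_psd] by meson
  then obtain v y where v: "\<And>T. T \<in> \<T> \<Longrightarrow> spec (?B T) (out_mat R ?A (?E T) (?K T) \<phi>) (?B T) (v T) (y T)" by metis
  have "\<forall>T\<in>\<T>. \<exists>f w. spec (?E T) (env_mat R ?A (?B T) (?K T) \<phi>) (?E T) f w"
    using psd_spectral[OF finBE'(2) env_mat_psd] by meson
  then obtain f w where f: "\<And>T. T \<in> \<T> \<Longrightarrow> spec (?E T) (env_mat R ?A (?B T) (?K T) \<phi>) (?E T) (f T) (w T)" by metis
  define k' where "k' T = rotated ?A (?B T) (?E T) u (v T) (f T) (?K T)" for T
  have c: "coding ?A (?B T) (?E T) (k' T) p (w T) (y T)" if T: "T \<in> \<T>" for T
    unfolding k'_def by (rule rotated_coding[OF kik[OF T] \<phi> su p0 v[OF T] f[OF T]])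
  have rate': "r < shannon (?B T) (y T) - shannon (?E T) (w T)" if T: "T \<in> \<T>" for T
    using rate[OF T] unfolding Ent_spec[OF finBE'(1)[OF T] v[OF T]] Ent_spec[OF finBE'(2)[OF T] f[OF T]] shannon_eta .
  have "\<forall>\<^sub>F q in sequentially. \<forall>m. 0 < m \<and> real m \<le> 2 powr (real q * r) \<longrightarrow>
      good_code \<T> (sys_power q ?A) (\<lambda>T. sys_power q (?B T)) (\<lambda>T. sys_power q (?E T)) (\<lambda>T. sys_power q (?E T))
        (\<lambda>T. kpow q (k' T)) m \<epsilon>"
    by (rule asymptotic_code[where w = w and q = y, OF finT nT c rate' eps])
  then show ?thesis
  proof (rule eventually_mono, intro allI impI)
    fix q m d
    assume "\<forall>m. 0 < m \<and> real m \<le> 2 powr (real q * r) \<longrightarrow>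
      good_code \<T> (sys_power q ?A) (\<lambda>T. sys_power q (?B T)) (\<lambda>T. sys_power q (?E T)) (\<lambda>T. sys_power q (?E T))
        (\<lambda>T. kpow q (k' T)) m \<epsilon>" and "0 < m \<and> real m \<le> 2 powr (real q * r)"
    then have g: "good_code \<T> (sys_power q ?A) (\<lambda>T. sys_power q (?B T)) (\<lambda>T. sys_power q (?E T)) (\<lambda>T. sys_power q (?E T))
        (\<lambda>T. kpow q (k' T)) m \<epsilon>" by blast
    define Z where "Z T = rotated (sys_power q ?A) (sys_power q (?B T)) (sys_power q (?E T)) (\<lambda>x y. \<Prod>t<q. u (x t) (y t))
        (\<lambda>x y. \<Prod>t<q. v T (x t) (y t)) (\<lambda>x y. \<Prod>t<q. f T (x t) (y t)) (kpow q (?K T))" for T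
    have kz: "kpow q (k' T) = Z T" if T: "T \<in> \<T>" for T
      unfolding k'_def Z_def by (intro ext kpow_rotated finA' finBE'[OF T])
    have "good_code \<T> (sys_power q ?A) (\<lambda>T. sys_power q (?B T)) (\<lambda>T. sys_power q (?E T)) (\<lambda>T. sys_power q (?E T)) Z m \<epsilon>"
      using g unfolding good_code_def by (simp add: kz cong: ball_cong)
    then have "good_code \<T> (sys_power q ?A) (\<lambda>T. sys_power q (?B T)) (\<lambda>T. sys_power q (?E T))
        (\<lambda>T. sys_power q (?E T) \<times> {()}) (\<lambda>T. kpow q (?K T)) m \<epsilon>"
      unfolding Z_def
      by (rule good_code_unrotate)
        (use finA' finBE' finite_sys_power orthon_power specD(2)[OF su] specD(2)[OF v] specD(2)[OF f] in blast)+
    then show "good_code \<T> (sys_power (q * k + d) A) (\<lambda>T. sys_power (q * k + d) (B T)) (\<lambda>T. sys_power (q * k + d) (E T))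
      (\<lambda>T. (sys_power q (?E T) \<times> {()}) \<times> sys_power d (B T)) (\<lambda>T. kpow (q * k + d) (K T)) m \<epsilon>"
      by (rule good_code_unblock[OF _ k finA finBE a0]) (use kraus_isoD(4)[OF ki] in simp_all)
  qed
qed

section \<open>Kraus representations\<close>

text \<open>Only values on matrix units are recorded, as tensor products and powers of maps are
  defined by expansion in them.\<close>

definition kraus_rep ::
  "'i set \<Rightarrow> 'j set \<Rightarrow> ('i, 'j) superop \<Rightarrow> 'e set \<Rightarrow> ('e \<Rightarrow> 'j \<Rightarrow> 'i \<Rightarrow> complex) \<Rightarrow> bool" where
  "kraus_rep I J \<Phi> E K \<longleftrightarrow> kraus_iso I J E K \<and>
     (\<forall>a\<in>I. \<forall>a'\<in>I. \<forall>b b'. \<Phi> (mat_unit a a') b b'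
        = (if b \<in> J \<and> b' \<in> J then \<Sum>e\<in>E. K e b a * cnj (K e b' a') else 0))"

lemma kraus_repD:
  assumes "kraus_rep I J \<Phi> E K"
  shows "kraus_iso I J E K"
    "\<And>a a' b b'. a \<in> I \<Longrightarrow> a' \<in> I \<Longrightarrow> \<Phi> (mat_unit a a') b b'
        = (if b \<in> J \<and> b' \<in> J then \<Sum>e\<in>E. K e b a * cnj (K e b' a') else 0)"
  using assms unfolding kraus_rep_def by blast+

lemma op_psd_iff: "op_psd I X \<longleftrightarrow> X \<in> opers I \<and> psd I X"
  by (simp add: op_psd_def psd_def ip_mv)

lemma mat_unit_opers: "a \<in> I \<Longrightarrow> a' \<in> I \<Longrightarrow> mat_unit a a' \<in> opers I"
  by (auto simp: opers_def mat_unit_def)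

lemma so_tensor_id:
  assumes fin: "finite R"
  shows "so_tensor R I id \<Phi> X (s, b) (s', b') = (if s \<in> R \<and> s' \<in> R
    then \<Sum>i\<in>I. \<Sum>i'\<in>I. X (s, i) (s', i') * \<Phi> (mat_unit i i') b b' else 0)" (is "?lhs = _")
proof -
  define Y where "Y r r' = (\<Sum>i\<in>I. \<Sum>i'\<in>I. X (r, i) (r', i') * \<Phi> (mat_unit i i') b b')" for r r'
  have "?lhs = (\<Sum>r\<in>R. \<Sum>r'\<in>R. if r = s then (if r' = s' then Y r r' else 0) else 0)"
    unfolding so_tensor_def prod.case
  proof (intro sum.cong refl)
    fix r r'
    show "(\<Sum>j\<in>I. \<Sum>j'\<in>I. X (r, j) (r', j') * id (mat_unit r r') s s' * \<Phi> (mat_unit j j') b b')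
        = (if r = s then (if r' = s' then Y r r' else 0) else 0)"
      by (auto simp: mat_unit_def Y_def)
  qed
  also have "\<dots> = (\<Sum>r\<in>R. if r = s then (\<Sum>r'\<in>R. if r' = s' then Y s r' else 0) else 0)"
    by (intro sum.cong refl) auto
  also have "\<dots> = (if s \<in> R \<and> s' \<in> R then Y s s' else 0)" using fin by simp
  finally show ?thesis by (simp add: Y_def)
qed

lemma channelD:
  assumes "channel I J \<Phi>"
  shows "\<And>X. X \<in> opers I \<Longrightarrow> \<Phi> X \<in> opers J"
    "\<And>(r::nat) X. op_psd ({..<r} \<times> I) X \<Longrightarrow> op_psd ({..<r} \<times> J) (so_tensor {..<r} I id \<Phi> X)"
    "\<And>X. X \<in> opers I \<Longrightarrow> op_trace J (\<Phi> X) = op_trace I X"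
proof -
  note c = assms[unfolded channel_def]
  note c' = conjunct2[OF conjunct2[OF conjunct2[OF c]]]
  show "X \<in> opers I \<Longrightarrow> \<Phi> X \<in> opers J" for X by (rule bspec[OF conjunct1[OF c]])
  show "op_psd ({..<r} \<times> I) X \<Longrightarrow> op_psd ({..<r} \<times> J) (so_tensor {..<r} I id \<Phi> X)" for X and r :: nat
    by (rule mp[OF spec[OF spec[OF conjunct1[OF c']]]])
  show "X \<in> opers I \<Longrightarrow> op_trace J (\<Phi> X) = op_trace I X" for X by (rule bspec[OF conjunct2[OF c']])
qed

text \<open>Choi's construction: the Kraus operators are the scaled eigenvectors of the Choi
  operator, and trace preservation makes them an isometry. The explicit label set bounds their
  number, which the converse uses for its decoders.\<close>

theorem channel_kraus:
  fixes I :: "'i set" and J :: "'j set"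
  assumes fin: "finite I" "finite J" and ch: "channel I J \<Phi>"
  shows "\<exists>K. kraus_rep I J \<Phi> ({..<card I} \<times> J) K"
proof -
  define r where "r = card I"
  obtain g where g: "bij_betw g {..<r} I"
    using ex_bij_betw_nat_finite[OF fin(1)] by (auto simp: r_def lessThan_atLeast0)
  have gI: "g s \<in> I" if "s < r" for s using g that by (auto simp: bij_betw_def)
  define gi where "gi = the_inv_into {..<r} g"
  have gi: "gi a < r" "g (gi a) = a" if "a \<in> I" for a
  proof -
    have "gi a \<in> {..<r}" unfolding gi_def using g that by (intro the_inv_into_into) (auto simp: bij_betw_def)
    then show "gi a < r" by simp
    show "g (gi a) = a" unfolding gi_def using g that by (intro f_the_inv_into_f) (auto simp: bij_betw_def)
  qed
  \<comment> \<open>The unnormalised maximally entangled vector. Complete positivity is stated for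
    references \<open>{..<r}\<close>, so \<open>g\<close> identifies \<open>{..<card I}\<close> with
    \<open>I\<close>.\<close>
  define \<psi> where "\<psi> = (\<lambda>(s, i). if s < r \<and> i = g s then 1 else (0::complex))"
  define X where "X = ketbra \<psi>"
  have "\<psi> x = 0" if "x \<notin> {..<r} \<times> I" for x
    using that gI by (cases x) (auto simp: \<psi>_def)
  then have Xo: "X \<in> opers ({..<r} \<times> I)" unfolding X_def by (rule ketbra_opers)
  have "psd ({..<r} \<times> I) X"
    using psd_gram[of "{..<r} \<times> I" "{()}" "\<lambda>_. \<psi>"] by (simp add: gram_def X_def ketbra_def)
  then have "op_psd ({..<r} \<times> J) (so_tensor {..<r} I id \<Phi> X)"
    using channelD(2)[OF ch] Xo op_psd_iff by blast
  define C where "C = so_tensor {..<r} I id \<Phi> X"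
  have pC: "psd ({..<r} \<times> J) C" using \<open>op_psd _ _\<close> by (simp add: op_psd_iff C_def)
  have Cval: "C (s, b) (s', b') = \<Phi> (mat_unit (g s) (g s')) b b'" if s: "s < r" "s' < r" for s s' b b'
  proof -
    have "C (s, b) (s', b') = (\<Sum>i\<in>I. \<Sum>i'\<in>I. if i = g s then (if i' = g s' then \<Phi> (mat_unit (g s) (g s')) b b' else 0) else 0)"
      unfolding C_def so_tensor_id[OF finite_lessThan] using s
      by (auto simp: X_def ketbra_def \<psi>_def intro!: sum.cong)
    also have "\<dots> = \<Phi> (mat_unit (g s) (g s')) b b'"
      by (rule sum_delta_pair2) (use fin gI s in auto)
    finally show ?thesis .
  qed
  have finrJ: "finite ({..<r} \<times> J)" using fin by simp
  obtain u d where sp: "spec ({..<r} \<times> J) C ({..<r} \<times> J) u d" and d0: "\<And>k. k \<in> {..<r} \<times> J \<Longrightarrow> 0 \<le> d k"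
    using psd_spectral[OF finrJ pC] by blast
  define K where "K e b a = of_real (sqrt (d e)) * u e (gi a, b)" for e b a
  have val: "\<Phi> (mat_unit a a') b b' = (if b \<in> J \<and> b' \<in> J then \<Sum>e\<in>{..<r} \<times> J. K e b a * cnj (K e b' a') else 0)"
    if a: "a \<in> I" "a' \<in> I" for a a' b b'
  proof (cases "b \<in> J \<and> b' \<in> J")
    case True
    have "\<Phi> (mat_unit a a') b b' = C (gi a, b) (gi a', b')" using Cval gi a by simp
    also have "\<dots> = gram ({..<r} \<times> J) (\<lambda>k i. of_real (sqrt (d k)) * u k i) (gi a, b) (gi a', b')"
      by (rule psd_is_gram(1)[OF finrJ sp d0]) (use gi a True in auto)
    finally show ?thesis using True by (simp add: gram_def K_def)
  next
    case False
    have "\<Phi> (mat_unit a a') \<in> opers J" by (rule channelD(1)[OF ch mat_unit_opers[OF a]])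
    then show ?thesis using False by (auto simp: opers_def)
  qed
  have "(\<Sum>e\<in>{..<r} \<times> J. \<Sum>b\<in>J. cnj (K e b a) * K e b a') = (if a = a' then 1 else 0)" (is "?lhs = _") if a: "a \<in> I" "a' \<in> I" for a a'
  proof -
    have "?lhs = (\<Sum>b\<in>J. \<Sum>e\<in>{..<r} \<times> J. K e b a' * cnj (K e b a))"
      by (subst sum.swap) (simp add: mult.commute)
    also have "\<dots> = op_trace J (\<Phi> (mat_unit a' a))"
      unfolding op_trace_def by (intro sum.cong refl) (simp add: val a)
    also have "\<dots> = op_trace I (mat_unit a' a)" by (rule channelD(3)[OF ch mat_unit_opers[OF a(2,1)]])
    also have "\<dots> = (\<Sum>i\<in>I. if i = a' then (if a = a' then 1 else 0) else 0)"
      unfolding op_trace_def mat_unit_def by (intro sum.cong refl) auto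
    also have "\<dots> = (if a = a' then 1 else 0)" using fin a by simp
    finally show ?thesis .
  qed
  then have "kraus_rep I J \<Phi> ({..<r} \<times> J) K"
    unfolding kraus_rep_def kraus_iso_def
    by (intro conjI ballI allI fin finite_cartesian_product finite_lessThan val)
  then show ?thesis unfolding r_def by blast
qed

section \<open>Channels from Kraus operators\<close>

definition kraus_channel :: "'i set \<Rightarrow> 'j set \<Rightarrow> 'e set \<Rightarrow> ('e \<Rightarrow> 'j \<Rightarrow> 'i \<Rightarrow> complex) \<Rightarrow> ('i, 'j) superop" where
  "kraus_channel I J E K X = (\<lambda>b b'. if b \<in> J \<and> b' \<in> J
     then \<Sum>e\<in>E. \<Sum>a\<in>I. \<Sum>a'\<in>I. K e b a * X a a' * cnj (K e b' a') else 0)"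

lemma kraus_channel_mat_unit:
  assumes "finite I" "a \<in> I" "a' \<in> I"
  shows "kraus_channel I J E K (mat_unit a a') b b'
    = (if b \<in> J \<and> b' \<in> J then \<Sum>e\<in>E. K e b a * cnj (K e b' a') else 0)"
proof -
  have "(\<Sum>x\<in>I. \<Sum>x'\<in>I. K e b x * mat_unit a a' x x' * cnj (K e b' x'))
      = (\<Sum>x\<in>I. \<Sum>x'\<in>I. if x = a then (if x' = a' then K e b a * cnj (K e b' a') else 0) else 0)" for e
    by (intro sum.cong refl) (auto simp: mat_unit_def)
  then have "(\<Sum>x\<in>I. \<Sum>x'\<in>I. K e b x * mat_unit a a' x x' * cnj (K e b' x')) = K e b a * cnj (K e b' a')" for e
    using sum_delta_pair2[OF assms(1,1,2,3)] by simp
  then show ?thesis by (simp add: kraus_channel_def)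
qed

text \<open>The algebra behind complete positivity, coherent information and decoded states: a map
  in Kraus form takes a sum of outer products to a sum of outer products over
  \<open>E \<times> L\<close>. Left and right families are separate so that off-diagonal blocks of
  bipartite operators are included.\<close>

lemma kraus_apply:
  assumes \<Phi>: "\<And>a a'. a \<in> A \<Longrightarrow> a' \<in> A \<Longrightarrow> Y a a' = (\<Sum>e\<in>E. K e a * cnj (K' e a'))"
    and X: "\<And>a a'. a \<in> A \<Longrightarrow> a' \<in> A \<Longrightarrow> X a a' = (\<Sum>l\<in>L. x l a * cnj (x' l a'))"
  shows "(\<Sum>a\<in>A. \<Sum>a'\<in>A. X a a' * Y a a') = (\<Sum>e\<in>E. \<Sum>l\<in>L. (\<Sum>a\<in>A. K e a * x l a) * cnj (\<Sum>a'\<in>A. K' e a' * x' l a'))" (is "?lhs = _")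
proof -
  have "?lhs
      = (\<Sum>a\<in>A. \<Sum>a'\<in>A. \<Sum>y\<in>E \<times> L. (K (fst y) a * x (snd y) a) * cnj (K' (fst y) a' * x' (snd y) a'))"
  proof (intro sum.cong refl)
    fix a a' assume a: "a \<in> A" "a' \<in> A"
    have "X a a' * Y a a' = (\<Sum>e\<in>E. \<Sum>l\<in>L. (x l a * cnj (x' l a')) * (K e a * cnj (K' e a')))"
      unfolding X[OF a] \<Phi>[OF a] sum_product by (rule sum.swap)
    then show "X a a' * Y a a' = (\<Sum>y\<in>E \<times> L. (K (fst y) a * x (snd y) a) * cnj (K' (fst y) a' * x' (snd y) a'))"
      by (simp add: sum_Times ac_simps)
  qed
  also have "\<dots> = (\<Sum>y\<in>E \<times> L. \<Sum>a\<in>A. \<Sum>a'\<in>A. (K (fst y) a * x (snd y) a) * cnj (K' (fst y) a' * x' (snd y) a'))"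
    by (rule trans[OF sum.cong[OF refl sum.swap] sum.swap])
  also have "\<dots> = (\<Sum>y\<in>E \<times> L. (\<Sum>a\<in>A. K (fst y) a * x (snd y) a) * cnj (\<Sum>a'\<in>A. K' (fst y) a' * x' (snd y) a'))"
    unfolding cnj_sum sum_product ..
  finally show ?thesis by (simp add: sum_Times)
qed

theorem kraus_channel_channel:
  fixes I :: "'i set" and J :: "'j set"
  assumes k: "kraus_iso I J E K"
  shows "channel I J (kraus_channel I J E K)" "kraus_rep I J (kraus_channel I J E K) E K"
proof -
  note fin = kraus_isoD(1-3)[OF k]
  show "kraus_rep I J (kraus_channel I J E K) E K"
    unfolding kraus_rep_def by (intro conjI k ballI allI kraus_channel_mat_unit[OF fin(1)])
  have tr: "op_trace J (kraus_channel I J E K X) = op_trace I X" (is "?lhs = _") for X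
  proof -
    have "?lhs = (\<Sum>b\<in>J. \<Sum>e\<in>E. \<Sum>a\<in>I. \<Sum>a'\<in>I. X a a' * (cnj (K e b a') * K e b a))"
      unfolding op_trace_def kraus_channel_def by (intro sum.cong refl) (simp add: ac_simps)
    also have "\<dots> = (\<Sum>y\<in>E \<times> J. \<Sum>a\<in>I. \<Sum>a'\<in>I. X a a' * (cnj (K (fst y) (snd y) a') * K (fst y) (snd y) a))"
      by (rule trans, rule sum.swap, simp add: sum_Times)
    also have "\<dots> = (\<Sum>a\<in>I. \<Sum>a'\<in>I. \<Sum>y\<in>E \<times> J. X a a' * (cnj (K (fst y) (snd y) a') * K (fst y) (snd y) a))"
      by (subst sum.swap, intro sum.cong refl, rule sum.swap)
    also have "\<dots> = (\<Sum>a\<in>I. \<Sum>a'\<in>I. if a' = a then X a a' else 0)"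
      unfolding sum_distrib_left[symmetric] sum_Times using kraus_isoD(4)[OF k] by (intro sum.cong refl) simp
    also have "\<dots> = op_trace I X" using fin by (simp add: op_trace_def)
    finally show ?thesis .
  qed
  have cp: "op_psd ({..<r} \<times> J) (so_tensor {..<r} I id (kraus_channel I J E K) X)"
    if X: "op_psd ({..<r} \<times> I) X" for r :: nat and X
    unfolding op_psd_iff
  proof
    let ?Y = "so_tensor {..<r} I id (kraus_channel I J E K) X"
    show "?Y \<in> opers ({..<r} \<times> J)"
      unfolding opers_def
    proof (intro CollectI allI impI)
      fix x y assume xy: "x \<notin> {..<r} \<times> J \<or> y \<notin> {..<r} \<times> J"
      obtain s b s' b' where e: "x = (s, b)" "y = (s', b')" by (cases x, cases y) blast
      show "?Y x y = 0"
        unfolding e so_tensor_id[OF finite_lessThan] using xy fin(1)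
        by (auto simp: e kraus_channel_def intro!: sum.neutral)
    qed
    have fI: "finite ({..<r} \<times> I)" using fin by simp
    have pX: "psd ({..<r} \<times> I) X" using X by (simp add: op_psd_iff)
    obtain u d where sp: "spec ({..<r} \<times> I) X ({..<r} \<times> I) u d" and d0: "\<And>l. l \<in> {..<r} \<times> I \<Longrightarrow> 0 \<le> d l"
      using psd_spectral[OF fI pX] by blast
    define x where "x l i = of_real (sqrt (d l)) * u l i" for l i
    have Xx: "X i j = (\<Sum>l\<in>{..<r} \<times> I. x l i * cnj (x l j))" if "i \<in> {..<r} \<times> I" "j \<in> {..<r} \<times> I" for i j
      using psd_is_gram(1)[OF fI sp d0 that] by (simp add: gram_def x_def)
    have "?Y i j = gram (E \<times> ({..<r} \<times> I)) (\<lambda>(e, l) (s, b). \<Sum>a\<in>I. K e b a * x l (s, a)) i j"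
      if ij: "i \<in> {..<r} \<times> J" "j \<in> {..<r} \<times> J" for i j
    proof -
      obtain s b s' b' where e: "i = (s, b)" "j = (s', b')" by (cases i, cases j) blast
      have "?Y i j = (\<Sum>a\<in>I. \<Sum>a'\<in>I. X (s, a) (s', a') * kraus_channel I J E K (mat_unit a a') b b')"
        unfolding e so_tensor_id[OF finite_lessThan] using ij by (simp add: e)
      also have "\<dots> = (\<Sum>e\<in>E. \<Sum>l\<in>{..<r} \<times> I. (\<Sum>a\<in>I. K e b a * x l (s, a)) * cnj (\<Sum>a'\<in>I. K e b' a' * x l (s', a')))"
        using ij by (intro kraus_apply) (simp_all add: e kraus_channel_mat_unit[OF fin(1)] Xx)
      finally show ?thesis by (simp only: gram_def sum_Times[of _ E] e prod.case)
    qed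
    then show "psd ({..<r} \<times> J) ?Y" using psd_gram psd_cong[of "{..<r} \<times> J" ?Y] by blast
  qed
  show "channel I J (kraus_channel I J E K)"
    unfolding channel_def
  proof (intro conjI ballI allI impI cp tr)
    fix X show "kraus_channel I J E K X \<in> opers J" by (auto simp: opers_def kraus_channel_def)
  next
    fix X Y show "kraus_channel I J E K (\<lambda>i i'. X i i' + Y i i') = (\<lambda>j j'. kraus_channel I J E K X j j' + kraus_channel I J E K Y j j')"
      by (intro ext) (simp add: kraus_channel_def algebra_simps sum.distrib)
  next
    fix c X show "kraus_channel I J E K (\<lambda>i i'. c * X i i') = (\<lambda>j j'. c * kraus_channel I J E K X j j')"
      by (intro ext) (simp add: kraus_channel_def sum_distrib_left ac_simps)
  qed
qed

text \<open>The identity minus the sum of all \<open>K\<^sup>\<dagger> K\<close> is positive. Each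
  of its eigenvectors yields one more Kraus operator, which sends the missing weight to the fixed
  label \<open>b0\<close>.\<close>

theorem contraction_completion:
  fixes E :: "'e set" and I :: "'i set" and J :: "'j set"
  assumes fin: "finite I" "finite J" "finite E" and c: "contr (E \<times> J) I (\<lambda>(e, b) a. K e b a)" and b0: "b0 \<in> J"
  obtains K' :: "'e + 'i \<Rightarrow> 'j \<Rightarrow> 'i \<Rightarrow> complex" where "kraus_iso I J (E <+> I) K'" "\<And>e. K' (Inl e) = K e"
proof -
  define L where "L a a' = (if a = a' then 1 else 0) - (\<Sum>e\<in>E. \<Sum>b\<in>J. cnj (K e b a) * K e b a')" for a a'
  let ?F = "\<lambda>a a'. \<Sum>x\<in>E \<times> J. cnj (K (fst x) (snd x) a) * K (fst x) (snd x) a'"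
  let ?G = "\<lambda>e b v. mv I (\<lambda>x a. (case x of (e, b) \<Rightarrow> \<lambda>a. K e b a) a) v"
  have "psd I L"
    unfolding psd_def
  proof
    fix v
    have id: "mv I (\<lambda>i j. if i = j then 1 else 0) v i = v i" (is "?lhs = _") if "i \<in> I" for i
    proof -
      have "?lhs = (\<Sum>j\<in>I. if i = j then v j else 0)"
        unfolding mv_def by (intro sum.cong refl) auto
      then show ?thesis using fin that by simp
    qed
    have "mv I L v = (\<lambda>i. mv I (\<lambda>i j. if i = j then 1 else 0) v i
        - mv I ?F v i)"
      by (rule ext) (simp add: mv_def L_def left_diff_distrib sum_subtractf sum_Times)
    then have "ip I v (mv I L v) = ip I v v - ip I v (mv I ?F v)"
      by (simp only: ip_diff_right) (simp add: id cong: ip_cong)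
    also have "ip I v (mv I ?F v)
        = of_real (nsq (E \<times> J) (mv I (\<lambda>(e, b) a. K e b a) v))" (is "?lhs2 = _")
    proof -
      have "mv (E \<times> J) (\<lambda>a x. cnj ((case x of (e, b) \<Rightarrow> \<lambda>a. K e b a) a)) (?G e b v)
          = mv I ?F v"
        unfolding mv_comp by (simp add: case_prod_unfold)
      then have "?lhs2
          = ip (E \<times> J) (?G e b v) (?G e b v)"
        by (simp add: ip_mv_adjoint flip: mv_comp)
      then show ?thesis by (simp add: ip_self case_prod_unfold)
    qed
    finally have "ip I v (mv I L v) = of_real (nsq I v - nsq (E \<times> J) (mv I (\<lambda>(e, b) a. K e b a) v))"
      by (simp add: ip_self)
    then show "ip I v (mv I L v) \<in> \<real>\<^sub>\<ge>\<^sub>0"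
      using contrD[OF c, of v] by (simp only: nonneg_Reals_of_real_iff)
  qed
  then obtain u d where s: "spec I L I u d" and d0: "\<And>k. k \<in> I \<Longrightarrow> 0 \<le> d k" using psd_spectral[OF fin(1)] by blast
  define K' where "K' = case_sum K (\<lambda>k b a. if b = b0 then of_real (sqrt (d k)) * cnj (u k a) else 0)"
  have "(\<Sum>e\<in>E <+> I. \<Sum>b\<in>J. cnj (K' e b a) * K' e b a') = (if a = a' then 1 else 0)" if a: "a \<in> I" "a' \<in> I" for a a'
  proof -
    have "(\<Sum>k\<in>I. \<Sum>b\<in>J. cnj (K' (Inr k) b a) * K' (Inr k) b a') = (\<Sum>k\<in>I. of_real (sqrt (d k)) * u k a * cnj (of_real (sqrt (d k)) * u k a'))"
    proof (intro sum.cong refl)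
      fix k
      have "(\<Sum>b\<in>J. cnj (K' (Inr k) b a) * K' (Inr k) b a')
          = (\<Sum>b\<in>J. if b = b0 then of_real (sqrt (d k)) * u k a * cnj (of_real (sqrt (d k)) * u k a') else 0)"
        unfolding K'_def by (intro sum.cong refl) auto
      then show "(\<Sum>b\<in>J. cnj (K' (Inr k) b a) * K' (Inr k) b a')
          = of_real (sqrt (d k)) * u k a * cnj (of_real (sqrt (d k)) * u k a')"
        using fin b0 by simp
    qed
    also have "\<dots> = L a a'" using psd_is_gram(1)[OF fin(1) s d0 a] by (simp add: gram_def)
    finally show ?thesis using fin by (simp add: sum.Plus K'_def L_def)
  qed
  then have "kraus_iso I J (E <+> I) K'" unfolding kraus_iso_def using fin by auto
  then show ?thesis using that by (simp add: K'_def)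
qed

lemma so_power_mat_unit:
  assumes fin: "finite I" and a: "a \<in> sys_power n I" "a' \<in> sys_power n I"
  shows "so_power n I J \<Phi> (mat_unit a a') y y' = (if y \<in> sys_power n J \<and> y' \<in> sys_power n J
    then \<Prod>t<n. \<Phi> (mat_unit (a t) (a' t)) (y t) (y' t) else 0)"
proof -
  let ?P = "\<Prod>t<n. \<Phi> (mat_unit (a t) (a' t)) (y t) (y' t)"
  have "(\<Sum>x\<in>sys_power n I. \<Sum>x'\<in>sys_power n I. mat_unit a a' x x' * (\<Prod>t<n. \<Phi> (mat_unit (x t) (x' t)) (y t) (y' t)))
      = (\<Sum>x\<in>sys_power n I. \<Sum>x'\<in>sys_power n I. if x = a then (if x' = a' then ?P else 0) else 0)"
    by (intro sum.cong refl) (auto simp: mat_unit_def)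
  also have "\<dots> = ?P" by (rule sum_delta_pair2) (use a finite_sys_power[OF fin] in auto)
  finally show ?thesis by (simp add: so_power_def)
qed

lemma kraus_rep_power:
  assumes k: "kraus_rep I J \<Phi> E K"
  shows "kraus_rep (sys_power n I) (sys_power n J) (so_power n I J \<Phi>) (sys_power n E) (kpow n K)"
proof -
  note fin = kraus_isoD(1-3)[OF kraus_repD(1)[OF k]]
  have "so_power n I J \<Phi> (mat_unit a a') b b' = (if b \<in> sys_power n J \<and> b' \<in> sys_power n J
      then \<Sum>e\<in>sys_power n E. kpow n K e b a * cnj (kpow n K e b' a') else 0)"
    if a: "a \<in> sys_power n I" "a' \<in> sys_power n I" for a a' b b'
  proof (cases "b \<in> sys_power n J \<and> b' \<in> sys_power n J")
    case True
    have "(\<Prod>t<n. \<Phi> (mat_unit (a t) (a' t)) (b t) (b' t)) = (\<Prod>t<n. \<Sum>e\<in>E. K e (b t) (a t) * cnj (K e (b' t) (a' t)))"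
    proof (intro prod.cong refl)
      fix t assume t: "t \<in> {..<n}"
      have m: "a t \<in> I" "a' t \<in> I" "b t \<in> J" "b' t \<in> J" using sys_powerD a True t by auto
      show "\<Phi> (mat_unit (a t) (a' t)) (b t) (b' t) = (\<Sum>e\<in>E. K e (b t) (a t) * cnj (K e (b' t) (a' t)))"
        using kraus_repD(2)[OF k m(1,2)] m(3,4) by simp
    qed
    also have "\<dots> = (\<Sum>e\<in>sys_power n E. \<Prod>t<n. K (e t) (b t) (a t) * cnj (K (e t) (b' t) (a' t)))"
      by (rule sum_sys_power[OF fin(3), symmetric])
    finally show ?thesis unfolding so_power_mat_unit[OF fin(1) a] using True by (simp add: kpow_def prod.distrib)
  qed (auto simp: so_power_mat_unit[OF fin(1) a])
  then show ?thesis unfolding kraus_rep_def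
    by (intro conjI ballI allI kraus_iso_power[OF kraus_repD(1)[OF k]])
qed

lemma hermitian_cong:
  assumes "hermitian I M" "\<And>i j. i \<in> I \<Longrightarrow> j \<in> I \<Longrightarrow> M' i j = M i j"
  shows "hermitian I M'"
  using assms(1) unfolding hermitian_def by (metis assms(2))

text \<open>With the environment included the state is pure, so reference and output jointly have
  the entropy of the environment.\<close>

theorem coherent_info_kraus:
  assumes k: "kraus_rep A J \<Phi> E K"
  shows "coherent_info A J (so_tensor A A id \<Phi> (ketbra \<phi>))
    = Ent J (out_mat A A E K \<phi>) - Ent E (env_mat A A J K \<phi>)"
proof -
  note fin = kraus_isoD(1-3)[OF kraus_repD(1)[OF k]]
  define X where "X = so_tensor A A id \<Phi> (ketbra \<phi>)"
  have X: "X (s, b) (s', b') = (if (s, b) \<in> A \<times> J \<and> (s', b') \<in> A \<times> J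
      then \<Sum>e\<in>E. out_amp A K \<phi> e b s * cnj (out_amp A K \<phi> e b' s') else 0)" for s b s' b'
  proof -
    have "(\<Sum>a\<in>A. \<Sum>a'\<in>A. ketbra \<phi> (s, a) (s', a') * \<Phi> (mat_unit a a') b b')
        = (if b \<in> J \<and> b' \<in> J then \<Sum>e\<in>E. \<Sum>l\<in>{()}. (\<Sum>a\<in>A. K e b a * \<phi> (s, a)) * cnj (\<Sum>a'\<in>A. K e b' a' * \<phi> (s', a')) else 0)"
    proof (cases "b \<in> J \<and> b' \<in> J")
      case True
      then show ?thesis unfolding if_P[OF True]
        by (intro kraus_apply) (simp_all add: kraus_repD(2)[OF k] ketbra_def)
    next
      case False
      then have "\<Phi> (mat_unit a a') b b' = 0" if "a \<in> A" "a' \<in> A" for a a'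
        using kraus_repD(2)[OF k that] by auto
      then show ?thesis unfolding if_not_P[OF False] by (intro sum.neutral ballI) simp
    qed
    then show ?thesis unfolding X_def so_tensor_id[OF fin(1)] by (simp add: out_amp_def)
  qed
  have "ptrace_fst A X b b' = (if b \<in> J \<and> b' \<in> J then out_mat A A E K \<phi> b b' else 0)" for b b'
  proof -
    have "ptrace_fst A X b b' = (\<Sum>s\<in>A. if b \<in> J \<and> b' \<in> J then \<Sum>e\<in>E. out_amp A K \<phi> e b s * cnj (out_amp A K \<phi> e b' s) else 0)"
      unfolding ptrace_fst_def X by (intro sum.cong refl) auto
    then show ?thesis by (auto simp: out_mat_def intro: sum.swap)
  qed
  note P = this
  have "hermitian J (out_mat A A E K \<phi>)" by (rule psd_hermitian[OF fin(2) out_mat_psd])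
  then have hP: "hermitian J (ptrace_fst A X)" by (rule hermitian_cong) (simp add: P)
  have "vn_entropy J (ptrace_fst A X) = Ent J (ptrace_fst A X)"
    by (rule vn_entropy_Ent[OF fin(2) hP]) (simp add: opers_def P)
  also have "\<dots> = Ent J (out_mat A A E K \<phi>)" by (rule Ent_cong) (simp add: P)
  finally have 1: "vn_entropy J (ptrace_fst A X) = Ent J (out_mat A A E K \<phi>)" .
  let ?F = "\<lambda>e (s, b). out_amp A K \<phi> e b s"
  have XG: "X x y = (if x \<in> A \<times> J \<and> y \<in> A \<times> J then gram E ?F x y else 0)" for x y
    by (cases x, cases y) (simp add: X gram_def)
  have finAJ: "finite (A \<times> J)" using fin by simp
  have "hermitian (A \<times> J) (gram E ?F)" by (rule psd_hermitian[OF finAJ psd_gram])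
  then have hX: "hermitian (A \<times> J) X" by (rule hermitian_cong) (simp add: XG)
  have "vn_entropy (A \<times> J) X = Ent (A \<times> J) X"
    by (rule vn_entropy_Ent[OF finAJ hX]) (auto simp: opers_def XG)
  also have "\<dots> = Ent (A \<times> J) (gram E ?F)" by (rule Ent_cong) (simp add: XG)
  also have "\<dots> = Ent E (gram (A \<times> J) (\<lambda>x e. case x of (s, b) \<Rightarrow> out_amp A K \<phi> e b s))"
    by (rule Ent_gram_dual[OF finAJ fin(3)])
  also have "gram (A \<times> J) (\<lambda>x e. case x of (s, b) \<Rightarrow> out_amp A K \<phi> e b s) = env_mat A A J K \<phi>"
    by (intro ext) (simp add: gram_def env_mat_def sum_Times, rule sum.swap)
  finally have 2: "vn_entropy (A \<times> J) X = Ent E (env_mat A A J K \<phi>)" .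
  show ?thesis unfolding coherent_info_def X_def[symmetric] 1 2 ..
qed

section \<open>Marginal channels and the decoded state\<close>

lemma so_tensor_id_right:
  assumes fin: "finite R"
  shows "so_tensor I R \<Phi> id X (k, l) (k', l') = (if l \<in> R \<and> l' \<in> R
    then \<Sum>i\<in>I. \<Sum>i'\<in>I. X (i, l) (i', l') * \<Phi> (mat_unit i i') k k' else 0)"
proof -
  have "(\<Sum>j\<in>R. \<Sum>j'\<in>R. X (i, j) (i', j') * \<Phi> (mat_unit i i') k k' * id (mat_unit j j') l l')
      = (if l \<in> R \<and> l' \<in> R then X (i, l) (i', l') * \<Phi> (mat_unit i i') k k' else 0)" (is "?lhs = _") for i i'
  proof -
    have "?lhs
        = (\<Sum>j\<in>R. if j = l then (\<Sum>j'\<in>R. if j' = l' then X (i, l) (i', l') * \<Phi> (mat_unit i i') k k' else 0) else 0)"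
      by (intro sum.cong refl) (auto simp: mat_unit_def intro!: sum.cong sum.neutral)
    then show ?thesis using fin by simp
  qed
  note eq = this
  show ?thesis
  proof (cases "l \<in> R \<and> l' \<in> R")
    case True
    then show ?thesis unfolding so_tensor_def prod.case eq by simp
  next
    case False
    then show ?thesis unfolding so_tensor_def prod.case eq by (simp only: if_False sum.neutral_const)
  qed
qed

lemma finite_sys_B: "finite T \<Longrightarrow> finite (sys_B dB T)"
  unfolding sys_B_def by (rule finite_PiE) auto

lemma merge_sys_B:
  assumes "T \<subseteq> U" "x \<in> sys_B dB T" "y \<in> sys_B dB (U - T)"
  shows "merge T (U - T) (x, y) \<in> sys_B dB U"
proof -
  have U: "T \<union> (U - T) = U" using assms(1) by blast
  have "merge T (U - T) (x, y) \<in> PiE (T \<union> (U - T)) (\<lambda>k. {..<dB k})"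
    unfolding PiE_cancel_merge[OF Diff_disjoint] using assms(2,3) by (simp add: sys_B_def PiE_def)
  then show ?thesis unfolding sys_B_def U .
qed

lemma sum_sys_B:
  assumes "T \<subseteq> U"
  shows "(\<Sum>b\<in>sys_B dB U. f b) = (\<Sum>x\<in>sys_B dB T. \<Sum>y\<in>sys_B dB (U - T). f (merge T (U - T) (x, y)))"
proof -
  have U: "T \<union> (U - T) = U" using assms by blast
  have "bij_betw (merge T (U - T)) (sys_B dB T \<times> sys_B dB (U - T)) (sys_B dB U)"
  proof (rule bij_betw_byWitness[where f' = "\<lambda>b. (restrict b T, restrict b (U - T))"])
    show "\<forall>a\<in>sys_B dB T \<times> sys_B dB (U - T). (restrict (merge T (U - T) a) T, restrict (merge T (U - T) a) (U - T)) = a"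
      by (auto simp: sys_B_def PiE_def extensional_restrict)
    show "\<forall>b\<in>sys_B dB U. merge T (U - T) (restrict b T, restrict b (U - T)) = b"
    proof
      fix b assume b: "b \<in> sys_B dB U"
      show "merge T (U - T) (restrict b T, restrict b (U - T)) = b"
      proof
        fix i show "merge T (U - T) (restrict b T, restrict b (U - T)) i = b i"
          using b assms by (cases "i \<in> T"; cases "i \<in> U") (auto simp: sys_B_def merge_def PiE_def extensional_def)
      qed
    qed
    show "merge T (U - T) ` (sys_B dB T \<times> sys_B dB (U - T)) \<subseteq> sys_B dB U"
      using merge_sys_B[OF assms] by auto
    show "(\<lambda>b. (restrict b T, restrict b (U - T))) ` sys_B dB U \<subseteq> sys_B dB T \<times> sys_B dB (U - T)"
      using assms by (auto simp: sys_B_def)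
  qed
  from sum.reindex_bij_betw[OF this, of f] show ?thesis by (simp add: sum_Times)
qed

definition marginal_kraus ::
  "nat set \<Rightarrow> nat set \<Rightarrow> ('e \<Rightarrow> (nat \<Rightarrow> nat) \<Rightarrow> 'a \<Rightarrow> complex) \<Rightarrow> 'e \<times> (nat \<Rightarrow> nat) \<Rightarrow> (nat \<Rightarrow> nat) \<Rightarrow> 'a \<Rightarrow> complex" where
  "marginal_kraus T T' k = (\<lambda>(e, y) x a. k e (merge T T' (x, y)) a)"

lemma marginal_mat:
  assumes "b \<in> sys_B dB T" "b' \<in> sys_B dB T"
  shows "marginal_channel K dB N T X b b'
    = (\<Sum>y\<in>sys_B dB ({1..K} - T). N X (merge T ({1..K} - T) (b, y)) (merge T ({1..K} - T) (b', y)))"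
  unfolding marginal_channel_def ptrace_snd_def relabel_def using assms by (intro sum.cong refl) simp

lemma kraus_rep_marginal:
  assumes k: "kraus_rep A (sys_B dB {1..K}) N E k" and T: "T \<subseteq> {1..K}"
  shows "kraus_rep A (sys_B dB T) (marginal_channel K dB N T) (E \<times> sys_B dB ({1..K} - T))
    (marginal_kraus T ({1..K} - T) k)"
proof -
  let ?T' = "{1..K} - T"
  note ki = kraus_repD(1)[OF k]
  note fin = kraus_isoD(1-3)[OF ki]
  have finT: "finite T" using T finite_subset by blast
  have fin': "finite (sys_B dB T)" "finite (E \<times> sys_B dB ?T')" using finT fin by (simp_all add: finite_sys_B)
  have iso: "(\<Sum>e\<in>E \<times> sys_B dB ?T'. \<Sum>b\<in>sys_B dB T. cnj (marginal_kraus T ?T' k e b a) * marginal_kraus T ?T' k e b a')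
      = (if a = a' then 1 else 0)" (is "?lhs = _") if a: "a \<in> A" "a' \<in> A" for a a'
  proof -
    have "?lhs
        = (\<Sum>e\<in>E. \<Sum>b\<in>sys_B dB T. \<Sum>y\<in>sys_B dB ?T'. cnj (k e (merge T ?T' (b, y)) a) * k e (merge T ?T' (b, y)) a')"
      unfolding sum_Times marginal_kraus_def prod.case by (intro sum.cong refl sum.swap)
    also have "\<dots> = (\<Sum>e\<in>E. \<Sum>b\<in>sys_B dB {1..K}. cnj (k e b a) * k e b a')"
      by (intro sum.cong refl sum_sys_B[OF T, symmetric])
    finally show ?thesis using kraus_isoD(4)[OF ki a] by simp
  qed
  have val: "marginal_channel K dB N T (mat_unit a a') b b' = (if b \<in> sys_B dB T \<and> b' \<in> sys_B dB T
      then \<Sum>e\<in>E \<times> sys_B dB ?T'. marginal_kraus T ?T' k e b a * cnj (marginal_kraus T ?T' k e b' a') else 0)" (is "?lhs2 = _")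
    if a: "a \<in> A" "a' \<in> A" for a a' b b'
  proof (cases "b \<in> sys_B dB T \<and> b' \<in> sys_B dB T")
    case True
    have "?lhs2
        = (\<Sum>y\<in>sys_B dB ?T'. \<Sum>e\<in>E. k e (merge T ?T' (b, y)) a * cnj (k e (merge T ?T' (b', y)) a'))"
      unfolding marginal_mat[OF conjunct1[OF True] conjunct2[OF True]]
      using merge_sys_B[OF T] True by (intro sum.cong refl) (simp add: kraus_repD(2)[OF k a])
    also have "\<dots> = (\<Sum>e\<in>E. \<Sum>y\<in>sys_B dB ?T'. k e (merge T ?T' (b, y)) a * cnj (k e (merge T ?T' (b', y)) a'))"
      by (rule sum.swap)
    finally show ?thesis unfolding if_P[OF True] sum_Times marginal_kraus_def prod.case .
  next
    case False
    then show ?thesis unfolding marginal_channel_def ptrace_snd_def relabel_def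
      by (auto intro!: sum.neutral)
  qed
  show ?thesis unfolding kraus_rep_def kraus_iso_def
    by (intro conjI ballI allI fin(1) fin' iso val)
qed

text \<open>Discarding the receivers outside \<open>T\<close> commutes with decoding, so encoder and
  decoder only meet the powers of the marginal channel.\<close>

lemma reduced_decoded_state_expand:
  assumes T: "T \<subseteq> {1..K}"
  shows "reduced_decoded_state K dA dB N m n F D T \<phi> (s, z) (s', z') = (if s < m \<and> s' < m then
    \<Sum>x\<in>sys_power n (sys_B dB T). \<Sum>x'\<in>sys_power n (sys_B dB T).
      (\<Sum>a\<in>sys_power n {..<dA}. \<Sum>a'\<in>sys_power n {..<dA}.
        (\<Sum>r<m. \<Sum>r'<m. \<phi> (s, r) * cnj (\<phi> (s', r')) * F (mat_unit r r') a a')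
        * so_power n {..<dA} (sys_B dB T) (marginal_channel K dB N T) (mat_unit a a') x x')
      * D T (mat_unit x x') z z' else 0)" (is "?lhs = _")
proof -
  define S where "S = {..<m}"
  define T' where "T' = {1..K} - T"
  define BT where "BT = sys_power n (sys_B dB T)"
  define BT' where "BT' = sys_power n (sys_B dB T')"
  define A where "A = sys_power n {..<dA}"
  define P where "P = so_power n {..<dA} (sys_B dB {1..K}) N"
  define M where "M = so_power n {..<dA} (sys_B dB T) (marginal_channel K dB N T)"
  define mg where "mg x y = (\<lambda>t\<in>{..<n}. merge T T' (x t, y t))" for x y :: "nat \<Rightarrow> nat \<Rightarrow> nat"
  define out where "out = so_tensor S S id (P \<circ> F) (ketbra \<phi>)"
  define rg where "rg = relabel ((S \<times> BT) \<times> BT') (\<lambda>((s, x), y). (s, mg x y)) out"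
  have finS: "finite S" and finA: "finite A" and finT: "finite T" and finT': "finite T'"
    using T finite_subset by (auto simp: S_def A_def T'_def intro: finite_sys_power)
  have finBT: "finite BT" "finite BT'" unfolding BT_def BT'_def
    by (intro finite_sys_power finite_sys_B finT finT')+
  have red: "?lhs
      = (\<Sum>y\<in>BT'. so_tensor (S \<times> BT) BT' (so_tensor S BT id (D T)) id rg ((s, z), y) ((s', z'), y))"
    unfolding reduced_decoded_state_def ptrace_snd_def decoded_state_def Let_def rg_def out_def P_def S_def BT_def BT'_def
      T'_def mg_def ..
  have mgm: "mg x y \<in> sys_power n (sys_B dB {1..K})" if "x \<in> BT" "y \<in> BT'" for x y
  proof -
    have "merge T T' (x t, y t) \<in> sys_B dB {1..K}" if "t < n" for t
      unfolding T'_def using sys_powerD[OF \<open>x \<in> BT\<close>[unfolded BT_def] that] sys_powerD[OF \<open>y \<in> BT'\<close>[unfolded BT'_def] that]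
      by (intro merge_sys_B[OF T]) (simp_all add: T'_def)
    then show ?thesis by (simp add: sys_power_def mg_def)
  qed
  let ?H = "\<lambda>y. if s \<in> S \<and> s' \<in> S then \<Sum>x\<in>BT. \<Sum>x'\<in>BT. rg ((s, x), y) ((s', x'), y) * D T (mat_unit x x') z z' else 0"
  have step1: "so_tensor (S \<times> BT) BT' (so_tensor S BT id (D T)) id rg ((s, z), y) ((s', z'), y)
      = ?H y" (is "?lhs2 = _")
    if y: "y \<in> BT'" for y
  proof -
    have in1: "so_tensor S BT id (D T) (mat_unit (s0, x) (s0', x')) (s, z) (s', z')
        = (if s \<in> S \<and> s' \<in> S \<and> s0 = s \<and> s0' = s' then D T (mat_unit x x') z z' else 0)"
      if x: "x \<in> BT" "x' \<in> BT" for s0 s0' x x'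
    proof (cases "s \<in> S \<and> s' \<in> S")
      case True
      have "(\<Sum>i\<in>BT. \<Sum>i'\<in>BT. mat_unit (s0, x) (s0', x') (s, i) (s', i') * D T (mat_unit i i') z z')
          = (\<Sum>i\<in>BT. \<Sum>i'\<in>BT. if i = x then (if i' = x' then (if s0 = s \<and> s0' = s' then D T (mat_unit x x') z z' else 0) else 0) else 0)"
        by (intro sum.cong refl) (auto simp: mat_unit_def)
      also have "\<dots> = (if s0 = s \<and> s0' = s' then D T (mat_unit x x') z z' else 0)"
        by (rule sum_delta_pair2[OF finBT(1) finBT(1) x])
      finally show ?thesis unfolding so_tensor_id[OF finS] using True by simp
    qed (auto simp: so_tensor_id[OF finS])
    have "?lhs2
        = (\<Sum>s0\<in>S. \<Sum>x\<in>BT. \<Sum>s0'\<in>S. \<Sum>x'\<in>BT. rg ((s0, x), y) ((s0', x'), y)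
           * (if s \<in> S \<and> s' \<in> S \<and> s0 = s \<and> s0' = s' then D T (mat_unit x x') z z' else 0))"
      unfolding so_tensor_id_right[OF finBT(2)] using y by (simp add: sum_Times in1 cong: sum.cong)
    also have "\<dots> = (\<Sum>s0\<in>S. if s0 = s then (\<Sum>x\<in>BT. \<Sum>s0'\<in>S. if s0' = s' then
         (if s \<in> S \<and> s' \<in> S then \<Sum>x'\<in>BT. rg ((s, x), y) ((s', x'), y) * D T (mat_unit x x') z z' else 0) else 0) else 0)"
      by (intro sum.cong refl) (auto intro!: sum.cong sum.neutral)
    also have "\<dots> = ?H y"
      using finS by simp
    finally show ?thesis .
  qed
  let ?F = "\<lambda>x y x'. \<Sum>r\<in>S. \<Sum>r'\<in>S. \<phi> (s, r) * cnj (\<phi> (s', r')) * (\<Sum>a\<in>A. \<Sum>a'\<in>A. F (mat_unit r r') a a' * (\<Prod>t<n. N (mat_unit (a t) (a' t)) (merge T T' (x t, y t)) (merge T T' (x' t, y t))))"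
  let ?G = "\<lambda>x x'. \<Sum>a\<in>A. \<Sum>a'\<in>A. (\<Sum>r\<in>S. \<Sum>r'\<in>S. \<phi> (s, r) * cnj (\<phi> (s', r')) * F (mat_unit r r') a a') * M (mat_unit a a') x x'"
  show ?thesis
  proof (cases "s \<in> S \<and> s' \<in> S")
    case False
    then have "?lhs = 0"
      unfolding red by (intro sum.neutral ballI) (simp only: step1 if_False)
    then show ?thesis using False by (auto simp: S_def)
  next
    case True
    have rgv: "rg ((s, x), y) ((s', x'), y) = ?F x y x'"
      if x: "x \<in> BT" "x' \<in> BT" "y \<in> BT'" for x x' y
    proof -
      have "rg ((s, x), y) ((s', x'), y) = out (s, mg x y) (s', mg x' y)"
        unfolding rg_def relabel_def using x True by simp
      also have "\<dots> = (\<Sum>r\<in>S. \<Sum>r'\<in>S. \<phi> (s, r) * cnj (\<phi> (s', r')) * P (F (mat_unit r r')) (mg x y) (mg x' y))"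
        unfolding out_def so_tensor_id[OF finS] using True by (simp add: ketbra_def)
      also have "\<dots> = ?F x y x'"
        unfolding P_def so_power_def A_def[symmetric] using mgm[OF x(1,3)] mgm[OF x(2,3)]
        by (intro sum.cong refl arg_cong2[where f = "(*)"]) (simp add: mg_def)
      finally show ?thesis .
    qed
    \<comment> \<open>The sum over words of the discarded receivers factorises over the channel
      uses, each factor being a partial trace.\<close>
    have pr: "(\<Sum>y\<in>BT'. \<Prod>t<n. N (mat_unit (a t) (a' t)) (merge T T' (x t, y t)) (merge T T' (x' t, y t)))
        = M (mat_unit a a') x x'" (is "?lhs3 = _") if x: "x \<in> BT" "x' \<in> BT" and a: "a \<in> A" "a' \<in> A" for a a' x x'
    proof -
      have "?lhs3
          = (\<Prod>t<n. \<Sum>y\<in>sys_B dB T'. N (mat_unit (a t) (a' t)) (merge T T' (x t, y)) (merge T T' (x' t, y)))"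
        unfolding BT'_def by (rule sum_sys_power[OF finite_sys_B[OF finT'],
          where f = "\<lambda>t y. N (mat_unit (a t) (a' t)) (merge T T' (x t, y)) (merge T T' (x' t, y))"])
      also have "\<dots> = (\<Prod>t<n. marginal_channel K dB N T (mat_unit (a t) (a' t)) (x t) (x' t))"
      proof (intro prod.cong refl)
        fix t assume "t \<in> {..<n}"
        then have "x t \<in> sys_B dB T" "x' t \<in> sys_B dB T" using x sys_powerD unfolding BT_def by auto
        then show "(\<Sum>y\<in>sys_B dB T'. N (mat_unit (a t) (a' t)) (merge T T' (x t, y)) (merge T T' (x' t, y)))
            = marginal_channel K dB N T (mat_unit (a t) (a' t)) (x t) (x' t)"
          by (simp add: marginal_mat T'_def)
      qed
      also have "\<dots> = M (mat_unit a a') x x'"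
        unfolding M_def so_power_mat_unit[OF finite_lessThan a[unfolded A_def]] using x by (simp add: BT_def)
      finally show ?thesis .
    qed
    have key: "(\<Sum>y\<in>BT'. rg ((s, x), y) ((s', x'), y)) = ?G x x'" (is "?lhs4 = _")
      if x: "x \<in> BT" "x' \<in> BT" for x x'
    proof -
      let ?c = "\<lambda>r r'. \<phi> (s, r) * cnj (\<phi> (s', r'))"
      let ?q = "\<lambda>y a a'. \<Prod>t<n. N (mat_unit (a t) (a' t)) (merge T T' (x t, y t)) (merge T T' (x' t, y t))"
      have "?lhs4
          = (\<Sum>y\<in>BT'. \<Sum>p\<in>S \<times> S. \<Sum>w\<in>A \<times> A. ?c (fst p) (snd p) * F (mat_unit (fst p) (snd p)) (fst w) (snd w) * ?q y (fst w) (snd w))"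
        by (intro sum.cong refl) (simp add: rgv[OF x] sum_Times sum_distrib_left mult.assoc)
      also have "\<dots> = (\<Sum>w\<in>A \<times> A. \<Sum>p\<in>S \<times> S. \<Sum>y\<in>BT'. ?c (fst p) (snd p) * F (mat_unit (fst p) (snd p)) (fst w) (snd w) * ?q y (fst w) (snd w))"
        by (rule trans, rule trans[OF sum.swap], rule sum.cong[OF refl], rule sum.swap, rule sum.swap)
      also have "\<dots> = (\<Sum>w\<in>A \<times> A. \<Sum>p\<in>S \<times> S. ?c (fst p) (snd p) * F (mat_unit (fst p) (snd p)) (fst w) (snd w) * M (mat_unit (fst w) (snd w)) x x')"
        unfolding sum_distrib_left[symmetric] by (intro sum.cong refl) (auto simp: pr[OF x])
      finally show ?thesis by (simp add: sum_Times sum_distrib_right)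
    qed
    have "?lhs
        = (\<Sum>y\<in>BT'. \<Sum>x\<in>BT. \<Sum>x'\<in>BT. rg ((s, x), y) ((s', x'), y) * D T (mat_unit x x') z z')"
      unfolding red by (intro sum.cong refl) (simp add: step1 True)
    also have "\<dots> = (\<Sum>x\<in>BT. \<Sum>x'\<in>BT. (\<Sum>y\<in>BT'. rg ((s, x), y) ((s', x'), y)) * D T (mat_unit x x') z z')"
      by (rule trans, rule trans[OF sum.swap], rule sum.cong[OF refl], rule sum.swap, simp only: sum_distrib_right)
    also have "\<dots> = (\<Sum>x\<in>BT. \<Sum>x'\<in>BT. (?G x x') * D T (mat_unit x x') z z')"
      by (intro sum.cong refl) (simp add: key)
    finally show ?thesis unfolding if_P[OF True] using True by (simp add: S_def A_def BT_def M_def)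
  qed
qed

text \<open>The reduced state is the Gram operator of the vectors obtained by applying each code
  operator to the second half of \<open>\<phi>\<close>, one for every triple of decoder, environment
  and encoder labels.\<close>

theorem fidelity_code:
  assumes T: "T \<subseteq> {1..K}" and k: "kraus_rep {..<dA} (sys_B dB {1..K}) N E k"
    and F: "kraus_rep {..<m} (sys_power n {..<dA}) F G kf"
    and D: "kraus_rep (sys_power n (sys_B dB T)) {..<m} (D T) H kd"
    and \<phi>: "\<phi> \<in> unit_kets ({..<m} \<times> {..<m})"
  shows "fidelity ({..<m} \<times> {..<m}) (ketbra \<phi>) (reduced_decoded_state K dA dB N m n F D T \<phi>)
    = (\<Sum>h\<in>H. \<Sum>e\<in>sys_power n (E \<times> sys_B dB ({1..K} - T)). \<Sum>g\<in>G.
        (cmod (amp {..<m} {..<m} (code_op (sys_power n {..<dA}) (sys_power n (sys_B dB T)) (\<lambda>(s, h). kd h s)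
          (kpow n (marginal_kraus T ({1..K} - T) k)) (kf g) e h) \<phi>))^2)"
proof -
  let ?S = "{..<m}" and ?A = "sys_power n {..<dA}" and ?B = "sys_power n (sys_B dB T)"
    and ?E = "sys_power n (E \<times> sys_B dB ({1..K} - T))" and ?k = "kpow n (marginal_kraus T ({1..K} - T) k)"
  note kT = kraus_rep_power[OF kraus_rep_marginal[OF k T], of n]
  define x where "x l = (\<lambda>(s, z). mv ?S (code_op ?A ?B (\<lambda>(s, h). kd h s) ?k (kf (snd (snd l))) (fst (snd l)) (fst l)) (\<lambda>r. \<phi> (s, r)) z)"
    for l
  let ?F = "\<lambda>s s' a a'. \<Sum>r<m. \<Sum>r'<m. \<phi> (s, r) * cnj (\<phi> (s', r')) * F (mat_unit r r') a a'"
  have "reduced_decoded_state K dA dB N m n F D T \<phi> i j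
      = (if i \<in> ?S \<times> ?S \<and> j \<in> ?S \<times> ?S then \<Sum>l\<in>H \<times> ?E \<times> G. x l i * cnj (x l j) else 0)" (is "?lhs = _") for i j
  proof -
    obtain s z s' z' where ij: "i = (s, z)" "j = (s', z')" by (cases i, cases j) blast
    define f where "f g a s = (\<Sum>r<m. kf g a r * \<phi> (s, r))" for g a s
    define y where "y p b s = (\<Sum>a\<in>?A. ?k (fst p) b a * f (snd p) a s)" for p b s
    have 1: "?F s s' a a'
        = (\<Sum>g\<in>G. f g a s * cnj (f g a' s'))" (is "?lhs2 = _") if a: "a \<in> ?A" "a' \<in> ?A" for a a'
    proof -
      have "?lhs2
          = (\<Sum>g\<in>G. \<Sum>l\<in>{()}. (\<Sum>r<m. kf g a r * \<phi> (s, r)) * cnj (\<Sum>r'<m. kf g a' r' * \<phi> (s', r')))"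
        using a by (intro kraus_apply) (simp_all add: kraus_repD(2)[OF F])
      then show ?thesis by (simp add: f_def)
    qed
    have 2: "(\<Sum>a\<in>?A. \<Sum>a'\<in>?A. (?F s s' a a')
          * so_power n {..<dA} (sys_B dB T) (marginal_channel K dB N T) (mat_unit a a') b b')
        = (\<Sum>p\<in>?E \<times> G. y p b s * cnj (y p b' s'))" (is "?lhs3 = _") if b: "b \<in> ?B" "b' \<in> ?B" for b b'
    proof -
      have "?lhs3
          = (\<Sum>e\<in>?E. \<Sum>g\<in>G. (\<Sum>a\<in>?A. ?k e b a * f g a s) * cnj (\<Sum>a'\<in>?A. ?k e b' a' * f g a' s'))"
        using b by (intro kraus_apply) (simp_all only: kraus_repD(2)[OF kT] 1 if_True simp_thms)
      then show ?thesis by (simp add: y_def sum_Times)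
    qed
    have 3: "(\<Sum>b\<in>?B. \<Sum>b'\<in>?B. (\<Sum>a\<in>?A. \<Sum>a'\<in>?A. (?F s s' a a')
          * so_power n {..<dA} (sys_B dB T) (marginal_channel K dB N T) (mat_unit a a') b b') * D T (mat_unit b b') z z')
        = (\<Sum>h\<in>H. \<Sum>p\<in>?E \<times> G. (\<Sum>b\<in>?B. kd h z b * y p b s) * cnj (\<Sum>b'\<in>?B. kd h z' b' * y p b' s'))" if z: "z < m" "z' < m"
      using z by (intro kraus_apply) (simp_all only: kraus_repD(2)[OF D] 2 lessThan_iff if_True simp_thms)
    have x: "x (h, p) (s, z) = (\<Sum>b\<in>?B. kd h z b * y p b s)" for h p s z
      unfolding x_def prod.case mv_code_op unfolding y_def f_def mv_def by simp
    show ?thesis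
    proof (cases "z < m \<and> z' < m")
      case True
      then show ?thesis unfolding ij reduced_decoded_state_expand[OF T] 3[OF conjunct1[OF True] conjunct2[OF True]]
        sum_Times[of _ H] x by auto
    next
      case False
      have "D T (mat_unit b b') z z' = 0" if "b \<in> ?B" "b' \<in> ?B" for b b'
        using kraus_repD(2)[OF D that] False by auto
      then have "?lhs = 0"
        unfolding ij reduced_decoded_state_expand[OF T] by (auto intro!: sum.neutral)
      then show ?thesis using False by (auto simp: ij)
    qed
  qed
  then have "fidelity (?S \<times> ?S) (ketbra \<phi>) (reduced_decoded_state K dA dB N m n F D T \<phi>)
      = (\<Sum>l\<in>H \<times> ?E \<times> G. (cmod (ip (?S \<times> ?S) \<phi> (x l)))^2)"
    by (intro fidelity_gram \<phi>) auto
  moreover have "ip (?S \<times> ?S) \<phi> (x l) = amp ?S ?S (code_op ?A ?B (\<lambda>(s, h). kd h s) ?k (kf (snd (snd l))) (fst (snd l)) (fst l)) \<phi>" for l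
    by (simp add: amp_def ip_def sum_Times x_def)
  ultimately show ?thesis by (simp add: sum_Times)
qed

lemma nsq_swap: "nsq (I \<times> J) (\<lambda>(i, j). f j i) = nsq (J \<times> I) (\<lambda>(j, i). f j i)"
  unfolding nsq_def sum_Times prod.case by (rule sum.swap)

text \<open>Handles a secret dimension clamped to 1. The encoder sends \<open>a0\<close>, and the
  decoder puts the whole output into its side label, so the fidelity sum is the norm of an image
  under an isometry.\<close>

lemma good_code_one:
  fixes B :: "'t \<Rightarrow> 'b set"
  assumes a0: "a0 \<in> A" and k: "\<And>T. T \<in> \<T> \<Longrightarrow> kraus_iso A (B T) (E T) (K T)" and eps: "0 \<le> \<epsilon>"
  shows "good_code \<T> A B E B K 1 \<epsilon>"
proof -
  define U where "U a s = (if a = a0 then 1 else 0 :: complex)" for a and s :: nat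
  define V where "V = (\<lambda>(T :: 't) (s :: nat, h :: 'b) b. if h = b then 1 else 0 :: complex)"
  have 1: "contr A {..<1} U"
    unfolding contr_def
  proof
    fix v
    have "nsq A (mv {..<1} U v) = (\<Sum>a\<in>A. if a = a0 then (cmod (v 0))^2 else 0)"
      unfolding nsq_def by (intro sum.cong refl) (auto simp: U_def mv_def)
    also have "\<dots> \<le> nsq {..<1} v" by (cases "finite A") (simp_all add: nsq_def a0)
    finally show "nsq A (mv {..<1} U v) \<le> nsq {..<1} v" .
  qed
  have 2: "contr ({..<1} \<times> B T) (B T) (V T)" if T: "T \<in> \<T>" for T
    unfolding contr_def
  proof
    fix v
    have "mv (B T) (V T) v (s, h) = v h" if "h \<in> B T" for s h
    proof -
      have "mv (B T) (V T) v (s, h) = (\<Sum>b\<in>B T. if b = h then v h else 0)"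
        unfolding mv_def V_def by (intro sum.cong refl) auto
      then show ?thesis using that kraus_isoD(2)[OF k[OF T]] by simp
    qed
    then show "nsq ({..<1} \<times> B T) (mv (B T) (V T) v) \<le> nsq (B T) v"
      unfolding nsq_def sum_Times by simp
  qed
  have 3: "1 - \<epsilon> \<le> (\<Sum>e\<in>E T. \<Sum>h\<in>B T. (cmod (amp {..<1} {..<1} (code_op A (B T) (V T) (K T) U e h) \<phi>))^2)"
    if T: "T \<in> \<T>" and \<phi>: "nsq ({..<1} \<times> {..<1}) \<phi> = 1" for T and \<phi> :: "nat \<times> nat \<Rightarrow> complex"
  proof -
    note ki = k[OF T]
    note fin = kraus_isoD(1-3)[OF ki]
    have n1: "(cmod (\<phi> (0, 0)))^2 = 1" using \<phi> by (simp add: nsq_def sum_Times)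
    have "(cmod (amp {..<1} {..<1} (code_op A (B T) (V T) (K T) U e h) \<phi>))^2 = (cmod (K T e h a0))^2"
      if h: "h \<in> B T" for e h
    proof -
      have "(\<Sum>a\<in>A. K T e b a * U a 0) = K T e b a0" for b
        using fin a0 by (simp add: U_def if_distrib[of "(*) _"] cong: if_cong)
      moreover have "(\<Sum>b\<in>B T. V T (0, h) b * K T e b a0) = (\<Sum>b\<in>B T. if b = h then K T e h a0 else 0)"
        unfolding V_def by (intro sum.cong refl) auto
      ultimately have "code_op A (B T) (V T) (K T) U e h 0 0 = K T e h a0"
        using fin h by (simp add: code_op_def)
      then have "amp {..<1} {..<1} (code_op A (B T) (V T) (K T) U e h) \<phi> = cnj (\<phi> (0, 0)) * (K T e h a0 * \<phi> (0, 0))"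
        by (simp add: amp_def ip_def mv_def)
      then show ?thesis using n1 by (simp add: norm_mult power_mult_distrib)
    qed
    then have "(\<Sum>e\<in>E T. \<Sum>h\<in>B T. (cmod (amp {..<1} {..<1} (code_op A (B T) (V T) (K T) U e h) \<phi>))^2)
        = (\<Sum>e\<in>E T. \<Sum>h\<in>B T. (cmod (K T e h a0))^2)" by simp
    also have "complex_of_real \<dots> = 1"
      using kraus_isoD(4)[OF ki a0 a0] by (simp add: complex_norm_square mult.commute flip: of_real_power)
    finally show ?thesis using eps by (simp only: of_real_eq_1_iff)
  qed
  show ?thesis unfolding good_code_def using 1 2 3 by blast
qed

text \<open>
  \<open>k\<close> is a Kraus representation of \<open>N\<close>; tracing out the receivers outside \<open>T\<close> adds their outputs to
  the environment.
\<close>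

locale broadcast =
  fixes K dA :: nat and dB :: "nat \<Rightarrow> nat" and N :: "(nat, nat \<Rightarrow> nat) superop" and \<A> :: "nat set set"
    and E :: "'e set" and k :: "'e \<Rightarrow> (nat \<Rightarrow> nat) \<Rightarrow> nat \<Rightarrow> complex"
  assumes dA: "0 < dA"
    and k: "kraus_rep {..<dA} (sys_B dB {1..K}) N E k"
    and \<A>: "\<A> \<noteq> {}" "\<A> \<subseteq> Pow {1..K}"
begin

definition An :: "nat \<Rightarrow> (nat \<Rightarrow> nat) set" where "An n = sys_power n {..<dA}"
definition Bn :: "nat \<Rightarrow> nat set \<Rightarrow> (nat \<Rightarrow> nat \<Rightarrow> nat) set" where "Bn n T = sys_power n (sys_B dB T)"
definition ET :: "nat set \<Rightarrow> ('e \<times> (nat \<Rightarrow> nat)) set" where "ET T = E \<times> sys_B dB ({1..K} - T)"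
definition En :: "nat \<Rightarrow> nat set \<Rightarrow> (nat \<Rightarrow> 'e \<times> (nat \<Rightarrow> nat)) set" where "En n T = sys_power n (ET T)"
definition kT where "kT T = marginal_kraus T ({1..K} - T) k"
definition kn where "kn n T = kpow n (kT T)"

text \<open>The reference \<open>R\<close> is arbitrary because one-letter inputs and codes bring
  references other than a copy of the input labels.\<close>

definition coh :: "'r set \<Rightarrow> nat \<Rightarrow> nat set \<Rightarrow> ('r \<times> (nat \<Rightarrow> nat) \<Rightarrow> complex) \<Rightarrow> real" where
  "coh R n T \<phi> = Ent (Bn n T) (out_mat R (An n) (En n T) (kn n T) \<phi>)
     - Ent (En n T) (env_mat R (An n) (Bn n T) (kn n T) \<phi>)"

lemma finite_\<A>: "finite \<A>"
  using \<A>(2) by (rule finite_subset) simp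

lemma \<A>_D: "T \<in> \<A> \<Longrightarrow> T \<subseteq> {1..K}"
  using \<A>(2) by blast

lemma kraus_rep_T:
  assumes "T \<in> \<A>"
  shows "kraus_rep {..<dA} (sys_B dB T) (marginal_channel K dB N T) (ET T) (kT T)"
  unfolding ET_def kT_def by (rule kraus_rep_marginal[OF k \<A>_D[OF assms]])

lemma kraus_iso_n:
  assumes "T \<in> \<A>"
  shows "kraus_iso (An n) (Bn n T) (En n T) (kn n T)"
  unfolding An_def Bn_def En_def kn_def
  by (rule kraus_repD(1)[OF kraus_rep_power[OF kraus_rep_T[OF assms]]])

lemma An_nonempty: "(\<lambda>t\<in>{..<n}. 0) \<in> An n"
  using dA by (simp add: An_def sys_power_def)

definition reliable :: "nat \<Rightarrow> nat \<Rightarrow> real \<Rightarrow> bool" where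
  "reliable m n \<epsilon> \<longleftrightarrow> (\<exists>F D. qss_code dA dB \<A> m n F D \<and> (\<forall>T\<in>\<A>. \<forall>\<phi>\<in>unit_kets ({..<m} \<times> {..<m}).
    1 - \<epsilon> \<le> fidelity ({..<m} \<times> {..<m}) (ketbra \<phi>) (reduced_decoded_state K dA dB N m n F D T \<phi>)))"

lemma achievable_iff: "achievable_qss_rate K dA dB N \<A> R \<longleftrightarrow> 0 \<le> R \<and>
    (\<forall>\<epsilon>>0. \<forall>\<delta>>0. \<forall>\<^sub>F n in sequentially. reliable (secret_dim n (R - \<delta>)) n \<epsilon>)"
  unfolding achievable_qss_rate_def reliable_def by simp

text \<open>Completion adds Kraus labels for encoder and decoders. Their terms in the fidelity sum
  are nonnegative, so the guarantee for the contractions carries over.\<close>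

theorem good_code_channels:
  assumes gc: "good_code \<A> (An n) (Bn n) (En n) H (kn n) m \<epsilon>" and m: "0 < m"
    and finH: "\<And>T. T \<in> \<A> \<Longrightarrow> finite (H T)"
  shows "reliable m n \<epsilon>"
proof -
  obtain U V where U: "contr (An n) {..<m} U" and V: "\<And>T. T \<in> \<A> \<Longrightarrow> contr ({..<m} \<times> H T) (Bn n T) (V T)"
    and fid: "\<And>T \<phi>. T \<in> \<A> \<Longrightarrow> nsq ({..<m} \<times> {..<m}) \<phi> = 1 \<Longrightarrow> 1 - \<epsilon> \<le> (\<Sum>e\<in>En n T. \<Sum>h\<in>H T.
      (cmod (amp {..<m} {..<m} (code_op (An n) (Bn n T) (V T) (kn n T) U e h) \<phi>))^2)"
    using gc unfolding good_code_def by blast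
  obtain T0 where T0: "T0 \<in> \<A>" using \<A>(1) by blast
  have finA: "finite (An n)" by (rule kraus_isoD(1)[OF kraus_iso_n[OF T0]])
  have cU: "contr ({()} \<times> An n) {..<m} (\<lambda>(e, b) a. U b a)"
    unfolding contr_def
  proof
    fix v
    show "nsq ({()} \<times> An n) (mv {..<m} (\<lambda>(e, b) a. U b a) v) \<le> nsq {..<m} v"
      using contrD[OF U, of v] by (simp add: nsq_def sum_Times mv_def)
  qed
  obtain kf where kf: "kraus_iso {..<m} (An n) ({()} <+> {..<m}) kf" "\<And>e. kf (Inl e) = U"
    using contraction_completion[OF finite_lessThan finA _ cU An_nonempty] by auto
  define F where "F = kraus_channel {..<m} (An n) ({()} <+> {..<m}) kf"
  have "\<exists>kd. kraus_iso (Bn n T) {..<m} (H T <+> Bn n T) kd \<and> (\<forall>h s. kd (Inl h) s = V T (s, h))" if T: "T \<in> \<A>" for T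
  proof -
    have "contr (H T \<times> {..<m}) (Bn n T) (\<lambda>(h, s) b. V T (s, h) b)"
      unfolding contr_def
    proof
      fix v
      have "nsq (H T \<times> {..<m}) (mv (Bn n T) (\<lambda>(h, s) b. V T (s, h) b) v)
          = nsq (H T \<times> {..<m}) (\<lambda>(h, s). mv (Bn n T) (V T) v (s, h))" by (simp add: nsq_def sum_Times mv_def)
      also have "\<dots> = nsq ({..<m} \<times> H T) (mv (Bn n T) (V T) v)"
        using nsq_swap[of "H T" "{..<m}" "\<lambda>s h. mv (Bn n T) (V T) v (s, h)"] by simp
      also have "\<dots> \<le> nsq (Bn n T) v" by (rule contrD[OF V[OF T]])
      finally show "nsq (H T \<times> {..<m}) (mv (Bn n T) (\<lambda>(h, s) b. V T (s, h) b) v) \<le> nsq (Bn n T) v" .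
    qed
    moreover have "0 \<in> {..<m}" using m by simp
    ultimately obtain kd where "kraus_iso (Bn n T) {..<m} (H T <+> Bn n T) kd"
      "\<And>h. kd (Inl h) = (\<lambda>s b. V T (s, h) b)"
      using contraction_completion[OF kraus_isoD(2)[OF kraus_iso_n[OF T]] finite_lessThan finH[OF T]] by blast
    then show ?thesis by auto
  qed
  then obtain kd where kd: "\<And>T. T \<in> \<A> \<Longrightarrow> kraus_iso (Bn n T) {..<m} (H T <+> Bn n T) (kd T)"
    "\<And>T h s. T \<in> \<A> \<Longrightarrow> kd T (Inl h) s = V T (s, h)" by metis
  define D where "D T = kraus_channel (Bn n T) {..<m} (H T <+> Bn n T) (kd T)" for T
  have F: "channel {..<m} (An n) F" "kraus_rep {..<m} (An n) F ({()} <+> {..<m}) kf"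
    unfolding F_def by (rule kraus_channel_channel[OF kf(1)])+
  have D: "channel (Bn n T) {..<m} (D T)" "kraus_rep (Bn n T) {..<m} (D T) (H T <+> Bn n T) (kd T)"
    if T: "T \<in> \<A>" for T
    unfolding D_def by (rule kraus_channel_channel[OF kd(1)[OF T]])+
  have "1 - \<epsilon> \<le> fidelity ({..<m} \<times> {..<m}) (ketbra \<phi>) (reduced_decoded_state K dA dB N m n F D T \<phi>)"
    if T: "T \<in> \<A>" and \<phi>: "\<phi> \<in> unit_kets ({..<m} \<times> {..<m})" for T \<phi>
  proof -
    let ?a = "\<lambda>h e g. (cmod (amp {..<m} {..<m} (code_op (An n) (Bn n T) (\<lambda>(s, h). kd T h s) (kn n T) (kf g) e h) \<phi>))^2"
    have "1 - \<epsilon> \<le> (\<Sum>e\<in>En n T. \<Sum>h\<in>H T.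
        (cmod (amp {..<m} {..<m} (code_op (An n) (Bn n T) (V T) (kn n T) U e h) \<phi>))^2)"
      by (rule fid[OF T unit_ketsD(2)[OF \<phi>]])
    also have "\<dots> = (\<Sum>e\<in>En n T. \<Sum>h\<in>H T. ?a (Inl h) e (Inl ()))"
    proof -
      have "code_op (An n) (Bn n T) (V T) (kn n T) U e h
          = code_op (An n) (Bn n T) (\<lambda>(s, h). kd T h s) (kn n T) (kf (Inl ())) e (Inl h)" for e h
        by (intro ext) (simp add: code_op_def kd(2)[OF T] kf(2))
      then show ?thesis by simp
    qed
    also have "\<dots> = (\<Sum>h\<in>H T. \<Sum>e\<in>En n T. ?a (Inl h) e (Inl ()))" by (rule sum.swap)
    also have "\<dots> \<le> (\<Sum>h\<in>H T. \<Sum>e\<in>En n T. \<Sum>g\<in>{()} <+> {..<m}. ?a (Inl h) e g)"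
      by (intro sum_mono member_le_sum) auto
    also have "\<dots> = (\<Sum>h\<in>Inl ` H T. \<Sum>e\<in>En n T. \<Sum>g\<in>{()} <+> {..<m}. ?a h e g)"
      by (subst sum.reindex) (auto simp: inj_on_def)
    also have "\<dots> \<le> (\<Sum>h\<in>H T <+> Bn n T. \<Sum>e\<in>En n T. \<Sum>g\<in>{()} <+> {..<m}. ?a h e g)"
      by (rule sum_mono2) (use finH[OF T] kraus_isoD(2)[OF kraus_iso_n[OF T]] in \<open>auto intro!: sum_nonneg\<close>)
    also have "\<dots> = fidelity ({..<m} \<times> {..<m}) (ketbra \<phi>) (reduced_decoded_state K dA dB N m n F D T \<phi>)"
      using fidelity_code[where D = D and T = T, OF \<A>_D[OF T] k F(2)[unfolded An_def] D(2)[OF T, unfolded Bn_def] \<phi>]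
      by (simp add: An_def Bn_def En_def ET_def kn_def kT_def)
    finally show ?thesis .
  qed
  moreover have "qss_code dA dB \<A> m n F D"
    unfolding qss_code_def using F(1) D(1) by (simp add: An_def Bn_def)
  ultimately show ?thesis unfolding reliable_def by blast
qed

lemma secret_dim_pos: "0 < secret_dim n R"
  by (simp add: secret_dim_def)

lemma secret_dim_le:
  assumes "0 \<le> x" "real n * R \<le> x"
  shows "real (secret_dim n R) \<le> 2 powr x"
proof -
  have "real (secret_dim n R) = max 1 (real_of_int \<lfloor>2 powr (real n * R)\<rfloor>)"
    by (simp add: secret_dim_def of_nat_nat of_int_max)
  also have "\<dots> \<le> max 1 (2 powr (real n * R))" by (intro max.mono) auto
  also have "\<dots> \<le> 2 powr x" using assms by (simp add: ge_one_powr_ge_zero)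
  finally show ?thesis .
qed

lemma achievable_zero: "achievable_qss_rate K dA dB N \<A> 0"
  unfolding achievable_iff
proof (intro conjI allI impI order_refl always_eventually)
  fix \<epsilon> \<delta> :: real and n assume eps: "0 < \<epsilon>" "0 < \<delta>"
  have "real (secret_dim n (0 - \<delta>)) \<le> 2 powr 0" by (rule secret_dim_le) (use eps in auto)
  then have "secret_dim n (0 - \<delta>) = 1" using secret_dim_pos[of n "0 - \<delta>"] by simp
  moreover have "good_code \<A> (An n) (Bn n) (En n) (Bn n) (kn n) 1 \<epsilon>"
    by (rule good_code_one[OF An_nonempty kraus_iso_n]) (use eps in auto)
  ultimately show "reliable (secret_dim n (0 - \<delta>)) n \<epsilon>"
    using good_code_channels[of n "Bn n" 1 \<epsilon>] kraus_isoD(2)[OF kraus_iso_n] by simp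
qed

theorem achievable_coh:
  assumes j: "0 < j" and \<phi>: "nsq (R \<times> An j) \<phi> = 1" and r: "0 \<le> r"
    and rate: "\<And>T. T \<in> \<A> \<Longrightarrow> real j * r < coh R j T \<phi>"
  shows "achievable_qss_rate K dA dB N \<A> r"
  unfolding achievable_iff
proof (intro conjI allI impI r)
  fix \<epsilon> \<delta> :: real assume eps: "0 < \<epsilon>" and del: "0 < \<delta>"
  define H where "H q d T = (sys_power q (En j T) \<times> {()}) \<times> sys_power d (sys_B dB T)" for q d T
  have a0: "0 \<in> {..<dA}" using dA by simp
  have "\<forall>\<^sub>F q in sequentially. \<forall>m d. 0 < m \<and> real m \<le> 2 powr (real q * (real j * r)) \<longrightarrow>
      good_code \<A> (An (q * j + d)) (Bn (q * j + d)) (En (q * j + d)) (H q d) (kn (q * j + d)) m \<epsilon>"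
    using direct_coding[OF finite_\<A> \<A>(1) kraus_repD(1)[OF kraus_rep_T] a0 j \<phi>[unfolded An_def]
      rate[unfolded coh_def Bn_def An_def En_def kn_def] eps]
    unfolding An_def Bn_def En_def kn_def H_def by simp
  then obtain q0 where q0: "\<And>q m d. q0 \<le> q \<Longrightarrow> 0 < m \<Longrightarrow> real m \<le> 2 powr (real q * (real j * r)) \<Longrightarrow>
      good_code \<A> (An (q * j + d)) (Bn (q * j + d)) (En (q * j + d)) (H q d) (kn (q * j + d)) m \<epsilon>"
    unfolding eventually_sequentially by blast
  \<comment> \<open>From here on the fewer than \<open>j\<close> positions of the rest waste at most
    \<open>n * \<delta>\<close> of \<open>n * r\<close>.\<close>
  obtain n0 :: nat where n0: "real j * r / \<delta> \<le> real n0" using real_arch_simple by blast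
  show "\<forall>\<^sub>F n in sequentially. reliable (secret_dim n (r - \<delta>)) n \<epsilon>"
    unfolding eventually_sequentially
  proof (intro exI[of _ "max (q0 * j) n0"] allI impI)
    fix n assume n: "max (q0 * j) n0 \<le> n"
    define q d where "q = n div j" and "d = n mod j"
    have nqd: "n = q * j + d" and d: "d < j" using j by (simp_all add: q_def d_def)
    have "q0 \<le> q" using n j by (simp add: q_def less_eq_div_iff_mult_less_eq)
    moreover have "real (secret_dim n (r - \<delta>)) \<le> 2 powr (real q * (real j * r))"
    proof (rule secret_dim_le)
      have "real d * r \<le> real j * r" using d r by (intro mult_right_mono) auto
      also have "\<dots> \<le> real n * \<delta>"
      proof -
        have "real j * r / \<delta> \<le> real n" using n0 n by linarith
        then show ?thesis using del by (simp add: divide_le_eq)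
      qed
      finally have "real d * r \<le> real n * \<delta>" .
      moreover have "real n * r = real q * (real j * r) + real d * r" unfolding nqd by (simp add: algebra_simps)
      ultimately show "real n * (r - \<delta>) \<le> real q * (real j * r)" by (simp add: right_diff_distrib)
    qed (use r in auto)
    ultimately have gc: "good_code \<A> (An n) (Bn n) (En n) (H q d) (kn n) (secret_dim n (r - \<delta>)) \<epsilon>"
      using q0[OF _ secret_dim_pos, of q n "r - \<delta>" d] nqd by simp
    have "finite (H q d T)" if T: "T \<in> \<A>" for T
      unfolding H_def using kraus_isoD(3)[OF kraus_iso_n[OF T]] kraus_isoD(2)[OF kraus_repD(1)[OF kraus_rep_T[OF T]]]
      by (intro finite_cartesian_product finite_sys_power) auto
    then show "reliable (secret_dim n (r - \<delta>)) n \<epsilon>"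
      using good_code_channels[OF gc secret_dim_pos] by simp
  qed
qed

end

section \<open>Continuity and attainment of the maximum\<close>

text \<open>The error terms of \<open>Ent_gram_perturbation\<close> for unit trace and
  \<open>t = sqrt x\<close>, where the weight \<open>(1 / t - 1) * x\<close> becomes
  \<open>sqrt x - x\<close>; \<open>L\<close> bounds the entropy.\<close>

definition Ent_modulus :: "real \<Rightarrow> real \<Rightarrow> real" where
  "Ent_modulus L x = sqrt x * L + (sqrt x - x) * L + eta (sqrt x - x) - eta (1 + (sqrt x - x))"

lemma Ent_modulus_tendsto: "(Ent_modulus L \<longlongrightarrow> 0) (at_right 0)"
  unfolding Ent_modulus_def eta_def log_def by real_asymp

lemma Ent_gram_continuity:
  assumes fin: "finite I" "finite L" and u: "(\<Sum>l\<in>L. nsq I (u l)) = 1" and v: "(\<Sum>l\<in>L. nsq I (v l)) = 1"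
    and x: "x = (\<Sum>l\<in>L. nsq I (\<lambda>i. u l i - v l i))" "0 < x" "x < 1"
  shows "Ent I (gram L v) - Ent I (gram L u) \<le> Ent_modulus (log 2 (card I)) x" (is "?lhs \<le> _")
proof -
  define t where "t = sqrt x"
  have t: "0 < t" "t < 1" using x by (simp_all add: t_def)
  have tt: "t * t = x" using x by (simp add: t_def)
  have ne: "I \<noteq> {}" using u by (auto simp: nsq_def)
  define p where "p = (1 / t - 1) * x"
  have p: "p = sqrt x - x" unfolding p_def using t tt by (simp add: field_simps t_def[symmetric])
  have "(1 - t) * Ent I (gram L v) - (1 - t) * eta 1 + eta (1 + p)
      \<le> Ent I (gram L u) + p * log 2 (real (card I)) + eta p"
    by (rule Ent_gram_perturbation[OF fin ne t, where w = "\<lambda>l i. u l i - v l i"])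
       (use u v x in \<open>simp_all add: p_def\<close>)
  moreover have "Ent I (gram L v) \<le> log 2 (card I)"
    using Ent_le_log_card[OF fin(1) ne psd_gram, of L v] v by (simp add: rtr_gram eta_def)
  then have "t * Ent I (gram L v) \<le> t * log 2 (card I)" using t by (intro mult_left_mono) auto
  moreover have "eta 1 = 0" by (simp add: eta_def)
  moreover have "(1 - t) * Ent I (gram L v) = Ent I (gram L v) - t * Ent I (gram L v)" by (simp add: left_diff_distrib)
  ultimately have "?lhs \<le> t * log 2 (card I) + p * log 2 (card I) + eta p - eta (1 + p)"
    by simp
  then show ?thesis unfolding Ent_modulus_def p t_def .
qed

lemma Ent_gram_continuity_abs:
  assumes fin: "finite I" "finite L" and u: "(\<Sum>l\<in>L. nsq I (u l)) = 1" and v: "(\<Sum>l\<in>L. nsq I (v l)) = 1"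
    and x: "x = (\<Sum>l\<in>L. nsq I (\<lambda>i. u l i - v l i))" "0 < x" "x < 1"
  shows "\<bar>Ent I (gram L u) - Ent I (gram L v)\<bar> \<le> Ent_modulus (log 2 (card I)) x"
proof -
  have "x = (\<Sum>l\<in>L. nsq I (\<lambda>i. v l i - u l i))" unfolding x(1) nsq_def by (simp add: norm_minus_commute)
  then show ?thesis using Ent_gram_continuity[OF fin u v x] Ent_gram_continuity[OF fin v u _ x(2,3)] by linarith
qed

lemma out_mat_gram: "out_mat R A E K \<phi> = gram (E \<times> R) (\<lambda>(e, r) b. out_amp A K \<phi> e b r)"
  by (intro ext) (simp add: out_mat_def gram_def sum_Times)

lemma env_mat_gram: "env_mat R A B K \<phi> = gram (B \<times> R) (\<lambda>(b, r) e. out_amp A K \<phi> e b r)"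
  by (intro ext) (simp add: env_mat_def gram_def sum_Times)

lemma out_amp_total:
  assumes k: "kraus_iso A B E K"
  shows "(\<Sum>e\<in>E. \<Sum>r\<in>R. \<Sum>b\<in>B. (cmod (out_amp A K \<phi> e b r))^2) = nsq (R \<times> A) \<phi>" (is "?lhs = _")
proof -
  have iso: "(\<Sum>e\<in>E. \<Sum>b\<in>B. (cmod (out_amp A K \<phi> e b r))^2) = (\<Sum>a\<in>A. (cmod (\<phi> (r, a)))^2)" for r
    using kraus_iso_ip[OF k, of "\<lambda>a. \<phi> (r, a)" "\<lambda>a. \<phi> (r, a)"]
    unfolding out_amp_def complex_norm_square[symmetric] of_real_sum[symmetric] of_real_eq_iff .
  have "?lhs
      = (\<Sum>r\<in>R. \<Sum>e\<in>E. \<Sum>b\<in>B. (cmod (out_amp A K \<phi> e b r))^2)" by (rule sum.swap)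
  then show ?thesis by (simp add: iso nsq_def sum_Times)
qed

lemma nsq_out_amp:
  assumes k: "kraus_iso A B E K"
  shows "(\<Sum>l\<in>E \<times> R. nsq B ((\<lambda>(e, r) b. out_amp A K \<phi> e b r) l)) = nsq (R \<times> A) \<phi>"
    "(\<Sum>l\<in>B \<times> R. nsq E ((\<lambda>(b, r) e. out_amp A K \<phi> e b r) l)) = nsq (R \<times> A) \<phi>"
proof -
  show "(\<Sum>l\<in>E \<times> R. nsq B ((\<lambda>(e, r) b. out_amp A K \<phi> e b r) l)) = nsq (R \<times> A) \<phi>"
    using out_amp_total[OF k] by (simp add: sum_Times nsq_def)
  let ?F = "\<Sum>l\<in>B \<times> R. nsq E ((\<lambda>(b, r) e. out_amp A K \<phi> e b r) l)"
  have "?F = (\<Sum>b\<in>B. \<Sum>e\<in>E. \<Sum>r\<in>R. (cmod (out_amp A K \<phi> e b r))^2)"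
    unfolding sum_Times nsq_def prod.case by (rule sum.cong[OF refl]) (rule sum.swap)
  also have "\<dots> = (\<Sum>e\<in>E. \<Sum>r\<in>R. \<Sum>b\<in>B. (cmod (out_amp A K \<phi> e b r))^2)"
    by (rule trans[OF sum.swap], rule sum.cong[OF refl], rule sum.swap)
  finally show "?F = nsq (R \<times> A) \<phi>"
    unfolding out_amp_total[OF k] .
qed

lemma out_amp_diff: "out_amp A K \<phi> e b r - out_amp A K \<psi> e b r = out_amp A K (\<lambda>x. \<phi> x - \<psi> x) e b r"
  by (simp add: out_amp_def sum_subtractf right_diff_distrib)

lemma Ent_out_env_continuity:
  assumes k: "kraus_iso A B E K" and fR: "finite R"
    and \<phi>: "nsq (R \<times> A) \<phi> = 1" and \<psi>: "nsq (R \<times> A) \<psi> = 1"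
    and x: "x = nsq (R \<times> A) (\<lambda>i. \<phi> i - \<psi> i)" "0 < x" "x < 1"
  shows "\<bar>Ent B (out_mat R A E K \<phi>) - Ent B (out_mat R A E K \<psi>)\<bar> \<le> Ent_modulus (log 2 (card B)) x"
    "\<bar>Ent E (env_mat R A B K \<phi>) - Ent E (env_mat R A B K \<psi>)\<bar> \<le> Ent_modulus (log 2 (card E)) x"
proof -
  note fin = kraus_isoD(1-3)[OF k]
  show "\<bar>Ent B (out_mat R A E K \<phi>) - Ent B (out_mat R A E K \<psi>)\<bar> \<le> Ent_modulus (log 2 (card B)) x"
    unfolding out_mat_gram
  proof (rule Ent_gram_continuity_abs)
    show "x = (\<Sum>l\<in>E \<times> R. nsq B (\<lambda>i. (case l of (e, r) \<Rightarrow> \<lambda>b. out_amp A K \<phi> e b r) i - (case l of (e, r) \<Rightarrow> \<lambda>b. out_amp A K \<psi> e b r) i))"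
      unfolding x(1) nsq_out_amp(1)[OF k, symmetric] by (intro sum.cong refl) (auto simp: out_amp_diff)
  qed (use fin fR \<phi> \<psi> x in \<open>simp_all add: nsq_out_amp(1)[OF k]\<close>)
  show "\<bar>Ent E (env_mat R A B K \<phi>) - Ent E (env_mat R A B K \<psi>)\<bar> \<le> Ent_modulus (log 2 (card E)) x"
    unfolding env_mat_gram
  proof (rule Ent_gram_continuity_abs)
    show "x = (\<Sum>l\<in>B \<times> R. nsq E (\<lambda>i. (case l of (b, r) \<Rightarrow> \<lambda>e. out_amp A K \<phi> e b r) i - (case l of (b, r) \<Rightarrow> \<lambda>e. out_amp A K \<psi> e b r) i))"
      unfolding x(1) nsq_out_amp(2)[OF k, symmetric] by (intro sum.cong refl) (auto simp: out_amp_diff)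
  qed (use fin fR \<phi> \<psi> x in \<open>simp_all add: nsq_out_amp(2)[OF k]\<close>)
qed

text \<open>The topology is that of pointwise convergence, for which the finite sum
  \<open>nsq I\<close> of differences is continuous. Distinct members of \<open>S\<close> differ
  somewhere on \<open>I\<close>, so a modulus for positive distances is enough.\<close>

lemma continuous_on_modulus:
  fixes f :: "('i \<Rightarrow> complex) \<Rightarrow> real"
  assumes fin: "finite I" and h: "(h \<longlongrightarrow> 0) (at_right 0)"
    and S: "\<And>\<phi> i. \<phi> \<in> S \<Longrightarrow> i \<notin> I \<Longrightarrow> \<phi> i = 0"
    and f: "\<And>\<phi> \<psi> x. \<phi> \<in> S \<Longrightarrow> \<psi> \<in> S \<Longrightarrow> x = nsq I (\<lambda>i. \<phi> i - \<psi> i) \<Longrightarrow> 0 < x \<Longrightarrow> x < 1 \<Longrightarrow> \<bar>f \<phi> - f \<psi>\<bar> \<le> h x"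
  shows "continuous_on S f"
  unfolding continuous_on_def
proof (intro ballI tendstoI)
  fix \<psi> and e :: real assume \<psi>: "\<psi> \<in> S" and e: "0 < e"
  have "\<forall>\<^sub>F x in at_right 0. dist (h x) 0 < e" using h e by (rule tendstoD)
  then obtain d where d: "0 < d" "\<And>x. 0 < x \<Longrightarrow> x < d \<Longrightarrow> \<bar>h x\<bar> < e"
    unfolding eventually_at_right_field by (auto simp: dist_real_def)
  have "continuous_on S (\<lambda>\<phi>. nsq I (\<lambda>i. \<phi> i - \<psi> i))"
    unfolding nsq_def by (intro continuous_intros continuous_on_coord)
  then have "((\<lambda>\<phi>. nsq I (\<lambda>i. \<phi> i - \<psi> i)) \<longlongrightarrow> nsq I (\<lambda>i. \<psi> i - \<psi> i)) (at \<psi> within S)"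
    using \<psi> unfolding continuous_on_def by blast
  then have "((\<lambda>\<phi>. nsq I (\<lambda>i. \<phi> i - \<psi> i)) \<longlongrightarrow> 0) (at \<psi> within S)" by (simp add: nsq_def)
  then have "\<forall>\<^sub>F \<phi> in at \<psi> within S. nsq I (\<lambda>i. \<phi> i - \<psi> i) < min d 1"
    using d by (intro order_tendstoD(2)[of _ 0]) auto
  moreover have "\<forall>\<^sub>F \<phi> in at \<psi> within S. \<phi> \<in> S \<and> \<phi> \<noteq> \<psi>" unfolding eventually_at_topological by auto
  ultimately show "\<forall>\<^sub>F \<phi> in at \<psi> within S. dist (f \<phi>) (f \<psi>) < e"
  proof eventually_elim
    case (elim \<phi>)
    define x where "x = nsq I (\<lambda>i. \<phi> i - \<psi> i)"
    have "\<exists>i\<in>I. \<phi> i \<noteq> \<psi> i" using elim S \<psi> by (metis ext)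
    then have "x \<noteq> 0" unfolding x_def nsq_def using fin by (simp add: sum_nonneg_eq_0_iff)
    moreover have "0 \<le> x" unfolding x_def nsq_def by (simp add: sum_nonneg)
    ultimately have "0 < x" by simp
    moreover have "x < d" "x < 1" using elim by (simp_all add: x_def)
    ultimately have "\<bar>f \<phi> - f \<psi>\<bar> < e" using f[of \<phi> \<psi> x] d(2)[of x] elim \<psi> x_def by fastforce
    then show ?case by (simp add: dist_real_def)
  qed
qed

lemma continuous_on_Min:
  fixes f :: "'t \<Rightarrow> 'a::topological_space \<Rightarrow> real"
  assumes "finite \<T>" "\<T> \<noteq> {}" "\<And>T. T \<in> \<T> \<Longrightarrow> continuous_on S (f T)"
  shows "continuous_on S (\<lambda>x. Min ((\<lambda>T. f T x) ` \<T>))"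
  using assms
proof (induction rule: finite_ne_induct)
  case (insert T \<T>)
  then have "continuous_on S (\<lambda>x. min (f T x) (Min ((\<lambda>T. f T x) ` \<T>)))" by (intro continuous_on_min) auto
  then show ?case using insert by simp
qed simp

lemma compact_unit_kets: "finite I \<Longrightarrow> compact (unit_kets I)"
  using compact_unit_sphere[of I "{}" "\<lambda>_. undefined"] by (simp add: unit_kets_def nsq_def)

lemma unit_kets_nonempty:
  assumes "finite I" "i \<in> I"
  shows "(\<lambda>j. if j = i then 1 else 0) \<in> unit_kets I"
proof -
  have "(\<Sum>j\<in>I. (cmod (if j = i then 1 else 0))^2) = (\<Sum>j\<in>I. if j = i then 1 else 0)" by (intro sum.cong refl) auto
  then show ?thesis using assms by (auto simp: unit_kets_def)
qed

text \<open>\<open>GREATEST\<close> has the intended value only if a maximum exists: the unit sphere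
  is compact, and a minimum of finitely many continuous functions is continuous.\<close>

theorem coherent_info_max_attained:
  fixes A :: "'a set" and B :: "nat set \<Rightarrow> 'b set"
  assumes fin: "finite \<A>" "\<A> \<noteq> {}" and a0: "a0 \<in> A"
    and k: "\<And>T. T \<in> \<A> \<Longrightarrow> kraus_rep A (B T) (M T) (E T) (K T)"
  defines "g \<equiv> \<lambda>\<phi>. Min ((\<lambda>T. Ent (B T) (out_mat A A (E T) (K T) \<phi>) - Ent (E T) (env_mat A A (B T) (K T) \<phi>)) ` \<A>)"
  shows "\<exists>\<phi>\<in>unit_kets (A \<times> A). coherent_info_max \<A> A B M = g \<phi> \<and> (\<forall>\<psi>\<in>unit_kets (A \<times> A). g \<psi> \<le> g \<phi>)"
proof -
  let ?c = "\<lambda>T \<phi>. Ent (B T) (out_mat A A (E T) (K T) \<phi>) - Ent (E T) (env_mat A A (B T) (K T) \<phi>)"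
  let ?S = "unit_kets (A \<times> A)"
  have finA: "finite A" using fin(2) kraus_isoD(1)[OF kraus_repD(1)[OF k]] by blast
  have "continuous_on ?S (?c T)" if T: "T \<in> \<A>" for T
  proof (rule continuous_on_modulus[where I = "A \<times> A" and
      h = "\<lambda>x. Ent_modulus (log 2 (card (B T))) x + Ent_modulus (log 2 (card (E T))) x"])
    show "((\<lambda>x. Ent_modulus (log 2 (card (B T))) x + Ent_modulus (log 2 (card (E T))) x) \<longlongrightarrow> 0) (at_right 0)"
      using tendsto_add[OF Ent_modulus_tendsto Ent_modulus_tendsto] by simp
    show "\<bar>?c T \<phi> - ?c T \<psi>\<bar> \<le> Ent_modulus (log 2 (card (B T))) x + Ent_modulus (log 2 (card (E T))) x"
      if "\<phi> \<in> ?S" "\<psi> \<in> ?S" "x = nsq (A \<times> A) (\<lambda>i. \<phi> i - \<psi> i)" "0 < x" "x < 1" for \<phi> \<psi> x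
      using Ent_out_env_continuity[OF kraus_repD(1)[OF k[OF T]] finA unit_ketsD(2)[OF that(1)] unit_ketsD(2)[OF that(2)] that(3-5)]
      by linarith
  next
    fix \<phi> i assume "\<phi> \<in> ?S" "i \<notin> A \<times> A"
    then show "\<phi> i = 0" by (rule unit_ketsD(1))
  qed (use finA in auto)
  then have "continuous_on ?S g" unfolding g_def by (rule continuous_on_Min[OF fin])
  moreover have "compact ?S" using finA by (simp add: compact_unit_kets)
  moreover have "?S \<noteq> {}" using unit_kets_nonempty[of "A \<times> A" "(a0, a0)"] finA a0 by blast
  ultimately obtain \<phi> where \<phi>: "\<phi> \<in> ?S" "\<forall>\<psi>\<in>?S. g \<psi> \<le> g \<phi>" using continuous_attains_sup by metis
  have "coherent_info A (B T) (so_tensor A A id (M T) (ketbra \<psi>)) = ?c T \<psi>" if "T \<in> \<A>" for T \<psi>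
    by (rule coherent_info_kraus[OF k[OF that]])
  then have "(\<lambda>T. coherent_info A (B T) (so_tensor A A id (M T) (ketbra \<psi>))) ` \<A> = (\<lambda>T. ?c T \<psi>) ` \<A>" for \<psi>
    by (intro image_cong refl)
  then have "coherent_info_max \<A> A B M = (GREATEST c. \<exists>\<psi>\<in>?S. c = g \<psi>)"
    unfolding coherent_info_max_def g_def by simp
  also have "\<dots> = g \<phi>" by (rule Greatest_equality) (use \<phi> in auto)
  finally show ?thesis using \<phi> by blast
qed

section \<open>One channel use, and lower bounds on the capacity\<close>

lemma sum_sys_power_one: "finite I \<Longrightarrow> (\<Sum>x\<in>sys_power 1 I. f (x 0)) = (\<Sum>i\<in>I. f i :: complex)"
  using sum_sys_power[of I "\<lambda>_. f" 1] by simp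

lemma sum_sys_power_one2:
  fixes f :: "'a \<Rightarrow> 'b \<Rightarrow> complex"
  assumes "finite I" "finite J"
  shows "(\<Sum>x\<in>sys_power 1 I. \<Sum>y\<in>sys_power 1 J. f (x 0) (y 0)) = (\<Sum>i\<in>I. \<Sum>j\<in>J. f i j)"
  unfolding sum_sys_power_one[OF assms(2), of "f _"]
  by (rule sum_sys_power_one[OF assms(1), of "\<lambda>i. \<Sum>j\<in>J. f i j"])

text \<open>The dual Gram operator consists of inner products, in which the passage from letters to
  words of length one is a mere reindexing.\<close>

lemma Ent_sys_power_one:
  assumes fin: "finite I" "finite L"
  shows "Ent (sys_power 1 I) (gram L (\<lambda>l x. u l (x 0))) = Ent I (gram L u)" (is "?lhs = _")
proof -
  have "?lhs = Ent L (gram (sys_power 1 I) (\<lambda>x l. u l (x 0)))"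
    by (rule Ent_gram_dual[OF finite_sys_power[OF fin(1)] fin(2)])
  also have "gram (sys_power 1 I) (\<lambda>x l. u l (x 0)) = gram I (\<lambda>i l. u l i)"
    unfolding gram_def using sum_sys_power_one[OF fin(1)] by (intro ext) fast
  also have "Ent L (gram I (\<lambda>i l. u l i)) = Ent I (gram L u)" by (rule Ent_gram_dual[OF fin, symmetric])
  finally show ?thesis .
qed

context broadcast
begin

theorem Ic_power_attained:
  "\<exists>\<phi>\<in>unit_kets (An n \<times> An n). Ic_power K dA dB N \<A> n = Min ((\<lambda>T. coh (An n) n T \<phi>) ` \<A>) \<and>
    (\<forall>\<psi>\<in>unit_kets (An n \<times> An n). Min ((\<lambda>T. coh (An n) n T \<psi>) ` \<A>) \<le> Min ((\<lambda>T. coh (An n) n T \<phi>) ` \<A>))"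
  using coherent_info_max_attained[OF finite_\<A> \<A>(1) An_nonempty[unfolded An_def] kraus_rep_power[OF kraus_rep_T]]
  unfolding Ic_power_def coh_def An_def Bn_def En_def kn_def .

lemma Ic_power_ge:
  assumes "\<phi> \<in> unit_kets (An n \<times> An n)" "\<And>T. T \<in> \<A> \<Longrightarrow> c \<le> coh (An n) n T \<phi>"
  shows "c \<le> Ic_power K dA dB N \<A> n"
proof -
  have "c \<le> Min ((\<lambda>T. coh (An n) n T \<phi>) ` \<A>)" using assms(2) finite_\<A> \<A>(1) by simp
  also have "\<dots> \<le> Ic_power K dA dB N \<A> n" using Ic_power_attained[of n] assms(1) by auto
  finally show ?thesis .
qed

lemma Ic_power_attains:
  obtains \<phi> where "\<phi> \<in> unit_kets (An n \<times> An n)" "\<And>T. T \<in> \<A> \<Longrightarrow> Ic_power K dA dB N \<A> n \<le> coh (An n) n T \<phi>"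
proof -
  obtain \<phi> where \<phi>: "\<phi> \<in> unit_kets (An n \<times> An n)" "Ic_power K dA dB N \<A> n = Min ((\<lambda>T. coh (An n) n T \<phi>) ` \<A>)"
    using Ic_power_attained[of n] by blast
  then show ?thesis using that[OF \<phi>(1)] finite_\<A> by simp
qed

lemma coh_one:
  assumes T: "T \<in> \<A>"
  shows "coh (An 1) 1 T (\<lambda>(r, a). \<phi> (r 0, a 0))
    = Ent (sys_B dB T) (out_mat {..<dA} {..<dA} (ET T) (kT T) \<phi>) - Ent (ET T) (env_mat {..<dA} {..<dA} (sys_B dB T) (kT T) \<phi>)"
proof -
  note ki = kraus_repD(1)[OF kraus_rep_T[OF T]]
  note fin = kraus_isoD(1-3)[OF ki]
  have o: "out_amp (An 1) (kn 1 T) (\<lambda>(r, a). \<phi> (r 0, a 0)) e b r = out_amp {..<dA} (kT T) \<phi> (e 0) (b 0) (r 0)" for e b r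
    unfolding out_amp_def An_def kn_def kpow_def
    using sum_sys_power_one[OF finite_lessThan, of "\<lambda>a. kT T (e 0) (b 0) a * \<phi> (r 0, a)" dA] by simp
  have "out_mat (An 1) (An 1) (En 1 T) (kn 1 T) (\<lambda>(r, a). \<phi> (r 0, a 0))
      = gram (ET T \<times> {..<dA}) (\<lambda>(e, r) b. out_amp {..<dA} (kT T) \<phi> e (b 0) r)"
    unfolding out_mat_def gram_def o sum_Times prod.case unfolding An_def En_def
    by (intro ext, rule sum_sys_power_one2[OF fin(3) finite_lessThan, where f = "\<lambda>e r. out_amp {..<dA} (kT T) \<phi> e (_ 0) r
      * cnj (out_amp {..<dA} (kT T) \<phi> e (_ 0) r)"])
  moreover have "env_mat (An 1) (An 1) (Bn 1 T) (kn 1 T) (\<lambda>(r, a). \<phi> (r 0, a 0))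
      = gram (sys_B dB T \<times> {..<dA}) (\<lambda>(b, r) e. out_amp {..<dA} (kT T) \<phi> (e 0) b r)"
    unfolding env_mat_def gram_def o sum_Times prod.case unfolding An_def Bn_def
    by (intro ext, rule sum_sys_power_one2[OF fin(2) finite_lessThan, where f = "\<lambda>b r. out_amp {..<dA} (kT T) \<phi> (_ 0) b r
      * cnj (out_amp {..<dA} (kT T) \<phi> (_ 0) b r)"])
  moreover have "Ent (Bn 1 T) (gram (ET T \<times> {..<dA}) (\<lambda>(e, r) b. out_amp {..<dA} (kT T) \<phi> e (b 0) r))
      = Ent (sys_B dB T) (out_mat {..<dA} {..<dA} (ET T) (kT T) \<phi>)"
    unfolding out_mat_gram Bn_def
    using Ent_sys_power_one[OF fin(2), of "ET T \<times> {..<dA}" "\<lambda>(e, r) b. out_amp {..<dA} (kT T) \<phi> e b r"] fin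
    by (simp add: case_prod_unfold)
  moreover have "Ent (En 1 T) (gram (sys_B dB T \<times> {..<dA}) (\<lambda>(b, r) e. out_amp {..<dA} (kT T) \<phi> (e 0) b r))
      = Ent (ET T) (env_mat {..<dA} {..<dA} (sys_B dB T) (kT T) \<phi>)"
    unfolding env_mat_gram En_def
    using Ent_sys_power_one[OF fin(3), of "sys_B dB T \<times> {..<dA}" "\<lambda>(b, r) e. out_amp {..<dA} (kT T) \<phi> e b r"] fin
    by (simp add: case_prod_unfold)
  ultimately show ?thesis unfolding coh_def by simp
qed

lemma Ic_attains:
  obtains \<phi> where "nsq ({..<dA} \<times> {..<dA}) \<phi> = 1"
    "\<And>T. T \<in> \<A> \<Longrightarrow> Ic K dA dB N \<A> \<le> coh (An 1) 1 T (\<lambda>(r, a). \<phi> (r 0, a 0))"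
proof -
  have a0: "0 \<in> {..<dA}" using dA by simp
  obtain \<phi> where \<phi>: "\<phi> \<in> unit_kets ({..<dA} \<times> {..<dA})" "Ic K dA dB N \<A> = Min ((\<lambda>T.
      Ent (sys_B dB T) (out_mat {..<dA} {..<dA} (ET T) (kT T) \<phi>) - Ent (ET T) (env_mat {..<dA} {..<dA} (sys_B dB T) (kT T) \<phi>)) ` \<A>)"
    using coherent_info_max_attained[where B = "sys_B dB" and M = "marginal_channel K dB N" and E = ET and K = kT,
      OF finite_\<A> \<A>(1) a0 kraus_rep_T] unfolding Ic_def by blast
  have "Ic K dA dB N \<A> \<le> coh (An 1) 1 T (\<lambda>(r, a). \<phi> (r 0, a 0))" if "T \<in> \<A>" for T
    unfolding coh_one[OF that] \<phi>(2) using finite_\<A> that by (intro Min_le) auto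
  then show ?thesis using that unit_ketsD(2)[OF \<phi>(1)] by blast
qed

text \<open>Coding needs a strict gap, so a positive bound is approached through smaller rates,
  while a nonpositive one follows from achievability of rate 0.\<close>

lemma capacity_ge:
  assumes j: "0 < j" and \<phi>: "nsq (R \<times> An j) \<phi> = 1" and c: "\<And>T. T \<in> \<A> \<Longrightarrow> c \<le> coh R j T \<phi>"
  shows "ereal (c / real j) \<le> qss_capacity K dA dB N \<A>"
proof (cases "c \<le> 0")
  case True
  then have "c / real j \<le> 0" by (simp add: divide_nonpos_nonneg)
  then have "ereal (c / real j) \<le> ereal 0" by simp
  also have "\<dots> \<le> qss_capacity K dA dB N \<A>"
    unfolding qss_capacity_def by (rule Sup_upper) (use achievable_zero in blast)
  finally show ?thesis .
next
  case False
  show ?thesis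
  proof (rule dense_le)
    fix y assume y: "y < ereal (c / real j)"
    show "y \<le> qss_capacity K dA dB N \<A>"
    proof (cases "y \<le> 0")
      case True
      also have "0 \<le> qss_capacity K dA dB N \<A>"
        unfolding qss_capacity_def zero_ereal_def by (rule Sup_upper) (use achievable_zero in blast)
      finally show ?thesis .
    next
      case False
      then obtain r where r: "y = ereal r" "0 < r" using y by (cases y) auto
      then have "real j * r < c" using y j by (simp add: field_simps)
      then have "achievable_qss_rate K dA dB N \<A> r"
        using achievable_coh[OF j \<phi>, of r] r(2) c by fastforce
      then show ?thesis unfolding qss_capacity_def r(1) by (intro Sup_upper) blast
    qed
  qed
qed

lemma capacity_ge_Ic_power: "0 < j \<Longrightarrow> ereal (Ic_power K dA dB N \<A> j / real j) \<le> qss_capacity K dA dB N \<A>"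
proof -
  assume j: "0 < j"
  obtain \<phi> where "\<phi> \<in> unit_kets (An j \<times> An j)" "\<And>T. T \<in> \<A> \<Longrightarrow> Ic_power K dA dB N \<A> j \<le> coh (An j) j T \<phi>"
    using Ic_power_attains[of j] by blast
  then show ?thesis using capacity_ge[OF j unit_ketsD(2)] by blast
qed

lemma capacity_ge_Ic: "ereal (Ic K dA dB N \<A>) \<le> qss_capacity K dA dB N \<A>"
proof -
  obtain \<phi> where \<phi>: "nsq ({..<dA} \<times> {..<dA}) \<phi> = 1"
    "\<And>T. T \<in> \<A> \<Longrightarrow> Ic K dA dB N \<A> \<le> coh (An 1) 1 T (\<lambda>(r, a). \<phi> (r 0, a 0))"
    using Ic_attains by blast
  have "complex_of_real (nsq (An 1 \<times> An 1) (\<lambda>(r, a). \<phi> (r 0, a 0)))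
      = (\<Sum>r\<in>sys_power 1 {..<dA}. \<Sum>a\<in>sys_power 1 {..<dA}. complex_of_real ((cmod (\<phi> (r 0, a 0)))^2))"
    by (simp add: nsq_def An_def sum_Times)
  also have "\<dots> = complex_of_real (nsq ({..<dA} \<times> {..<dA}) \<phi>)"
    unfolding sum_sys_power_one[OF finite_lessThan, of "\<lambda>a. complex_of_real ((cmod (\<phi> (_, a)))^2)"]
      sum_sys_power_one[OF finite_lessThan, of "\<lambda>r. \<Sum>a<dA. complex_of_real ((cmod (\<phi> (r, a)))^2)"]
    by (simp add: nsq_def sum_Times)
  finally have "nsq (An 1 \<times> An 1) (\<lambda>(r, a). \<phi> (r 0, a 0)) = 1" using \<phi>(1) by (simp only: of_real_eq_iff)
  from capacity_ge[OF zero_less_one this \<phi>(2)] show ?thesis by simp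
qed

end

section \<open>Converse\<close>

text \<open>A crude constant is enough: such terms are bounded independently of \<open>n\<close> and
  disappear after division by \<open>n\<close>.\<close>

lemma eta_le_two:
  assumes "0 \<le> x"
  shows "eta x \<le> 2"
proof (cases "x = 0")
  case False
  then have x: "0 < x" using assms by simp
  have "ln (1 / x) \<le> 1 / x - 1" using x by (intro ln_le_minus_one) simp
  then have "x * ln (1 / x) \<le> x * (1 / x - 1)" using x by (intro mult_left_mono) auto
  then have "- (x * ln x) \<le> 1" using x by (simp add: ln_div right_diff_distrib)
  also have "1 \<le> 2 * ln (2 :: real)" using exp_half_le2 ln_ge_iff[of "2 :: real" "1 / 2"] by simp
  finally show ?thesis unfolding eta_def log_def by (simp add: field_simps)
qed simp

lemma eta_one_plus_ge:
  assumes "0 \<le> p" "p \<le> 1"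
  shows "- 2 \<le> eta (1 + p)"
proof -
  have "log 2 (1 + p) \<le> log 2 2" using assms by (subst log_le_cancel_iff) auto
  then have "(1 + p) * log 2 (1 + p) \<le> 2 * 1" using assms by (intro mult_mono) auto
  then show ?thesis by (simp add: eta_def)
qed

text \<open>\<open>\<alpha> h e\<close> is the amplitude for finding decoded system and reference
  maximally entangled, with labels \<open>h\<close> and \<open>e\<close>. In that part
  \<open>S\<close> is maximally mixed and contributes \<open>log 2 (card S)\<close>, while the part
  on \<open>H\<close> has the spectrum of the corresponding environment part, so these two entropies
  cancel.\<close>

theorem decodable_coherent_info:
  fixes A :: "'a set" and B :: "'b set" and E :: "'e set" and S :: "'s set" and H :: "'h set"
  assumes K: "kraus_iso A B E K" and D: "kraus_iso B S H D" and ne: "S \<noteq> {}"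
    and \<psi>: "nsq (S \<times> A) \<psi> = 1" and t: "0 < t" "t < 1"
  defines "\<alpha> \<equiv> \<lambda>h e. (\<Sum>s\<in>S. \<Sum>b\<in>B. D h s b * out_amp A K \<psi> e b s) / complex_of_real (sqrt (card S))"
  assumes \<alpha>: "1 - t^2 \<le> (\<Sum>h\<in>H. \<Sum>e\<in>E. (cmod (\<alpha> h e))^2)"
  shows "(1 - t) * (1 - t^2) * log 2 (card S) - 2 * t * log 2 (card E) - t * log 2 (card S * card H) - 10
    \<le> Ent B (out_mat S A E K \<psi>) - Ent E (env_mat S A B K \<psi>)"
proof -
  note finK = kraus_isoD(1-3)[OF K] and finD = kraus_isoD(2,3)[OF D]
  define m where "m = real (card S)"
  have m: "1 \<le> m" using ne finD by (simp add: m_def Suc_le_eq card_gt_0_iff)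
  define sm where "sm = complex_of_real (sqrt m)"
  have sm: "sm \<noteq> 0" "sm * sm = complex_of_real m" "cnj sm = sm"
    using m by (simp_all add: sm_def flip: of_real_mult)
  have cS: "of_nat (card S) = complex_of_real m" by (simp add: m_def)
  \<comment> \<open>\<open>u\<close> is the decoded vector, \<open>v\<close> its component along the
    maximally entangled vector of \<open>S\<close> and the reference, and \<open>w\<close> the
    remainder.\<close>
  define u where "u = (\<lambda>(e :: 'e, s' :: 's) (s :: 's, h :: 'h). \<Sum>b\<in>B. D h s b * out_amp A K \<psi> e b s')"
  define v where "v = (\<lambda>(e :: 'e, s' :: 's) (s :: 's, h :: 'h). if s = s' then \<alpha> h e / sm else 0)"
  define w where "w l i = u l i - v l i" for l i
  have u: "u (e, s') (s, h) = (\<Sum>b\<in>B. D h s b * out_amp A K \<psi> e b s')" for e s' s h by (simp add: u_def)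
  have v: "v (e, s') (s, h) = (if s = s' then \<alpha> h e / sm else 0)" for e s' s h by (simp add: v_def)
  have tru: "(\<Sum>s\<in>S. u (e, s) (s, h)) = sm * \<alpha> h e" for e h
    using sm(1) by (simp add: u \<alpha>_def sm_def m_def)
  have trv: "(\<Sum>s\<in>S. v (e, s) (s, h)) = sm * \<alpha> h e" for e h
  proof -
    have "(\<Sum>s\<in>S. v (e, s) (s, h)) = sm * sm * (\<alpha> h e / sm)" by (simp add: v cS sm(2))
    then show ?thesis using sm(1) by simp
  qed
  have trw: "(\<Sum>s\<in>S. w (e, s) (s, h)) = 0" for e h
    using tru trv by (simp add: w_def sum_subtractf)
  have vsum: "(\<Sum>s\<in>S. \<Sum>s'\<in>S. v (e, s') (s, h) * f s s') = \<alpha> h e / sm * (\<Sum>s\<in>S. f s s)" (is "?lhs = _") for e h f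
  proof -
    have "?lhs = (\<Sum>s\<in>S. \<Sum>s'\<in>S. if s' = s then \<alpha> h e / sm * f s s else 0)"
      unfolding v by (intro sum.cong refl) auto
    then show ?thesis using finD(1) by (simp add: sum_distrib_left)
  qed
  \<comment> \<open>\<open>w\<close> has trace 0 in its two secret labels and is thus orthogonal to
    the matched part. This makes the environment state an exact sum of two positive operators, with
    no mixed terms.\<close>
  have cross: "(\<Sum>s\<in>S. \<Sum>s'\<in>S. v (e, s') (s, h) * cnj (w (e1, s') (s, h))) = 0" for e e1 h
    unfolding vsum by (simp add: trw flip: cnj_sum)
  have cross': "(\<Sum>s\<in>S. \<Sum>s'\<in>S. w (e, s') (s, h) * cnj (v (e1, s') (s, h))) = 0" (is "?lhs2 = _") for e e1 h
  proof -
    have "?lhs2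
        = cnj (\<Sum>s\<in>S. \<Sum>s'\<in>S. v (e1, s') (s, h) * cnj (w (e, s') (s, h)))"
      by (simp add: mult.commute)
    then show ?thesis unfolding cross by simp
  qed
  have vv: "(\<Sum>s\<in>S. \<Sum>s'\<in>S. v (e, s') (s, h) * cnj (v (e1, s') (s, h))) = \<alpha> h e * cnj (\<alpha> h e1)" (is "?lhs3 = _") for e e1 h
  proof -
    have "?lhs3 = \<alpha> h e / sm * cnj (sm * \<alpha> h e1)"
      unfolding vsum by (simp only: trv flip: cnj_sum)
    then show ?thesis using sm by simp
  qed
  have decomp: "(\<Sum>s\<in>S. \<Sum>s'\<in>S. u (e, s') (s, h) * cnj (u (e1, s') (s, h)))
      = \<alpha> h e * cnj (\<alpha> h e1) + (\<Sum>s\<in>S. \<Sum>s'\<in>S. w (e, s') (s, h) * cnj (w (e1, s') (s, h)))" for e e1 h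
  proof -
    have "u (e, s') (s, h) * cnj (u (e1, s') (s, h)) = v (e, s') (s, h) * cnj (v (e1, s') (s, h))
        + v (e, s') (s, h) * cnj (w (e1, s') (s, h)) + w (e, s') (s, h) * cnj (v (e1, s') (s, h))
        + w (e, s') (s, h) * cnj (w (e1, s') (s, h))" for s s'
      by (simp add: w_def algebra_simps)
    then show ?thesis by (simp add: sum.distrib cross cross' vv)
  qed
  define a where "a = (\<Sum>h\<in>H. \<Sum>e\<in>E. (cmod (\<alpha> h e))^2)"
  define VE where "VE = gram H \<alpha>"
  define WE where "WE = gram (H \<times> S \<times> S) (\<lambda>(h, s, s') e. w (e, s') (s, h))"
  have env: "env_mat S A B K \<psi> e e1 = VE e e1 + WE e e1" for e e1
  proof -
    have "env_mat S A B K \<psi> e e1 = (\<Sum>s'\<in>S. \<Sum>b\<in>B. out_amp A K \<psi> e b s' * cnj (out_amp A K \<psi> e1 b s'))"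
      unfolding env_mat_def by (rule sum.swap)
    also have "\<dots> = (\<Sum>s'\<in>S. \<Sum>h\<in>H. \<Sum>s\<in>S. u (e, s') (s, h) * cnj (u (e1, s') (s, h)))"
      unfolding u kraus_iso_ip[OF D] ..
    also have "\<dots> = (\<Sum>h\<in>H. \<Sum>s\<in>S. \<Sum>s'\<in>S. u (e, s') (s, h) * cnj (u (e1, s') (s, h)))"
      by (rule trans[OF sum.swap], rule sum.cong[OF refl], rule sum.swap)
    also have "\<dots> = VE e e1 + WE e e1"
      unfolding decomp VE_def WE_def gram_def by (simp add: sum.distrib sum_Times)
    finally show ?thesis .
  qed
  have trVE: "rtr E VE = a" unfolding VE_def rtr_gram a_def nsq_def ..
  define \<omega> where "\<omega> = rtr E WE"
  have "rtr E (env_mat S A B K \<psi>) = 1"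
    unfolding env_mat_gram rtr_gram nsq_out_amp(2)[OF K] by (rule \<psi>)
  then have "a + \<omega> = 1"
    unfolding trVE[symmetric] \<omega>_def rtr_add[symmetric] by (simp add: rtr_def env)
  have psdE: "psd E VE" "psd E WE" unfolding VE_def WE_def by (rule psd_gram)+
  have \<omega>0: "0 \<le> \<omega>" unfolding \<omega>_def by (rule rtr_nonneg[OF finK(3) psdE(2)])
  have a0: "0 \<le> a" unfolding a_def by (intro sum_nonneg) auto
  have \<omega>t: "\<omega> \<le> t^2" using \<alpha> \<open>a + \<omega> = 1\<close> by (simp add: a_def)
  have "t^2 < 1" using t by (simp add: power_less_one_iff)
  then have "a \<noteq> 0" using \<omega>t \<open>a + \<omega> = 1\<close> by auto
  then have neE: "E \<noteq> {}" and neH: "H \<noteq> {}" by (auto simp: a_def)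
  have LE0: "0 \<le> log 2 (card E)" and LH0: "0 \<le> log 2 (card H)" and Lm0: "0 \<le> log 2 m"
    using neE neH finK finD m by (simp_all add: Suc_le_eq card_gt_0_iff)
  have "Ent E (env_mat S A B K \<psi>) = Ent E (\<lambda>e e1. VE e e1 + WE e e1)" by (rule Ent_cong) (rule env)
  also have "\<dots> \<le> Ent E VE + Ent E WE" by (rule Ent_subadditive[OF finK(3) psdE])
  also have "Ent E WE \<le> \<omega> * log 2 (card E) + eta \<omega>"
    unfolding \<omega>_def by (rule Ent_le_log_card[OF finK(3) neE psdE(2)])
  finally have Eenv: "Ent E (env_mat S A B K \<psi>) \<le> Ent E VE + \<omega> * log 2 (card E) + eta \<omega>" by simp
  have EVE: "Ent E VE \<le> a * log 2 (card E) + eta a"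
    using Ent_le_log_card[OF finK(3) neE psdE(1)] by (simp add: trVE)
  have finES: "finite (E \<times> S)" and finSH: "finite (S \<times> H)" and neSH: "S \<times> H \<noteq> {}" using finK finD ne neH by auto
  let ?F = "\<lambda>b (e, s'). out_amp A K \<psi> e b s'"
  \<comment> \<open>Decoding is isometric, so it preserves the inner products in the dual Gram
    operator and hence the entropy.\<close>
  have Eout: "Ent B (out_mat S A E K \<psi>) = Ent (S \<times> H) (gram (E \<times> S) u)"
  proof -
    have "Ent B (out_mat S A E K \<psi>) = Ent (E \<times> S) (gram B ?F)"
      unfolding out_mat_gram
      using Ent_gram_dual[OF finK(2) finES, of "\<lambda>(e, s') b. out_amp A K \<psi> e b s'"] by (simp add: case_prod_unfold)
    also have "gram B ?F = gram (S \<times> H) (\<lambda>i l. u l i)"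
    proof (intro ext)
      fix l l1 :: "'e \<times> 's"
      obtain e s e1 s1 where l: "l = (e, s)" "l1 = (e1, s1)" by (cases l, cases l1) blast
      have "gram (S \<times> H) (\<lambda>i l. u l i) l l1 = (\<Sum>h\<in>H. \<Sum>s'\<in>S. u (e, s) (s', h) * cnj (u (e1, s1) (s', h)))"
        unfolding gram_def l sum_Times by (rule sum.swap)
      also have "\<dots> = gram B ?F l l1"
        unfolding u kraus_iso_ip[OF D] by (simp add: gram_def l)
      finally show "gram B ?F l l1 = gram (S \<times> H) (\<lambda>i l. u l i) l l1" ..
    qed
    also have "Ent (E \<times> S) \<dots> = Ent (S \<times> H) (gram (E \<times> S) u)" by (rule Ent_gram_dual[OF finSH finES, symmetric])
    finally show ?thesis .
  qed
  define X where "X = gram E (\<lambda>e h. \<alpha> h e)"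
  let ?G = "\<lambda>(s, h) (s', h'). (if s = s' then X h h' / complex_of_real (real (card S)) else 0)"
  have gv: "gram (E \<times> S) v x y = ?G x y"
    if "x \<in> S \<times> H" for x y
  proof -
    obtain s h s1 h1 where x: "x = (s, h)" "y = (s1, h1)" by (cases x, cases y) blast
    have s: "s \<in> S" using that x by simp
    have "gram (E \<times> S) v x y = (\<Sum>e\<in>E. \<Sum>s'\<in>S. if s' = s then (if s1 = s then \<alpha> h e * cnj (\<alpha> h1 e) / (sm * sm) else 0) else 0)"
      unfolding gram_def x sum_Times v by (intro sum.cong refl) (auto simp: sm(3))
    also have "\<dots> = (if s = s1 then X h h1 / (sm * sm) else 0)"
      using s finD(1) by (auto simp: X_def gram_def sum_divide_distrib)
    finally show ?thesis by (simp add: x sm(2) m_def)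
  qed
  have "psd H X" unfolding X_def by (rule psd_gram)
  then obtain f d where sp: "spec H X H f d" "\<And>k. k \<in> H \<Longrightarrow> 0 \<le> d k" using psd_spectral[OF finD(2)] by blast
  have "rtr H X = a" unfolding X_def rtr_gram a_def nsq_def by (rule sum.swap)
  have "Ent (S \<times> H) (gram (E \<times> S) v)
      = Ent (S \<times> H) ?G"
    by (rule Ent_cong) (rule gv)
  also have "\<dots> = Ent H X + a * log 2 m"
    using Ent_tensor_max_mixed[OF finD ne sp] \<open>rtr H X = a\<close> by (simp add: m_def)
  also have "Ent H X = Ent E VE" unfolding X_def VE_def by (rule Ent_gram_dual[OF finD(2) finK(3)])
  finally have Ev: "Ent (S \<times> H) (gram (E \<times> S) v) = Ent E VE + a * log 2 m" .
  \<comment> \<open>The threshold \<open>1 - t^2\<close> in the assumption is made for this weight: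
    \<open>\<omega> \<le> t^2\<close> gives \<open>p \<le> t - t^2\<close>.\<close>
  define p where "p = (1 / t - 1) * \<omega>"
  have tot: "(\<Sum>l\<in>E \<times> S. nsq (S \<times> H) (z l)) = (\<Sum>e\<in>E. \<Sum>h\<in>H. \<Sum>s\<in>S. \<Sum>s'\<in>S. (cmod (z (e, s') (s, h)))^2)"
    for z :: "'e \<times> 's \<Rightarrow> 's \<times> 'h \<Rightarrow> complex"
  proof -
    have "(\<Sum>s'\<in>S. \<Sum>s\<in>S. \<Sum>h\<in>H. (cmod (z (e, s') (s, h)))^2) = (\<Sum>h\<in>H. \<Sum>s\<in>S. \<Sum>s'\<in>S. (cmod (z (e, s') (s, h)))^2)" for e
      by (rule trans, rule sum.cong[OF refl], rule sum.swap, rule trans[OF sum.swap], rule sum.cong[OF refl], rule sum.swap)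
    then show ?thesis by (simp add: sum_Times nsq_def)
  qed
  have su: "1 = (\<Sum>l\<in>E \<times> S. nsq (S \<times> H) (u l))"
  proof -
    have "complex_of_real (\<Sum>h\<in>H. \<Sum>s\<in>S. (cmod (u (e, s') (s, h)))^2) = complex_of_real (\<Sum>b\<in>B. (cmod (out_amp A K \<psi> e b s'))^2)" for e s'
      using kraus_iso_ip[OF D, of "\<lambda>b. out_amp A K \<psi> e b s'" "\<lambda>b. out_amp A K \<psi> e b s'"]
      unfolding u[symmetric] by (simp add: complex_norm_square del: of_real_power)
    then have "(\<Sum>h\<in>H. \<Sum>s\<in>S. (cmod (u (e, s') (s, h)))^2) = (\<Sum>b\<in>B. (cmod (out_amp A K \<psi> e b s'))^2)" for e s'
      by (simp only: of_real_eq_iff)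
    then have "(\<Sum>e\<in>E. \<Sum>s'\<in>S. \<Sum>h\<in>H. \<Sum>s\<in>S. (cmod (u (e, s') (s, h)))^2) = 1"
      using out_amp_total[OF K, where R = S and \<phi> = \<psi>] \<psi> by simp
    moreover have "(\<Sum>s'\<in>S. \<Sum>h\<in>H. \<Sum>s\<in>S. (cmod (u (e, s') (s, h)))^2) = (\<Sum>h\<in>H. \<Sum>s\<in>S. \<Sum>s'\<in>S. (cmod (u (e, s') (s, h)))^2)" for e
      by (rule trans[OF sum.swap], rule sum.cong[OF refl], rule sum.swap)
    ultimately show ?thesis unfolding tot by simp
  qed
  have sv: "a = (\<Sum>l\<in>E \<times> S. nsq (S \<times> H) (v l))"
  proof -
    have "complex_of_real (\<Sum>s\<in>S. \<Sum>s'\<in>S. (cmod (v (e, s') (s, h)))^2) = complex_of_real ((cmod (\<alpha> h e))^2)" for e h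
      unfolding of_real_sum complex_norm_square vv ..
    then have "(\<Sum>s\<in>S. \<Sum>s'\<in>S. (cmod (v (e, s') (s, h)))^2) = (cmod (\<alpha> h e))^2" for e h by (simp only: of_real_eq_iff)
    then show ?thesis unfolding tot a_def by (simp add: sum.swap[of _ H])
  qed
  have sw: "p = (1 / t - 1) * (\<Sum>l\<in>E \<times> S. nsq (S \<times> H) (w l))"
  proof -
    have "\<omega> = (\<Sum>e\<in>E. \<Sum>x\<in>H \<times> S \<times> S. (cmod (case x of (h, s, s') \<Rightarrow> w (e, s') (s, h)))^2)"
      unfolding \<omega>_def WE_def rtr_gram nsq_def by (rule trans[OF sum.swap]) (simp add: case_prod_unfold)
    then show ?thesis unfolding p_def tot by (simp add: sum_Times)
  qed
  have pert: "(1 - t) * Ent (S \<times> H) (gram (E \<times> S) v) - (1 - t) * eta a + eta (1 + p)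
      \<le> Ent (S \<times> H) (gram (E \<times> S) u) + p * log 2 (real (card (S \<times> H))) + eta p"
    by (rule Ent_gram_perturbation[OF finSH finES neSH t _ su sv sw]) (simp add: w_def)
  have p0: "0 \<le> p" unfolding p_def using t \<omega>0 by (intro mult_nonneg_nonneg) auto
  have "p \<le> (1 / t - 1) * t^2" unfolding p_def using t \<omega>t by (intro mult_left_mono) auto
  also have "\<dots> = t - t^2" using t by (simp add: field_simps power2_eq_square)
  finally have pt: "p \<le> t" using zero_le_power2[of t] by linarith
  define L where "L = log 2 (real (card S * card H))"
  have L0: "0 \<le> L" unfolding L_def using ne neH finD by (simp add: Suc_le_eq card_gt_0_iff flip: of_nat_mult)
  have "p * L \<le> t * L" using pt L0 by (rule mult_right_mono)
  moreover have "card (S \<times> H) = card S * card H" by (rule card_cartesian_product)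
  ultimately have out: "(1 - t) * (Ent E VE + a * log 2 m) - (1 - t) * eta a + eta (1 + p) - t * L - eta p \<le> Ent B (out_mat S A E K \<psi>)"
    using pert unfolding Ev Eout L_def by simp
  have "(1 - t) * ((1 - t^2) * log 2 m) \<le> (1 - t) * (a * log 2 m)"
    using t \<alpha> Lm0 by (intro mult_left_mono mult_right_mono) (auto simp: a_def)
  moreover have "t * Ent E VE \<le> t * (log 2 (card E) + 2)"
  proof -
    have "a * log 2 (card E) \<le> 1 * log 2 (card E)" using LE0 \<omega>0 \<open>a + \<omega> = 1\<close> by (intro mult_right_mono) auto
    then show ?thesis using EVE eta_le_two[OF a0] t by (intro mult_left_mono) auto
  qed
  moreover have "\<omega> * log 2 (card E) \<le> t * log 2 (card E)"
  proof -
    have "t^2 \<le> t" using t by (simp add: power2_eq_square mult_left_le)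
    then show ?thesis using \<omega>t LE0 by (intro mult_right_mono) auto
  qed
  moreover have "(1 - t) * eta a \<le> (1 - t) * 2" using eta_le_two[OF a0] t by (intro mult_left_mono) auto
  moreover have "- 2 \<le> eta (1 + p)" using p0 pt t by (intro eta_one_plus_ge) auto
  moreover have "eta p \<le> 2" "eta \<omega> \<le> 2" using eta_le_two p0 \<omega>0 by auto
  moreover have "(1 - t) * (Ent E VE + a * log 2 m) = Ent E VE - t * Ent E VE + (1 - t) * (a * log 2 m)"
    by (simp add: algebra_simps)
  moreover have "(1 - t) * 2 = 2 - t * 2" "t * (log 2 (card E) + 2) = t * log 2 (card E) + t * 2"
    by (simp_all add: algebra_simps)
  \<comment> \<open>The \<open>eta\<close> terms cost at most 8 in all, within the constant
    10.\<close>
  ultimately have "(1 - t) * ((1 - t^2) * log 2 m) - 2 * (t * log 2 (card E)) - t * L - 10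
      \<le> Ent B (out_mat S A E K \<psi>) - Ent E (env_mat S A B K \<psi>)"
    using out Eenv by linarith
  then show ?thesis by (simp add: L_def m_def mult.assoc)
qed

text \<open>The output and environment states only depend on the reduced state on \<open>A\<close>.\<close>

lemma reference_copy:
  assumes K: "finite A" and \<psi>: "nsq (R \<times> A) \<psi> = 1"
  shows "\<exists>\<phi>\<in>unit_kets (A \<times> A). (\<forall>E (K :: 'e \<Rightarrow> 'b \<Rightarrow> _). out_mat A A E K \<phi> = out_mat R A E K \<psi>) \<and>
    (\<forall>B (K :: 'e \<Rightarrow> 'b \<Rightarrow> _). env_mat A A B K \<phi> = env_mat R A B K \<psi>)"
proof -
  define \<rho> where "\<rho> = gram R (\<lambda>r a. \<psi> (r, a))"
  have "psd A \<rho>" unfolding \<rho>_def by (rule psd_gram)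
  then obtain u d where sp: "spec A \<rho> A u d" and d0: "\<And>k. k \<in> A \<Longrightarrow> 0 \<le> d k" using psd_spectral[OF K] by blast
  \<comment> \<open>The canonical purification: weighted eigenvectors of the reduced state, labelled
    by \<open>A\<close>. The reference thereby gets the labels over which the maximum is
    taken.\<close>
  define \<phi> where "\<phi> = (\<lambda>(k, a). if k \<in> A \<and> a \<in> A then of_real (sqrt (d k)) * u k a else 0)"
  have \<rho>: "\<rho> a a' = (\<Sum>k\<in>A. \<phi> (k, a) * cnj (\<phi> (k, a')))" if "a \<in> A" "a' \<in> A" for a a'
    using psd_is_gram(1)[OF K sp d0 that] that by (simp add: gram_def \<phi>_def)
  have amp: "(\<Sum>r\<in>R'. out_amp A K \<xi> e b r * cnj (out_amp A K \<xi> e' b' r))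
      = (\<Sum>a\<in>A. \<Sum>a'\<in>A. K e b a * cnj (K e' b' a') * (\<Sum>r\<in>R'. \<xi> (r, a) * cnj (\<xi> (r, a'))))" (is "?lhs = _")
    for R' :: "'z set" and \<xi> and K :: "'e \<Rightarrow> 'b \<Rightarrow> _" and e b e' b'
  proof -
    have "?lhs
        = (\<Sum>r\<in>R'. \<Sum>a\<in>A. \<Sum>a'\<in>A. K e b a * cnj (K e' b' a') * (\<xi> (r, a) * cnj (\<xi> (r, a'))))"
      unfolding out_amp_def cnj_sum sum_product by (simp add: ac_simps)
    also have "\<dots> = (\<Sum>a\<in>A. \<Sum>a'\<in>A. \<Sum>r\<in>R'. K e b a * cnj (K e' b' a') * (\<xi> (r, a) * cnj (\<xi> (r, a'))))"
      by (rule trans[OF sum.swap], rule sum.cong[OF refl], rule sum.swap)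
    finally show ?thesis by (simp only: sum_distrib_left)
  qed
  show ?thesis
  proof (intro bexI[of _ \<phi>] conjI allI)
    fix B E and K :: "'e \<Rightarrow> 'b \<Rightarrow> _"
    have "(\<Sum>r\<in>A. out_amp A K \<phi> e b r * cnj (out_amp A K \<phi> e' b' r)) = (\<Sum>r\<in>R. out_amp A K \<psi> e b r * cnj (out_amp A K \<psi> e' b' r))"
      for e b e' b'
      unfolding amp by (intro sum.cong refl) (simp add: \<rho>[symmetric] \<rho>_def gram_def)
    then show "out_mat A A E K \<phi> = out_mat R A E K \<psi>" "env_mat A A B K \<phi> = env_mat R A B K \<psi>"
      by (simp_all add: out_mat_def env_mat_def fun_eq_iff)
  next
    have "of_real (nsq (A \<times> A) \<phi>) = (\<Sum>a\<in>A. \<rho> a a)"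
      unfolding nsq_def sum_Times of_real_sum complex_norm_square
      by (rule trans[OF sum.swap]) (simp add: \<rho>)
    also have "\<dots> = of_real (nsq (R \<times> A) \<psi>)"
      unfolding \<rho>_def gram_trace by (simp add: nsq_def sum_Times)
    finally have "nsq (A \<times> A) \<phi> = 1" using \<psi> by (simp only: of_real_eq_iff)
    then show "\<phi> \<in> unit_kets (A \<times> A)" by (auto simp: unit_kets_def nsq_def \<phi>_def)
  qed
qed

section \<open>Maximally entangled secrets and the choice of a Kraus operator\<close>

definition max_ent :: "nat \<Rightarrow> nat \<times> nat \<Rightarrow> complex" where
  "max_ent m = (\<lambda>(r, s). if r < m \<and> r = s then of_real (1 / sqrt m) else 0)"

lemma max_ent_unit:
  assumes "0 < m"
  shows "max_ent m \<in> unit_kets ({..<m} \<times> {..<m})"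
proof -
  have "(\<Sum>r<m. \<Sum>s<m. (cmod (max_ent m (r, s)))^2) = (\<Sum>r<m. \<Sum>s<m. if s = r then 1 / real m else 0)"
    by (intro sum.cong refl) (auto simp: max_ent_def norm_divide power_divide)
  also have "\<dots> = 1" using assms by simp
  finally show ?thesis by (auto simp: unit_kets_def sum_Times max_ent_def)
qed

lemma amp_max_ent: "amp {..<m} {..<m} G (max_ent m) = (\<Sum>s<m. G s s) / of_nat m"
proof -
  have mv: "mv {..<m} G (\<lambda>s. max_ent m (r, s)) x = G x r * complex_of_real (1 / sqrt m)" (is "?lhs = _") if "r < m" for r x
  proof -
    have "?lhs = (\<Sum>s<m. if s = r then G x r * complex_of_real (1 / sqrt m) else 0)"
      unfolding mv_def by (intro sum.cong refl) (auto simp: max_ent_def)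
    then show ?thesis using that by simp
  qed
  have ip: "ip {..<m} (\<lambda>s. max_ent m (r, s)) f = complex_of_real (1 / sqrt m) * f r" (is "?lhs2 = _") if "r < m" for r f
  proof -
    have "?lhs2 = (\<Sum>s<m. if s = r then complex_of_real (1 / sqrt m) * f r else 0)"
      unfolding ip_def by (intro sum.cong refl) (auto simp: max_ent_def)
    then show ?thesis using that by simp
  qed
  have c: "complex_of_real (1 / sqrt m) * (g * complex_of_real (1 / sqrt m)) = g / of_nat m" for g
  proof -
    have "complex_of_real (1 / sqrt m) * complex_of_real (1 / sqrt m) = complex_of_real (1 / real m)"
      by (simp flip: of_real_mult)
    then show ?thesis by (simp add: field_simps)
  qed
  have "amp {..<m} {..<m} G (max_ent m) = (\<Sum>r<m. complex_of_real (1 / sqrt m) * (G r r * complex_of_real (1 / sqrt m)))"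
    unfolding amp_def by (intro sum.cong refl) (simp add: ip mv)
  then show ?thesis unfolding c by (simp add: sum_divide_distrib)
qed

lemma trace_cauchy_schwarz:
  assumes "finite S"
  shows "(cmod (\<Sum>s\<in>S. G s s))^2 \<le> real (card S) * (\<Sum>s\<in>S. \<Sum>s'\<in>S. (cmod (G s s'))^2)" (is "?lhs \<le> _")
proof -
  have "?lhs \<le> nsq S (\<lambda>_. 1) * nsq S (\<lambda>s. G s s)"
    using cauchy_schwarz_ip[of S "\<lambda>_. 1" "\<lambda>s. G s s"] by (simp add: ip_def)
  also have "nsq S (\<lambda>_. 1) = real (card S)" by (simp add: nsq_def)
  also have "nsq S (\<lambda>s. G s s) \<le> (\<Sum>s\<in>S. \<Sum>s'\<in>S. (cmod (G s s'))^2)"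
    unfolding nsq_def by (intro sum_mono member_le_sum assms) auto
  finally show ?thesis by (simp add: mult_left_mono)
qed

text \<open>With all Kraus labels kept, channel and decoder are isometries and preserve
  Hilbert-Schmidt weight. This limits what a single Kraus operator of the encoder can contribute to
  the fidelity.\<close>

lemma code_op_norm:
  assumes K: "kraus_iso A B E K" and D: "kraus_iso B S H D"
  shows "(\<Sum>h\<in>H. \<Sum>e\<in>E. \<Sum>s\<in>S. \<Sum>s'\<in>R. (cmod (code_op A B (\<lambda>(s, h). D h s) K U e h s s'))^2)
    = (\<Sum>a\<in>A. \<Sum>s'\<in>R. (cmod (U a s'))^2)"
proof -
  define y where "y e b s' = (\<Sum>a\<in>A. K e b a * U a s')" for e b s'
  have y: "y e b s' = out_amp A K (\<lambda>(r, a). U a r) e b s'" for e b s' by (simp add: y_def out_amp_def)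
  have c: "code_op A B (\<lambda>(s, h). D h s) K U e h s s' = (\<Sum>b\<in>B. D h s b * y e b s')" for e h s s'
    by (simp add: code_op_def y_def)
  have 1: "(\<Sum>h\<in>H. \<Sum>s\<in>S. (cmod (\<Sum>b\<in>B. D h s b * y e b s'))^2) = (\<Sum>b\<in>B. (cmod (y e b s'))^2)" for e s'
  proof -
    have "complex_of_real (\<Sum>h\<in>H. \<Sum>s\<in>S. (cmod (\<Sum>b\<in>B. D h s b * y e b s'))^2) = complex_of_real (\<Sum>b\<in>B. (cmod (y e b s'))^2)"
      using kraus_iso_ip[OF D, of "\<lambda>b. y e b s'" "\<lambda>b. y e b s'"] unfolding of_real_sum complex_norm_square .
    then show ?thesis by (simp only: of_real_eq_iff)
  qed
  have "(\<Sum>h\<in>H. \<Sum>e\<in>E. \<Sum>s\<in>S. \<Sum>s'\<in>R. (cmod (\<Sum>b\<in>B. D h s b * y e b s'))^2) = (\<Sum>e\<in>E. \<Sum>h\<in>H. \<Sum>s'\<in>R. \<Sum>s\<in>S. (cmod (\<Sum>b\<in>B. D h s b * y e b s'))^2)"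
    by (rule trans, rule sum.swap, rule sum.cong[OF refl], rule sum.cong[OF refl], rule sum.swap)
  also have "\<dots> = (\<Sum>e\<in>E. \<Sum>s'\<in>R. \<Sum>h\<in>H. \<Sum>s\<in>S. (cmod (\<Sum>b\<in>B. D h s b * y e b s'))^2)"
    by (rule sum.cong[OF refl], rule sum.swap)
  also have "\<dots> = (\<Sum>e\<in>E. \<Sum>s'\<in>R. \<Sum>b\<in>B. (cmod (y e b s'))^2)" unfolding 1 ..
  also have "\<dots> = nsq (R \<times> A) (\<lambda>(r, a). U a r)" unfolding y by (rule out_amp_total[OF K])
  also have "\<dots> = (\<Sum>a\<in>A. \<Sum>s'\<in>R. (cmod (U a s'))^2)"
    unfolding nsq_def sum_Times prod.case by (rule sum.swap)
  finally show ?thesis unfolding c .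
qed

text \<open>The losses of all \<open>T\<close> are added for each \<open>g\<close>; relative to the
  distribution \<open>p\<close>, some \<open>g\<close> of positive weight loses no more than the
  average. That \<open>g\<close> is good for every \<open>T\<close> at the price of the factor
  \<open>card \<T>\<close>.\<close>

lemma ex_good_index:
  fixes p :: "'g \<Rightarrow> real" and f :: "'t \<Rightarrow> 'g \<Rightarrow> real"
  assumes fin: "finite G" "finite \<T>" and p: "(\<Sum>g\<in>G. p g) = 1" "\<And>g. g \<in> G \<Longrightarrow> 0 \<le> p g"
    and f: "\<And>T g. T \<in> \<T> \<Longrightarrow> g \<in> G \<Longrightarrow> f T g \<le> p g" and s: "\<And>T. T \<in> \<T> \<Longrightarrow> 1 - \<epsilon> \<le> (\<Sum>g\<in>G. f T g)"
  shows "\<exists>g\<in>G. 0 < p g \<and> (\<forall>T\<in>\<T>. (1 - real (card \<T>) * \<epsilon>) * p g \<le> f T g)"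
proof -
  define q where "q g = (\<Sum>T\<in>\<T>. p g - f T g)" for g
  have q0: "0 \<le> q g" if "g \<in> G" for g unfolding q_def using f that by (intro sum_nonneg) auto
  have "(\<Sum>g\<in>G. q g) = (\<Sum>T\<in>\<T>. 1 - (\<Sum>g\<in>G. f T g))"
    unfolding q_def by (rule trans[OF sum.swap]) (simp add: sum_subtractf p)
  also have "\<dots> \<le> (\<Sum>T\<in>\<T>. \<epsilon>)" using s by (intro sum_mono) (simp add: algebra_simps)
  finally have Q: "(\<Sum>g\<in>G. q g) \<le> real (card \<T>) * \<epsilon>" by simp
  have "\<exists>g\<in>G. 0 < p g \<and> q g \<le> real (card \<T>) * \<epsilon> * p g"
  proof (rule ccontr)
    assume n: "\<not> ?thesis"
    have le: "real (card \<T>) * \<epsilon> * p g \<le> q g" if "g \<in> G" for g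
      using n p(2)[OF that] q0[OF that] that by (cases "p g = 0") force+
    have "\<exists>g\<in>G. p g \<noteq> 0" using p(1) by (metis sum.neutral zero_neq_one)
    then obtain g0 where g0: "g0 \<in> G" "0 < p g0" using p(2) by force
    have "(\<Sum>g\<in>G. real (card \<T>) * \<epsilon> * p g) < (\<Sum>g\<in>G. q g)"
      by (rule sum_strict_mono_ex1[OF fin(1)]) (use le n g0 in force)+
    then show False using Q p(1) by (simp flip: sum_distrib_left)
  qed
  then obtain g where g: "g \<in> G" "0 < p g" "q g \<le> real (card \<T>) * \<epsilon> * p g" by blast
  have "(1 - real (card \<T>) * \<epsilon>) * p g \<le> f T g" if T: "T \<in> \<T>" for T
  proof -
    have "p g - f T g \<le> q g" unfolding q_def using f g(1) by (intro member_le_sum[OF T _ fin(2)]) auto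
    then show ?thesis using g(3) by (simp add: left_diff_distrib)
  qed
  then show ?thesis using g by blast
qed

lemma card_sys_power: "card (sys_power n I) = card I ^ n"
  by (simp add: sys_power_def card_PiE)

context broadcast
begin

text \<open>The dimension terms of \<open>decodable_coherent_info\<close>, per channel use and unit
  of \<open>t\<close>, that do not involve the code size.\<close>

definition overhead :: "nat set \<Rightarrow> real" where
  "overhead T = 2 * log 2 (card (ET T)) + log 2 (card (sys_B dB T))"

lemma card_pos:
  assumes T: "T \<in> \<A>"
  shows "0 < card (ET T)" "0 < card (sys_B dB T)"
proof -
  note ki = kraus_repD(1)[OF kraus_rep_T[OF T]]
  note iso = kraus_isoD(4)[OF ki, of 0 0]
  have "ET T \<noteq> {}" "sys_B dB T \<noteq> {}" using iso dA by auto
  then show "0 < card (ET T)" "0 < card (sys_B dB T)" using kraus_isoD(2,3)[OF ki] by (simp_all add: card_gt_0_iff)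
qed

lemma overhead_nonneg: "T \<in> \<A> \<Longrightarrow> 0 \<le> overhead T"
  using card_pos[of T] by (simp add: overhead_def Suc_le_eq)

text \<open>The error is divided by \<open>card \<A>\<close> because \<open>ex_good_index\<close>
  multiplies it back. In the factor \<open>1 - 4 * t\<close>, a loss of \<open>2 * t\<close> comes
  from \<open>(1 - t) * (1 - t^2)\<close> and another \<open>2 * t\<close> from the term for decoded
  system and decoder labels: there are \<open>m\<close> secret labels and
  \<open>m * card (Bn n T)\<close> decoder labels.\<close>

theorem converse:
  assumes rel: "reliable m n (t^2 / card \<A>)" and m: "0 < m" and t: "0 < t" "t < 1"
  shows "(1 - 4 * t) * log 2 m - real n * t * (\<Sum>T\<in>\<A>. overhead T) - 10 \<le> Ic_power K dA dB N \<A> n" (is "?lhs \<le> _")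
proof -
  obtain F D where code: "qss_code dA dB \<A> m n F D" and fid: "\<And>T \<phi>. T \<in> \<A> \<Longrightarrow> \<phi> \<in> unit_kets ({..<m} \<times> {..<m}) \<Longrightarrow>
      1 - t^2 / card \<A> \<le> fidelity ({..<m} \<times> {..<m}) (ketbra \<phi>) (reduced_decoded_state K dA dB N m n F D T \<phi>)"
    using rel unfolding reliable_def by blast
  define S where "S = {..<m}"
  have finS: "finite S" and neS: "S \<noteq> {}" and cardS: "card S = m" using m by (auto simp: S_def)
  obtain T0 where T0: "T0 \<in> \<A>" using \<A>(1) by blast
  have finA: "finite (An n)" by (rule kraus_isoD(1)[OF kraus_iso_n[OF T0]])
  define G where "G = {..<m} \<times> An n"
  have F: "channel {..<m} (An n) F" and D: "\<And>T. T \<in> \<A> \<Longrightarrow> channel (Bn n T) {..<m} (D T)"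
    using code by (simp_all add: qss_code_def An_def Bn_def)
  obtain kf where kf: "kraus_rep {..<m} (An n) F G kf"
    using channel_kraus[OF finite_lessThan finA F] by (auto simp: G_def)
  define H where "H T = {..<card (Bn n T)} \<times> {..<m}" for T
  have "\<exists>kd. kraus_rep (Bn n T) {..<m} (D T) (H T) kd" if T: "T \<in> \<A>" for T
    unfolding H_def by (rule channel_kraus[OF kraus_isoD(2)[OF kraus_iso_n[OF T]] finite_lessThan D[OF T]])
  then obtain kd where kd: "\<And>T. T \<in> \<A> \<Longrightarrow> kraus_rep (Bn n T) {..<m} (D T) (H T) (kd T)" by metis
  have kfi: "kraus_iso S (An n) G kf" using kraus_repD(1)[OF kf] by (simp add: S_def)
  have kdi: "kraus_iso (Bn n T) S (H T) (kd T)" if "T \<in> \<A>" for T using kraus_repD(1)[OF kd[OF that]] by (simp add: S_def)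
  have finG: "finite G" by (rule kraus_isoD(3)[OF kfi])
  let ?c = "\<lambda>T g e h. code_op (An n) (Bn n T) (\<lambda>(s, h). kd T h s) (kn n T) (kf g) e h"
  define p where "p g = (\<Sum>a\<in>An n. \<Sum>s\<in>S. (cmod (kf g a s))^2) / m" for g
  define f where "f T g = (\<Sum>h\<in>H T. \<Sum>e\<in>En n T. (cmod ((\<Sum>s\<in>S. ?c T g e h s s) / of_nat m))^2)" for T g
  have psum: "(\<Sum>g\<in>G. p g) = 1"
  proof -
    have "complex_of_real (\<Sum>g\<in>G. \<Sum>a\<in>An n. \<Sum>s\<in>S. (cmod (kf g a s))^2)
        = (\<Sum>l\<in>G \<times> An n. \<Sum>s\<in>S. cnj (kf (fst l) (snd l) s) * kf (fst l) (snd l) s)"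
      unfolding of_real_sum complex_norm_square sum_Times by (simp add: mult.commute)
    also have "\<dots> = (\<Sum>s\<in>S. 1)"
      by (rule trans[OF sum.swap]) (use kraus_isoD(4)[OF kfi] in \<open>simp add: sum_Times\<close>)
    also have "\<dots> = complex_of_real m" by (simp add: cardS)
    finally have "(\<Sum>g\<in>G. \<Sum>a\<in>An n. \<Sum>s\<in>S. (cmod (kf g a s))^2) = m" by (simp only: of_real_eq_iff)
    then show ?thesis using m by (simp add: p_def flip: sum_divide_distrib)
  qed
  have p0: "0 \<le> p g" for g unfolding p_def by (intro divide_nonneg_nonneg sum_nonneg) auto
  have fp: "f T g \<le> p g" if T: "T \<in> \<A>" for T g
  proof -
    have "(cmod ((\<Sum>s\<in>S. ?c T g e h s s) / of_nat m))^2 \<le> (\<Sum>s\<in>S. \<Sum>s'\<in>S. (cmod (?c T g e h s s'))^2) / m" (is "?lhs2 \<le> _") for e h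
    proof -
      have "?lhs2 = (cmod (\<Sum>s\<in>S. ?c T g e h s s))^2 / (real m * real m)"
        by (simp add: norm_divide power2_eq_square)
      also have "\<dots> \<le> (real m * (\<Sum>s\<in>S. \<Sum>s'\<in>S. (cmod (?c T g e h s s'))^2)) / (real m * real m)"
        using trace_cauchy_schwarz[OF finS, of "?c T g e h"] m by (intro divide_right_mono) (simp_all add: cardS)
      also have "\<dots> = (\<Sum>s\<in>S. \<Sum>s'\<in>S. (cmod (?c T g e h s s'))^2) / m" using m by simp
      finally show ?thesis .
    qed
    then have "f T g \<le> (\<Sum>h\<in>H T. \<Sum>e\<in>En n T. (\<Sum>s\<in>S. \<Sum>s'\<in>S. (cmod (?c T g e h s s'))^2) / m)"
      unfolding f_def by (intro sum_mono)
    also have "\<dots> = p g"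
      unfolding p_def code_op_norm[OF kraus_iso_n[OF T] kdi[OF T], where R = S and U = "kf g", symmetric]
      by (simp add: sum_divide_distrib)
    finally show ?thesis .
  qed
  have fsum: "1 - t^2 / card \<A> \<le> (\<Sum>g\<in>G. f T g)" if T: "T \<in> \<A>" for T
  proof -
    have "1 - t^2 / card \<A> \<le> (\<Sum>h\<in>H T. \<Sum>e\<in>En n T. \<Sum>g\<in>G. (cmod (amp {..<m} {..<m} (?c T g e h) (max_ent m)))^2)"
      using fid[OF T max_ent_unit[OF m]] fidelity_code[where D = D and T = T, OF \<A>_D[OF T] k kf[unfolded An_def]
        kd[OF T, unfolded Bn_def] max_ent_unit[OF m]]
      by (simp add: An_def Bn_def En_def ET_def kn_def kT_def)
    also have "\<dots> = (\<Sum>h\<in>H T. \<Sum>e\<in>En n T. \<Sum>g\<in>G. (cmod ((\<Sum>s\<in>S. ?c T g e h s s) / of_nat m))^2)"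
      unfolding amp_max_ent S_def ..
    also have "\<dots> = (\<Sum>g\<in>G. f T g)"
      unfolding f_def
      by (rule trans, rule sum.cong[OF refl], rule sum.swap, rule sum.swap)
    finally show ?thesis .
  qed
  obtain g where g: "g \<in> G" "0 < p g" and fg: "\<And>T. T \<in> \<A> \<Longrightarrow> (1 - t^2) * p g \<le> f T g"
  proof -
    have "real (card \<A>) * (t^2 / card \<A>) = t^2" using finite_\<A> \<A>(1) by simp
    then have "\<exists>g\<in>G. 0 < p g \<and> (\<forall>T\<in>\<A>. (1 - t^2) * p g \<le> f T g)"
      using ex_good_index[where f = f and \<T> = \<A>, OF finG finite_\<A> psum p0 fp fsum] by simp
    then show ?thesis using that by blast
  qed
  \<comment> \<open>Normalises the pure input that Kraus operator \<open>g\<close> makes of a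
    maximally entangled secret: \<open>kf g / sqrt m\<close> has squared norm
    \<open>p g\<close>.\<close>
  define c where "c = complex_of_real (1 / sqrt (m * p g))"
  have cn: "(cmod c)^2 = 1 / (m * p g)" using g(2) by (simp add: c_def norm_divide power_divide)
  define \<psi> where "\<psi> = (\<lambda>(s, a). c * kf g a s)"
  have \<psi>1: "nsq (S \<times> An n) \<psi> = 1"
  proof -
    have "nsq (S \<times> An n) \<psi> = (\<Sum>a\<in>An n. \<Sum>s\<in>S. (cmod c)^2 * (cmod (kf g a s))^2)"
      by (rule trans[rotated], rule sum.swap, simp add: nsq_def sum_Times \<psi>_def norm_mult power_mult_distrib)
    also have "\<dots> = (cmod c)^2 * (m * p g)" using m by (simp add: p_def flip: sum_distrib_left)
    finally show ?thesis using g(2) m by (simp add: cn)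
  qed
  obtain \<phi> where \<phi>: "\<phi> \<in> unit_kets (An n \<times> An n)"
    and out: "\<forall>E (K :: (nat \<Rightarrow> 'e \<times> (nat \<Rightarrow> nat)) \<Rightarrow> (nat \<Rightarrow> nat \<Rightarrow> nat) \<Rightarrow> _). out_mat (An n) (An n) E K \<phi> = out_mat S (An n) E K \<psi>"
    and env: "\<forall>B (K :: (nat \<Rightarrow> 'e \<times> (nat \<Rightarrow> nat)) \<Rightarrow> (nat \<Rightarrow> nat \<Rightarrow> nat) \<Rightarrow> _). env_mat (An n) (An n) B K \<phi> = env_mat S (An n) B K \<psi>"
    using reference_copy[OF finA \<psi>1] by auto
  let ?F = "\<lambda>kd T h e. \<Sum>s\<in>S. \<Sum>b\<in>Bn n T. kd T h s b * out_amp (An n) (kn n T) \<psi> e b s"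
  have "?lhs \<le> coh (An n) n T \<phi>" if T: "T \<in> \<A>" for T
  proof -
    have "(?F kd T h e) = c * (\<Sum>s\<in>S. ?c T g e h s s)" for h e
      by (simp add: out_amp_def \<psi>_def code_op_def sum_distrib_left ac_simps)
    then have \<alpha>: "(?F kd T h e) / complex_of_real (sqrt (card S))
        = c * (\<Sum>s\<in>S. ?c T g e h s s) / complex_of_real (sqrt m)" for h e
      by (simp add: cardS)
    have sq: "(cmod (c * x / complex_of_real (sqrt m)))^2 = (cmod (x / of_nat m))^2 / p g" (is "?lhs3 = _") for x
    proof -
      have "?lhs3 = (cmod c)^2 * (cmod x)^2 / m"
        by (simp add: norm_mult norm_divide power_mult_distrib power_divide)
      then show ?thesis unfolding cn by (simp add: norm_divide power_divide power2_eq_square)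
    qed
    have tot: "(\<Sum>h\<in>H T. \<Sum>e\<in>En n T. (cmod ((?F kd T h e)
        / complex_of_real (sqrt (card S))))^2) = f T g / p g"
      unfolding \<alpha> sq f_def by (simp only: sum_divide_distrib)
    have "1 - t^2 \<le> f T g / p g" using fg[OF T] g(2) by (simp add: pos_le_divide_eq)
    then have main: "(1 - t) * (1 - t^2) * log 2 (card S) - 2 * t * log 2 (card (En n T)) - t * log 2 (card S * card (H T)) - 10
        \<le> Ent (Bn n T) (out_mat S (An n) (En n T) (kn n T) \<psi>) - Ent (En n T) (env_mat S (An n) (Bn n T) (kn n T) \<psi>)"
      by (intro decodable_coherent_info[OF kraus_iso_n[OF T] kdi[OF T] neS \<psi>1 t]) (simp only: tot)
    have lE: "log 2 (card (En n T)) = real n * log 2 (card (ET T))"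
      using card_pos(1)[OF T] by (simp add: En_def card_sys_power log_nat_power)
    have lB: "log 2 (card (Bn n T)) = real n * log 2 (card (sys_B dB T))"
      using card_pos(2)[OF T] by (simp add: Bn_def card_sys_power log_nat_power)
    have cB: "0 < card (Bn n T)" using card_pos(2)[OF T] by (simp add: Bn_def card_sys_power)
    have "log 2 (card S * card (H T)) = log 2 (real m * (real (card (Bn n T)) * real m))"
      by (simp add: cardS H_def)
    also have "\<dots> = 2 * log 2 m + real n * log 2 (card (sys_B dB T))"
      using m cB by (simp add: log_mult lB)
    finally have lH: "log 2 (card S * card (H T)) = 2 * log 2 m + real n * log 2 (card (sys_B dB T))" .
    have "real n * t * overhead T \<le> real n * t * (\<Sum>T\<in>\<A>. overhead T)"
      using t overhead_nonneg by (intro mult_left_mono member_le_sum[OF T _ finite_\<A>]) auto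
    moreover have "real n * t * overhead T = 2 * t * (real n * log 2 (card (ET T))) + t * (real n * log 2 (card (sys_B dB T)))"
      by (simp add: overhead_def algebra_simps)
    moreover have "(1 - 2 * t) * log 2 m \<le> (1 - t) * (1 - t^2) * log 2 m"
    proof (rule mult_right_mono)
      have "(1 - t) * (1 - t^2) = 1 - t - t * t + t * t * t" by (simp add: algebra_simps power2_eq_square)
      moreover have "t * t \<le> t" "0 \<le> t * t * t" using t by (simp_all add: mult_left_le)
      ultimately show "1 - 2 * t \<le> (1 - t) * (1 - t^2)" by linarith
    qed (use m in simp)
    moreover have "t * (2 * log 2 m + real n * log 2 (card (sys_B dB T))) = 2 * t * log 2 m + t * (real n * log 2 (card (sys_B dB T)))"
      by (simp add: algebra_simps)
    moreover have "(1 - 4 * t) * log 2 m = (1 - 2 * t) * log 2 m - 2 * t * log 2 m" by (simp add: algebra_simps)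
    ultimately have "?lhs
        \<le> Ent (Bn n T) (out_mat S (An n) (En n T) (kn n T) \<psi>) - Ent (En n T) (env_mat S (An n) (Bn n T) (kn n T) \<psi>)"
      using main unfolding lE lH unfolding cardS by linarith
    then show ?thesis unfolding coh_def by (simp only: out env)
  qed
  then show ?thesis by (rule Ic_power_ge[OF \<phi>])
qed

text \<open>Rounding down a number that is at least 2 loses less than half of it, hence at most one
  bit; below that the left-hand side is negative.\<close>

lemma log_secret_dim_ge: "real n * R - 1 \<le> log 2 (secret_dim n R)"
proof (cases "1 \<le> real n * R")
  case True
  then have "2 \<le> 2 powr (real n * R)" using powr_mono[of 1 "real n * R" 2] by simp
  then have "2 powr (real n * R) / 2 \<le> real_of_int \<lfloor>2 powr (real n * R)\<rfloor>" by linarith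
  also have "\<dots> \<le> real (secret_dim n R)" by (simp add: secret_dim_def of_nat_nat of_int_max)
  finally have "log 2 (2 powr (real n * R) / 2) \<le> log 2 (secret_dim n R)"
    using secret_dim_pos[of n R] by (subst log_le_cancel_iff) auto
  then show ?thesis by (simp add: log_divide)
next
  case False
  then show ?thesis using secret_dim_pos[of n R] by (simp add: Suc_le_eq order_trans[of _ 0])
qed

lemma rate_le_Ic_power:
  assumes R: "achievable_qss_rate K dA dB N \<A> R" and x: "x < R"
  shows "\<forall>\<^sub>F n in sequentially. x < 1 / real n * Ic_power K dA dB N \<A> n"
proof -
  define C where "C = (\<Sum>T\<in>\<A>. overhead T)"
  define \<delta> where "\<delta> = (R - x) / 2"
  have \<delta>: "0 < \<delta>" "x < R - \<delta>" using x by (simp_all add: \<delta>_def field_simps)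
  \<comment> \<open>The cost \<open>t * C\<close> per channel use does not shrink with
    \<open>n\<close>, so \<open>t\<close> is fixed before \<open>n\<close> grows. At
    \<open>t = 0\<close> the expression is \<open>R - \<delta>\<close>, above
    \<open>x\<close>.\<close>
  have "((\<lambda>t. (1 - 4 * t) * (R - \<delta>) - t * C) \<longlongrightarrow> (1 - 4 * 0) * (R - \<delta>) - 0 * C) (at_right 0)"
    by (intro tendsto_intros)
  then have "\<forall>\<^sub>F t in at_right 0. x < (1 - 4 * t) * (R - \<delta>) - t * C"
    by (rule order_tendstoD) (use \<delta> in simp)
  moreover have "\<forall>\<^sub>F t in at_right (0 :: real). 0 < t \<and> t < 1 / 4"
    unfolding eventually_at_right_field by (intro exI[of _ "1 / 4"]) auto
  ultimately have "\<forall>\<^sub>F t in at_right 0. x < (1 - 4 * t) * (R - \<delta>) - t * C \<and> 0 < t \<and> t < 1 / 4"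
    by eventually_elim blast
  then obtain t where t: "x < (1 - 4 * t) * (R - \<delta>) - t * C" "0 < t" "t < 1 / 4"
    using eventually_happens'[OF trivial_limit_at_right_real] by blast
  have "0 < t^2 / card \<A>" using t finite_\<A> \<A>(1) by (simp add: card_gt_0_iff)
  then have "\<forall>\<^sub>F n in sequentially. reliable (secret_dim n (R - \<delta>)) n (t^2 / card \<A>)"
    using R \<delta>(1) unfolding achievable_iff by blast
  moreover have "((\<lambda>n. (1 - 4 * t) * (R - \<delta> - 1 / real n) - t * C - 10 / real n) \<longlongrightarrow> (1 - 4 * t) * (R - \<delta> - 0) - t * C - 0) sequentially"
    by (intro tendsto_intros lim_1_over_n lim_const_over_n)
  then have "\<forall>\<^sub>F n in sequentially. x < (1 - 4 * t) * (R - \<delta> - 1 / real n) - t * C - 10 / real n"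
    by (rule order_tendstoD) (use t in simp)
  moreover have "\<forall>\<^sub>F n :: nat in sequentially. 0 < n" by (rule eventually_gt_at_top)
  ultimately show ?thesis
  proof eventually_elim
    case (elim n)
    define m where "m = secret_dim n (R - \<delta>)"
    have "reliable m n (t^2 / card \<A>)" using elim(1) by (simp add: m_def)
    then have "(1 - 4 * t) * log 2 m - real n * t * C - 10 \<le> Ic_power K dA dB N \<A> n"
      unfolding C_def using t secret_dim_pos m_def by (intro converse) auto
    moreover have "(1 - 4 * t) * (real n * (R - \<delta>) - 1) \<le> (1 - 4 * t) * log 2 m"
      unfolding m_def using t by (intro mult_left_mono log_secret_dim_ge) auto
    ultimately have "(1 - 4 * t) * (real n * (R - \<delta>) - 1) - real n * t * C - 10 \<le> Ic_power K dA dB N \<A> n" by linarith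
    moreover have "(1 - 4 * t) * (real n * (R - \<delta>) - 1) - real n * t * C - 10
        = real n * ((1 - 4 * t) * (R - \<delta> - 1 / real n) - t * C - 10 / real n)"
      using elim(3) by (simp add: field_simps)
    moreover have "real n * x < real n * ((1 - 4 * t) * (R - \<delta> - 1 / real n) - t * C - 10 / real n)"
      using elim(2,3) by (intro mult_strict_left_mono) auto
    ultimately have "real n * x < Ic_power K dA dB N \<A> n" by linarith
    then show ?case using elim(3) by (simp add: pos_less_divide_eq mult.commute)
  qed
qed

text \<open>Convergence follows from a sandwich, without superadditivity: every term with positive
  \<open>n\<close> is at most the capacity by the direct part, and the converse puts the terms
  eventually above each number below an achievable rate.\<close>

theorem Ic_power_limit:
  "(\<lambda>n. ereal (1 / real n * Ic_power K dA dB N \<A> n)) \<longlonglongrightarrow> qss_capacity K dA dB N \<A>"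
proof (rule order_tendstoI)
  fix y assume "y < qss_capacity K dA dB N \<A>"
  then obtain R where R: "achievable_qss_rate K dA dB N \<A> R" "y < ereal R"
    unfolding qss_capacity_def less_Sup_iff by blast
  then obtain x where x: "y < ereal x" "x < R" using ereal_dense2[of y "ereal R"] by auto
  show "\<forall>\<^sub>F n in sequentially. y < ereal (1 / real n * Ic_power K dA dB N \<A> n)"
    using rate_le_Ic_power[OF R(1) x(2)]
  proof eventually_elim
    case (elim n)
    then have "ereal x < ereal (1 / real n * Ic_power K dA dB N \<A> n)" by simp
    with x(1) show ?case by (rule less_trans)
  qed
next
  fix y assume y: "qss_capacity K dA dB N \<A> < y"
  have "\<forall>\<^sub>F n :: nat in sequentially. 0 < n" by (rule eventually_gt_at_top)
  then show "\<forall>\<^sub>F n in sequentially. ereal (1 / real n * Ic_power K dA dB N \<A> n) < y"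
  proof eventually_elim
    case (elim n)
    from le_less_trans[OF capacity_ge_Ic_power[OF elim] y] show ?case by simp
  qed
qed

end

text \<open>The set of all participants is qualified: if it were in the adversary structure, the
  empty set would belong to it by downward closure and not belong to it by self-duality.\<close>

lemma access_structure_nonempty:
  assumes "access_structure K \<A>"
  shows "\<A> \<noteq> {}" "\<A> \<subseteq> Pow {1..K}"
proof -
  obtain \<Z> where Z: "adversary_structure K \<Z>" "\<A> = Pow {1..K} - \<Z>" using assms unfolding access_structure_def by blast
  have "{1..K} \<in> \<Z> \<longleftrightarrow> {} \<notin> \<Z>" using Z(1) unfolding adversary_structure_def by (metis Diff_cancel order_refl)
  moreover have "{1..K} \<in> \<Z> \<Longrightarrow> {} \<in> \<Z>" using Z(1) unfolding adversary_structure_def by blast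
  ultimately have "{1..K} \<in> \<A>" using Z(2) by blast
  then show "\<A> \<noteq> {}" "\<A> \<subseteq> Pow {1..K}" using Z(2) by auto
qed

theorem corollary1:
  fixes K dA :: nat
    and dB :: "nat \<Rightarrow> nat"
    and N :: "(nat, nat \<Rightarrow> nat) superop"
    and \<A> :: "nat set set"
  assumes "dA > 0"
    and "\<forall>k\<in>{1..K}. dB k > 0"
    and "channel {..<dA} (sys_B dB {1..K}) N"
    and "access_structure K \<A>"
  shows "qss_capacity K dA dB N \<A> \<ge> ereal (Ic K dA dB N \<A>) \<and>
    (\<lambda>n. ereal (1 / real n * Ic_power K dA dB N \<A> n)) \<longlonglongrightarrow> qss_capacity K dA dB N \<A>"
proof -
  obtain k where "kraus_rep {..<dA} (sys_B dB {1..K}) N ({..<card {..<dA}} \<times> sys_B dB {1..K}) k"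
    using channel_kraus[OF finite_lessThan finite_sys_B[OF finite_atLeastAtMost] assms(3)] by blast
  then interpret broadcast K dA dB N \<A> "{..<card {..<dA}} \<times> sys_B dB {1..K}" k
    using assms(1,2) access_structure_nonempty[OF assms(4)] by unfold_locales auto
  show ?thesis using capacity_ge_Ic Ic_power_limit by blast
qed

end
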